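(* Let $d\ge 1$, $L\ge 3$, $J,\mu,U\in\mathbb{R}$. Let $\gamma_d(0)$ be a positive trace class operator on $\mathcal F$ with $\mathrm{Tr}(\gamma_d(0))=1$, let $\gamma_d(t)$ be the solution of $i\partial_t\gamma_d(t)=[H_d,\gamma_d(t)]$ with this initial datum, and let $\varphi$ be the solution of the mean-field equation $i\partial_t\varphi(t)=h^{\varphi(t)}\varphi(t)$ with initial datum $\varphi(0)\in\ell^2(\mathbb C)$, $\|\varphi(0)\|_{\ell^2}=1$. Write $p_\varphi(t)=|\varphi(t)\rangle\langle\varphi(t)|$. Assume that there exist $\kappa,c>0$ such that for all $n\in\mathbb N$ $$\mathrm{Tr}\big(p_\varphi(0)\mathbb 1_{\mathcal N=n}\big)\le c\,e^{-n/\kappa}\quad\text{and}\quad \mathrm{Tr}\big(\gamma_d^{(1)}(0)\mathbb 1_{\mathcal N=n}\big)\le c\,e^{-n/\kappa}.$$ Define (with $e$ Euler's number) $$C_1=2e|J|\max\big(\mathrm{Tr}(p_\varphi(0)\mathcal N),1\big),\qquad C_2=4\big(c(1+\kappa)+e^{-1}\big)\big(2+4(\kappa+e)\big),$$ $$C_3=\big(\mathrm{Tr}(p_\varphi(0)\mathcal N)+1\big)^{1/2},\qquad C_4=4\,\mathrm{Tr}(p_\varphi(0)\mathcal N)^{1/2}+2,$$ $$D(t)=C_4+2\Big(\sqrt{2(\kappa+e)}\,e^{\frac{C_1}{2}t}+1\Big)\sqrt{\ln(d+1)}.$$ Then for all $t\ge 0$, $$\big\|\gamma_d^{(1)}(t)-p_\varphi(t)\big\|_{\mathcal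 L^1}\le \sqrt2\left(\big\|\gamma_d^{(1)}(0)-p_\varphi(0)\big\|_{\mathcal L^1}+\frac{C_2e^{C_1t}+\mathrm{Tr}(p_\varphi(0)\mathcal N)^{1/2}}{d\,D(t)}\right)^{1/2}e^{|J|C_3D(t)\,t}.$$
   Context: $\mathbb N=\{0,1,2,\dots\}$. $\ell^2(\mathbb C)=\ell^2(\mathbb N;\mathbb C)$ is the one-site Hilbert space with canonical basis $(|n\rangle)_{n\in\mathbb N}$; $a|0\rangle=0$, $a|n\rangle=\sqrt n|n-1\rangle$, $a^*|n\rangle=\sqrt{n+1}|n+1\rangle$, $\mathcal N=a^*a$; $\mathbb 1_{\mathcal N=n}=|n\rangle\langle n|$. $\Lambda=(\mathbb Z/L\mathbb Z)^d$, $|\Lambda|=L^d$; $x\sim y$ means nearest neighbours (each site has $2d$ nearest neighbours); $\sum_{\langle x,y\rangle}$ is the sum over unordered nearest-neighbour pairs. $\mathcal F=\ell^2(\mathbb C)^{\otimes|\Lambda|}$ (one tensor factor per site). For a one-site operator $B$, $B_x$ is $B$ acting on the factor at $x$ and the identity elsewhere. Bose–Hubbard Hamiltonian: $$H_d=-\frac{J}{2d}\sum_{\langle x,y\rangle}(a_x^*a_y+a_y^*a_x)+(J-\mu)\sum_{x\in\Lambda}\mathcal N_x+\frac U2\sum_{x\in\Lambda}\mathcal N_x(\mathcal N_x-1).$$ It commutes with $\sum_x\mathcal N_x$ and is self-adjoint as a direct sum over its finite-dimensional eigenspaces; the solution of the von Neumann equation is $\gamma_d(t)=e^{-itH_d}\gamma_d(0)e^{itH_d}$.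 Mean-field operator: $h^\varphi=-J(\alpha_\varphi a^*+\overline{\alpha_\varphi}a-|\alpha_\varphi|^2)+(J-\mu)\mathcal N+\frac U2\mathcal N(\mathcal N-1)$, with $\alpha_\varphi=\langle\varphi,a\varphi\rangle$. A solution of the mean-field equation is $\varphi\in C(\mathbb R;\mathcal D(\mathcal N^2))\cap C^1(\mathbb R;\ell^2(\mathbb C))$ satisfying $i\partial_t\varphi(t)=h^{\varphi(t)}\varphi(t)$. One-lattice-site reduced density matrix: $\gamma_d^{(1)}=\frac1{|\Lambda|}\sum_{x\in\Lambda}\mathrm{Tr}_{\Lambda\setminus\{x\}}(\gamma_d)$ (partial trace over all sites except $x$), an operator on $\ell^2(\mathbb C)$. $\|\cdot\|_{\mathcal L^1}$ is the trace norm. *)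

theory Defs
  imports "HOL-Analysis.Analysis" "Berlekamp_Zassenhaus.Finite_Field"
begin

section \<open>The Hilbert space of square-summable families\<close>

definition square_summable :: "('a \<Rightarrow> complex) \<Rightarrow> bool" where
  "square_summable f \<longleftrightarrow> (\<lambda>i. (cmod (f i))\<^sup>2) summable_on UNIV"

lemma square_summable_0: "square_summable (\<lambda>i. 0)"
  by (simp add: square_summable_def)

lemma square_summable_add:
  assumes "square_summable f" "square_summable g"
  shows "square_summable (\<lambda>i. f i + g i)"
  unfolding square_summable_def
proof (rule summable_on_comparison_test)
  show "(\<lambda>i. 2 * (cmod (f i))\<^sup>2 + 2 * (cmod (g i))\<^sup>2) summable_on UNIV"
    using assms unfolding square_summable_def
    by (intro summable_on_add summable_on_cmult_right)
  fix i
  have "(cmod (f i + g i))\<^sup>2 \<le> (cmod (f i) + cmod (g i))\<^sup>2"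
    by (intro power_mono norm_triangle_ineq norm_ge_zero)
  also have "\<dots> \<le> 2 * (cmod (f i))\<^sup>2 + 2 * (cmod (g i))\<^sup>2"
    using sum_squares_bound[of "cmod (f i)" "cmod (g i)"] by (simp add: power2_sum)
  finally show "(cmod (f i + g i))\<^sup>2 \<le> 2 * (cmod (f i))\<^sup>2 + 2 * (cmod (g i))\<^sup>2" .
qed auto

lemma square_summable_scale:
  assumes "square_summable f"
  shows "square_summable (\<lambda>i. c * f i)"
  using assms unfolding square_summable_def
  by (auto simp: norm_mult power_mult_distrib intro: summable_on_cmult_right)

lemma square_summable_mult:
  assumes "square_summable f" "square_summable g"
  shows "(\<lambda>i. cnj (f i) * g i) summable_on UNIV"
proof (rule abs_summable_summable, rule summable_on_comparison_test)
  show "(\<lambda>i. (cmod (f i))\<^sup>2 + (cmod (g i))\<^sup>2) summable_on UNIV"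
    using assms unfolding square_summable_def by (rule summable_on_add)
  fix i
  have "2 * (cmod (f i) * cmod (g i)) \<le> (cmod (f i))\<^sup>2 + (cmod (g i))\<^sup>2"
    using sum_squares_bound[of "cmod (f i)" "cmod (g i)"] by simp
  moreover have "0 \<le> cmod (f i) * cmod (g i)" by simp
  ultimately show "cmod (cnj (f i) * g i) \<le> (cmod (f i))\<^sup>2 + (cmod (g i))\<^sup>2"
    unfolding norm_mult complex_mod_cnj by linarith
qed auto

lemma square_summable_inj:
  assumes "square_summable f" "inj h"
  shows "square_summable (\<lambda>i. f (h i))"
proof -
  have "(\<lambda>i. (cmod (f i))\<^sup>2) summable_on range h"
    using assms(1) unfolding square_summable_def by (rule summable_on_subset) auto
  then show ?thesis
    using summable_on_reindex[OF assms(2), of "\<lambda>i. (cmod (f i))\<^sup>2"]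
    by (simp add: square_summable_def o_def)
qed

typedef 'a ell2 = "{f :: 'a \<Rightarrow> complex. square_summable f}"
  morphisms coords Abs_ell2
  using square_summable_0 by blast

setup_lifting type_definition_ell2

lift_definition ket :: "'a \<Rightarrow> 'a ell2" is "\<lambda>i j. if j = i then 1 else 0"
proof -
  fix i :: 'a
  have "(\<lambda>j. (cmod (if j = i then 1 else 0))\<^sup>2) summable_on {i}" by simp
  also have "?this \<longleftrightarrow> (\<lambda>j. (cmod (if j = i then 1 else 0))\<^sup>2) summable_on UNIV"
    by (rule summable_on_cong_neutral) auto
  finally show "square_summable (\<lambda>j. if j = i then 1 else 0)"
    by (simp add: square_summable_def)
qed

lift_definition scaleC :: "complex \<Rightarrow> 'a ell2 \<Rightarrow> 'a ell2" (infixr "*\<^sub>C" 75)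
  is "\<lambda>c f i. c * f i"
  by (rule square_summable_scale)

(* antilinear in the first argument *)
lift_definition cinner :: "'a ell2 \<Rightarrow> 'a ell2 \<Rightarrow> complex"
  is "\<lambda>f g. \<Sum>\<^sub>\<infinity>i. cnj (f i) * g i" .

instantiation ell2 :: (type) real_vector
begin

lift_definition zero_ell2 :: "'a ell2" is "\<lambda>i. 0"
  by (rule square_summable_0)
lift_definition plus_ell2 :: "'a ell2 \<Rightarrow> 'a ell2 \<Rightarrow> 'a ell2" is "\<lambda>f g i. f i + g i"
  by (rule square_summable_add)
lift_definition uminus_ell2 :: "'a ell2 \<Rightarrow> 'a ell2" is "\<lambda>f i. - f i"
  by (simp add: square_summable_def)
lift_definition minus_ell2 :: "'a ell2 \<Rightarrow> 'a ell2 \<Rightarrow> 'a ell2" is "\<lambda>f g i. f i - g i"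
proof -
  fix f g :: "'a \<Rightarrow> complex"
  assume "square_summable f" "square_summable g"
  then show "square_summable (\<lambda>i. f i - g i)"
    using square_summable_add[of f "\<lambda>i. (-1) * g i"] square_summable_scale[of g "-1"] by simp
qed
lift_definition scaleR_ell2 :: "real \<Rightarrow> 'a ell2 \<Rightarrow> 'a ell2" is "\<lambda>r f i. complex_of_real r * f i"
  by (rule square_summable_scale)
instance
proof
  fix x y z :: "'a ell2" and r s :: real
  show "x + y + z = x + (y + z)" by transfer (simp add: add.assoc)
  show "x + y = y + x" by transfer (simp add: add.commute)
  show "0 + x = x" by transfer simp
  show "- x + x = 0" by transfer simp
  show "x - y = x + - y" by transfer simp
  show "r *\<^sub>R (x + y) = r *\<^sub>R x + r *\<^sub>R y" by transfer (simp add: distrib_left)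
  show "(r + s) *\<^sub>R x = r *\<^sub>R x + s *\<^sub>R x" by transfer (simp add: distrib_right)
  show "r *\<^sub>R s *\<^sub>R x = (r * s) *\<^sub>R x" by transfer (simp add: mult.assoc)
  show "1 *\<^sub>R x = x" by transfer simp
qed

end

instantiation ell2 :: (type) real_inner
begin

definition inner_ell2 :: "'a ell2 \<Rightarrow> 'a ell2 \<Rightarrow> real" where
  "inner_ell2 \<psi> \<eta> = Re (cinner \<psi> \<eta>)"
definition norm_ell2 :: "'a ell2 \<Rightarrow> real" where
  "norm_ell2 \<psi> = sqrt (inner \<psi> \<psi>)"
definition dist_ell2 :: "'a ell2 \<Rightarrow> 'a ell2 \<Rightarrow> real" where
  "dist_ell2 \<psi> \<eta> = norm (\<psi> - \<eta>)"
definition sgn_ell2 :: "'a ell2 \<Rightarrow> 'a ell2" where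
  "sgn_ell2 \<psi> = \<psi> /\<^sub>R norm \<psi>"
definition uniformity_ell2 :: "('a ell2 \<times> 'a ell2) filter" where
  "uniformity_ell2 = (INF e\<in>{0<..}. principal {(x, y). dist x y < e})"
definition open_ell2 :: "'a ell2 set \<Rightarrow> bool" where
  "open_ell2 S \<longleftrightarrow> (\<forall>x\<in>S. \<forall>\<^sub>F (x', y) in uniformity. x' = x \<longrightarrow> y \<in> S)"

instance
proof
  fix x y z :: "'a ell2" and r :: real
  have self: "cinner x x = complex_of_real (\<Sum>\<^sub>\<infinity>i. (cmod (coords x i))\<^sup>2)"
  proof -
    have "cinner x x = (\<Sum>\<^sub>\<infinity>i. complex_of_real ((cmod (coords x i))\<^sup>2))"
      unfolding cinner.rep_eq by (simp only: complex_norm_square mult.commute)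
    also have "\<dots> = complex_of_real (\<Sum>\<^sub>\<infinity>i. (cmod (coords x i))\<^sup>2)"
      using coords[of x] unfolding square_summable_def mem_Collect_eq
      by (intro infsumI has_sum_of_real has_sum_infsum)
    finally show ?thesis .
  qed
  show "dist x y = norm (x - y)" by (rule dist_ell2_def)
  show "sgn x = x /\<^sub>R norm x" by (rule sgn_ell2_def)
  show "uniformity = (INF e\<in>{0<..}. principal {(x :: 'a ell2, y). dist x y < e})"
    by (rule uniformity_ell2_def)
  show "open S \<longleftrightarrow> (\<forall>x\<in>S. \<forall>\<^sub>F (x', y) in uniformity. x' = x \<longrightarrow> y \<in> S)" for S :: "'a ell2 set"
    by (rule open_ell2_def)
  show "norm x = sqrt (inner x x)" by (rule norm_ell2_def)
  have "cinner y x = cnj (cinner x y)"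
    unfolding cinner.rep_eq infsum_cnj[symmetric] by (simp add: mult.commute)
  then show "inner x y = inner y x" by (simp add: inner_ell2_def)
  have "cinner (x + y) z = cinner x z + cinner y z"
    unfolding cinner.rep_eq plus_ell2.rep_eq complex_cnj_add distrib_right
    using coords by (intro infsum_add square_summable_mult) blast+
  then show "inner (x + y) z = inner x z + inner y z" by (simp add: inner_ell2_def)
  have "cinner (r *\<^sub>R x) y = complex_of_real r * cinner x y"
    unfolding cinner.rep_eq scaleR_ell2.rep_eq
    by (simp add: infsum_cmult_right' mult.assoc)
  then show "inner (r *\<^sub>R x) y = r * inner x y" by (simp add: inner_ell2_def)
  show "0 \<le> inner x x" by (simp add: inner_ell2_def self infsum_nonneg)
  show "inner x x = 0 \<longleftrightarrow> x = 0"
  proof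
    assume "inner x x = 0"
    then have z: "(\<Sum>\<^sub>\<infinity>i. (cmod (coords x i))\<^sup>2) = 0" by (simp add: inner_ell2_def self)
    have s: "(\<lambda>i. (cmod (coords x i))\<^sup>2) summable_on UNIV"
      using coords[of x] by (simp add: square_summable_def)
    have "coords x i = 0" for i
      using nonneg_infsum_le_0D[of "\<lambda>i. (cmod (coords x i))\<^sup>2" UNIV i] z s by simp
    then have "coords x = coords 0" by (auto simp: zero_ell2.rep_eq)
    then show "x = 0" by (simp add: coords_inject)
  qed (simp add: inner_ell2_def cinner.rep_eq zero_ell2.rep_eq)
qed

end

section \<open>Operators\<close>

definition bounded_clinear :: "('a ell2 \<Rightarrow> 'b ell2) \<Rightarrow> bool" where
  "bounded_clinear A \<longleftrightarrow> bounded_linear A \<and> (\<forall>c \<psi>. A (c *\<^sub>C \<psi>) = c *\<^sub>C A \<psi>)"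

definition positive_op :: "('a ell2 \<Rightarrow> 'a ell2) \<Rightarrow> bool" where
  "positive_op A \<longleftrightarrow> bounded_clinear A \<and> (\<forall>\<psi>. cinner \<psi> (A \<psi>) \<in> \<real>\<^sub>\<ge>\<^sub>0)"

definition adjoint_op :: "('a ell2 \<Rightarrow> 'a ell2) \<Rightarrow> 'a ell2 \<Rightarrow> 'a ell2" where
  "adjoint_op A = (THE B. \<forall>\<psi> \<eta>. cinner (B \<psi>) \<eta> = cinner \<psi> (A \<eta>))"

definition abs_op :: "('a ell2 \<Rightarrow> 'a ell2) \<Rightarrow> 'a ell2 \<Rightarrow> 'a ell2" where
  "abs_op A = (THE P. positive_op P \<and> P \<circ> P = adjoint_op A \<circ> A)"

definition op_trace :: "('a ell2 \<Rightarrow> 'a ell2) \<Rightarrow> complex" where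
  "op_trace A = (\<Sum>\<^sub>\<infinity>i. cinner (ket i) (A (ket i)))"

definition trace_class :: "('a ell2 \<Rightarrow> 'a ell2) \<Rightarrow> bool" where
  "trace_class A \<longleftrightarrow>
     bounded_clinear A \<and> (\<lambda>i. cinner (ket i) (abs_op A (ket i))) summable_on UNIV"

(* Only meaningful for trace class operators: a divergent infsum is 0. *)
definition trace_norm :: "('a ell2 \<Rightarrow> 'a ell2) \<Rightarrow> real" where
  "trace_norm A = Re (op_trace (abs_op A))"

definition ketbra :: "'a ell2 \<Rightarrow> 'a ell2 \<Rightarrow> 'a ell2 \<Rightarrow> 'a ell2" where
  "ketbra \<psi> \<eta> = (\<lambda>\<xi>. cinner \<eta> \<xi> *\<^sub>C \<psi>)"

text \<open>
  Unbounded operators are given by their formal action on arbitrary coefficient families; such an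
  action \<open>F\<close> defines an operator on its maximal domain \<open>maximal_domain F\<close>. Outside of it, the total
  function \<open>operator_of F\<close> takes the dummy value 0.
\<close>

definition maximal_domain :: "(('a \<Rightarrow> complex) \<Rightarrow> 'a \<Rightarrow> complex) \<Rightarrow> 'a ell2 set" where
  "maximal_domain F = {\<psi>. square_summable (F (coords \<psi>))}"

definition operator_of :: "(('a \<Rightarrow> complex) \<Rightarrow> 'a \<Rightarrow> complex) \<Rightarrow> 'a ell2 \<Rightarrow> 'a ell2" where
  "operator_of F \<psi> = (if \<psi> \<in> maximal_domain F then Abs_ell2 (F (coords \<psi>)) else 0)"

section \<open>One-site operators\<close>

(* For n = 0 the coefficient sqrt n vanishes, so the truncated difference is harmless. *)
definition creation :: "(nat \<Rightarrow> complex) \<Rightarrow> nat \<Rightarrow> complex" where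
  "creation \<psi> = (\<lambda>n. complex_of_real (sqrt (real n)) * \<psi> (n - 1))"

definition annihilation :: "(nat \<Rightarrow> complex) \<Rightarrow> nat \<Rightarrow> complex" where
  "annihilation \<psi> = (\<lambda>n. complex_of_real (sqrt (real n + 1)) * \<psi> (n + 1))"

definition number :: "(nat \<Rightarrow> complex) \<Rightarrow> nat \<Rightarrow> complex" where
  "number \<psi> = creation (annihilation \<psi>)"

(* N (N - 1) *)
definition pair_number :: "(nat \<Rightarrow> complex) \<Rightarrow> nat \<Rightarrow> complex" where
  "pair_number \<psi> = number (\<lambda>n. number \<psi> n - \<psi> n)"

lemma annihilation_ket:
  "annihilation (coords (ket 0)) = (\<lambda>_. 0)"
  "annihilation (coords (ket (Suc n))) = (\<lambda>m. complex_of_real (sqrt (real (Suc n))) * coords (ket n) m)"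
  by (auto simp: annihilation_def ket.rep_eq)

lemma creation_ket:
  "creation (coords (ket n)) = (\<lambda>m. complex_of_real (sqrt (real (Suc n))) * coords (ket (Suc n)) m)"
  by (rule ext, case_tac m) (auto simp: creation_def ket.rep_eq)

lemma number_eq: "number \<psi> = (\<lambda>n. of_nat n * \<psi> n)"
proof
  fix n show "number \<psi> n = of_nat n * \<psi> n"
  proof (cases n)
    case (Suc k)
    have "complex_of_real (sqrt (real n)) * complex_of_real (sqrt (real n)) = of_nat n"
      by (simp flip: of_real_mult)
    with Suc show ?thesis
      by (simp add: number_def creation_def annihilation_def mult.assoc[symmetric] add.commute)
  qed (simp add: number_def creation_def)
qed

definition level_proj :: "nat \<Rightarrow> nat ell2 \<Rightarrow> nat ell2" where
  "level_proj n = ketbra (ket n) (ket n)"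

section \<open>Mean-field equation\<close>

definition order_parameter :: "nat ell2 \<Rightarrow> complex" where
  "order_parameter \<phi> = cinner \<phi> (operator_of annihilation \<phi>)"

definition mean_field_op ::
    "real \<Rightarrow> real \<Rightarrow> real \<Rightarrow> nat ell2 \<Rightarrow> (nat \<Rightarrow> complex) \<Rightarrow> nat \<Rightarrow> complex" where
  "mean_field_op J \<mu> U \<phi> \<psi> =
     (let \<alpha> = order_parameter \<phi> in
      (\<lambda>n. - of_real J * (\<alpha> * creation \<psi> n + cnj \<alpha> * annihilation \<psi> n
                            - of_real ((cmod \<alpha>)\<^sup>2) * \<psi> n)
           + of_real (J - \<mu>) * number \<psi> n
           + of_real (U / 2) * pair_number \<psi> n))"

(* Continuity into D(N^2) refers to the graph norm, i.e. to continuity of phi and of N^2 phi. *)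
definition mean_field_solution ::
    "real \<Rightarrow> real \<Rightarrow> real \<Rightarrow> (real \<Rightarrow> nat ell2) \<Rightarrow> bool" where
  "mean_field_solution J \<mu> U \<phi> \<longleftrightarrow>
     (\<forall>t. \<phi> t \<in> maximal_domain (number \<circ> number)) \<and>
     continuous_on UNIV \<phi> \<and>
     continuous_on UNIV (\<lambda>t. operator_of (number \<circ> number) (\<phi> t)) \<and>
     (\<exists>\<phi>'. continuous_on UNIV \<phi>' \<and>
           (\<forall>t. (\<phi> has_vector_derivative \<phi>' t) (at t)) \<and>
           (\<forall>t. \<i> *\<^sub>C \<phi>' t = operator_of (mean_field_op J \<mu> U (\<phi> t)) (\<phi> t)))"

section \<open>Bose--Hubbard dynamics\<close>

text \<open>
  The lattice \<open>(\<int>/L\<int>)\<^sup>d\<close> is the type \<^typ>\<open>'l mod_ring ^ 'd\<close> with \<open>L = CARD('l)\<close> and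
  \<open>d = CARD('d)\<close>. The tensor product of one copy of \<^typ>\<open>nat ell2\<close> per site \<^typ>\<open>'s\<close> is
  \<^typ>\<open>('s \<Rightarrow> nat) ell2\<close>, where \<^term>\<open>ket n\<close> stands for the product of the vectors
  \<^term>\<open>ket (n x)\<close>.
\<close>

(* B acting on the tensor factor at x *)
definition at_site ::
    "((nat \<Rightarrow> complex) \<Rightarrow> nat \<Rightarrow> complex) \<Rightarrow> 's \<Rightarrow> (('s \<Rightarrow> nat) \<Rightarrow> complex) \<Rightarrow> ('s \<Rightarrow> nat) \<Rightarrow> complex" where
  "at_site B x \<Psi> = (\<lambda>n. B (\<lambda>m. \<Psi> (n(x := m))) (n x))"

definition nearest_neighbours :: "'l::nontriv mod_ring ^ 'd::finite \<Rightarrow> 'l mod_ring ^ 'd \<Rightarrow> bool" where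
  "nearest_neighbours x y \<longleftrightarrow> (\<exists>i. y = x + axis i 1 \<or> y = x - axis i 1)"

(* The hopping sum runs over ordered pairs; the factor 1/2 turns it into a sum over unordered
   pairs. *)
definition bose_hubbard ::
    "real \<Rightarrow> real \<Rightarrow> real \<Rightarrow> (('l::nontriv mod_ring ^ 'd::finite \<Rightarrow> nat) \<Rightarrow> complex)
      \<Rightarrow> ('l mod_ring ^ 'd \<Rightarrow> nat) \<Rightarrow> complex" where
  "bose_hubbard J \<mu> U \<Psi> = (\<lambda>n.
     - of_real (J / (2 * real CARD('d))) *
        ((1/2) * (\<Sum>(x, y) | nearest_neighbours x y.
           at_site creation x (at_site annihilation y \<Psi>) n
           + at_site creation y (at_site annihilation x \<Psi>) n))
     + of_real (J - \<mu>) * (\<Sum>x\<in>UNIV. at_site number x \<Psi> n)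
     + of_real (U / 2) * (\<Sum>x\<in>UNIV. at_site pair_number x \<Psi> n))"

text \<open>
  \<open>propagator J \<mu> U t\<close> is \<open>exp (- \<i> t H)\<close>. As \<open>H\<close> preserves the total particle number and the
  sectors of fixed particle number are finite-dimensional, the exponential series converges on each
  sector, i.e. coefficientwise for every \<open>\<Psi>\<close>.
\<close>

definition propagator ::
    "real \<Rightarrow> real \<Rightarrow> real \<Rightarrow> real
      \<Rightarrow> ('l::nontriv mod_ring ^ 'd::finite \<Rightarrow> nat) ell2 \<Rightarrow> ('l mod_ring ^ 'd \<Rightarrow> nat) ell2" where
  "propagator J \<mu> U t =
     operator_of (\<lambda>\<Psi> n. \<Sum>k. (- \<i> * of_real t) ^ k / fact k * (bose_hubbard J \<mu> U ^^ k) \<Psi> n)"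

definition von_neumann_evolution ::
    "real \<Rightarrow> real \<Rightarrow> real
      \<Rightarrow> (('l::nontriv mod_ring ^ 'd::finite \<Rightarrow> nat) ell2 \<Rightarrow> ('l mod_ring ^ 'd \<Rightarrow> nat) ell2) \<Rightarrow> real
      \<Rightarrow> ('l mod_ring ^ 'd \<Rightarrow> nat) ell2 \<Rightarrow> ('l mod_ring ^ 'd \<Rightarrow> nat) ell2" where
  "von_neumann_evolution J \<mu> U \<gamma>\<^sub>0 t = propagator J \<mu> U t \<circ> \<gamma>\<^sub>0 \<circ> propagator J \<mu> U (- t)"

section \<open>One-site reduced density matrix\<close>

text \<open>
  \<open>tensor_ket x \<sigma> \<psi>\<close> has \<open>\<psi>\<close> at the site \<open>x\<close> and the basis vectors \<open>ket (\<sigma> y)\<close> at all other sites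
  \<open>y\<close>; \<open>contract_bra x \<sigma>\<close> is its adjoint. The value \<open>\<sigma> x\<close> is irrelevant, so that the
  configurations of the complement of \<open>x\<close> are represented by the \<open>\<sigma>\<close> with \<open>\<sigma> x = 0\<close>.
\<close>

lift_definition tensor_ket :: "'s \<Rightarrow> ('s \<Rightarrow> nat) \<Rightarrow> nat ell2 \<Rightarrow> ('s \<Rightarrow> nat) ell2"
  is "\<lambda>x \<sigma> \<psi> n. if \<forall>y. y \<noteq> x \<longrightarrow> n y = \<sigma> y then \<psi> (n x) else 0"
proof -
  fix x :: 's and \<sigma> :: "'s \<Rightarrow> nat" and \<psi> :: "nat \<Rightarrow> complex"
  assume \<psi>: "square_summable \<psi>"
  define F where "F = (\<lambda>n. if \<forall>y. y \<noteq> x \<longrightarrow> n y = \<sigma> y then \<psi> (n x) else 0)"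
  let ?h = "\<lambda>m. \<sigma>(x := m)"
  have inj: "inj ?h" by (rule injI) (metis fun_upd_same)
  have "(\<lambda>n. (cmod (F n))\<^sup>2) summable_on range ?h \<longleftrightarrow> (\<lambda>m. (cmod (F (?h m)))\<^sup>2) summable_on UNIV"
    using summable_on_reindex[OF inj, of "\<lambda>n. (cmod (F n))\<^sup>2"] by (simp add: o_def)
  moreover have "(\<lambda>m. (cmod (F (?h m)))\<^sup>2) summable_on UNIV"
    using \<psi> by (simp add: F_def square_summable_def)
  moreover have "(\<lambda>n. (cmod (F n))\<^sup>2) summable_on range ?h \<longleftrightarrow> (\<lambda>n. (cmod (F n))\<^sup>2) summable_on UNIV"
  proof (rule summable_on_cong_neutral)
    fix n assume n: "n \<in> UNIV - range ?h"
    have "\<not> (\<forall>y. y \<noteq> x \<longrightarrow> n y = \<sigma> y)"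
    proof
      assume "\<forall>y. y \<noteq> x \<longrightarrow> n y = \<sigma> y"
      then have "n = ?h (n x)" by auto
      with n show False by blast
    qed
    then show "(cmod (F n))\<^sup>2 = 0" by (auto simp: F_def)
  qed auto
  ultimately show "square_summable (\<lambda>n. if \<forall>y. y \<noteq> x \<longrightarrow> n y = \<sigma> y then \<psi> (n x) else 0)"
    by (simp add: square_summable_def F_def)
qed

lift_definition contract_bra :: "'s \<Rightarrow> ('s \<Rightarrow> nat) \<Rightarrow> ('s \<Rightarrow> nat) ell2 \<Rightarrow> nat ell2"
  is "\<lambda>x \<sigma> \<Psi> m. \<Psi> (\<sigma>(x := m))"
proof -
  fix x :: 's and \<sigma> :: "'s \<Rightarrow> nat" and \<Psi> :: "('s \<Rightarrow> nat) \<Rightarrow> complex"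
  assume "square_summable \<Psi>"
  moreover have "inj (\<lambda>m. \<sigma>(x := m))" by (rule injI) (metis fun_upd_same)
  ultimately show "square_summable (\<lambda>m. \<Psi> (\<sigma>(x := m)))" by (rule square_summable_inj)
qed

(* trace over all sites except x *)
definition partial_trace ::
    "'s \<Rightarrow> (('s \<Rightarrow> nat) ell2 \<Rightarrow> ('s \<Rightarrow> nat) ell2) \<Rightarrow> nat ell2 \<Rightarrow> nat ell2" where
  "partial_trace x \<gamma> \<psi> = (\<Sum>\<^sub>\<infinity>\<sigma>\<in>{\<sigma>. \<sigma> x = 0}. contract_bra x \<sigma> (\<gamma> (tensor_ket x \<sigma> \<psi>)))"

definition one_site_density ::
    "(('s::finite \<Rightarrow> nat) ell2 \<Rightarrow> ('s \<Rightarrow> nat) ell2) \<Rightarrow> nat ell2 \<Rightarrow> nat ell2" where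
  "one_site_density \<gamma> \<psi> = (\<Sum>x\<in>UNIV. partial_trace x \<gamma> \<psi>) /\<^sub>R real CARD('s)"

end

(*
  Let q(t) = 1 - |phi(t)><phi(t)| and alpha(t) = Tr(gamma^(1)(t) q(t)). Since the negative part of
  gamma^(1) - |phi><phi| has rank at most one, 2 alpha <= ||gamma^(1) - |phi><phi| ||_1 <= 2 sqrt(alpha), so a
  Gronwall estimate for alpha suffices.

  Decompose gamma(0) into pure states, truncated to finitely many particles. In the derivative of
  sum_x <Psi, p_x Psi> the on-site terms cancel and only fluctuations a_z - <a> at the neighbours z of
  x survive. Insert 1 = p_z + q_z: the terms of type pp vanish by the choice of h^phi or by symmetry in
  x and z; the term creating two excitations from the condensate is O(alpha + 1/d) because the
  2d neighbours commute with each other; the remaining terms contain an unbounded operator a_z next to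
  q_z, which is cut off at the occupation number M(t). With M(t) proportional to
  exp(C_1 t) ln(d + 1), the tail beyond the cut-off is O(1/d), because the exponential moments with
  rate 1/kappa(t), kappa(t) = (3/2)(kappa + e) exp(C_1 t), stay bounded: this growth of kappa
  compensates the hopping between levels.
*)
theory Submission
  imports Defs "HOL-Real_Asymp.Real_Asymp"
begin

text \<open>The obstacle is that annihilation at a neighbour is unbounded: the Gronwall rate
  contains the square root of the cut-off \<open>M\<close>, while the tail beyond \<open>M\<close>
  must be of order \<open>1 / (d + 1)\<close>. For a given final time \<open>t\<close> the cut-off
  stays constant on the whole interval from 0 to \<open>t\<close>, so the exponent contains
  \<open>D t * t\<close> and not an integral. The scale starts from
  \<open>\<kappa>\<^sub>0 = 3 / 2 * (\<kappa> + exp 1)\<close>: the factor 3/2 turns the initial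
  exponential moment into a convergent geometric series, and the summand \<open>exp 1\<close> makes
  \<open>\<kappa>\<^sub>0 \<ge> 4\<close>, as the growth estimate for one step of the weight
  requires. \<open>M\<close> solves \<open>3 * M / (4 * \<kappa> t) = ln (d + 1)\<close>, where
  \<open>\<kappa> t = \<kappa>\<^sub>0 * exp (C\<^sub>1 * t)\<close>; three quarters of the
  exponential weight pay for the tail, one quarter for the unbounded factor. Norm and particle
  number are conserved along the mean-field flow because the current between levels decays fast.
  Operators are treated without spectral theory: square roots are binomial series, and density
  matrices are weak sums of rank one operators, a notion stable under evolution and partial
  trace.\<close>

section \<open>The complex inner product\<close>

lemma square_summable_coords [simp]: "square_summable (coords \<psi>)"
  using coords[of \<psi>] by simp

lemma coords_Abs: "square_summable f \<Longrightarrow> coords (Abs_ell2 f) = f"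
  by (simp add: Abs_ell2_inverse)

lemma ell2_eqI: "(\<And>i. coords \<psi> i = coords \<eta> i) \<Longrightarrow> \<psi> = \<eta>"
  by (metis coords_inject ext)

lemma coords_zero [simp]: "coords 0 i = 0"
  by (simp add: zero_ell2.rep_eq)
lemma coords_add [simp]: "coords (\<psi> + \<eta>) i = coords \<psi> i + coords \<eta> i"
  by (simp add: plus_ell2.rep_eq)
lemma coords_minus [simp]: "coords (- \<psi>) i = - coords \<psi> i"
  by (simp add: uminus_ell2.rep_eq)
lemma coords_diff [simp]: "coords (\<psi> - \<eta>) i = coords \<psi> i - coords \<eta> i"
  by (simp add: minus_ell2.rep_eq)
lemma coords_scaleC [simp]: "coords (c *\<^sub>C \<psi>) i = c * coords \<psi> i"
  by (simp add: scaleC.rep_eq)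
lemma coords_scaleR [simp]: "coords (r *\<^sub>R \<psi>) i = of_real r * coords \<psi> i"
  by (simp add: scaleR_ell2.rep_eq)
lemma coords_ket: "coords (ket i) j = (if j = i then 1 else 0)"
  by (simp add: ket.rep_eq)
lemma coords_sum [simp]: "coords (\<Sum>k\<in>I. f k) i = (\<Sum>k\<in>I. coords (f k) i)"
  by (induction I rule: infinite_finite_induct) auto

lemma scaleC_add_right: "c *\<^sub>C (\<psi> + \<eta>) = c *\<^sub>C \<psi> + c *\<^sub>C \<eta>"
  by (rule ell2_eqI) (simp add: algebra_simps)
lemma scaleC_add_left: "(b + c) *\<^sub>C \<psi> = b *\<^sub>C \<psi> + c *\<^sub>C \<psi>"
  by (rule ell2_eqI) (simp add: algebra_simps)
lemma scaleC_diff_right: "c *\<^sub>C (\<psi> - \<eta>) = c *\<^sub>C \<psi> - c *\<^sub>C \<eta>"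
  by (rule ell2_eqI) (simp add: algebra_simps)
lemma scaleC_scaleC [simp]: "b *\<^sub>C c *\<^sub>C \<psi> = (b * c) *\<^sub>C \<psi>"
  by (rule ell2_eqI) simp
lemma scaleC_one [simp]: "1 *\<^sub>C \<psi> = \<psi>"
  by (rule ell2_eqI) simp
lemma scaleC_zero_left [simp]: "0 *\<^sub>C \<psi> = 0"
  by (rule ell2_eqI) simp
lemma scaleC_zero_right [simp]: "c *\<^sub>C 0 = 0"
  by (rule ell2_eqI) simp
lemma scaleC_minus_left [simp]: "(- c) *\<^sub>C \<psi> = - (c *\<^sub>C \<psi>)"
  by (rule ell2_eqI) simp
lemma scaleC_minus_right [simp]: "c *\<^sub>C (- \<psi>) = - (c *\<^sub>C \<psi>)"
  by (rule ell2_eqI) simp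
lemma scaleR_scaleC: "r *\<^sub>R \<psi> = of_real r *\<^sub>C \<psi>"
  by (rule ell2_eqI) simp

lemma cinner_has_sum: "((\<lambda>i. cnj (coords \<psi> i) * coords \<eta> i) has_sum cinner \<psi> \<eta>) UNIV"
  unfolding cinner.rep_eq by (rule has_sum_infsum, rule square_summable_mult) auto

lemma cinner_unique:
  "((\<lambda>i. cnj (coords \<psi> i) * coords \<eta> i) has_sum z) UNIV \<Longrightarrow> cinner \<psi> \<eta> = z"
  using cinner_has_sum has_sum_unique by blast

lemma cinner_commute: "cinner \<eta> \<psi> = cnj (cinner \<psi> \<eta>)"
proof (rule cinner_unique)
  have "((\<lambda>i. cnj (cnj (coords \<psi> i) * coords \<eta> i)) has_sum cnj (cinner \<psi> \<eta>)) UNIV"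
    using cinner_has_sum[of \<psi> \<eta>] by (simp only: has_sum_cnj_iff)
  then show "((\<lambda>i. cnj (coords \<eta> i) * coords \<psi> i) has_sum cnj (cinner \<psi> \<eta>)) UNIV"
    by (simp add: mult.commute)
qed

lemma cinner_add_right: "cinner \<psi> (\<eta> + \<xi>) = cinner \<psi> \<eta> + cinner \<psi> \<xi>"
  by (rule cinner_unique)
    (use has_sum_add[OF cinner_has_sum[of \<psi> \<eta>] cinner_has_sum[of \<psi> \<xi>]] in
      \<open>simp add: algebra_simps\<close>)

lemma cinner_scaleC_right: "cinner \<psi> (c *\<^sub>C \<eta>) = c * cinner \<psi> \<eta>"
  by (rule cinner_unique)
    (use has_sum_cmult_right[OF cinner_has_sum[of \<psi> \<eta>], of c] in \<open>simp add: algebra_simps\<close>)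

lemma cinner_add_left: "cinner (\<psi> + \<xi>) \<eta> = cinner \<psi> \<eta> + cinner \<xi> \<eta>"
  using cinner_add_right[of \<eta> \<psi> \<xi>] by (metis cinner_commute complex_cnj_add)

lemma cinner_scaleC_left: "cinner (c *\<^sub>C \<psi>) \<eta> = cnj c * cinner \<psi> \<eta>"
  using cinner_scaleC_right[of \<eta> c \<psi>] by (metis cinner_commute complex_cnj_mult)

lemma cinner_scaleR_right: "cinner \<psi> (r *\<^sub>R \<eta>) = of_real r * cinner \<psi> \<eta>"
  by (simp add: scaleR_scaleC cinner_scaleC_right)
lemma cinner_scaleR_left: "cinner (r *\<^sub>R \<psi>) \<eta> = of_real r * cinner \<psi> \<eta>"
  by (simp add: scaleR_scaleC cinner_scaleC_left)

lemma cinner_zero_right [simp]: "cinner \<psi> 0 = 0"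
  using cinner_scaleC_right[of \<psi> 0 0] by simp
lemma cinner_zero_left [simp]: "cinner 0 \<psi> = 0"
  using cinner_scaleC_left[of 0 0 \<psi>] by simp
lemma cinner_minus_right: "cinner \<psi> (- \<eta>) = - cinner \<psi> \<eta>"
  using cinner_scaleC_right[of \<psi> "-1" \<eta>] by simp
lemma cinner_minus_left: "cinner (- \<psi>) \<eta> = - cinner \<psi> \<eta>"
  using cinner_scaleC_left[of "-1" \<psi> \<eta>] by simp
lemma cinner_diff_right: "cinner \<psi> (\<eta> - \<xi>) = cinner \<psi> \<eta> - cinner \<psi> \<xi>"
  using cinner_add_right[of \<psi> \<eta> "- \<xi>"] by (simp add: cinner_minus_right)
lemma cinner_diff_left: "cinner (\<psi> - \<xi>) \<eta> = cinner \<psi> \<eta> - cinner \<xi> \<eta>"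
  using cinner_add_left[of \<psi> "- \<xi>" \<eta>] by (simp add: cinner_minus_left)
lemma cinner_sum_right: "cinner \<psi> (\<Sum>k\<in>I. f k) = (\<Sum>k\<in>I. cinner \<psi> (f k))"
  by (induction I rule: infinite_finite_induct) (auto simp: cinner_add_right)
lemma cinner_sum_left: "cinner (\<Sum>k\<in>I. f k) \<psi> = (\<Sum>k\<in>I. cinner (f k) \<psi>)"
  by (induction I rule: infinite_finite_induct) (auto simp: cinner_add_left)

lemmas cinner_simps = cinner_add_left cinner_add_right cinner_diff_left cinner_diff_right
  cinner_scaleC_left cinner_scaleC_right cinner_scaleR_left cinner_scaleR_right
  cinner_minus_left cinner_minus_right

lemma cinner_self: "cinner \<psi> \<psi> = of_real ((norm \<psi>)\<^sup>2)"
proof -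
  have "Im (cinner \<psi> \<psi>) = 0"
    using cinner_commute[of \<psi> \<psi>] by (simp add: complex_eq_iff)
  moreover have "Re (cinner \<psi> \<psi>) = (norm \<psi>)\<^sup>2"
    by (simp add: power2_norm_eq_inner inner_ell2_def)
  ultimately show ?thesis by (simp add: complex_eq_iff)
qed

lemma norm_sq_has_sum: "((\<lambda>i. (cmod (coords \<psi> i))\<^sup>2) has_sum (norm \<psi>)\<^sup>2) UNIV"
proof -
  have "((\<lambda>i. Re (cnj (coords \<psi> i) * coords \<psi> i)) has_sum Re (cinner \<psi> \<psi>)) UNIV"
    by (rule has_sum_Re[OF cinner_has_sum])
  moreover have "Re (cnj (coords \<psi> i) * coords \<psi> i) = (cmod (coords \<psi> i))\<^sup>2" for i
    unfolding cmod_power2 by (simp add: power2_eq_square)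
  ultimately show ?thesis by (simp add: cinner_self)
qed

lemma norm_scaleC [simp]: "norm (c *\<^sub>C \<psi>) = cmod c * norm \<psi>"
proof -
  have "of_real ((norm (c *\<^sub>C \<psi>))\<^sup>2) = cinner (c *\<^sub>C \<psi>) (c *\<^sub>C \<psi>)"
    by (simp only: cinner_self)
  also have "\<dots> = of_real ((cmod c * norm \<psi>)\<^sup>2)"
    by (simp only: cinner_scaleC_left cinner_scaleC_right cinner_self[of \<psi>])
      (simp add: power_mult_distrib complex_norm_square[symmetric] mult.assoc[symmetric] flip: of_real_power)
  finally show ?thesis
    by (metis norm_ge_zero mult_nonneg_nonneg of_real_eq_iff power2_eq_imp_eq)
qed

text \<open>A unimodular multiple of \<open>\<eta>\<close> makes the product real and nonnegative,
  so the real Cauchy--Schwarz inequality applies.\<close>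

lemma cinner_Cauchy_Schwarz: "cmod (cinner \<psi> \<eta>) \<le> norm \<psi> * norm \<eta>"
proof (cases "cinner \<psi> \<eta> = 0")
  case False
  define z where "z = cinner \<psi> \<eta>"
  have "cinner \<psi> ((cnj z / of_real (cmod z)) *\<^sub>C \<eta>) = of_real (cmod z)"
    using False by (simp add: cinner_simps z_def[symmetric] complex_norm_square[symmetric] mult.commute
        power2_eq_square field_simps)
  then have "cmod z = inner \<psi> ((cnj z / of_real (cmod z)) *\<^sub>C \<eta>)"
    by (simp add: inner_ell2_def)
  also have "\<dots> \<le> norm \<psi> * norm ((cnj z / of_real (cmod z)) *\<^sub>C \<eta>)"
    by (rule norm_cauchy_schwarz)
  also have "\<dots> = norm \<psi> * norm \<eta>"
    using False by (simp add: norm_divide z_def)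
  finally show ?thesis by (simp add: z_def)
qed simp

lemma cinner_ket_left [simp]: "cinner (ket i) \<psi> = coords \<psi> i"
proof (rule cinner_unique)
  have "((\<lambda>j. cnj (coords (ket i) j) * coords \<psi> j) has_sum coords \<psi> i) {i}"
    by (rule has_sum_finiteI) (auto simp: coords_ket)
  also have "?this \<longleftrightarrow> ((\<lambda>j. cnj (coords (ket i) j) * coords \<psi> j) has_sum coords \<psi> i) UNIV"
    by (rule has_sum_cong_neutral) (auto simp: coords_ket)
  finally show "((\<lambda>j. cnj (coords (ket i) j) * coords \<psi> j) has_sum coords \<psi> i) UNIV" .
qed

lemma cinner_ket_right [simp]: "cinner \<psi> (ket i) = cnj (coords \<psi> i)"
  by (metis cinner_commute cinner_ket_left)

lemma norm_ket [simp]: "norm (ket i) = 1"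
proof -
  have "of_real ((norm (ket i))\<^sup>2) = (1::complex)"
    unfolding cinner_self[symmetric] by (simp add: coords_ket)
  then have "(norm (ket i))\<^sup>2 = 1" by (metis of_real_1 of_real_eq_iff)
  then show ?thesis by (metis norm_ge_zero power2_eq_1_iff neg_0_le_iff_le not_one_le_zero)
qed

lemma cmod_coords_le: "cmod (coords \<psi> i) \<le> norm \<psi>"
  using cinner_Cauchy_Schwarz[of "ket i" \<psi>] by simp

lemma bounded_bilinear_cinner: "bounded_bilinear (cinner :: 'a ell2 \<Rightarrow> 'a ell2 \<Rightarrow> complex)"
proof
  show "\<exists>K. \<forall>\<psi> \<eta>. norm (cinner \<psi> \<eta>) \<le> norm \<psi> * norm \<eta> * K"
    by (rule exI[of _ 1]) (simp add: cinner_Cauchy_Schwarz)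
qed (auto simp: cinner_simps scaleR_conv_of_real)

text \<open>Uniform bounds on finite partial sums already yield a vector of the space together with
  its norm bound. Completeness and the square summability of the coefficientwise evolution rest on
  this.\<close>

lemma norm_le_finite_sums:
  assumes "\<And>F. finite F \<Longrightarrow> (\<Sum>i\<in>F. (cmod (f i))\<^sup>2) \<le> b\<^sup>2" "b \<ge> 0"
  shows "square_summable f" "norm (Abs_ell2 f) \<le> b"
proof -
  show s: "square_summable f"
    unfolding square_summable_def
    by (rule nonneg_bdd_above_summable_on) (use assms(1) in \<open>auto intro!: bdd_aboveI2\<close>)
  have "(norm (Abs_ell2 f))\<^sup>2 \<le> b\<^sup>2"
    by (rule has_sum_le_finite_sums[OF norm_sq_has_sum]) (use assms(1) in \<open>auto simp: coords_Abs[OF s]\<close>)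
  then show "norm (Abs_ell2 f) \<le> b"
    using assms(2) by (rule power2_le_imp_le)
qed

lemma sum_cmod_le_norm: "finite F \<Longrightarrow> (\<Sum>i\<in>F. (cmod (coords \<psi> i))\<^sup>2) \<le> (norm \<psi>)\<^sup>2"
  using finite_sum_le_has_sum[OF norm_sq_has_sum, of F \<psi>] by simp

text \<open>The limit is taken coordinatewise; the Cauchy estimate survives on every finite set of
  coordinates, and \<open>norm_le_finite_sums\<close> turns it into a norm estimate.\<close>

instance ell2 :: (type) complete_space
proof
  fix X :: "nat \<Rightarrow> 'a ell2"
  assume X: "Cauchy X"
  have "\<exists>l. (\<lambda>n. coords (X n) i) \<longlonglongrightarrow> l" for i
  proof -
    have "Cauchy (\<lambda>n. coords (X n) i)"
    proof (rule metric_CauchyI)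
      fix e :: real assume "e > 0"
      then obtain M where M: "\<And>m n. m \<ge> M \<Longrightarrow> n \<ge> M \<Longrightarrow> dist (X m) (X n) < e"
        using metric_CauchyD[OF X] by blast
      have "dist (coords (X m) i) (coords (X n) i) < e" if "m \<ge> M" "n \<ge> M" for m n
        using M[OF that] cmod_coords_le[of "X m - X n" i] by (simp add: dist_norm)
      then show "\<exists>M. \<forall>m\<ge>M. \<forall>n\<ge>M. dist (coords (X m) i) (coords (X n) i) < e" by blast
    qed
    then show ?thesis using Cauchy_convergent convergent_def by blast
  qed
  then obtain f where f: "\<And>i. (\<lambda>n. coords (X n) i) \<longlonglongrightarrow> f i" by metis
  have *: "\<exists>M. \<forall>n\<ge>M. square_summable (\<lambda>i. f i - coords (X n) i) \<and>
      norm (Abs_ell2 (\<lambda>i. f i - coords (X n) i)) \<le> e" if "e > 0" for e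
  proof -
    obtain M where M: "\<And>m n. m \<ge> M \<Longrightarrow> n \<ge> M \<Longrightarrow> dist (X m) (X n) < e"
      using metric_CauchyD[OF X \<open>e > 0\<close>] by blast
    have "(\<Sum>i\<in>F. (cmod (f i - coords (X n) i))\<^sup>2) \<le> e\<^sup>2" if "finite F" "n \<ge> M" for F n
    proof (rule LIMSEQ_le_const2)
      show "(\<lambda>m. \<Sum>i\<in>F. (cmod (coords (X m) i - coords (X n) i))\<^sup>2)
          \<longlonglongrightarrow> (\<Sum>i\<in>F. (cmod (f i - coords (X n) i))\<^sup>2)"
        by (intro tendsto_intros f)
      have "(\<Sum>i\<in>F. (cmod (coords (X m) i - coords (X n) i))\<^sup>2) \<le> e\<^sup>2" if "m \<ge> M" for m
      proof -
        have "(\<Sum>i\<in>F. (cmod (coords (X m) i - coords (X n) i))\<^sup>2) \<le> (norm (X m - X n))\<^sup>2"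
          using sum_cmod_le_norm[OF \<open>finite F\<close>, of "X m - X n"] by simp
        also have "\<dots> \<le> e\<^sup>2"
          using M[OF that \<open>n \<ge> M\<close>] by (intro power_mono) (auto simp: dist_norm)
        finally show ?thesis .
      qed
      then show "\<exists>N. \<forall>m\<ge>N. (\<Sum>i\<in>F. (cmod (coords (X m) i - coords (X n) i))\<^sup>2) \<le> e\<^sup>2" by blast
    qed
    then show ?thesis
      using \<open>e > 0\<close> by (intro exI[of _ M] allI impI conjI norm_le_finite_sums) auto
  qed
  obtain M where "square_summable (\<lambda>i. f i - coords (X M) i)"
    using *[of 1] by auto
  then have sf: "square_summable f"
    using square_summable_add[of "\<lambda>i. f i - coords (X M) i" "coords (X M)"] by simp
  have "X \<longlonglongrightarrow> Abs_ell2 f"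
  proof (rule metric_LIMSEQ_I)
    fix e :: real assume "e > 0"
    then obtain M where M: "\<And>n. n \<ge> M \<Longrightarrow> square_summable (\<lambda>i. f i - coords (X n) i) \<and>
      norm (Abs_ell2 (\<lambda>i. f i - coords (X n) i)) \<le> e / 2"
      using *[of "e/2"] by auto
    have "dist (X n) (Abs_ell2 f) < e" if "n \<ge> M" for n
    proof -
      have "Abs_ell2 (\<lambda>i. f i - coords (X n) i) = Abs_ell2 f - X n"
        by (rule ell2_eqI) (use M[OF that] sf in \<open>simp add: coords_Abs\<close>)
      then show ?thesis
        using M[OF that] \<open>e > 0\<close> by (simp add: dist_norm norm_minus_commute)
    qed
    then show "\<exists>no. \<forall>n\<ge>no. dist (X n) (Abs_ell2 f) < e" by blast
  qed
  then show "convergent X" by (rule convergentI)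
qed

instance ell2 :: (type) banach ..

lemma has_sum_dist_iff:
  fixes f :: "'a \<Rightarrow> 'b::{comm_monoid_add, metric_space}"
  shows "(f has_sum S) UNIV \<longleftrightarrow>
    (\<forall>e>0. \<exists>F. finite F \<and> (\<forall>G. finite G \<and> F \<subseteq> G \<longrightarrow> dist (sum f G) S < e))"
  by (simp add: has_sum_def tendsto_iff eventually_finite_subsets_at_top)

text \<open>The squared error of a finite partial sum is the part of the norm series that is still
  missing.\<close>

lemma ket_expansion: "((\<lambda>i. coords \<psi> i *\<^sub>C ket i) has_sum \<psi>) UNIV"
  unfolding has_sum_dist_iff
proof (intro allI impI)
  fix e :: real assume e: "e > 0"
  have "\<exists>F. finite F \<and> (\<forall>G. finite G \<and> F \<subseteq> G \<longrightarrow>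
      dist (\<Sum>i\<in>G. (cmod (coords \<psi> i))\<^sup>2) ((norm \<psi>)\<^sup>2) < e\<^sup>2)"
    using norm_sq_has_sum[of \<psi>] e unfolding has_sum_dist_iff by (auto simp: zero_less_power)
  then obtain F where F: "finite F"
    "\<And>G. finite G \<Longrightarrow> F \<subseteq> G \<Longrightarrow> dist (\<Sum>i\<in>G. (cmod (coords \<psi> i))\<^sup>2) ((norm \<psi>)\<^sup>2) < e\<^sup>2"
    by auto
  have "dist (\<Sum>i\<in>G. coords \<psi> i *\<^sub>C ket i) \<psi> < e" if G: "finite G" "F \<subseteq> G" for G
  proof -
    let ?s = "\<Sum>i\<in>G. coords \<psi> i *\<^sub>C ket i"
    have 1: "cinner \<psi> ?s = of_real (\<Sum>i\<in>G. (cmod (coords \<psi> i))\<^sup>2)"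
      by (simp add: cinner_sum_right cinner_simps complex_norm_square del: of_real_power)
    have "coords ?s i = (if i \<in> G then coords \<psi> i else 0)" for i
      using G(1) by (simp add: coords_ket if_distrib[of "\<lambda>x. _ * x"] sum.delta' cong: if_cong)
    then have "cinner ?s ?s = of_real (\<Sum>i\<in>G. (cmod (coords \<psi> i))\<^sup>2)"
      by (subst cinner_sum_left) (simp add: cinner_simps complex_norm_square mult.commute del: of_real_power)
    moreover have "cinner ?s \<psi> = of_real (\<Sum>i\<in>G. (cmod (coords \<psi> i))\<^sup>2)"
      by (subst cinner_commute, subst 1) simp
    ultimately have "cinner (?s - \<psi>) (?s - \<psi>) = of_real ((norm \<psi>)\<^sup>2 - (\<Sum>i\<in>G. (cmod (coords \<psi> i))\<^sup>2))"
      using 1 by (simp only: cinner_diff_left cinner_diff_right cinner_self[of \<psi>]) simp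
    then have "(norm (?s - \<psi>))\<^sup>2 = (norm \<psi>)\<^sup>2 - (\<Sum>i\<in>G. (cmod (coords \<psi> i))\<^sup>2)"
      by (metis cinner_self of_real_eq_iff)
    also have "\<dots> < e\<^sup>2"
      using F(2)[OF G] by (simp add: dist_real_def)
    finally show ?thesis
      using e by (auto simp: dist_norm intro: power2_less_imp_less)
  qed
  then show "\<exists>X. finite X \<and> (\<forall>Y. finite Y \<and> X \<subseteq> Y \<longrightarrow>
      dist (\<Sum>i\<in>Y. coords \<psi> i *\<^sub>C ket i) \<psi> < e)"
    using F(1) by blast
qed

section \<open>Positive operators: polarisation and Cauchy--Schwarz\<close>

section \<open>Bounded operators\<close>

lemma bounded_clinear_bounded_linear: "bounded_clinear A \<Longrightarrow> bounded_linear A"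
  by (simp add: bounded_clinear_def)

lemma bounded_clinear_scaleC: "bounded_clinear A \<Longrightarrow> A (c *\<^sub>C \<psi>) = c *\<^sub>C A \<psi>"
  by (simp add: bounded_clinear_def)

lemma bounded_clinearI:
  assumes "\<And>\<psi> \<eta>. A (\<psi> + \<eta>) = A \<psi> + A \<eta>" "\<And>c \<psi>. A (c *\<^sub>C \<psi>) = c *\<^sub>C A \<psi>"
    "\<And>\<psi>. norm (A \<psi>) \<le> b * norm \<psi>"
  shows "bounded_clinear A"
  unfolding bounded_clinear_def
  by (intro conjI bounded_linear_intro[where K = b])
    (use assms in \<open>auto simp: scaleR_scaleC mult.commute\<close>)

lemma bounded_linear_scaleC: "bounded_linear (\<lambda>\<psi>. c *\<^sub>C \<psi>)"
  by (rule bounded_linear_intro[where K = "cmod c"])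
    (auto simp: scaleC_add_right scaleR_scaleC mult.commute)

lemma bounded_clinear_eq_on_kets:
  assumes "bounded_clinear A" "bounded_clinear B" "\<And>i. A (ket i) = B (ket i)"
  shows "A \<psi> = B \<psi>"
proof -
  have "((\<lambda>i. A (coords \<psi> i *\<^sub>C ket i)) has_sum A \<psi>) UNIV"
    using has_sum_bounded_linear[OF bounded_clinear_bounded_linear[OF assms(1)] ket_expansion[of \<psi>]]
    by (simp add: o_def)
  moreover have "((\<lambda>i. B (coords \<psi> i *\<^sub>C ket i)) has_sum B \<psi>) UNIV"
    using has_sum_bounded_linear[OF bounded_clinear_bounded_linear[OF assms(2)] ket_expansion[of \<psi>]]
    by (simp add: o_def)
  moreover have "A (coords \<psi> i *\<^sub>C ket i) = B (coords \<psi> i *\<^sub>C ket i)" for i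
    using assms by (simp add: bounded_clinear_scaleC)
  ultimately show ?thesis using has_sum_unique by fastforce
qed


definition self_adjoint :: "('a ell2 \<Rightarrow> 'a ell2) \<Rightarrow> bool" where
  "self_adjoint A \<longleftrightarrow> (\<forall>\<psi> \<eta>. cinner (A \<psi>) \<eta> = cinner \<psi> (A \<eta>))"

lemma bounded_clinear_add: "bounded_clinear A \<Longrightarrow> A (\<psi> + \<eta>) = A \<psi> + A \<eta>"
  by (simp add: bounded_clinear_def linear_simps)
lemma bounded_clinear_diff: "bounded_clinear A \<Longrightarrow> A (\<psi> - \<eta>) = A \<psi> - A \<eta>"
  by (simp add: bounded_clinear_def linear_simps)
lemma bounded_clinear_zero: "bounded_clinear A \<Longrightarrow> A 0 = 0"
  by (simp add: bounded_clinear_def linear_simps)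
lemma bounded_clinear_scaleR: "bounded_clinear A \<Longrightarrow> A (r *\<^sub>R \<psi>) = r *\<^sub>R A \<psi>"
  by (simp add: bounded_clinear_def linear_simps)

lemmas bounded_clinear_simps = bounded_clinear_add bounded_clinear_diff bounded_clinear_scaleC
  bounded_clinear_scaleR

lemma bounded_clinear_boundE:
  assumes "bounded_clinear A"
  obtains b where "b > 0" "\<And>\<psi>. norm (A \<psi>) \<le> b * norm \<psi>"
  using bounded_linear.pos_bounded[OF bounded_clinear_bounded_linear[OF assms]]
  by (metis mult.commute)

lemma bounded_clinear_id: "bounded_clinear (\<lambda>\<psi>. \<psi>)"
  by (rule bounded_clinearI[where b = 1]) auto

lemma bounded_clinear_compose:
  assumes "bounded_clinear A" "bounded_clinear B"
  shows "bounded_clinear (\<lambda>\<psi>. A (B \<psi>))"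
  unfolding bounded_clinear_def
  using bounded_linear_compose[OF bounded_clinear_bounded_linear bounded_clinear_bounded_linear, OF assms]
  by (simp add: bounded_clinear_scaleC assms)

lemma bounded_clinear_plus:
  assumes "bounded_clinear A" "bounded_clinear B"
  shows "bounded_clinear (\<lambda>\<psi>. A \<psi> + B \<psi>)"
  using assms unfolding bounded_clinear_def
  by (auto intro: bounded_linear_add simp: scaleC_add_right)

lemma bounded_clinear_minus:
  assumes "bounded_clinear A" "bounded_clinear B"
  shows "bounded_clinear (\<lambda>\<psi>. A \<psi> - B \<psi>)"
  using assms unfolding bounded_clinear_def
  by (auto intro: bounded_linear_sub simp: scaleC_diff_right)

lemma bounded_clinear_scale:
  assumes "bounded_clinear A"
  shows "bounded_clinear (\<lambda>\<psi>. r *\<^sub>R A \<psi>)"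
  unfolding bounded_clinear_def
  using bounded_linear_compose[OF bounded_linear_scaleR_right bounded_clinear_bounded_linear[OF assms]]
  by (simp add: bounded_clinear_scaleC[OF assms]) (simp add: scaleR_scaleC mult.commute)

lemma self_adjointD: "self_adjoint A \<Longrightarrow> cinner (A \<psi>) \<eta> = cinner \<psi> (A \<eta>)"
  by (simp add: self_adjoint_def)

lemma self_adjoint_real:
  assumes "self_adjoint A"
  shows "cinner \<psi> (A \<psi>) = of_real (Re (cinner \<psi> (A \<psi>)))"
proof -
  have "cinner \<psi> (A \<psi>) = cnj (cinner \<psi> (A \<psi>))"
    using self_adjointD[OF assms, of \<psi> \<psi>] cinner_commute[of \<psi> "A \<psi>"] by simp
  then show ?thesis by (auto simp: complex_eq_iff)
qed

lemma positive_op_bounded: "positive_op A \<Longrightarrow> bounded_clinear A"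
  by (simp add: positive_op_def)

lemma nonneg_Reals_iff: "(z::complex) \<in> \<real>\<^sub>\<ge>\<^sub>0 \<longleftrightarrow> Re z \<ge> 0 \<and> Im z = 0"
  by (auto simp: complex_nonneg_Reals_iff)

lemma positive_op_Re: "positive_op A \<Longrightarrow> Re (cinner \<psi> (A \<psi>)) \<ge> 0"
  by (auto simp: positive_op_def nonneg_Reals_iff)

text \<open>Polarisation: that the form is real at \<open>\<psi> + \<eta>\<close> settles the
  imaginary part, at \<open>\<psi> + \<i> *\<^sub>C \<eta>\<close> the real part.\<close>

lemma positive_op_self_adjoint:
  assumes "positive_op A"
  shows "self_adjoint A"
  unfolding self_adjoint_def
proof (intro allI)
  fix \<psi> \<eta>
  have lin: "bounded_clinear A" and im: "\<And>\<xi>. Im (cinner \<xi> (A \<xi>)) = 0"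
    using assms by (auto simp: positive_op_def nonneg_Reals_iff)
  have "Im (cinner \<psi> (A \<eta>)) = - Im (cinner \<eta> (A \<psi>))"
    using im[of "\<psi> + \<eta>"] im[of \<psi>] im[of \<eta>] by (simp add: bounded_clinear_simps[OF lin] cinner_simps)
  moreover have "Re (cinner \<psi> (A \<eta>)) = Re (cinner \<eta> (A \<psi>))"
    using im[of "\<psi> + \<i> *\<^sub>C \<eta>"] im[of \<psi>] im[of \<eta>]
    by (simp add: bounded_clinear_simps[OF lin] cinner_simps)
  ultimately have "cinner \<psi> (A \<eta>) = cnj (cinner \<eta> (A \<psi>))"
    by (simp add: complex_eq_iff)
  then show "cinner (A \<psi>) \<eta> = cinner \<psi> (A \<eta>)"
    by (metis cinner_commute)
qed

lemma positive_opI: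
  assumes "bounded_clinear A" "self_adjoint A" "\<And>\<psi>. Re (cinner \<psi> (A \<psi>)) \<ge> 0"
  shows "positive_op A"
  unfolding positive_op_def
  using assms self_adjoint_real[OF assms(2)] by (metis Re_complex_of_real Im_complex_of_real nonneg_Reals_iff)

lemma positive_op_Cauchy_Schwarz:
  assumes "positive_op A"
  shows "(cmod (cinner \<eta> (A \<psi>)))\<^sup>2 \<le> Re (cinner \<eta> (A \<eta>)) * Re (cinner \<psi> (A \<psi>))"
proof -
  note lin = positive_op_bounded[OF assms]
  note sa = positive_op_self_adjoint[OF assms]
  define a b c where "a = Re (cinner \<eta> (A \<eta>))" and "b = cinner \<eta> (A \<psi>)" and "c = Re (cinner \<psi> (A \<psi>))"
  have b': "cinner \<psi> (A \<eta>) = cnj b"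
    using self_adjointD[OF sa, of \<psi> \<eta>] cinner_commute[of \<eta> "A \<psi>"] by (simp add: b_def)
  have ac: "a \<ge> 0" "c \<ge> 0" using positive_op_Re[OF assms] by (auto simp: a_def c_def)
  have quad: "0 \<le> a - 2 * s * (cmod b)\<^sup>2 + s\<^sup>2 * (cmod b)\<^sup>2 * c" for s :: real
  proof -
    \<comment> \<open>The phase of \<open>l\<close> turns the form at
      \<open>\<eta> - l *\<^sub>C \<psi>\<close> into a real polynomial in \<open>s\<close>.\<close>
    define l where "l = of_real s * cnj b"
    have "cinner (\<eta> - l *\<^sub>C \<psi>) (A (\<eta> - l *\<^sub>C \<psi>))
        = cinner \<eta> (A \<eta>) - l * b - cnj l * cnj b + (cnj l * l) * cinner \<psi> (A \<psi>)"
      by (simp add: bounded_clinear_simps[OF lin] cinner_simps b_def[symmetric] b' algebra_simps)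
    also have "l * b = of_real (s * (cmod b)\<^sup>2)"
      unfolding l_def of_real_mult complex_norm_square by (simp add: ac_simps)
    also have "cnj l * cnj b = of_real (s * (cmod b)\<^sup>2)"
      unfolding l_def of_real_mult complex_norm_square by (simp add: ac_simps)
    also have "cnj l * l = of_real (s\<^sup>2 * (cmod b)\<^sup>2)"
      unfolding l_def of_real_mult complex_norm_square by (simp add: ac_simps power2_eq_square)
    also have "Re (cinner \<eta> (A \<eta>) - of_real (s * (cmod b)\<^sup>2) - of_real (s * (cmod b)\<^sup>2)
        + of_real (s\<^sup>2 * (cmod b)\<^sup>2) * cinner \<psi> (A \<psi>))
        = a - 2 * s * (cmod b)\<^sup>2 + s\<^sup>2 * (cmod b)\<^sup>2 * c"
      unfolding a_def c_def by (simp add: Re_complex_of_real del: of_real_mult of_real_power)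
    finally show ?thesis using positive_op_Re[OF assms] by metis
  qed
  have "(cmod b)\<^sup>2 \<le> a * c"
  proof (cases "c = 0")
    case True
    have "b = 0"
    proof (rule ccontr)
      assume "b \<noteq> 0"
      then have "(cmod b)\<^sup>2 > 0" by simp
      \<comment> \<open>For \<open>c = 0\<close> the polynomial is affine in \<open>s\<close>, and
        at the chosen \<open>s\<close> its value is -1.\<close>
      then show False
        using quad[of "(a + 1) / (2 * (cmod b)\<^sup>2)"] True ac by (simp add: field_simps)
    qed
    then show ?thesis using ac by simp
  next
    case False
    then have "c > 0" using ac by simp
    have "0 \<le> a - (cmod b)\<^sup>2 / c"
      using quad[of "1/c"] \<open>c > 0\<close> by (simp add: power2_eq_square field_simps)
    then show ?thesis using \<open>c > 0\<close> by (simp add: field_simps)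
  qed
  then show ?thesis by (simp add: a_def b_def c_def)
qed

lemma positive_op_form_zero:
  assumes "positive_op A" "Re (cinner \<psi> (A \<psi>)) = 0"
  shows "A \<psi> = 0"
proof -
  have "(cmod (cinner (A \<psi>) (A \<psi>)))\<^sup>2 \<le> 0"
    using positive_op_Cauchy_Schwarz[OF assms(1), of "A \<psi>" \<psi>] assms(2) by simp
  then show ?thesis by (simp add: cinner_self)
qed

text \<open>Cauchy--Schwarz for the form of \<open>A\<close>, taken at \<open>A \<psi>\<close> and
  \<open>\<psi>\<close>, converts a bound on the form into a bound on the norm.\<close>

lemma positive_contraction:
  assumes "positive_op A" "\<And>\<psi>. Re (cinner \<psi> (A \<psi>)) \<le> (norm \<psi>)\<^sup>2"
  shows "norm (A \<psi>) \<le> norm \<psi>"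
proof -
  have "(norm (A \<psi>))\<^sup>2 * (norm (A \<psi>))\<^sup>2 = (cmod (cinner (A \<psi>) (A \<psi>)))\<^sup>2"
    by (simp only: cinner_self norm_of_real) (simp add: power2_eq_square)
  also have "\<dots> \<le> Re (cinner (A \<psi>) (A (A \<psi>))) * Re (cinner \<psi> (A \<psi>))"
    by (rule positive_op_Cauchy_Schwarz[OF assms(1)])
  also have "\<dots> \<le> (norm (A \<psi>))\<^sup>2 * (norm \<psi>)\<^sup>2"
    by (intro mult_mono assms(2) positive_op_Re[OF assms(1)]) auto
  finally have "(norm (A \<psi>))\<^sup>2 * ((norm (A \<psi>))\<^sup>2 - (norm \<psi>)\<^sup>2) \<le> 0"
    by (simp add: algebra_simps)
  then have "A \<psi> = 0 \<or> (norm (A \<psi>))\<^sup>2 \<le> (norm \<psi>)\<^sup>2"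
    by (auto simp: mult_le_0_iff)
  then show ?thesis by (auto intro: power2_le_imp_le)
qed

section \<open>Existence and uniqueness of positive square roots by the binomial series\<close>

section \<open>Square roots\<close>

text \<open>The Taylor coefficients of \<open>sqrt (1 - x)\<close>.\<close>

definition sqrt_coeff :: "nat \<Rightarrow> real" where
  "sqrt_coeff k = (-1) ^ k * ((1/2) gchoose k)"

lemma sqrt_coeff_0 [simp]: "sqrt_coeff 0 = 1"
  by (simp add: sqrt_coeff_def)

lemma sqrt_coeff_Suc: "sqrt_coeff (Suc k) = sqrt_coeff k * (real k - 1/2) / (real k + 1)"
proof -
  have "(real (Suc k)) * ((1/2) gchoose Suc k) = (1/2 - real k) * ((1/2) gchoose k)"
    using gbinomial_absorb_comp[of "1/2::real" k] gbinomial_absorption'[of "Suc k" "1/2::real"]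
      gbinomial_mult_1[of "1/2::real" k]
    by (simp add: algebra_simps)
  then have *: "((1/2) gchoose Suc k) = (1/2 - real k) * ((1/2) gchoose k) / (real k + 1)"
    by (simp add: field_simps)
  show ?thesis unfolding sqrt_coeff_def * by (simp add: field_simps)
qed

lemma sqrt_coeff_nonpos: "sqrt_coeff (Suc k) \<le> 0"
  by (induction k) (auto simp: sqrt_coeff_Suc[of 0] sqrt_coeff_Suc[of "Suc _"] divide_le_0_iff mult_le_0_iff)

text \<open>Summing coefficients divides the series by 1 - x, and sqrt (1 - x) / (1 - x) is -2 times
  the derivative of sqrt (1 - x). By \<open>sqrt_coeff_nonpos\<close> the right-hand side is
  nonnegative, which bounds the total modulus of all coefficients after the first by 1.\<close>

lemma sum_sqrt_coeff: "(\<Sum>k\<le>n. sqrt_coeff k) = - 2 * (real n + 1) * sqrt_coeff (Suc n)"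
proof (induction n)
  case (Suc n)
  then have "(\<Sum>k\<le>Suc n. sqrt_coeff k) = - (2 * real n + 1) * sqrt_coeff (Suc n)"
    by (simp add: algebra_simps)
  moreover have "(real n + 2) * sqrt_coeff (Suc (Suc n)) = (real n + 1/2) * sqrt_coeff (Suc n)"
    by (subst sqrt_coeff_Suc) (simp add: field_simps)
  ultimately show ?case by (simp add: algebra_simps)
qed (simp add: sqrt_coeff_Suc)

lemma sum_abs_sqrt_coeff: "(\<Sum>k<n. \<bar>sqrt_coeff (Suc k)\<bar>) \<le> 1"
proof -
  have "(\<Sum>k\<le>n. sqrt_coeff k) = 1 + (\<Sum>k<n. sqrt_coeff (Suc k))"
    by (induction n) auto
  moreover have "(\<Sum>k\<le>n. sqrt_coeff k) \<ge> 0"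
    unfolding sum_sqrt_coeff using sqrt_coeff_nonpos[of n]
    by (intro mult_nonpos_nonpos) auto
  moreover have "(\<Sum>k<n. \<bar>sqrt_coeff (Suc k)\<bar>) = - (\<Sum>k<n. sqrt_coeff (Suc k))"
    unfolding sum_negf[symmetric] by (rule sum.cong) (auto simp: sqrt_coeff_nonpos)
  ultimately show ?thesis by simp
qed

lemma summable_abs_sqrt_coeff: "summable (\<lambda>k. \<bar>sqrt_coeff k\<bar>)"
proof -
  have "summable (\<lambda>k. \<bar>sqrt_coeff (Suc k)\<bar>)"
    by (rule summableI_nonneg_bounded[where x = 1]) (use sum_abs_sqrt_coeff in auto)
  then show ?thesis by (rule summable_Suc_iff[THEN iffD1])
qed

lemma summable_abs_sqrt_coeff_Suc: "summable (\<lambda>k. \<bar>sqrt_coeff (Suc k)\<bar>)"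
  using summable_abs_sqrt_coeff by (rule summable_Suc_iff[THEN iffD2])

lemma suminf_abs_sqrt_coeff: "(\<Sum>k. \<bar>sqrt_coeff (Suc k)\<bar>) \<le> 1"
  by (intro suminf_le_const summable_abs_sqrt_coeff_Suc sum_abs_sqrt_coeff)

text \<open>The series squares to 1 - x; this is the Vandermonde identity for 1/2 + 1/2 = 1.\<close>

lemma sqrt_coeff_convolution:
  "(\<Sum>j\<le>n. sqrt_coeff j * sqrt_coeff (n - j)) = (if n = 0 then 1 else if n = 1 then -1 else 0)"
proof -
  have "(\<Sum>j\<le>n. sqrt_coeff j * sqrt_coeff (n - j))
      = (\<Sum>j\<le>n. (-1) ^ n * (((1/2) gchoose j) * ((1/2) gchoose (n - j))))"
    by (intro sum.cong) (auto simp: sqrt_coeff_def ac_simps simp flip: power_add)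
  also have "\<dots> = (-1) ^ n * ((1/2 + 1/2) gchoose n)"
    unfolding gbinomial_Vandermonde[of "1/2::real" "1/2" n, symmetric]
    by (simp only: sum_distrib_left atLeast0AtMost)
  also have "(1/2 + 1/2 :: real) gchoose n = of_nat (1 choose n)"
    using binomial_gbinomial[of 1 n, where ?'a = real] by simp
  also have "(1::nat) choose n = (if n = 0 then 1 else if n = 1 then 1 else 0)"
    by (auto simp: binomial_eq_0)
  finally show ?thesis by auto
qed

text \<open>When \<open>m n\<close> is a matrix element of the n-th power of a contraction R, this
  says that the series for sqrt (1 - R) squares to 1 - R. The double series converges absolutely, so
  it may be summed along j + k = n, where the convolution collapses to two terms.\<close>

lemma double_series_sqrt_coeff:
  fixes m :: "nat \<Rightarrow> complex"
  assumes "\<And>n. cmod (m n) \<le> M"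
  shows "(\<Sum>j. of_real (sqrt_coeff j) * (\<Sum>k. of_real (sqrt_coeff k) * m (j + k))) = m 0 - m 1"
proof -
  let ?c = "\<lambda>k. complex_of_real (sqrt_coeff k)"
  let ?f = "\<lambda>(j, k). ?c j * (?c k * m (j + k))"
  have M: "M \<ge> 0" using assms[of 0] norm_ge_zero order_trans by blast
  have cs: "(\<lambda>k. \<bar>sqrt_coeff k\<bar>) summable_on UNIV"
    using summable_abs_sqrt_coeff by (intro norm_summable_imp_summable_on) simp
  have row: "(\<lambda>k. ?c k * m (j + k)) summable_on UNIV" for j
  proof (rule abs_summable_summable, rule summable_on_comparison_test[OF summable_on_cmult_left[OF cs, of M]])
    show "cmod (?c k * m (j + k)) \<le> \<bar>sqrt_coeff k\<bar> * M" for k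
      by (simp add: norm_mult mult_left_mono assms)
  qed auto
  have rowsum: "(\<Sum>\<^sub>\<infinity>k. ?c k * m (j + k)) = (\<Sum>k. ?c k * m (j + k))" for j
    using has_sum_imp_sums[OF has_sum_infsum[OF row]] sums_unique by metis
  have rb: "cmod (\<Sum>\<^sub>\<infinity>k. ?c k * m (j + k)) \<le> (\<Sum>\<^sub>\<infinity>k. \<bar>sqrt_coeff k\<bar> * M)" for j
    by (rule norm_infsum_le[OF has_sum_infsum[OF row] has_sum_infsum[OF summable_on_cmult_left[OF cs]]])
      (simp add: norm_mult mult_left_mono assms)
  have f: "?f summable_on UNIV"
  proof -
    have "(\<lambda>(j, k). \<bar>sqrt_coeff j\<bar> * (\<bar>sqrt_coeff k\<bar> * M)) summable_on (UNIV \<times> UNIV)"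
      using cs by (intro summable_on_SigmaI[where g = "\<lambda>j. \<bar>sqrt_coeff j\<bar> * (\<Sum>\<^sub>\<infinity>k. \<bar>sqrt_coeff k\<bar> * M)"])
        (auto intro!: has_sum_cmult_right has_sum_infsum summable_on_cmult_left mult_nonneg_nonneg M)
    then have "(\<lambda>(j, k). \<bar>sqrt_coeff j\<bar> * (\<bar>sqrt_coeff k\<bar> * M)) summable_on UNIV" by simp
    then show ?thesis
    proof (rule abs_summable_summable[OF summable_on_comparison_test])
      fix p :: "nat \<times> nat"
      have "\<bar>sqrt_coeff (fst p)\<bar> * (\<bar>sqrt_coeff (snd p)\<bar> * cmod (m (fst p + snd p)))
          \<le> \<bar>sqrt_coeff (fst p)\<bar> * (\<bar>sqrt_coeff (snd p)\<bar> * M)"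
        by (intro mult_left_mono assms) auto
      then show "cmod (?f p) \<le> (case p of (j, k) \<Rightarrow> \<bar>sqrt_coeff j\<bar> * (\<bar>sqrt_coeff k\<bar> * M))"
        by (simp add: case_prod_unfold norm_mult)
    qed auto
  qed
  have "(\<Sum>\<^sub>\<infinity>(j, k). ?c j * (?c k * m (j + k))) = (\<Sum>\<^sub>\<infinity>j. \<Sum>\<^sub>\<infinity>k. ?c j * (?c k * m (j + k)))"
    using f infsum_Sigma'_banach[of "\<lambda>j k. ?c j * (?c k * m (j + k))" UNIV "\<lambda>_. UNIV"] by simp
  also have "\<dots> = (\<Sum>\<^sub>\<infinity>j. ?c j * (\<Sum>k. ?c k * m (j + k)))"
    by (simp add: infsum_cmult_right' rowsum)
  also have "\<dots> = (\<Sum>j. ?c j * (\<Sum>k. ?c k * m (j + k)))"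
  proof -
    have "(\<lambda>j. ?c j * (\<Sum>k. ?c k * m (j + k))) summable_on UNIV"
    proof (rule abs_summable_summable, rule summable_on_comparison_test[OF summable_on_cmult_left[OF cs]])
      show "cmod (?c j * (\<Sum>k. ?c k * m (j + k))) \<le> \<bar>sqrt_coeff j\<bar> * (\<Sum>\<^sub>\<infinity>k. \<bar>sqrt_coeff k\<bar> * M)" for j
        using rb[of j] by (simp add: norm_mult mult_left_mono rowsum)
    qed auto
    then show ?thesis
      using has_sum_imp_sums[OF has_sum_infsum] sums_unique by metis
  qed
  finally have 1: "(\<Sum>\<^sub>\<infinity>(j, k). ?c j * (?c k * m (j + k))) = (\<Sum>j. ?c j * (\<Sum>k. ?c k * m (j + k)))" .
  let ?h = "\<lambda>(n::nat, j). (j, n - j)"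
  have bij: "bij_betw ?h (SIGMA n:UNIV. {..n}) UNIV"
    by (rule bij_betwI[where g = "\<lambda>(j, k). (j + k, j)"]) auto
  have "(\<Sum>\<^sub>\<infinity>(j, k). ?c j * (?c k * m (j + k))) = (\<Sum>\<^sub>\<infinity>p\<in>(SIGMA n:UNIV. {..n}). ?f (?h p))"
    by (rule infsum_reindex_bij_betw[OF bij, symmetric])
  also have "\<dots> = (\<Sum>\<^sub>\<infinity>(n, j)\<in>(SIGMA n:UNIV. {..n}). ?c j * ?c (n - j) * m n)"
    by (rule infsum_cong) auto
  also have "\<dots> = (\<Sum>\<^sub>\<infinity>n. \<Sum>\<^sub>\<infinity>j\<in>{..n}. ?c j * ?c (n - j) * m n)"
  proof (rule infsum_Sigma'_banach[symmetric])
    have "(\<lambda>p. ?f (?h p)) summable_on (SIGMA n:UNIV. {..n})"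
      using f summable_on_reindex_bij_betw[OF bij, of ?f] by simp
    then show "(\<lambda>(n, j). ?c j * ?c (n - j) * m n) summable_on (SIGMA n:UNIV. {..n})"
      by (rule summable_on_cong[THEN iffD1, rotated]) auto
  qed
  also have "\<dots> = (\<Sum>\<^sub>\<infinity>n. of_real (\<Sum>j\<le>n. sqrt_coeff j * sqrt_coeff (n - j)) * m n)"
    by (simp add: sum_distrib_right)
  also have "\<dots> = (\<Sum>\<^sub>\<infinity>n\<in>{0,1}. of_real (\<Sum>j\<le>n. sqrt_coeff j * sqrt_coeff (n - j)) * m n)"
    by (rule infsum_cong_neutral) (simp_all only: sqrt_coeff_convolution, auto)
  also have "\<dots> = m 0 - m 1"
    by (simp only: sqrt_coeff_convolution) simp
  finally show ?thesis using 1 by simp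
qed

lemma funpow_commute_apply: "(\<And>\<psi>. B (R \<psi>) = R (B \<psi>)) \<Longrightarrow> B ((R ^^ k) \<psi>) = (R ^^ k) (B \<psi>)"
  by (induction k) auto

text \<open>The binomial series in \<open>R\<close>. It is positive because its first term is the
  identity and the other coefficients have total modulus at most 1. The commutation clause is what
  later lets two square roots be compared and an operator be split into positive and negative
  part.\<close>

lemma sqrt_of_one_minus:
  fixes R :: "'a ell2 \<Rightarrow> 'a ell2"
  assumes R: "bounded_clinear R" "self_adjoint R" "\<And>\<psi>. norm (R \<psi>) \<le> norm \<psi>"
  shows "\<exists>S. positive_op S \<and> (\<forall>\<psi>. S (S \<psi>) = \<psi> - R \<psi>) \<and>
    (\<forall>B. bounded_clinear B \<longrightarrow> (\<forall>\<psi>. B (R \<psi>) = R (B \<psi>)) \<longrightarrow> (\<forall>\<psi>. B (S \<psi>) = S (B \<psi>)))"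
proof -
  define S where "S \<psi> = (\<Sum>k. sqrt_coeff k *\<^sub>R (R ^^ k) \<psi>)" for \<psi>
  have Rk: "norm ((R ^^ k) \<psi>) \<le> norm \<psi>" for k \<psi>
    by (induction k) (auto intro: order_trans R(3))
  have Rka: "(R ^^ k) (\<psi> + \<eta>) = (R ^^ k) \<psi> + (R ^^ k) \<eta>" for k \<psi> \<eta>
    by (induction k) (auto simp: bounded_clinear_simps[OF R(1)])
  have Rksa: "cinner ((R ^^ k) \<psi>) \<eta> = cinner \<psi> ((R ^^ k) \<eta>)" for k \<psi> \<eta>
    by (induction k arbitrary: \<psi> \<eta>) (auto simp: self_adjointD[OF R(2)] funpow_swap1)
  have ns: "norm (sqrt_coeff k *\<^sub>R (R ^^ k) \<psi>) \<le> \<bar>sqrt_coeff k\<bar> * norm \<psi>" for k \<psi>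
    by (simp add: mult_left_mono Rk)
  have sm: "summable (\<lambda>k. sqrt_coeff k *\<^sub>R (R ^^ k) \<psi>)" for \<psi>
    by (rule summable_comparison_test'[OF summable_mult2[OF summable_abs_sqrt_coeff] ns])
  have sn: "summable (\<lambda>k. norm (sqrt_coeff k *\<^sub>R (R ^^ k) \<psi>))" for \<psi>
    by (rule summable_comparison_test'[OF summable_mult2[OF summable_abs_sqrt_coeff, of "norm \<psi>"], where N = 0])
      (simp add: mult_left_mono Rk)
  have Sadd: "S (\<psi> + \<eta>) = S \<psi> + S \<eta>" for \<psi> \<eta>
    unfolding S_def by (simp add: Rka scaleR_add_right suminf_add[OF sm sm])
  have Scomm: "B (S \<psi>) = S (B \<psi>)" if "bounded_linear B" "\<And>\<psi>. B (R \<psi>) = R (B \<psi>)" for B \<psi>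
    unfolding S_def bounded_linear.suminf[OF that(1) sm]
    by (simp add: linear_simps[OF that(1)] funpow_commute_apply[of B R, OF that(2)])
  have Sscale: "S (c *\<^sub>C \<psi>) = c *\<^sub>C S \<psi>" for c \<psi>
    by (rule Scomm[symmetric]) (simp_all add: bounded_linear_scaleC bounded_clinear_scaleC[OF R(1)])
  have Snorm: "norm (S \<psi>) \<le> (\<Sum>k. \<bar>sqrt_coeff k\<bar>) * norm \<psi>" for \<psi>
  proof -
    have "norm (S \<psi>) \<le> (\<Sum>k. norm (sqrt_coeff k *\<^sub>R (R ^^ k) \<psi>))"
      unfolding S_def
      by (rule summable_norm[OF sn])
    also have "\<dots> \<le> (\<Sum>k. \<bar>sqrt_coeff k\<bar> * norm \<psi>)"
      by (intro suminf_le ns sn summable_mult2 summable_abs_sqrt_coeff)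
    also have "\<dots> = (\<Sum>k. \<bar>sqrt_coeff k\<bar>) * norm \<psi>"
      by (rule suminf_mult2[symmetric]) (rule summable_abs_sqrt_coeff)
    finally show ?thesis .
  qed
  have Sb: "bounded_clinear S"
    by (rule bounded_clinearI[OF Sadd Sscale Snorm])
  have Sinner: "cinner \<eta> (S \<psi>) = (\<Sum>k. of_real (sqrt_coeff k) * cinner \<eta> ((R ^^ k) \<psi>))" for \<eta> \<psi>
    unfolding S_def
      bounded_linear.suminf[OF bounded_bilinear.bounded_linear_right[OF bounded_bilinear_cinner] sm]
    by (simp add: cinner_simps)
  have Sinner': "cinner (S \<eta>) \<psi> = (\<Sum>k. of_real (sqrt_coeff k) * cinner \<eta> ((R ^^ k) \<psi>))" for \<eta> \<psi>
    unfolding S_def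
      bounded_linear.suminf[OF bounded_bilinear.bounded_linear_left[OF bounded_bilinear_cinner] sm]
    by (simp add: cinner_simps Rksa)
  have Ssa: "self_adjoint S"
    unfolding self_adjoint_def by (simp add: Sinner Sinner')
  have "Re (cinner \<psi> (S \<psi>)) \<ge> 0" for \<psi>
  proof -
    let ?g = "\<lambda>k. Re (of_real (sqrt_coeff k) * cinner \<psi> ((R ^^ k) \<psi>))"
    have gs: "summable (\<lambda>k. of_real (sqrt_coeff k) * cinner \<psi> ((R ^^ k) \<psi>))"
      using bounded_linear.summable[OF bounded_bilinear.bounded_linear_right[OF bounded_bilinear_cinner, of \<psi>] sm[of \<psi>]]
      by (simp add: cinner_simps)
    then have gs': "summable ?g" by (rule summable_Re)
    have gs'': "summable (\<lambda>k. ?g (Suc k))"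
      using gs' by (rule summable_Suc_iff[THEN iffD2])
    have b: "\<bar>?g k\<bar> \<le> \<bar>sqrt_coeff k\<bar> * (norm \<psi>)\<^sup>2" for k
    proof -
      have "\<bar>?g k\<bar> \<le> cmod (of_real (sqrt_coeff k) * cinner \<psi> ((R ^^ k) \<psi>))"
        by (rule abs_Re_le_cmod)
      also have "\<dots> \<le> \<bar>sqrt_coeff k\<bar> * (norm \<psi> * norm ((R ^^ k) \<psi>))"
        by (simp add: norm_mult mult_left_mono cinner_Cauchy_Schwarz)
      also have "\<dots> \<le> \<bar>sqrt_coeff k\<bar> * (norm \<psi>)\<^sup>2"
        by (simp add: power2_eq_square mult_left_mono Rk)
      finally show ?thesis .
    qed
    have "Re (cinner \<psi> (S \<psi>)) = (\<Sum>k. ?g k)"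
      unfolding Sinner by (rule Re_suminf[OF gs])
    also have "\<dots> = ?g 0 + (\<Sum>k. ?g (Suc k))"
      using suminf_split_head[OF gs'] by simp
    finally have 1: "Re (cinner \<psi> (S \<psi>)) = ?g 0 + (\<Sum>k. ?g (Suc k))" .
    have 2: "?g 0 = (norm \<psi>)\<^sup>2" by (simp add: cinner_self flip: of_real_power)
    have 3: "(\<Sum>k. ?g (Suc k)) \<ge> - (norm \<psi>)\<^sup>2"
    proof -
      have "- (\<Sum>k. ?g (Suc k)) = (\<Sum>k. - ?g (Suc k))"
        by (rule suminf_minus[OF gs'', symmetric])
      also have "\<dots> \<le> (\<Sum>k. \<bar>sqrt_coeff (Suc k)\<bar> * (norm \<psi>)\<^sup>2)"
      proof (rule suminf_le)
        show "- ?g (Suc k) \<le> \<bar>sqrt_coeff (Suc k)\<bar> * (norm \<psi>)\<^sup>2" for k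
          using b[of "Suc k"] by linarith
        show "summable (\<lambda>k. - ?g (Suc k))"
          using gs'' by (rule summable_minus)
        show "summable (\<lambda>k. \<bar>sqrt_coeff (Suc k)\<bar> * (norm \<psi>)\<^sup>2)"
          by (rule summable_mult2[OF summable_abs_sqrt_coeff_Suc])
      qed
      also have "\<dots> = (\<Sum>k. \<bar>sqrt_coeff (Suc k)\<bar>) * (norm \<psi>)\<^sup>2"
        by (rule suminf_mult2[OF summable_abs_sqrt_coeff_Suc, symmetric])
      also have "\<dots> \<le> 1 * (norm \<psi>)\<^sup>2"
        by (intro mult_right_mono suminf_abs_sqrt_coeff) simp
      finally show ?thesis by linarith
    qed
    show ?thesis using 1 2 3 by linarith
  qed
  then have pos: "positive_op S" using positive_opI[OF Sb Ssa] by blast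
  have "S (S \<psi>) = \<psi> - R \<psi>" for \<psi>
  proof (rule ell2_eqI)
    fix i
    have "coords (S (S \<psi>)) i = cinner (S (ket i)) (S \<psi>)"
      by (simp add: self_adjointD[OF Ssa])
    also have "\<dots> = (\<Sum>j. of_real (sqrt_coeff j) * cinner (ket i) ((R ^^ j) (S \<psi>)))"
      by (rule Sinner')
    also have "\<dots> = (\<Sum>j. of_real (sqrt_coeff j) * (\<Sum>k. of_real (sqrt_coeff k) * cinner (ket i) ((R ^^ (j + k)) \<psi>)))"
    proof -
      have "cinner (ket i) ((R ^^ j) (S \<psi>)) = (\<Sum>k. of_real (sqrt_coeff k) * cinner (ket i) ((R ^^ (j + k)) \<psi>))" for j
      proof -
        have "cinner (ket i) ((R ^^ j) (S \<psi>)) = cinner ((R ^^ j) (ket i)) (S \<psi>)"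
          by (simp only: Rksa)
        also have "\<dots> = (\<Sum>k. of_real (sqrt_coeff k) * cinner ((R ^^ j) (ket i)) ((R ^^ k) \<psi>))"
          by (rule Sinner)
        also have "\<dots> = (\<Sum>k. of_real (sqrt_coeff k) * cinner (ket i) ((R ^^ (j + k)) \<psi>))"
          by (simp only: Rksa[of j] funpow_add o_apply)
        finally show ?thesis .
      qed
      then show ?thesis by simp
    qed
    also have "\<dots> = cinner (ket i) ((R ^^ 0) \<psi>) - cinner (ket i) ((R ^^ 1) \<psi>)"
      by (rule double_series_sqrt_coeff[where M = "norm \<psi>"])
        (auto intro: order_trans[OF cmod_coords_le Rk])
    finally show "coords (S (S \<psi>)) i = coords (\<psi> - R \<psi>) i" by simp
  qed
  then show ?thesis
    using pos Scomm bounded_clinear_bounded_linear by blast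
qed

text \<open>If \<open>b\<close> bounds \<open>T\<close>, then \<open>R\<close>, one minus
  \<open>T\<close> over \<open>b\<close>, is a positive contraction, and \<open>T\<close> is
  \<open>b\<close> times one minus \<open>R\<close>.\<close>

lemma positive_sqrt_exists:
  assumes "positive_op T"
  shows "\<exists>S. positive_op S \<and> (\<forall>\<psi>. S (S \<psi>) = T \<psi>) \<and>
    (\<forall>B. bounded_clinear B \<longrightarrow> (\<forall>\<psi>. B (T \<psi>) = T (B \<psi>)) \<longrightarrow> (\<forall>\<psi>. B (S \<psi>) = S (B \<psi>)))"
proof -
  note lin = positive_op_bounded[OF assms]
  note sa = positive_op_self_adjoint[OF assms]
  obtain b where b: "b > 0" "\<And>\<psi>. norm (T \<psi>) \<le> b * norm \<psi>"
    using bounded_clinear_boundE[OF lin] by blast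
  define R where "R \<psi> = \<psi> - (1/b) *\<^sub>R T \<psi>" for \<psi>
  have Rb: "bounded_clinear R"
    unfolding R_def by (intro bounded_clinear_minus bounded_clinear_scale bounded_clinear_id lin)
  have Rsa: "self_adjoint R"
    unfolding self_adjoint_def R_def by (simp add: cinner_simps self_adjointD[OF sa])
  have Tb: "Re (cinner \<psi> (T \<psi>)) \<le> b * (norm \<psi>)\<^sup>2" for \<psi>
  proof -
    have "Re (cinner \<psi> (T \<psi>)) \<le> norm \<psi> * norm (T \<psi>)"
      using complex_Re_le_cmod cinner_Cauchy_Schwarz order_trans by blast
    also have "\<dots> \<le> norm \<psi> * (b * norm \<psi>)"
      by (intro mult_left_mono b) auto
    finally show ?thesis by (simp add: power2_eq_square ac_simps)
  qed
  have Rform: "Re (cinner \<psi> (R \<psi>)) = (norm \<psi>)\<^sup>2 - Re (cinner \<psi> (T \<psi>)) / b" for \<psi>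
    by (simp add: R_def cinner_simps cinner_self flip: of_real_power)
  have Rpos: "positive_op R"
    by (rule positive_opI[OF Rb Rsa]) (use Tb b(1) in \<open>simp add: Rform field_simps\<close>)
  have "norm (R \<psi>) \<le> norm \<psi>" for \<psi>
    by (rule positive_contraction[OF Rpos])
      (use positive_op_Re[OF assms] b(1) in \<open>simp add: Rform\<close>)
  then obtain S where S: "positive_op S" "\<And>\<psi>. S (S \<psi>) = \<psi> - R \<psi>"
    "\<And>B \<psi>. bounded_clinear B \<Longrightarrow> (\<And>\<psi>. B (R \<psi>) = R (B \<psi>)) \<Longrightarrow> B (S \<psi>) = S (B \<psi>)"
    using sqrt_of_one_minus[OF Rb Rsa] by metis
  note Sb = positive_op_bounded[OF S(1)] and Ssa = positive_op_self_adjoint[OF S(1)]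
  let ?S = "\<lambda>\<psi>. sqrt b *\<^sub>R S \<psi>"
  have "positive_op ?S"
  proof (rule positive_opI)
    show "bounded_clinear ?S" by (rule bounded_clinear_scale[OF Sb])
    show "self_adjoint ?S"
      unfolding self_adjoint_def by (simp add: cinner_simps self_adjointD[OF Ssa])
    show "0 \<le> Re (cinner \<psi> (?S \<psi>))" for \<psi>
      using positive_op_Re[OF S(1), of \<psi>] b(1) by (simp add: cinner_simps)
  qed
  moreover have "?S (?S \<psi>) = T \<psi>" for \<psi>
    using b(1) by (simp add: bounded_clinear_scaleR[OF Sb] S(2) R_def)
  moreover have "B (?S \<psi>) = ?S (B \<psi>)" if B: "bounded_clinear B" "\<And>\<psi>. B (T \<psi>) = T (B \<psi>)" for B \<psi>
  proof -
    have "B (R \<psi>) = R (B \<psi>)" for \<psi>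
      by (simp add: R_def bounded_clinear_simps[OF B(1)] B(2))
    then show ?thesis
      using S(3)[OF B(1)] by (simp add: bounded_clinear_scaleR[OF B(1)])
  qed
  ultimately show ?thesis by (intro exI[of _ ?S]) blast
qed

lemma positive_op_sum_zero:
  assumes "positive_op A" "positive_op B" "\<And>\<psi>. A \<psi> + B \<psi> = 0"
  shows "A \<psi> = 0"
proof (rule positive_op_form_zero[OF assms(1)])
  have "Re (cinner \<psi> (A \<psi>)) + Re (cinner \<psi> (B \<psi>)) = Re (cinner \<psi> (A \<psi> + B \<psi>))"
    by (simp add: cinner_add_right)
  also have "\<dots> = 0" by (simp add: assms(3))
  finally show "Re (cinner \<psi> (A \<psi>)) = 0"
    using positive_op_Re[OF assms(1), of \<psi>] positive_op_Re[OF assms(2), of \<psi>] by linarith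
qed

lemma positive_op_sandwich:
  assumes "positive_op A" "bounded_clinear D" "self_adjoint D"
  shows "positive_op (\<lambda>\<psi>. D (A (D \<psi>)))"
proof (rule positive_opI)
  show "bounded_clinear (\<lambda>\<psi>. D (A (D \<psi>)))"
    by (intro bounded_clinear_compose[OF assms(2)] bounded_clinear_compose[OF positive_op_bounded[OF assms(1)]] assms(2))
  show "self_adjoint (\<lambda>\<psi>. D (A (D \<psi>)))"
    by (simp add: self_adjoint_def self_adjointD[OF assms(3)] self_adjointD[OF positive_op_self_adjoint[OF assms(1)]])
  show "0 \<le> Re (cinner \<psi> (D (A (D \<psi>))))" for \<psi>
    using positive_op_Re[OF assms(1), of "D \<psi>"] by (simp add: self_adjointD[OF assms(3)])
qed

text \<open>Two roots are not known to commute, so each is compared with the constructed root, which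
  commutes with everything that commutes with its square. For a commuting pair the difference
  \<open>D\<close> satisfies D S D + D P D = 0 with both summands positive; hence both vanish, D^3 =
  0, and D = 0 by self-adjointness.\<close>

lemma positive_sqrt_unique:
  assumes P: "positive_op P" and Q: "positive_op Q" and eq: "\<And>\<psi>. P (P \<psi>) = Q (Q \<psi>)"
  shows "P = Q"
proof -
  have *: "P = S" if P: "positive_op P" and S: "positive_op S" "\<And>\<psi>. S (S \<psi>) = P (P \<psi>)"
    and comm: "\<And>\<psi>. P (S \<psi>) = S (P \<psi>)" for P S :: "'a ell2 \<Rightarrow> 'a ell2"
  proof
    fix \<psi>
    note lin = positive_op_bounded[OF P] positive_op_bounded[OF S(1)]
    note sa = positive_op_self_adjoint[OF P] positive_op_self_adjoint[OF S(1)]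
    define D where "D \<psi> = S \<psi> - P \<psi>" for \<psi>
    have D: "bounded_clinear D" unfolding D_def by (rule bounded_clinear_minus[OF lin(2,1)])
    have Dsa: "self_adjoint D"
      unfolding self_adjoint_def D_def by (simp add: cinner_simps self_adjointD[OF sa(1)] self_adjointD[OF sa(2)])
    have SD: "S (D \<psi>) + P (D \<psi>) = 0" for \<psi>
      by (simp add: D_def bounded_clinear_simps[OF lin(1)] bounded_clinear_simps[OF lin(2)] S(2) comm)
    have z: "D (S (D \<psi>)) + D (P (D \<psi>)) = 0" for \<psi>
      using SD[of \<psi>] bounded_clinear_add[OF D, of "S (D \<psi>)" "P (D \<psi>)"] bounded_clinear_zero[OF D] by simp
    have 1: "D (S (D \<psi>)) = 0" for \<psi>
      by (rule positive_op_sum_zero[OF positive_op_sandwich[OF S(1) D Dsa] positive_op_sandwich[OF P D Dsa] z])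
    have 2: "D (P (D \<psi>)) = 0" for \<psi>
      using 1[of \<psi>] z[of \<psi>] by simp
    have "D (D (D \<psi>)) = 0" for \<psi>
      using 1[of \<psi>] 2[of \<psi>] by (subst (2) D_def) (simp add: bounded_clinear_simps[OF D])
    then have "cinner (D (D \<psi>)) (D (D \<psi>)) = 0"
      using self_adjointD[OF Dsa, of "D \<psi>" "D (D \<psi>)"] by simp
    then have "D (D \<psi>) = 0" by (simp add: cinner_self)
    then have "cinner (D \<psi>) (D \<psi>) = 0"
      using self_adjointD[OF Dsa, of \<psi> "D \<psi>"] by simp
    then show "P \<psi> = S \<psi>" by (simp add: cinner_self D_def)
  qed
  have "positive_op (\<lambda>\<psi>. P (P \<psi>))"
  proof (rule positive_opI)
    show "bounded_clinear (\<lambda>\<psi>. P (P \<psi>))"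
      by (rule bounded_clinear_compose[OF positive_op_bounded[OF P] positive_op_bounded[OF P]])
    show "self_adjoint (\<lambda>\<psi>. P (P \<psi>))"
      by (simp add: self_adjoint_def self_adjointD[OF positive_op_self_adjoint[OF P]])
    show "0 \<le> Re (cinner \<psi> (P (P \<psi>)))" for \<psi>
      using cinner_self[of "P \<psi>"]
      by (simp add: self_adjointD[OF positive_op_self_adjoint[OF P], symmetric] flip: of_real_power)
  qed
  from positive_sqrt_exists[OF this] obtain S where S: "positive_op S" "\<And>\<psi>. S (S \<psi>) = P (P \<psi>)"
    "\<And>B \<psi>. bounded_clinear B \<Longrightarrow> (\<And>\<psi>. B (P (P \<psi>)) = P (P (B \<psi>))) \<Longrightarrow> B (S \<psi>) = S (B \<psi>)"
    by blast
  have "P = S"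
    by (rule *[OF P S(1,2) S(3)[OF positive_op_bounded[OF P]]]) simp
  moreover have "Q = S"
    by (rule *[OF Q S(1) _ S(3)[OF positive_op_bounded[OF Q]]]) (simp_all add: S(2) eq)
  ultimately show ?thesis by simp
qed

lemma adjoint_op_self_adjoint:
  assumes "self_adjoint A"
  shows "adjoint_op A = A"
  unfolding adjoint_op_def
proof (rule the_equality)
  fix B assume B: "\<forall>\<psi> \<eta>. cinner (B \<psi>) \<eta> = cinner \<psi> (A \<eta>)"
  show "B = A"
  proof
    fix \<psi>
    have "cinner (B \<psi> - A \<psi>) (B \<psi> - A \<psi>) = 0"
      using B by (simp add: cinner_simps self_adjointD[OF assms])
    then show "B \<psi> = A \<psi>" by (simp add: cinner_self)
  qed
qed (use assms in \<open>simp add: self_adjoint_def\<close>)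

text \<open>Resolves the definite description in \<open>abs_op\<close>; its uniqueness part is
  \<open>positive_sqrt_unique\<close>.\<close>

lemma abs_op_eqI:
  assumes "self_adjoint A" "positive_op P" "\<And>\<psi>. P (P \<psi>) = A (A \<psi>)"
  shows "abs_op A = P"
  unfolding abs_op_def adjoint_op_self_adjoint[OF assms(1)]
proof (rule the_equality)
  show "positive_op P \<and> P \<circ> P = A \<circ> A" using assms by auto
  fix Q assume "positive_op Q \<and> Q \<circ> Q = A \<circ> A"
  then show "Q = P"
    using positive_sqrt_unique[of Q P] assms(2,3) by (simp add: fun_eq_iff)
qed


section \<open>Trace norm versus fidelity when one of the states is pure\<close>

section \<open>Trace norm distance of a density matrix to a pure state\<close>

text \<open>With \<open>W\<close> the absolute value of \<open>X\<close>, the operator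
  \<open>N = W - X\<close> is twice the negative part, and \<open>X\<close> acts as
  \<open>- W\<close> on its range. There the cubic form of \<open>X\<close> is minus that of
  \<open>W\<close>, so both vanish and \<open>N = 0\<close>. A cubic condition is exactly what the
  relation between an operator and its absolute value provides below.\<close>

lemma positive_op_of_cube:
  assumes X: "bounded_clinear X" "self_adjoint X" and cube: "\<And>\<psi>. Re (cinner (X \<psi>) (X (X \<psi>))) \<ge> 0"
  shows "positive_op X"
proof -
  have "positive_op (\<lambda>\<psi>. X (X \<psi>))"
  proof (rule positive_opI)
    show "bounded_clinear (\<lambda>\<psi>. X (X \<psi>))" by (rule bounded_clinear_compose[OF X(1) X(1)])
    show "self_adjoint (\<lambda>\<psi>. X (X \<psi>))" by (simp add: self_adjoint_def self_adjointD[OF X(2)])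
    show "0 \<le> Re (cinner \<psi> (X (X \<psi>)))" for \<psi>
      using cinner_self[of "X \<psi>"] by (simp add: self_adjointD[OF X(2), symmetric] flip: of_real_power)
  qed
  from positive_sqrt_exists[OF this] obtain W where W: "positive_op W" "\<And>\<psi>. W (W \<psi>) = X (X \<psi>)"
    "\<And>B \<psi>. bounded_clinear B \<Longrightarrow> (\<And>\<psi>. B (X (X \<psi>)) = X (X (B \<psi>))) \<Longrightarrow> B (W \<psi>) = W (B \<psi>)"
    by blast
  have comm: "X (W \<psi>) = W (X \<psi>)" for \<psi> by (rule W(3)[OF X(1)]) simp
  note lin = positive_op_bounded[OF W(1)] and sa = positive_op_self_adjoint[OF W(1)]
  define N where "N \<psi> = W \<psi> - X \<psi>" for \<psi>
  have N: "bounded_clinear N" "self_adjoint N"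
    unfolding N_def self_adjoint_def
    by (auto intro!: bounded_clinear_minus lin X(1) simp: cinner_simps self_adjointD[OF sa] self_adjointD[OF X(2)])
  have XN: "X (N \<psi>) = - W (N \<psi>)" for \<psi>
    by (simp add: N_def bounded_clinear_simps[OF X(1)] bounded_clinear_simps[OF lin] W(2) comm)
  have NX: "N (X \<psi>) = X (N \<psi>)" "N (W \<psi>) = W (N \<psi>)" for \<psi>
    by (simp_all add: N_def bounded_clinear_simps[OF X(1)] bounded_clinear_simps[OF lin] comm)
  have WN: "W (N \<psi>) = 0" for \<psi>
  proof -
    have neg: "X (- \<xi>) = - X \<xi>" "W (- \<xi>) = - W \<xi>" for \<xi>
      using bounded_clinear_scaleR[OF X(1), of "-1" \<xi>] bounded_clinear_scaleR[OF lin, of "-1" \<xi>] by auto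
    have "Re (cinner (X (N \<psi>)) (X (X (N \<psi>)))) = - Re (cinner (W (N \<psi>)) (W (W (N \<psi>))))"
      by (simp add: XN neg comm cinner_minus_left cinner_minus_right)
    then have "Re (cinner (W (N \<psi>)) (W (W (N \<psi>)))) = 0"
      using cube[of "N \<psi>"] positive_op_Re[OF W(1), of "W (N \<psi>)"] by linarith
    then have "W (W (N \<psi>)) = 0" by (rule positive_op_form_zero[OF W(1)])
    then have "cinner (W (N \<psi>)) (W (N \<psi>)) = 0" by (simp add: self_adjointD[OF sa])
    then show ?thesis by (simp add: cinner_self)
  qed
  have "N (N \<psi>) = 0" for \<psi>
    using WN[of \<psi>] XN[of \<psi>] by (subst N_def) simp
  then have "cinner (N \<psi>) (N \<psi>) = 0" for \<psi>
    by (simp add: self_adjointD[OF N(2)])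
  then have "X = W" by (auto simp: cinner_self N_def)
  then show ?thesis using W(1) by simp
qed

text \<open>\<open>A\<close> is the sum of the rank one operators \<open>|g k\<rangle>\<langle>g k|\<close>, \<open>k \<in> I\<close>, in the weak sense.\<close>

definition mixture :: "'k set \<Rightarrow> ('k \<Rightarrow> 'a ell2) \<Rightarrow> ('a ell2 \<Rightarrow> 'a ell2) \<Rightarrow> bool" where
  "mixture I g A \<longleftrightarrow> (\<forall>\<eta> \<psi>. ((\<lambda>k. cinner \<eta> (g k) * cinner (g k) \<psi>) has_sum cinner \<eta> (A \<psi>)) I)"

lemma mixtureD: "mixture I g A \<Longrightarrow> ((\<lambda>k. cinner \<eta> (g k) * cinner (g k) \<psi>) has_sum cinner \<eta> (A \<psi>)) I"
  by (simp add: mixture_def)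

lemma mixture_form:
  assumes "mixture I g A"
  shows "((\<lambda>k. (cmod (cinner \<psi> (g k)))\<^sup>2) has_sum Re (cinner \<psi> (A \<psi>))) I"
proof -
  have "Re (cinner \<psi> (g k) * cinner (g k) \<psi>) = (cmod (cinner \<psi> (g k)))\<^sup>2" for k
    using cinner_commute[of "g k" \<psi>] complex_norm_square[of "cinner \<psi> (g k)"]
    by (metis Re_complex_of_real)
  then show ?thesis
    using has_sum_Re[OF mixtureD[OF assms, of \<psi> \<psi>]] by simp
qed

lemma mixture_self_adjoint:
  assumes "mixture I g A"
  shows "self_adjoint A"
  unfolding self_adjoint_def
proof (intro allI)
  fix \<psi> \<eta>
  have "((\<lambda>k. cnj (cinner \<eta> (g k) * cinner (g k) \<psi>)) has_sum cnj (cinner \<eta> (A \<psi>))) I"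
    using mixtureD[OF assms] by (simp only: has_sum_cnj_iff)
  moreover have "cnj (cinner \<eta> (g k) * cinner (g k) \<psi>) = cinner \<psi> (g k) * cinner (g k) \<eta>" for k
    using cinner_commute[of "g k" \<eta>] cinner_commute[of "g k" \<psi>] by simp
  ultimately have "cnj (cinner \<eta> (A \<psi>)) = cinner \<psi> (A \<eta>)"
    using mixtureD[OF assms, of \<psi> \<eta>] has_sum_unique by fastforce
  then show "cinner (A \<psi>) \<eta> = cinner \<psi> (A \<eta>)"
    using cinner_commute[of "A \<psi>" \<eta>] by simp
qed

lemma mixture_norm_le:
  assumes "mixture I g A" and s: "((\<lambda>k. (norm (g k))\<^sup>2) has_sum b) I"
  shows "norm (A \<psi>) \<le> b * norm \<psi>"
proof -
  have "cmod (cinner (A \<psi>) (A \<psi>)) \<le> norm (A \<psi>) * norm \<psi> * b"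
  proof (rule norm_infsum_le[OF mixtureD[OF assms(1)] has_sum_cmult_right[OF s]])
    fix k
    have "cmod (cinner (A \<psi>) (g k) * cinner (g k) \<psi>) \<le> (norm (A \<psi>) * norm (g k)) * (norm (g k) * norm \<psi>)"
      unfolding norm_mult by (intro mult_mono cinner_Cauchy_Schwarz) auto
    then show "cmod (cinner (A \<psi>) (g k) * cinner (g k) \<psi>) \<le> norm (A \<psi>) * norm \<psi> * (norm (g k))\<^sup>2"
      by (simp add: power2_eq_square ac_simps)
  qed
  then have *: "norm (A \<psi>) * norm (A \<psi>) \<le> norm (A \<psi>) * (b * norm \<psi>)"
    by (simp add: cinner_self norm_power power2_eq_square norm_mult ac_simps)
  have "b \<ge> 0" by (rule has_sum_nonneg[OF s]) auto
  with * show ?thesis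
    by (cases "A \<psi> = 0") auto
qed

text \<open>\<open>mixture\<close> prescribes only the form of \<open>A\<close>. Moving
  \<open>A\<close> to the other side by self-adjointness leaves the argument bare, where the inner
  product is linear.\<close>

lemma mixture_bounded:
  assumes "mixture I g A" and s: "((\<lambda>k. (norm (g k))\<^sup>2) has_sum b) I"
  shows "bounded_clinear A"
proof (rule bounded_clinearI[where b = b])
  have eqI: "\<psi> = \<eta>" if "\<And>\<xi>. cinner \<xi> \<psi> = cinner \<xi> \<eta>" for \<psi> \<eta> :: "'b ell2"
    by (rule ell2_eqI) (use that[of "ket _"] in simp)
  note sa = self_adjointD[OF mixture_self_adjoint[OF assms(1)], symmetric]
  show "A (\<psi> + \<eta>) = A \<psi> + A \<eta>" for \<psi> \<eta>
    by (rule eqI) (simp add: sa cinner_simps)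
  show "A (c *\<^sub>C \<psi>) = c *\<^sub>C A \<psi>" for c \<psi>
    by (rule eqI) (simp add: sa cinner_simps)
  show "norm (A \<psi>) \<le> b * norm \<psi>" for \<psi>
    by (rule mixture_norm_le[OF assms])
qed

lemma mixture_positive:
  assumes "mixture I g A" "((\<lambda>k. (norm (g k))\<^sup>2) has_sum b) I"
  shows "positive_op A"
  by (rule positive_opI[OF mixture_bounded[OF assms] mixture_self_adjoint[OF assms(1)]])
    (rule has_sum_nonneg[OF mixture_form[OF assms(1)]], simp)

lemma has_sum_diff:
  fixes f g :: "'a \<Rightarrow> 'b::real_normed_vector"
  assumes "(f has_sum a) A" "(g has_sum b) A"
  shows "((\<lambda>x. f x - g x) has_sum (a - b)) A"
  using has_sum_add[OF assms(1), of "\<lambda>x. - g x" "- b"] assms(2) by (simp add: has_sum_uminus)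

lemma has_sum_swap_nonneg:
  fixes f :: "'a \<Rightarrow> 'b \<Rightarrow> real"
  assumes row: "\<And>x. x \<in> A \<Longrightarrow> (f x has_sum r x) B" and col: "\<And>y. y \<in> B \<Longrightarrow> ((\<lambda>x. f x y) has_sum c y) A"
    and s: "(r has_sum S) A" and nn: "\<And>x y. x \<in> A \<Longrightarrow> y \<in> B \<Longrightarrow> f x y \<ge> 0"
  shows "(c has_sum S) B"
proof -
  have *: "((\<lambda>(x, y). f x y) has_sum S) (A \<times> B)"
  proof -
    have "(\<lambda>(x, y). f x y) summable_on (A \<times> B)"
      by (rule summable_on_SigmaI[where g = r]) (use row s nn in \<open>auto simp: has_sum_imp_summable\<close>)
    then have "((\<lambda>(x, y). f x y) has_sum infsum (\<lambda>(x, y). f x y) (A \<times> B)) (A \<times> B)" by simp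
    moreover from this have "(r has_sum infsum (\<lambda>(x, y). f x y) (A \<times> B)) A"
      by (rule has_sum_SigmaD) (use row in auto)
    ultimately show ?thesis using s has_sum_unique by metis
  qed
  then have "((\<lambda>(y, x). f x y) has_sum S) (B \<times> A)"
    using has_sum_reindex_bij_betw[of prod.swap "B \<times> A" "A \<times> B" "\<lambda>(x, y). f x y" S]
    by (simp add: case_prod_unfold bij_betw_def inj_on_def product_swap)
  then show ?thesis by (rule has_sum_SigmaD) (use col in auto)
qed

text \<open>Tonelli for the squared coordinates of the vectors \<open>g k\<close>.\<close>

lemma mixture_trace:
  assumes "mixture I g A" "((\<lambda>k. (norm (g k))\<^sup>2) has_sum b) I"
  shows "((\<lambda>i. Re (coords (A (ket i)) i)) has_sum b) UNIV"
proof (rule has_sum_swap_nonneg[OF _ _ assms(2)])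
  show "((\<lambda>i. (cmod (coords (g k) i))\<^sup>2) has_sum (norm (g k))\<^sup>2) UNIV" for k
    by (rule norm_sq_has_sum)
  show "((\<lambda>k. (cmod (coords (g k) i))\<^sup>2) has_sum Re (coords (A (ket i)) i)) I" for i
    using mixture_form[OF assms(1), of "ket i"] by simp
qed auto

text \<open>Bessel's inequality for the pair, applied to every vector of the mixture.\<close>

lemma mixture_orthonormal_pair:
  assumes "mixture I g A" "((\<lambda>k. (norm (g k))\<^sup>2) has_sum b) I"
    and "norm v = 1" "norm u = 1" "cinner v u = 0"
  shows "Re (cinner v (A v)) + Re (cinner u (A u)) \<le> b"
proof -
  have "((\<lambda>k. (cmod (cinner v (g k)))\<^sup>2 + (cmod (cinner u (g k)))\<^sup>2) has_sum
      (Re (cinner v (A v)) + Re (cinner u (A u)))) I"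
    by (intro has_sum_add mixture_form assms(1))
  then show ?thesis
  proof (rule has_sum_mono[OF _ assms(2)])
    fix k
    let ?a = "cinner v (g k)" and ?b = "cinner u (g k)"
    define z where "z = g k - ?a *\<^sub>C v - ?b *\<^sub>C u"
    have uv: "cinner u v = 0" using cinner_commute[of u v] assms(5) by simp
    have gv: "cinner (g k) v = cnj ?a" "cinner (g k) u = cnj ?b" by (metis cinner_commute)+
    have "cinner z z = of_real ((norm (g k))\<^sup>2) - ?a * cnj ?a - ?b * cnj ?b"
      unfolding z_def cinner_diff_left cinner_diff_right cinner_scaleC_left cinner_scaleC_right
        cinner_self[of v] cinner_self[of u] cinner_self[of "g k"] assms(3-5) uv gv
      by (simp add: algebra_simps)
    then have "of_real ((norm z)\<^sup>2) = complex_of_real ((norm (g k))\<^sup>2 - (cmod ?a)\<^sup>2 - (cmod ?b)\<^sup>2)"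
      by (simp only: cinner_self of_real_diff complex_norm_square)
    then have "(norm z)\<^sup>2 = (norm (g k))\<^sup>2 - (cmod ?a)\<^sup>2 - (cmod ?b)\<^sup>2"
      by (simp only: of_real_eq_iff)
    then show "(cmod ?a)\<^sup>2 + (cmod ?b)\<^sup>2 \<le> (norm (g k))\<^sup>2"
      using zero_le_power2[of "norm z"] by linarith
  qed
qed

text \<open>The inequality between fidelity and total variation for the two-point distributions with
  weights r, 1 - r and s, 1 - s.\<close>

lemma fidelity_bound:
  fixes r s :: real
  assumes "0 \<le> r" "r \<le> 1" "0 \<le> s" "s \<le> 1"
  shows "(sqrt (r * s) + sqrt ((1 - r) * (1 - s)))\<^sup>2 \<le> 1 - (r - s)\<^sup>2"
proof -
  have "2 * (sqrt (r * s) * sqrt ((1 - r) * (1 - s))) = 2 * (sqrt (r * (1 - r)) * sqrt (s * (1 - s)))"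
    by (simp add: real_sqrt_mult ac_simps)
  also have "\<dots> \<le> (sqrt (r * (1 - r)))\<^sup>2 + (sqrt (s * (1 - s)))\<^sup>2"
    using sum_squares_bound[of "sqrt (r * (1 - r))" "sqrt (s * (1 - s))"] by simp
  also have "\<dots> = r * (1 - r) + s * (1 - s)"
    using assms by simp
  finally show ?thesis
    using assms by (simp add: power2_sum power2_diff) (simp add: power2_eq_square algebra_simps)
qed

text \<open>Measuring \<open>v\<close> against its complement turns \<phi> and \<open>G\<close> into
  two-point distributions, and a measurement does not decrease the fidelity. When \<open>v\<close>
  is a unit eigenvector of \<open>G - ketbra \<phi> \<phi>\<close>, the left-hand side is the square
  of its eigenvalue.\<close>

lemma mixture_fidelity:
  assumes G: "mixture I g G" "((\<lambda>k. (norm (g k))\<^sup>2) has_sum 1) I"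
    and "norm v = 1" "norm \<phi> = 1"
  shows "((cmod (cinner v \<phi>))\<^sup>2 - Re (cinner v (G v)))\<^sup>2 \<le> 1 - Re (cinner \<phi> (G \<phi>))"
proof -
  note pos = mixture_positive[OF G] and lin = mixture_bounded[OF G] and sa = mixture_self_adjoint[OF G(1)]
  define a where "a = cinner v \<phi>"
  define u where "u = \<phi> - a *\<^sub>C v"
  define r s h where "r = (cmod a)\<^sup>2" and "s = Re (cinner v (G v))" and "h = Re (cinner u (G u))"
  have vu: "cinner v u = 0" "cinner u v = 0"
  proof -
    show "cinner v u = 0" using assms(3) by (simp add: u_def a_def cinner_simps cinner_self)
    then show "cinner u v = 0" using cinner_commute[of u v] by simp
  qed
  have \<phi>: "\<phi> = a *\<^sub>C v + u" by (simp add: u_def)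
  have nu: "(norm u)\<^sup>2 = 1 - r"
  proof -
    have "cinner \<phi> \<phi> = cnj a * a + cinner u u"
      unfolding arg_cong2[OF \<phi> \<phi>, of cinner] cinner_add_left cinner_add_right cinner_scaleC_left
        cinner_scaleC_right cinner_self[of v] assms(3) vu by simp
    then have "complex_of_real 1 = of_real (r + (norm u)\<^sup>2)"
      unfolding cinner_self assms(4) r_def of_real_add complex_norm_square by (simp add: mult.commute)
    then have "1 = r + (norm u)\<^sup>2" by (simp only: of_real_eq_iff)
    then show ?thesis by simp
  qed
  have r: "0 \<le> r" "r \<le> 1"
    using nu zero_le_power2[of "norm u"] by (simp_all add: r_def)
  have s0: "0 \<le> s" unfolding s_def by (rule positive_op_Re[OF pos])
  have s1: "s \<le> 1"
    using has_sum_mono[OF mixture_form[OF G(1), of v] G(2)] cinner_Cauchy_Schwarz[of v] assms(3)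
    by (simp add: s_def power_mono)
  \<comment> \<open>\<open>u\<close> is orthogonal to \<open>v\<close>, where the trace of
    \<open>G\<close> is at most \<open>1 - s\<close>; the squared norm of \<open>u\<close> is
    \<open>1 - r\<close>.\<close>
  have h: "h \<le> (1 - r) * (1 - s)"
  proof (cases "u = 0")
    case False
    define w where "w = (1 / norm u) *\<^sub>R u"
    have "s + Re (cinner w (G w)) \<le> 1"
      unfolding s_def
      by (rule mixture_orthonormal_pair[OF G assms(3)]) (use False vu in \<open>auto simp: w_def cinner_simps\<close>)
    also have "Re (cinner w (G w)) = h / (norm u)\<^sup>2"
      by (simp add: w_def cinner_simps bounded_clinear_scaleR[OF lin] h_def power2_eq_square)
    finally show ?thesis using False by (simp add: nu[symmetric] field_simps)
  qed (use r s1 in \<open>auto simp: h_def bounded_clinear_zero[OF lin]\<close>)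
  have h0: "0 \<le> h" unfolding h_def by (rule positive_op_Re[OF pos])
  have cross: "cmod (cinner v (G u)) \<le> sqrt s * sqrt h"
  proof -
    have "(cmod (cinner v (G u)))\<^sup>2 \<le> s * h"
      unfolding s_def h_def by (rule positive_op_Cauchy_Schwarz[OF pos])
    then show ?thesis by (simp add: real_le_rsqrt real_sqrt_mult[symmetric])
  qed
  have "cinner u (G v) = cnj (cinner v (G u))"
    using cinner_commute[of "G v" u] self_adjointD[OF sa, of v u] by (metis cinner_commute)
  then have "cinner \<phi> (G \<phi>) = cnj a * a * cinner v (G v) + (cnj a * cinner v (G u) + cnj (cnj a * cinner v (G u))) + cinner u (G u)"
    by (subst (1 2) \<phi>) (simp add: cinner_simps bounded_clinear_simps[OF lin] algebra_simps)
  also have "cnj a * a * cinner v (G v) = of_real (r * s)"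
    using self_adjoint_real[OF sa, of v] complex_norm_square[of a] by (simp add: r_def s_def mult.commute)
  finally have "Re (cinner \<phi> (G \<phi>)) = r * s + 2 * Re (cnj a * cinner v (G u)) + h"
    by (simp add: h_def)
  also have "\<dots> \<le> r * s + 2 * (sqrt r * (sqrt s * sqrt h)) + h"
  proof -
    have "Re (cnj a * cinner v (G u)) \<le> cmod a * cmod (cinner v (G u))"
      using complex_Re_le_cmod[of "cnj a * cinner v (G u)"] by (simp add: norm_mult)
    also have "\<dots> \<le> sqrt r * (sqrt s * sqrt h)"
      using cross by (simp add: r_def mult_left_mono)
    finally show ?thesis by simp
  qed
  also have "\<dots> = (sqrt (r * s) + sqrt h)\<^sup>2"
    using r s0 h0 by (simp add: power2_sum real_sqrt_mult power_mult_distrib)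
  also have "\<dots> \<le> (sqrt (r * s) + sqrt ((1 - r) * (1 - s)))\<^sup>2"
    using h r s0 h0 by (intro power_mono add_left_mono) auto
  also have "\<dots> \<le> 1 - (r - s)\<^sup>2"
    by (rule fidelity_bound[OF r s0 s1])
  finally show ?thesis by (simp add: r_def s_def a_def)
qed

lemma ketbra_self_adjoint: "self_adjoint (ketbra \<phi> \<phi>)"
  unfolding self_adjoint_def ketbra_def
  by (auto simp: cinner_simps) (metis cinner_commute mult.commute)

lemma ketbra_bounded: "bounded_clinear (ketbra \<phi> \<eta>)"
  by (rule bounded_clinearI[where b = "norm \<phi> * norm \<eta>"])
    (use mult_right_mono[OF cinner_Cauchy_Schwarz norm_ge_zero, of \<eta> _ \<phi>] in
      \<open>auto simp: ketbra_def cinner_simps scaleC_add_left ac_simps\<close>)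

text \<open>\<open>G\<close> and the projection have equal trace, so the trace norm is twice the
  trace of the negative part, here \<open>2 * (norm w)\<^sup>2\<close>. Testing the form with \<phi>
  bounds this from below; \<open>mixture_fidelity\<close> at the normalised \<open>w\<close> bounds
  it from above.\<close>

lemma trace_norm_pure_state_bounds:
  assumes G: "mixture I g G" "((\<lambda>k. (norm (g k))\<^sup>2) has_sum 1) I" and \<phi>: "norm \<phi> = 1"
  defines "\<delta> \<equiv> 1 - Re (cinner \<phi> (G \<phi>))"
  shows "2 * \<delta> \<le> trace_norm (\<lambda>\<psi>. G \<psi> - ketbra \<phi> \<phi> \<psi>)"
    and "trace_norm (\<lambda>\<psi>. G \<psi> - ketbra \<phi> \<phi> \<psi>) \<le> 2 * sqrt \<delta>"
proof -
  note Gpos = mixture_positive[OF G] and Glin = mixture_bounded[OF G] and Gsa = mixture_self_adjoint[OF G(1)]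
  define A where "A \<psi> = G \<psi> - ketbra \<phi> \<phi> \<psi>" for \<psi>
  have A: "bounded_clinear A" "self_adjoint A"
    unfolding A_def using self_adjointD[OF Gsa] self_adjointD[OF ketbra_self_adjoint[of \<phi>]]
    by (auto intro!: bounded_clinear_minus Glin ketbra_bounded simp: self_adjoint_def cinner_simps)
  have Aform: "Re (cinner \<psi> (A \<psi>)) = Re (cinner \<psi> (G \<psi>)) - (cmod (cinner \<phi> \<psi>))\<^sup>2" for \<psi>
  proof -
    have "cinner \<psi> (ketbra \<phi> \<phi> \<psi>) = cinner \<phi> \<psi> * cnj (cinner \<phi> \<psi>)"
      unfolding ketbra_def cinner_scaleC_right by (simp add: cinner_commute[of \<phi> \<psi>])
    then show ?thesis
      unfolding A_def cinner_diff_right by (simp flip: complex_norm_square)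
  qed
  have "positive_op (\<lambda>\<psi>. A (A \<psi>))"
  proof (rule positive_opI)
    show "bounded_clinear (\<lambda>\<psi>. A (A \<psi>))" by (rule bounded_clinear_compose[OF A(1) A(1)])
    show "self_adjoint (\<lambda>\<psi>. A (A \<psi>))" by (simp add: self_adjoint_def self_adjointD[OF A(2)])
    show "0 \<le> Re (cinner \<psi> (A (A \<psi>)))" for \<psi>
      using cinner_self[of "A \<psi>"] by (simp add: self_adjointD[OF A(2), symmetric] flip: of_real_power)
  qed
  from positive_sqrt_exists[OF this] obtain P where P: "positive_op P" "\<And>\<psi>. P (P \<psi>) = A (A \<psi>)"
    "\<And>B \<psi>. bounded_clinear B \<Longrightarrow> (\<And>\<psi>. B (A (A \<psi>)) = A (A (B \<psi>))) \<Longrightarrow> B (P \<psi>) = P (B \<psi>)"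
    by blast
  note Plin = positive_op_bounded[OF P(1)] and Psa = positive_op_self_adjoint[OF P(1)]
  have comm: "A (P \<psi>) = P (A \<psi>)" for \<psi> by (rule P(3)[OF A(1)]) simp
  have absA: "abs_op A = P" by (rule abs_op_eqI[OF A(2) P(1,2)])
  \<comment> \<open>Twice the negative part and twice the positive part of \<open>A\<close>.\<close>
  define M Q where "M \<psi> = P \<psi> - A \<psi>" and "Q \<psi> = P \<psi> + A \<psi>" for \<psi>
  have M: "bounded_clinear M" "self_adjoint M" and Q: "bounded_clinear Q" "self_adjoint Q"
    unfolding M_def Q_def using self_adjointD[OF Psa] self_adjointD[OF A(2)]
    by (auto intro!: bounded_clinear_minus bounded_clinear_plus Plin A(1) simp: self_adjoint_def cinner_simps)
  have QM: "Q (M \<psi>) = 0" "M (Q \<psi>) = 0" for \<psi>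
    by (simp_all add: M_def Q_def bounded_clinear_simps[OF Plin] bounded_clinear_simps[OF A(1)] comm P(2))
  have MM: "M (M \<psi>) = 2 *\<^sub>R P (M \<psi>)" and QQ: "Q (Q \<psi>) = 2 *\<^sub>R P (Q \<psi>)" for \<psi>
  proof -
    have "M \<xi> + Q \<xi> = 2 *\<^sub>R P \<xi>" for \<xi> by (simp add: M_def Q_def scaleR_2)
    from this[of "M \<psi>"] this[of "Q \<psi>"] show "M (M \<psi>) = 2 *\<^sub>R P (M \<psi>)" "Q (Q \<psi>) = 2 *\<^sub>R P (Q \<psi>)"
      by (simp_all add: QM)
  qed
  have Mpos: "positive_op M"
    by (rule positive_op_of_cube[OF M]) (use positive_op_Re[OF P(1)] in \<open>simp add: MM cinner_simps\<close>)
  have Qpos: "positive_op Q"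
    by (rule positive_op_of_cube[OF Q]) (use positive_op_Re[OF P(1)] in \<open>simp add: QQ cinner_simps\<close>)
  have A2: "2 *\<^sub>R A \<psi> = Q \<psi> - M \<psi>" for \<psi>
    by (simp add: Q_def M_def scaleR_2)
  \<comment> \<open>The negative part of \<open>G - |\<phi>\<rangle>\<langle>\<phi>|\<close> has rank at most one.\<close>
  have ker: "M \<psi> = 0" if "cinner (M \<phi>) \<psi> = 0" for \<psi>
  proof -
    have "cinner \<phi> (M \<psi>) = 0" using that by (simp add: self_adjointD[OF M(2)])
    then have "Re (cinner (M \<psi>) (A (M \<psi>))) \<ge> 0"
      using positive_op_Re[OF Gpos, of "M \<psi>"] by (simp add: Aform)
    moreover have "Re (cinner (M \<psi>) (2 *\<^sub>R A (M \<psi>))) = - Re (cinner (M \<psi>) (M (M \<psi>)))"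
      by (simp only: A2 QM) (simp add: cinner_simps)
    ultimately have "Re (cinner (M \<psi>) (M (M \<psi>))) \<le> 0"
      by (simp add: cinner_simps)
    then have "M (M \<psi>) = 0"
      using positive_op_Re[OF Mpos, of "M \<psi>"] by (intro positive_op_form_zero[OF Mpos]) simp
    then have "cinner (M \<psi>) (M \<psi>) = 0" by (simp add: self_adjointD[OF M(2)])
    then show ?thesis by (simp add: cinner_self)
  qed
  obtain w where w: "\<And>\<psi>. M \<psi> = 2 *\<^sub>R (cinner w \<psi> *\<^sub>C w)"
  proof (cases "M \<phi> = 0")
    case True
    then have "M \<psi> = 2 *\<^sub>R (cinner 0 \<psi> *\<^sub>C 0)" for \<psi> using ker[of \<psi>] by simp
    then show ?thesis by (rule that)
  next
    case False
    define m where "m = M \<phi>"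
    define b where "b = (norm m)\<^sup>2"
    have b: "b > 0" using False by (simp add: b_def m_def)
    have Mm: "M \<psi> = (cinner m \<psi> / of_real b) *\<^sub>C M m" for \<psi>
    proof -
      have "M (\<psi> - (cinner m \<psi> / of_real b) *\<^sub>C m) = 0"
        by (rule ker) (use b in \<open>simp add: m_def[symmetric] cinner_simps cinner_self b_def\<close>)
      then show ?thesis by (simp add: bounded_clinear_simps[OF M(1)])
    qed
    define c where "c = Re (cinner m (M m)) / b"
    have c: "c \<ge> 0" using positive_op_Re[OF Mpos] b by (simp add: c_def)
    \<comment> \<open>By \<open>Mm\<close> the range of \<open>M\<close> is spanned by
      \<open>M m\<close>; self-adjointness makes it parallel to \<open>m\<close>.\<close>
    have "M m = of_real c *\<^sub>C m"
    proof (rule ell2_eqI)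
      fix i
      have "coords (M m) i = cinner (M (ket i)) m" by (simp add: self_adjointD[OF M(2)])
      also have "\<dots> = cinner ((cinner m (ket i) / of_real b) *\<^sub>C M m) m" by (subst Mm) simp
      also have "\<dots> = (coords m i / of_real b) * cinner m (M m)"
        by (simp add: cinner_simps self_adjointD[OF M(2)])
      also have "\<dots> = of_real c * coords m i"
        by (subst self_adjoint_real[OF M(2)]) (simp add: c_def)
      finally show "coords (M m) i = coords (of_real c *\<^sub>C m) i" by simp
    qed
    then have "M \<psi> = 2 *\<^sub>R (cinner (sqrt (c / (2 * b)) *\<^sub>R m) \<psi> *\<^sub>C (sqrt (c / (2 * b)) *\<^sub>R m))" for \<psi>
    proof -
      define q where "q = sqrt (c / (2 * b))"
      have "q * q = c / (2 * b)" using b c by (simp add: q_def)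
      then have "c / b = 2 * (q * q)" using b by simp
      then have "complex_of_real (c / b) = of_real (2 * (q * q))" by (simp only:)
      then have "complex_of_real c / of_real b = 2 * (of_real q * of_real q)" by simp
      then show ?thesis
      proof -
        assume q: "complex_of_real c / of_real b = 2 * (of_real q * of_real q)"
        have "M \<psi> = (cinner m \<psi> * (of_real c / of_real b)) *\<^sub>C m"
          by (subst Mm) (simp add: \<open>M m = of_real c *\<^sub>C m\<close>)
        also have "\<dots> = 2 *\<^sub>R (cinner (q *\<^sub>R m) \<psi> *\<^sub>C (q *\<^sub>R m))"
          unfolding q by (simp add: cinner_simps scaleR_scaleC ac_simps)
        finally show ?thesis by (simp only: q_def)
      qed
    qed
    then show ?thesis by (rule that)
  qed
  have PA: "P \<psi> = A \<psi> + 2 *\<^sub>R (cinner w \<psi> *\<^sub>C w)" for \<psi>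
    using w[of \<psi>] by (simp add: M_def algebra_simps)
  have tr: "trace_norm A = 2 * (norm w)\<^sup>2"
  proof -
    have "((\<lambda>i. Re (coords (G (ket i)) i) - (cmod (coords \<phi> i))\<^sup>2 + 2 * (cmod (coords w i))\<^sup>2)
        has_sum (1 - 1 + 2 * (norm w)\<^sup>2)) UNIV"
      using \<phi> norm_sq_has_sum[of \<phi>] norm_sq_has_sum[of w]
      by (intro has_sum_add has_sum_diff mixture_trace[OF G] has_sum_cmult_right) auto
    moreover have "cinner (ket i) (P (ket i)) =
        of_real (Re (coords (G (ket i)) i) - (cmod (coords \<phi> i))\<^sup>2 + 2 * (cmod (coords w i))\<^sup>2)" for i
    proof -
      have "Re (cinner (ket i) (P (ket i))) = Re (cinner (ket i) (A (ket i))) + 2 * Re (cnj (coords w i) * coords w i)"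
        by (simp add: PA)
      also have "Re (cinner (ket i) (A (ket i))) = Re (coords (G (ket i)) i) - (cmod (coords \<phi> i))\<^sup>2"
        unfolding Aform by simp
      also have "Re (cnj (coords w i) * coords w i) = (cmod (coords w i))\<^sup>2"
        unfolding cmod_power2 by (simp add: power2_eq_square)
      finally show ?thesis using self_adjoint_real[OF Psa, of "ket i"] by simp
    qed
    ultimately have "((\<lambda>i. cinner (ket i) (P (ket i))) has_sum of_real (2 * (norm w)\<^sup>2)) UNIV"
      by (simp only: has_sum_of_real_iff) simp
    then show ?thesis
      unfolding trace_norm_def op_trace_def absA by (simp add: infsumI flip: of_real_power)
  qed
  have "2 * \<delta> \<le> trace_norm A"
  proof -
    have "2 * Re (cinner \<phi> (A \<phi>)) = Re (cinner \<phi> (2 *\<^sub>R A \<phi>))" by (simp add: cinner_simps)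
    also have "\<dots> \<ge> - Re (cinner \<phi> (M \<phi>))"
      unfolding A2 using positive_op_Re[OF Qpos, of \<phi>] by (simp add: cinner_simps)
    also have "Re (cinner \<phi> (M \<phi>)) = 2 * (cmod (cinner w \<phi>))\<^sup>2"
    proof -
      have "cinner \<phi> (M \<phi>) = 2 * (cinner w \<phi> * cnj (cinner w \<phi>))"
        unfolding w cinner_simps by (simp add: cinner_commute[of w \<phi>])
      then show ?thesis by (simp flip: complex_norm_square)
    qed
    finally have "- Re (cinner \<phi> (A \<phi>)) \<le> (cmod (cinner w \<phi>))\<^sup>2" by simp
    also have "\<dots> \<le> (norm w)\<^sup>2"
      using cinner_Cauchy_Schwarz[of w \<phi>] \<phi> by (simp add: power_mono)
    finally show ?thesis
      using Aform[of \<phi>] \<phi> by (simp add: tr \<delta>_def cinner_self)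
  qed
  then show "2 * \<delta> \<le> trace_norm (\<lambda>\<psi>. G \<psi> - ketbra \<phi> \<phi> \<psi>)"
    by (simp add: A_def[abs_def])
  have "trace_norm A \<le> 2 * sqrt \<delta>"
  proof (cases "w = 0")
    case True
    have "\<delta> \<ge> 0"
    proof -
      have "Re (cinner \<phi> (G \<phi>)) \<le> 1"
        using has_sum_mono[OF mixture_form[OF G(1), of \<phi>] G(2)] cinner_Cauchy_Schwarz[of \<phi>] \<phi>
        by (simp add: power_mono)
      then show ?thesis by (simp add: \<delta>_def)
    qed
    then show ?thesis using tr True by simp
  next
    case False
    define v where "v = (1 / norm w) *\<^sub>R w"
    have v: "norm v = 1" using False by (simp add: v_def)
    \<comment> \<open>\<open>w\<close> spans the range of \<open>M\<close>, which \<open>Q\<close>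
      annihilates; hence \<open>w\<close> is an eigenvector of \<open>A\<close> with eigenvalue
      \<open>- (norm w)\<^sup>2\<close>.\<close>
    have "Q w = 0"
    proof -
      have "Q (M w) = of_real (2 * (norm w)\<^sup>2) *\<^sub>C Q w"
        unfolding w by (simp add: bounded_clinear_simps[OF Q(1)] cinner_self scaleR_scaleC)
      then have "of_real (2 * (norm w)\<^sup>2) *\<^sub>C Q w = 0" by (simp only: QM)
      then have "norm (of_real (2 * (norm w)\<^sup>2) *\<^sub>C Q w) = 0" by (simp only: norm_zero)
      then show ?thesis using False by simp
    qed
    then have "2 *\<^sub>R A w = - (2 *\<^sub>R (cinner w w *\<^sub>C w))" unfolding A2 w by simp
    then have "2 *\<^sub>R A w = 2 *\<^sub>R (- (cinner w w *\<^sub>C w))" by simp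
    then have Aw: "A w = - (cinner w w *\<^sub>C w)" using scaleR_cancel_left[of 2] by fastforce
    then have "A v = - (cinner w w *\<^sub>C v)"
      by (simp add: v_def bounded_clinear_simps[OF A(1)] scaleR_scaleC mult.commute)
    then have "Re (cinner v (A v)) = - ((norm w)\<^sup>2)"
      using v by (simp add: cinner_simps cinner_self flip: of_real_power of_real_mult)
    then have "(norm w)\<^sup>2 = (cmod (cinner v \<phi>))\<^sup>2 - Re (cinner v (G v))"
      using Aform[of v] cinner_commute[of \<phi> v] by simp
    then have "((norm w)\<^sup>2)\<^sup>2 \<le> \<delta>"
      using mixture_fidelity[OF G v \<phi>] by (simp only: \<delta>_def)
    then have "(norm w)\<^sup>2 \<le> sqrt \<delta>" by (rule real_le_rsqrt)
    then show ?thesis by (simp add: tr)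
  qed
  then show "trace_norm (\<lambda>\<psi>. G \<psi> - ketbra \<phi> \<phi> \<psi>) \<le> 2 * sqrt \<delta>"
    by (simp add: A_def[abs_def])
qed


section \<open>Operators acting on a single tensor factor\<close>

section \<open>Rank one operators at a site\<close>

lemma coords_contract_bra [simp]: "coords (contract_bra x \<sigma> \<Psi>) m = coords \<Psi> (\<sigma>(x := m))"
  by (simp add: contract_bra.rep_eq)

lemma contract_bra_upd [simp]: "contract_bra x (\<sigma>(x := k)) \<Psi> = contract_bra x \<sigma> \<Psi>"
  by (rule ell2_eqI) simp

lemma contract_bra_add: "contract_bra x \<sigma> (\<Psi> + \<Phi>) = contract_bra x \<sigma> \<Psi> + contract_bra x \<sigma> \<Phi>"
  by (rule ell2_eqI) simp

lemma contract_bra_scaleC: "contract_bra x \<sigma> (c *\<^sub>C \<Psi>) = c *\<^sub>C contract_bra x \<sigma> \<Psi>"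
  by (rule ell2_eqI) simp

lemma bij_betw_site: "bij_betw (\<lambda>(\<sigma>, m). \<sigma>(x := m)) ({\<sigma>. \<sigma> x = (0::nat)} \<times> UNIV) UNIV"
  by (rule bij_betwI[where g = "\<lambda>n. (n(x := 0), n x)"]) auto

lemma has_sum_site:
  assumes "(f has_sum S) UNIV"
  shows "((\<lambda>(\<sigma>, m). f (\<sigma>(x := m))) has_sum S) ({\<sigma>. \<sigma> x = (0::nat)} \<times> UNIV)"
  using has_sum_reindex_bij_betw[OF bij_betw_site[of x], of f S] assms by (simp add: case_prod_unfold)

lemma norm_sq_slices: "((\<lambda>\<sigma>. (norm (contract_bra x \<sigma> \<Psi>))\<^sup>2) has_sum (norm \<Psi>)\<^sup>2) {\<sigma>. \<sigma> x = 0}"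
  by (rule has_sum_SigmaD[OF has_sum_site[OF norm_sq_has_sum[of \<Psi>], of x]])
    (use norm_sq_has_sum[of "contract_bra x _ \<Psi>"] in simp)

lemma cinner_slices:
  "((\<lambda>\<sigma>. cinner (contract_bra x \<sigma> \<Phi>) (contract_bra x \<sigma> \<Psi>)) has_sum cinner \<Phi> \<Psi>) {\<sigma>. \<sigma> x = 0}"
  by (rule has_sum_SigmaD[OF has_sum_site[OF cinner_has_sum[of \<Phi> \<Psi>], of x]])
    (use cinner_has_sum[of "contract_bra x _ \<Phi>" "contract_bra x _ \<Psi>"] in simp)

text \<open>\<open>ketbra \<eta> \<xi>\<close> on the factor at \<open>x\<close>, the identity
  elsewhere. A ladder operator next to the projection onto \<phi> is again of this form, with one
  \<phi> replaced by its image under a ladder operator; this keeps the operators at the site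
  \<open>x\<close> itself bounded throughout.\<close>

definition site_ketbra :: "'s \<Rightarrow> nat ell2 \<Rightarrow> nat ell2 \<Rightarrow> ('s \<Rightarrow> nat) ell2 \<Rightarrow> ('s \<Rightarrow> nat) ell2" where
  "site_ketbra x \<eta> \<xi> \<Psi> = Abs_ell2 (\<lambda>n. coords \<eta> (n x) * cinner \<xi> (contract_bra x n \<Psi>))"

lemma site_ketbra_square_summable:
  "square_summable (\<lambda>n. coords \<eta> (n x) * cinner \<xi> (contract_bra x n \<Psi>))"
proof -
  let ?f = "\<lambda>n. (cmod (coords \<eta> (n x) * cinner \<xi> (contract_bra x n \<Psi>)))\<^sup>2"
  have "(\<lambda>\<sigma>. (norm \<eta>)\<^sup>2 * (cmod (cinner \<xi> (contract_bra x \<sigma> \<Psi>)))\<^sup>2) summable_on {\<sigma>. \<sigma> x = 0}"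
  proof (rule summable_on_cmult_right, rule summable_on_comparison_test)
    show "(\<lambda>\<sigma>. (norm \<xi>)\<^sup>2 * (norm (contract_bra x \<sigma> \<Psi>))\<^sup>2) summable_on {\<sigma>. \<sigma> x = 0}"
      using norm_sq_slices[of x \<Psi>] by (intro summable_on_cmult_right) (simp add: has_sum_imp_summable)
    show "(cmod (cinner \<xi> (contract_bra x \<sigma> \<Psi>)))\<^sup>2 \<le> (norm \<xi>)\<^sup>2 * (norm (contract_bra x \<sigma> \<Psi>))\<^sup>2" for \<sigma>
      by (simp add: power_mono cinner_Cauchy_Schwarz flip: power_mult_distrib)
  qed auto
  then have "(\<lambda>(\<sigma>, m). ?f (\<sigma>(x := m))) summable_on ({\<sigma>. \<sigma> x = 0} \<times> UNIV)"
  proof (rule summable_on_SigmaI[rotated])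
    show "((\<lambda>m. case (\<sigma>, m) of (\<sigma>, m) \<Rightarrow> ?f (\<sigma>(x := m))) has_sum ((norm \<eta>)\<^sup>2 * (cmod (cinner \<xi> (contract_bra x \<sigma> \<Psi>)))\<^sup>2)) UNIV" for \<sigma>
      using has_sum_cmult_left[OF norm_sq_has_sum[of \<eta>], of "(cmod (cinner \<xi> (contract_bra x \<sigma> \<Psi>)))\<^sup>2"]
      by (simp add: norm_mult power_mult_distrib)
  qed auto
  then show ?thesis
    unfolding square_summable_def
    using summable_on_reindex_bij_betw[OF bij_betw_site[of x], of ?f] by (simp add: case_prod_unfold)
qed

lemma coords_site_ketbra [simp]:
  "coords (site_ketbra x \<eta> \<xi> \<Psi>) n = coords \<eta> (n x) * cinner \<xi> (contract_bra x n \<Psi>)"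
  by (simp add: site_ketbra_def coords_Abs[OF site_ketbra_square_summable])

lemma contract_bra_site_ketbra: "contract_bra x \<sigma> (site_ketbra x \<eta> \<xi> \<Psi>) = cinner \<xi> (contract_bra x \<sigma> \<Psi>) *\<^sub>C \<eta>"
  by (rule ell2_eqI) simp

lemma norm_site_ketbra: "norm (site_ketbra x \<eta> \<xi> \<Psi>) \<le> norm \<eta> * norm \<xi> * norm \<Psi>"
proof -
  have "(norm (site_ketbra x \<eta> \<xi> \<Psi>))\<^sup>2 \<le> (norm \<eta> * norm \<xi>)\<^sup>2 * (norm \<Psi>)\<^sup>2"
  proof (rule has_sum_mono[OF norm_sq_slices[of x] has_sum_cmult_right[OF norm_sq_slices[of x]]])
    fix \<sigma>
    have "norm (contract_bra x \<sigma> (site_ketbra x \<eta> \<xi> \<Psi>)) \<le> (norm \<xi> * norm (contract_bra x \<sigma> \<Psi>)) * norm \<eta>"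
      by (simp add: contract_bra_site_ketbra mult_right_mono cinner_Cauchy_Schwarz)
    then show "(norm (contract_bra x \<sigma> (site_ketbra x \<eta> \<xi> \<Psi>)))\<^sup>2 \<le> (norm \<eta> * norm \<xi>)\<^sup>2 * (norm (contract_bra x \<sigma> \<Psi>))\<^sup>2"
      unfolding power_mult_distrib[symmetric] by (intro power_mono) (auto simp: ac_simps)
  qed
  then show ?thesis
    unfolding power_mult_distrib[symmetric] by (rule power2_le_imp_le) auto
qed

lemma site_ketbra_add: "site_ketbra x \<eta> \<xi> (\<Psi> + \<Phi>) = site_ketbra x \<eta> \<xi> \<Psi> + site_ketbra x \<eta> \<xi> \<Phi>"
  by (rule ell2_eqI) (simp add: contract_bra_add cinner_simps algebra_simps)

lemma site_ketbra_scaleC: "site_ketbra x \<eta> \<xi> (c *\<^sub>C \<Psi>) = c *\<^sub>C site_ketbra x \<eta> \<xi> \<Psi>"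
  by (rule ell2_eqI) (simp add: contract_bra_scaleC cinner_simps algebra_simps)

lemma site_ketbra_bounded: "bounded_clinear (site_ketbra x \<eta> \<xi>)"
  by (rule bounded_clinearI[where b = "norm \<eta> * norm \<xi>"])
    (simp_all add: site_ketbra_add site_ketbra_scaleC norm_site_ketbra)

lemma site_ketbra_add_ket: "site_ketbra x (\<eta> + \<eta>') \<xi> \<Psi> = site_ketbra x \<eta> \<xi> \<Psi> + site_ketbra x \<eta>' \<xi> \<Psi>"
  by (rule ell2_eqI) (simp add: algebra_simps)
lemma site_ketbra_scaleC_ket: "site_ketbra x (c *\<^sub>C \<eta>) \<xi> \<Psi> = c *\<^sub>C site_ketbra x \<eta> \<xi> \<Psi>"
  by (rule ell2_eqI) (simp add: algebra_simps)
lemma site_ketbra_add_bra: "site_ketbra x \<eta> (\<xi> + \<xi>') \<Psi> = site_ketbra x \<eta> \<xi> \<Psi> + site_ketbra x \<eta> \<xi>' \<Psi>"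
  by (rule ell2_eqI) (simp add: cinner_simps algebra_simps)
lemma site_ketbra_scaleC_bra: "site_ketbra x \<eta> (c *\<^sub>C \<xi>) \<Psi> = cnj c *\<^sub>C site_ketbra x \<eta> \<xi> \<Psi>"
  by (rule ell2_eqI) (simp add: cinner_simps algebra_simps)

lemma site_ketbra_diff: "site_ketbra x \<eta> \<xi> (\<Psi> - \<Phi>) = site_ketbra x \<eta> \<xi> \<Psi> - site_ketbra x \<eta> \<xi> \<Phi>"
  by (rule bounded_clinear_diff[OF site_ketbra_bounded])

lemmas site_ketbra_simps = site_ketbra_add site_ketbra_diff site_ketbra_scaleC site_ketbra_add_ket
  site_ketbra_scaleC_ket site_ketbra_add_bra site_ketbra_scaleC_bra

lemma site_ketbra_adjoint: "cinner (site_ketbra x \<eta> \<xi> \<Phi>) \<Psi> = cinner \<Phi> (site_ketbra x \<xi> \<eta> \<Psi>)"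
proof -
  have "cinner (contract_bra x \<sigma> (site_ketbra x \<eta> \<xi> \<Phi>)) (contract_bra x \<sigma> \<Psi>)
      = cinner (contract_bra x \<sigma> \<Phi>) (contract_bra x \<sigma> (site_ketbra x \<xi> \<eta> \<Psi>))" for \<sigma>
    by (simp add: contract_bra_site_ketbra cinner_simps cinner_commute[of "contract_bra x \<sigma> \<Phi>" \<xi>])
  then show ?thesis
    using cinner_slices[of x "site_ketbra x \<eta> \<xi> \<Phi>" \<Psi>] cinner_slices[of x \<Phi> "site_ketbra x \<xi> \<eta> \<Psi>"]
    by (simp add: has_sum_unique)
qed

lemma site_ketbra_mult:
  "site_ketbra x \<eta> \<xi> (site_ketbra x \<eta>' \<xi>' \<Psi>) = cinner \<xi> \<eta>' *\<^sub>C site_ketbra x \<eta> \<xi>' \<Psi>"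
  by (rule ell2_eqI) (simp add: contract_bra_site_ketbra cinner_simps)

lemma coords_tensor_ket:
  "coords (tensor_ket x \<sigma> \<psi>) n = (if \<forall>y. y \<noteq> x \<longrightarrow> n y = \<sigma> y then coords \<psi> (n x) else 0)"
  by (simp add: tensor_ket.rep_eq)

lemma site_ketbra_tensor_ket:
  assumes "x \<noteq> y"
  shows "coords (site_ketbra y \<eta> \<xi> (tensor_ket x n \<psi>)) k =
    (if \<forall>z. z \<noteq> x \<longrightarrow> z \<noteq> y \<longrightarrow> k z = n z then coords \<eta> (k y) * cnj (coords \<xi> (n y)) * coords \<psi> (k x) else 0)"
proof -
  have "contract_bra y k (tensor_ket x n \<psi>) =
      (if \<forall>z. z \<noteq> x \<longrightarrow> z \<noteq> y \<longrightarrow> k z = n z then coords \<psi> (k x) else 0) *\<^sub>C ket (n y)"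
    using assms by (intro ell2_eqI) (auto simp: coords_tensor_ket coords_ket)
  then show ?thesis by (auto simp: cinner_simps)
qed

lemma site_ketbra_ket: "site_ketbra x \<eta> \<xi> (ket n) = cnj (coords \<xi> (n x)) *\<^sub>C tensor_ket x n \<eta>"
proof (rule ell2_eqI)
  fix k
  have "contract_bra x k (ket n) = (if \<forall>z. z \<noteq> x \<longrightarrow> k z = n z then 1 else 0) *\<^sub>C ket (n x)"
    by (intro ell2_eqI) (auto simp: coords_ket fun_eq_iff)
  then show "coords (site_ketbra x \<eta> \<xi> (ket n)) k = coords (cnj (coords \<xi> (n x)) *\<^sub>C tensor_ket x n \<eta>) k"
    by (auto simp: coords_tensor_ket cinner_simps)
qed

text \<open>Both sides are bounded, so it suffices to compare them on the basis vectors, where they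
  are explicit.\<close>

lemma site_ketbra_commute:
  assumes "x \<noteq> y"
  shows "site_ketbra x \<eta> \<xi> (site_ketbra y \<eta>' \<xi>' \<Psi>) = site_ketbra y \<eta>' \<xi>' (site_ketbra x \<eta> \<xi> \<Psi>)"
proof (rule bounded_clinear_eq_on_kets[where A = "\<lambda>\<Psi>. site_ketbra x \<eta> \<xi> (site_ketbra y \<eta>' \<xi>' \<Psi>)"])
  show "site_ketbra x \<eta> \<xi> (site_ketbra y \<eta>' \<xi>' (ket n)) = site_ketbra y \<eta>' \<xi>' (site_ketbra x \<eta> \<xi> (ket n))" for n
    by (rule ell2_eqI) (use assms in \<open>auto simp: site_ketbra_ket site_ketbra_scaleC site_ketbra_tensor_ket
      simp del: coords_site_ketbra\<close>)
qed (rule bounded_clinear_compose[OF site_ketbra_bounded site_ketbra_bounded])+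

text \<open>Antilinear in \<open>\<xi>\<close>, yet bilinear over the reals; this lets the product
  rule treat a moving bra and a moving state at once.\<close>

lemma bounded_bilinear_site_ketbra: "bounded_bilinear (\<lambda>\<xi> \<Psi>. site_ketbra x \<eta> \<xi> \<Psi>)"
proof
  show "\<exists>K. \<forall>\<xi> \<Psi>. norm (site_ketbra x \<eta> \<xi> \<Psi>) \<le> norm \<xi> * norm \<Psi> * K"
    by (rule exI[of _ "norm \<eta>"]) (use norm_site_ketbra[of x \<eta>] in \<open>simp add: mult.commute mult.left_commute\<close>)
qed (simp_all only: site_ketbra_add site_ketbra_add_bra scaleR_scaleC site_ketbra_scaleC
    site_ketbra_scaleC_bra complex_cnj_complex_of_real)

section \<open>Ladder operators at a site\<close>

lemma at_site_annihilation:
  "at_site annihilation x f n = of_real (sqrt (real (n x) + 1)) * f (n(x := n x + 1))"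
  by (simp add: at_site_def annihilation_def)

lemma at_site_creation:
  "at_site creation x f n = of_real (sqrt (real (n x))) * f (n(x := n x - 1))"
  by (simp add: at_site_def creation_def)

lemma at_site_diagonal:
  "at_site number x f n = of_nat (n x) * f n"
  "at_site pair_number x f n = of_real (real (n x) * (real (n x) - 1)) * f n"
  by (simp_all add: at_site_def number_eq pair_number_def algebra_simps)

text \<open>On finitely supported vectors all ladder operators are defined; other vectors are
  reached by truncation and continuity.\<close>

definition finsup :: "'a ell2 \<Rightarrow> bool" where
  "finsup \<psi> \<longleftrightarrow> finite {i. coords \<psi> i \<noteq> 0}"

lemma square_summable_finite: "finite {i. f i \<noteq> 0} \<Longrightarrow> square_summable f"
proof -
  assume "finite {i. f i \<noteq> 0}"
  then have "(\<lambda>i. (cmod (f i))\<^sup>2) summable_on {i. f i \<noteq> 0}" by simp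
  also have "?this \<longleftrightarrow> (\<lambda>i. (cmod (f i))\<^sup>2) summable_on UNIV"
    by (rule summable_on_cong_neutral) auto
  finally show ?thesis by (simp add: square_summable_def)
qed

lemma finsup_Abs: "finite {i. f i \<noteq> 0} \<Longrightarrow> finsup (Abs_ell2 f)"
  by (simp add: finsup_def coords_Abs square_summable_finite)

definition lower :: "'s \<Rightarrow> ('s \<Rightarrow> nat) ell2 \<Rightarrow> ('s \<Rightarrow> nat) ell2" where
  "lower x \<Psi> = Abs_ell2 (at_site annihilation x (coords \<Psi>))"

definition raise :: "'s \<Rightarrow> ('s \<Rightarrow> nat) ell2 \<Rightarrow> ('s \<Rightarrow> nat) ell2" where
  "raise x \<Psi> = Abs_ell2 (at_site creation x (coords \<Psi>))"

lemma finite_lower: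
  assumes "finsup \<Psi>" shows "finite {n. at_site annihilation x (coords \<Psi>) n \<noteq> 0}"
proof (rule finite_subset)
  show "{n. at_site annihilation x (coords \<Psi>) n \<noteq> 0} \<subseteq> (\<lambda>n. n(x := n x - 1)) ` {n. coords \<Psi> n \<noteq> 0}"
    by (auto simp: at_site_annihilation intro!: image_eqI[where x = "_(x := Suc (_ x))"])
qed (use assms in \<open>simp add: finsup_def\<close>)

lemma finite_raise:
  assumes "finsup \<Psi>" shows "finite {n. at_site creation x (coords \<Psi>) n \<noteq> 0}"
proof (rule finite_subset)
  show "{n. at_site creation x (coords \<Psi>) n \<noteq> 0} \<subseteq> (\<lambda>n. n(x := n x + 1)) ` {n. coords \<Psi> n \<noteq> 0}"
    by (auto simp: at_site_creation intro!: image_eqI[where x = "_(x := _ x - 1)"])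
qed (use assms in \<open>simp add: finsup_def\<close>)

lemma coords_lower: "finsup \<Psi> \<Longrightarrow> coords (lower x \<Psi>) = at_site annihilation x (coords \<Psi>)"
  by (simp add: lower_def coords_Abs square_summable_finite finite_lower)
lemma coords_raise: "finsup \<Psi> \<Longrightarrow> coords (raise x \<Psi>) = at_site creation x (coords \<Psi>)"
  by (simp add: raise_def coords_Abs square_summable_finite finite_raise)
lemma finsup_lower: "finsup \<Psi> \<Longrightarrow> finsup (lower x \<Psi>)"
  by (simp add: lower_def finsup_Abs finite_lower)
text \<open>A shift of the occupation number at \<open>x\<close> by one. The images are given by
  their coordinates because vectors such as \<open>site_ketbra x \<eta> \<xi> \<Psi>\<close> are in
  general not finitely supported, so that \<open>lower\<close> and \<open>raise\<close> do not
  describe their images.\<close>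

lemma ladder_adjoint:
  assumes \<Phi>': "\<And>n. coords \<Phi>' n = at_site annihilation x (coords \<Phi>) n"
    and \<Psi>': "\<And>n. coords \<Psi>' n = at_site creation x (coords \<Psi>) n"
  shows "cinner \<Phi> \<Psi>' = cinner \<Phi>' \<Psi>"
proof -
  let ?h = "\<lambda>n. n(x := Suc (n x))" and ?f = "\<lambda>n. cnj (coords \<Phi> n) * coords \<Psi>' n"
  have inj: "inj ?h"
  proof (rule injI)
    fix n m :: "'a \<Rightarrow> nat" assume h: "?h n = ?h m"
    show "n = m"
    proof
      fix y show "n y = m y"
        using fun_cong[OF h, of y] by (cases "y = x") auto
    qed
  qed
  have "(?f has_sum cinner \<Phi> \<Psi>') UNIV" by (rule cinner_has_sum)
  also have "?this \<longleftrightarrow> (?f has_sum cinner \<Phi> \<Psi>') (range ?h)"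
  proof (rule has_sum_cong_neutral)
    fix n assume "n \<in> UNIV - range ?h"
    then have "n x = 0"
      using fun_upd_triv[of n x] by (cases "n x") (auto simp: image_iff, metis fun_upd_same fun_upd_upd)
    then show "?f n = 0" by (simp add: \<Psi>' at_site_creation)
  qed auto
  also have "\<dots> \<longleftrightarrow> ((?f \<circ> ?h) has_sum cinner \<Phi> \<Psi>') UNIV"
    by (rule has_sum_reindex[OF inj])
  also have "?f \<circ> ?h = (\<lambda>n. cnj (coords \<Phi>' n) * coords \<Psi> n)"
    by (rule ext) (simp add: \<Phi>' \<Psi>' at_site_annihilation at_site_creation add.commute)
  finally show ?thesis using cinner_unique by metis
qed

lemma site_ketbra_lower_other:
  assumes "finsup \<Psi>" "x \<noteq> y"
  shows "coords (site_ketbra x \<eta> \<xi> (lower y \<Psi>)) n = at_site annihilation y (coords (site_ketbra x \<eta> \<xi> \<Psi>)) n"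
proof -
  have "contract_bra x n (lower y \<Psi>) = of_real (sqrt (real (n y) + 1)) *\<^sub>C contract_bra x (n(y := n y + 1)) \<Psi>"
    using assms by (intro ell2_eqI) (simp add: coords_lower at_site_annihilation fun_upd_twist)
  then show ?thesis
    using assms(2) by (simp add: at_site_annihilation cinner_simps)
qed

definition mult_op :: "('a \<Rightarrow> real) \<Rightarrow> 'a ell2 \<Rightarrow> 'a ell2" where
  "mult_op v \<psi> = Abs_ell2 (\<lambda>i. of_real (v i) * coords \<psi> i)"

lemma finite_mult_op: "finsup \<psi> \<Longrightarrow> finite {i. complex_of_real (v i) * coords \<psi> i \<noteq> 0}"
  unfolding finsup_def by (erule finite_subset[rotated]) auto
lemma coords_mult_op: "finsup \<psi> \<Longrightarrow> coords (mult_op v \<psi>) i = of_real (v i) * coords \<psi> i"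
  by (simp add: mult_op_def coords_Abs[OF square_summable_finite[OF finite_mult_op]])
section \<open>Ladder operators of a one-site vector\<close>

lemma annihilation_adjoint:
  assumes fa: "\<And>n. coords f' n = annihilation (coords f) n" and gc: "\<And>n. coords g' n = creation (coords g) n"
  shows "cinner g' f = cinner g f'"
proof -
  let ?f = "\<lambda>n. cnj (coords g' n) * coords f n"
  have "(?f has_sum cinner g' f) UNIV" by (rule cinner_has_sum)
  also have "?this \<longleftrightarrow> (?f has_sum cinner g' f) (range Suc)"
  proof (rule has_sum_cong_neutral)
    fix n assume "n \<in> UNIV - range Suc"
    then have "n = 0" by (cases n) auto
    then show "?f n = 0" by (simp add: gc creation_def)
  qed auto
  also have "\<dots> \<longleftrightarrow> ((?f \<circ> Suc) has_sum cinner g' f) UNIV"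
    by (rule has_sum_reindex) simp
  also have "?f \<circ> Suc = (\<lambda>n. cnj (coords g n) * coords f' n)"
    by (rule ext) (simp add: fa gc annihilation_def creation_def add.commute)
  finally show ?thesis using cinner_unique by metis
qed

text \<open>The annihilation operator is absorbed by the bra, on which it acts as its
  adjoint.\<close>

lemma site_ketbra_lower_same:
  assumes "finsup \<Psi>" "\<And>n. coords \<xi>' n = creation (coords \<xi>) n"
  shows "site_ketbra x \<eta> \<xi> (lower x \<Psi>) = site_ketbra x \<eta> \<xi>' \<Psi>"
proof (rule ell2_eqI)
  fix n
  have "cinner \<xi>' (contract_bra x n \<Psi>) = cinner \<xi> (contract_bra x n (lower x \<Psi>))"
    by (rule annihilation_adjoint)
      (simp_all add: assms coords_lower at_site_annihilation annihilation_def)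
  then show "coords (site_ketbra x \<eta> \<xi> (lower x \<Psi>)) n = coords (site_ketbra x \<eta> \<xi>' \<Psi>) n" by simp
qed

lemma at_site_annihilation_site_ketbra:
  assumes "\<And>n. coords \<eta>' n = annihilation (coords \<eta>) n"
  shows "at_site annihilation x (coords (site_ketbra x \<eta> \<xi> \<Psi>)) n = coords (site_ketbra x \<eta>' \<xi> \<Psi>) n"
  by (simp add: at_site_annihilation assms annihilation_def)

section \<open>Block decomposition and bounds of the interaction at a fixed time\<close>

section \<open>Interaction estimate\<close>

lemma has_sum_shift_site:
  fixes f :: "('s \<Rightarrow> nat) \<Rightarrow> real"
  assumes "((\<lambda>n. f (n(x := Suc (n x)))) has_sum S) UNIV" "\<And>n. n x = 0 \<Longrightarrow> f n = 0"
  shows "(f has_sum S) UNIV"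
proof -
  let ?h = "\<lambda>n. n(x := Suc (n x))"
  have inj: "inj ?h"
  proof (rule injI)
    fix n m :: "'s \<Rightarrow> nat" assume h: "?h n = ?h m"
    show "n = m"
    proof
      fix y show "n y = m y"
        using fun_cong[OF h, of y] by (cases "y = x") auto
    qed
  qed
  have "((f \<circ> ?h) has_sum S) UNIV" using assms(1) by (simp add: o_def)
  then have "(f has_sum S) (range ?h)" by (simp only: has_sum_reindex[OF inj])
  also have "?this \<longleftrightarrow> (f has_sum S) UNIV"
  proof (rule has_sum_cong_neutral)
    fix n assume "n \<in> UNIV - range ?h"
    then have "n x = 0"
      using fun_upd_triv[of n x] by (cases "n x") (auto simp: image_iff, metis fun_upd_same fun_upd_upd)
    then show "f n = 0" by (rule assms(2))
  qed auto
  finally show ?thesis .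
qed

lemma norm_sq_annihilation:
  assumes "\<And>n. coords \<phi>a n = annihilation (coords \<phi>) n"
  shows "((\<lambda>n. real n * (cmod (coords \<phi> n))\<^sup>2) has_sum (norm \<phi>a)\<^sup>2) UNIV"
proof -
  let ?f = "\<lambda>n. real n * (cmod (coords \<phi> n))\<^sup>2"
  have "((?f \<circ> Suc) has_sum (norm \<phi>a)\<^sup>2) UNIV"
    using norm_sq_has_sum[of \<phi>a]
    by (simp add: o_def assms annihilation_def norm_mult power_mult_distrib add.commute)
  then have "(?f has_sum (norm \<phi>a)\<^sup>2) (range Suc)" by (subst has_sum_reindex) auto
  also have "?this \<longleftrightarrow> (?f has_sum (norm \<phi>a)\<^sup>2) UNIV"
  proof (rule has_sum_cong_neutral)
    fix n assume "n \<in> UNIV - range Suc"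
    then have "n = 0" by (cases n) auto
    then show "?f n = 0" by simp
  qed auto
  finally show ?thesis .
qed

lemma norm_sq_creation:
  assumes "\<And>n. coords \<phi>c n = creation (coords \<phi>) n"
  shows "((\<lambda>n. (real n + 1) * (cmod (coords \<phi> n))\<^sup>2) has_sum (norm \<phi>c)\<^sup>2) UNIV"
proof -
  have "((\<lambda>n. (cmod (coords \<phi>c n))\<^sup>2) has_sum (norm \<phi>c)\<^sup>2) UNIV" by (rule norm_sq_has_sum)
  also have "?this \<longleftrightarrow> ((\<lambda>n. (cmod (coords \<phi>c n))\<^sup>2) has_sum (norm \<phi>c)\<^sup>2) (range Suc)"
  proof (rule has_sum_cong_neutral)
    fix n assume "n \<in> UNIV - range Suc"
    then have "n = 0" by (cases n) auto
    then show "(cmod (coords \<phi>c n))\<^sup>2 = 0" by (simp add: assms creation_def)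
  qed auto
  also have "\<dots> \<longleftrightarrow> (((\<lambda>n. (cmod (coords \<phi>c n))\<^sup>2) \<circ> Suc) has_sum (norm \<phi>c)\<^sup>2) UNIV"
    by (rule has_sum_reindex) simp
  finally show ?thesis
    by (simp add: o_def assms creation_def norm_mult power_mult_distrib add.commute)
qed

text \<open>The canonical commutation relation, evaluated in \<phi>.\<close>

lemma norm_creation_annihilation:
  assumes "\<And>n. coords \<phi>a n = annihilation (coords \<phi>) n" "\<And>n. coords \<phi>c n = creation (coords \<phi>) n"
  shows "(norm \<phi>c)\<^sup>2 = (norm \<phi>a)\<^sup>2 + (norm \<phi>)\<^sup>2"
  using has_sum_add[OF norm_sq_annihilation[of \<phi>a \<phi>] norm_sq_has_sum[of \<phi>]] norm_sq_creation[of \<phi>c \<phi>] assms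
  by (simp add: algebra_simps has_sum_unique)

text \<open>Exchanging the two sites conjugates each summand. This removes the terms in which both
  sites carry the same operator.\<close>

lemma Im_hermitian_sum:
  fixes z :: "'s \<Rightarrow> 's \<Rightarrow> complex"
  assumes "sym E" "\<And>x y. (x, y) \<in> E \<Longrightarrow> z y x = cnj (z x y)"
  shows "(\<Sum>(x, y)\<in>E. Im (z x y)) = 0"
proof -
  have "(\<Sum>(x, y)\<in>E. Im (z x y)) = (\<Sum>(x, y)\<in>E. Im (z y x))"
    by (rule sum.reindex_bij_witness[where i = prod.swap and j = prod.swap])
      (use assms(1) in \<open>auto simp: sym_def\<close>)
  also have "\<dots> = (\<Sum>(x, y)\<in>E. - Im (z x y))"
    by (rule sum.cong) (auto simp: assms(2))
  also have "\<dots> = - (\<Sum>(x, y)\<in>E. Im (z x y))"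
    by (simp add: case_prod_unfold sum_negf)
  finally show ?thesis by simp
qed

lemma sum_regular_graph:
  fixes f :: "'s::finite \<Rightarrow> real"
  assumes "sym E" "\<And>x. card {y. (x, y) \<in> E} = k"
  shows "(\<Sum>(x, y)\<in>E. f y) = real k * (\<Sum>x\<in>UNIV. f x)" "(\<Sum>(x, y)\<in>E. f x) = real k * (\<Sum>x\<in>UNIV. f x)"
    "(\<Sum>(x, y)\<in>E. g x y) = (\<Sum>x\<in>UNIV. \<Sum>y | (x, y) \<in> E. g x y)"
proof -
  have E: "E = (SIGMA x:UNIV. {y. (x, y) \<in> E})" by auto
  show "(\<Sum>(x, y)\<in>E. g x y) = (\<Sum>x\<in>UNIV. \<Sum>y | (x, y) \<in> E. g x y)" for g :: "'s \<Rightarrow> 's \<Rightarrow> 'b::comm_monoid_add"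
    by (subst E, subst sum.Sigma) auto
  from this[of "\<lambda>x y. f x"] show 2: "(\<Sum>(x, y)\<in>E. f x) = real k * (\<Sum>x\<in>UNIV. f x)"
    by (simp add: assms(2) sum_distrib_left)
  have "(\<Sum>(x, y)\<in>E. f y) = (\<Sum>(x, y)\<in>E. f x)"
    by (rule sum.reindex_bij_witness[where i = prod.swap and j = prod.swap])
      (use assms(1) in \<open>auto simp: sym_def\<close>)
  then show "(\<Sum>(x, y)\<in>E. f y) = real k * (\<Sum>x\<in>UNIV. f x)" using 2 by simp
qed

text \<open>One time slice: the images of \<phi> under the ladder operators are named as vectors, so
  that no domains enter the algebra.\<close>

locale mean_field_vector =
  fixes \<phi> \<phi>a \<phi>c :: "nat ell2"
  assumes norm_phi: "norm \<phi> = 1"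
    and coords_a: "\<And>n. coords \<phi>a n = annihilation (coords \<phi>) n"
    and coords_c: "\<And>n. coords \<phi>c n = creation (coords \<phi>) n"
begin

definition "\<alpha> = cinner \<phi> \<phi>a"
definition "\<nu> = (norm \<phi>a)\<^sup>2"
text \<open>Components orthogonal to \<phi>. With p the projection onto \<phi>, q its complement and
  a the annihilation operator, q a p is \<open>ketbra u \<phi>\<close> and p a q is
  \<open>ketbra \<phi> w\<close>.\<close>

definition "u = \<phi>a - \<alpha> *\<^sub>C \<phi>"
definition "w = \<phi>c - cnj \<alpha> *\<^sub>C \<phi>"
definition proj :: "'s \<Rightarrow> ('s \<Rightarrow> nat) ell2 \<Rightarrow> ('s \<Rightarrow> nat) ell2" where
  "proj x \<Psi> = site_ketbra x \<phi> \<phi> \<Psi>"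
definition excited :: "'s \<Rightarrow> ('s \<Rightarrow> nat) ell2 \<Rightarrow> ('s \<Rightarrow> nat) ell2" where
  "excited x \<Psi> = \<Psi> - proj x \<Psi>"
definition fluct :: "'s \<Rightarrow> ('s \<Rightarrow> nat) ell2 \<Rightarrow> ('s \<Rightarrow> nat) ell2" where
  "fluct x \<Psi> = lower x \<Psi> - \<alpha> *\<^sub>C \<Psi>"

lemma cinner_phi [simp]: "cinner \<phi> \<phi> = 1"
  using norm_phi by (simp add: cinner_self)

lemma nu_nonneg: "\<nu> \<ge> 0" by (simp add: \<nu>_def)

lemma norm_a: "norm \<phi>a = sqrt \<nu>" by (simp add: \<nu>_def)
lemma norm_c: "norm \<phi>c = sqrt (\<nu> + 1)"
  using norm_creation_annihilation[OF coords_a coords_c] norm_phi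
  by (metis \<nu>_def norm_ge_zero one_power2 real_sqrt_unique)

lemma cinner_phi_c: "cinner \<phi> \<phi>c = cnj \<alpha>"
  using annihilation_adjoint[OF coords_a coords_c] cinner_commute[of \<phi> \<phi>c] by (simp add: \<alpha>_def)

lemma phi_u [simp]: "cinner \<phi> u = 0"
  by (simp add: u_def cinner_simps \<alpha>_def)
lemma phi_w [simp]: "cinner \<phi> w = 0"
  by (simp add: w_def cinner_simps cinner_phi_c)
lemma u_phi [simp]: "cinner u \<phi> = 0"
  using cinner_commute[of \<phi> u] by simp
lemma w_phi [simp]: "cinner w \<phi> = 0"
  using cinner_commute[of \<phi> w] by simp

lemma norm_alpha: "cmod \<alpha> \<le> sqrt \<nu>"
  using cinner_Cauchy_Schwarz[of \<phi> \<phi>a] by (simp add: \<alpha>_def norm_phi norm_a)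

lemma norm_proj_diff_le: "norm (\<psi> - cinner \<phi> \<psi> *\<^sub>C \<phi>) \<le> norm \<psi>"
proof -
  define z where "z = cinner \<phi> \<psi>"
  have "cinner \<psi> \<phi> = cnj z" using cinner_commute[of \<psi> \<phi>] by (simp add: z_def)
  then have "cinner (\<psi> - z *\<^sub>C \<phi>) (\<psi> - z *\<^sub>C \<phi>) = cinner \<psi> \<psi> - z * cnj z"
    by (simp only: cinner_diff_left cinner_diff_right cinner_scaleC_left cinner_scaleC_right cinner_phi
        z_def[symmetric]) simp
  then have "complex_of_real ((norm (\<psi> - z *\<^sub>C \<phi>))\<^sup>2) = of_real ((norm \<psi>)\<^sup>2 - (cmod z)\<^sup>2)"
    by (simp only: cinner_self of_real_diff complex_norm_square)
  then have "(norm (\<psi> - z *\<^sub>C \<phi>))\<^sup>2 = (norm \<psi>)\<^sup>2 - (cmod z)\<^sup>2" by (simp only: of_real_eq_iff)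
  then have "(norm (\<psi> - z *\<^sub>C \<phi>))\<^sup>2 \<le> (norm \<psi>)\<^sup>2" by simp
  then show ?thesis unfolding z_def by (rule power2_le_imp_le) simp
qed

lemma norm_u: "norm u \<le> sqrt \<nu>"
  using norm_proj_diff_le[of \<phi>a] by (simp add: u_def \<alpha>_def norm_a)
lemma norm_w: "norm w \<le> sqrt (\<nu> + 1)"
  using norm_proj_diff_le[of \<phi>c] by (simp add: w_def cinner_phi_c norm_c)

lemma excited_self_adjoint: "cinner (excited x \<Psi>) \<Phi> = cinner \<Psi> (excited x \<Phi>)"
  by (simp add: excited_def proj_def cinner_simps site_ketbra_adjoint)

lemma proj_excited [simp]: "site_ketbra x \<eta> \<phi> (excited x \<Psi>) = 0"
  by (simp add: excited_def proj_def site_ketbra_diff site_ketbra_mult)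

lemma excited_excited [simp]: "excited x (excited x \<Psi>) = excited x \<Psi>"
  using proj_excited[of x \<phi> \<Psi>] by (simp add: excited_def[of x "excited x \<Psi>"] proj_def)

lemma site_ketbra_excited: "cinner \<xi> \<phi> = 0 \<Longrightarrow> site_ketbra x \<eta> \<xi> (excited x \<Psi>) = site_ketbra x \<eta> \<xi> \<Psi>"
  by (simp add: excited_def proj_def site_ketbra_diff site_ketbra_mult)

lemma site_ketbra_excited_commute:
  "x \<noteq> z \<Longrightarrow> excited z (site_ketbra x \<eta> \<xi> \<Psi>) = site_ketbra x \<eta> \<xi> (excited z \<Psi>)"
  by (simp add: excited_def proj_def site_ketbra_diff site_ketbra_commute)

lemma norm_sq_excited: "(norm (excited x \<Psi>))\<^sup>2 = (norm \<Psi>)\<^sup>2 - Re (cinner \<Psi> (proj x \<Psi>))"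
proof -
  have "cinner (excited x \<Psi>) (excited x \<Psi>) = cinner \<Psi> \<Psi> - cinner \<Psi> (proj x \<Psi>)"
    by (subst excited_self_adjoint) (simp, simp add: excited_def cinner_simps)
  then have "Re (cinner (excited x \<Psi>) (excited x \<Psi>)) = Re (cinner \<Psi> \<Psi>) - Re (cinner \<Psi> (proj x \<Psi>))" by simp
  then show ?thesis by (simp add: cinner_self flip: of_real_power)
qed

lemma norm_site_ketbra_excited:
  assumes "cinner \<xi> \<phi> = 0"
  shows "norm (site_ketbra x \<eta> \<xi> \<Psi>) \<le> norm \<eta> * norm \<xi> * norm (excited x \<Psi>)"
  using norm_site_ketbra[of x \<eta> \<xi> "excited x \<Psi>"] by (simp add: site_ketbra_excited[OF assms])

text \<open>The block p (a - \<alpha>) p vanishes by the definition of \<alpha>; what remains is p a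
  q.\<close>

lemma proj_fluct:
  assumes "finsup \<Psi>"
  shows "proj z (fluct z \<Psi>) = site_ketbra z \<phi> w \<Psi>"
proof -
  have "site_ketbra z \<phi> \<phi>c \<Psi> = site_ketbra z \<phi> (w + cnj \<alpha> *\<^sub>C \<phi>) \<Psi>" by (simp add: w_def)
  then show ?thesis
    by (simp add: fluct_def proj_def site_ketbra_simps site_ketbra_lower_same[OF assms coords_c])
qed

text \<open>The blocks of the fluctuation with respect to the projection at \<open>z\<close>: pq,
  qp, and the block qq, the only one in which the unbounded operator survives.\<close>

lemma fluct_decomp:
  assumes "finsup \<Psi>"
  shows "fluct z \<Psi> = site_ketbra z \<phi> w \<Psi> + site_ketbra z u \<phi> \<Psi> + excited z (fluct z \<Psi> - site_ketbra z u \<phi> \<Psi>)"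
proof -
  have "excited z (site_ketbra z u \<phi> \<Psi>) = site_ketbra z u \<phi> \<Psi>"
    by (simp add: excited_def proj_def site_ketbra_mult)
  then have "excited z (fluct z \<Psi>) = site_ketbra z u \<phi> \<Psi> + excited z (fluct z \<Psi> - site_ketbra z u \<phi> \<Psi>)"
    by (simp add: excited_def proj_def site_ketbra_diff)
  then have "proj z (fluct z \<Psi>) + excited z (fluct z \<Psi>) = site_ketbra z \<phi> w \<Psi> +
      (site_ketbra z u \<phi> \<Psi> + excited z (fluct z \<Psi> - site_ketbra z u \<phi> \<Psi>))"
    by (simp only: proj_fluct[OF assms])
  moreover have "proj z (fluct z \<Psi>) + excited z (fluct z \<Psi>) = fluct z \<Psi>" by (simp add: excited_def)
  ultimately show ?thesis by (simp only: add.assoc)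
qed

text \<open>The outer q of the block qq is self-adjoint and commutes with operators at
  \<open>x\<close>, so it passes to the other vector and supplies an excitation factor
  there.\<close>

lemma cinner_fluct_decomp:
  assumes "finsup \<Psi>" "x \<noteq> z"
  shows "cinner (site_ketbra x \<eta> \<xi> \<Psi>) (fluct z \<Psi>) =
    cinner (site_ketbra x \<eta> \<xi> \<Psi>) (site_ketbra z \<phi> w \<Psi>) + cinner (site_ketbra x \<eta> \<xi> \<Psi>) (site_ketbra z u \<phi> \<Psi>)
    + cinner (site_ketbra x \<eta> \<xi> (excited z \<Psi>)) (fluct z \<Psi> - site_ketbra z u \<phi> \<Psi>)"
proof -
  have "cinner (site_ketbra x \<eta> \<xi> \<Psi>) (excited z (fluct z \<Psi> - site_ketbra z u \<phi> \<Psi>))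
      = cinner (site_ketbra x \<eta> \<xi> (excited z \<Psi>)) (fluct z \<Psi> - site_ketbra z u \<phi> \<Psi>)"
    by (simp only: excited_self_adjoint[symmetric] site_ketbra_excited_commute[OF assms(2)])
  then show ?thesis
    by (subst fluct_decomp[OF assms(1)]) (simp only: cinner_add_right)
qed

text \<open>Creating an excitation at \<open>x\<close> together with one at some neighbour: commuting the creation at
  one neighbour past the annihilation at another leaves only diagonal terms without an excitation
  factor, and there are \<open>card B\<close> instead of \<open>(card B)\<^sup>2\<close> of them.\<close>

lemma norm_sum_pair_creation:
  assumes "finite B"
  shows "(norm (\<Sum>z\<in>B. site_ketbra z w \<phi> \<Psi>))\<^sup>2
    \<le> (\<nu> + 1) * (real (card B) * ((\<Sum>z\<in>B. (norm (excited z \<Psi>))\<^sup>2) + (norm \<Psi>)\<^sup>2))"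
proof -
  let ?K = "\<lambda>z. site_ketbra z w \<phi> \<Psi>" and ?q = "\<lambda>z. norm (excited z \<Psi>)"
  have w2: "norm w * norm w \<le> \<nu> + 1"
    using power_mono[OF norm_w, of 2] nu_nonneg by (simp add: power2_eq_square)
  have pair: "Re (cinner (?K y) (?K z)) \<le> (\<nu> + 1) * (?q y * ?q z + (if y = z then (norm \<Psi>)\<^sup>2 else 0))" for y z
  proof (cases "y = z")
    case True
    have "Re (cinner (?K y) (?K z)) = (norm (?K y))\<^sup>2"
      using True by (simp add: cinner_self flip: of_real_power)
    also have "\<dots> \<le> (norm w * norm \<Psi>)\<^sup>2"
      using norm_site_ketbra[of y w \<phi> \<Psi>] by (intro power_mono) (auto simp: norm_phi)
    also have "\<dots> = (norm w * norm w) * (norm \<Psi>)\<^sup>2" by (simp add: power2_eq_square)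
    also have "\<dots> \<le> (\<nu> + 1) * (norm \<Psi>)\<^sup>2" by (intro mult_right_mono w2) simp
    also have "\<dots> \<le> (\<nu> + 1) * (?q y * ?q z + (if y = z then (norm \<Psi>)\<^sup>2 else 0))"
      using True nu_nonneg by (intro mult_left_mono) auto
    finally show ?thesis .
  next
    case False
    have "cinner (?K y) (?K z) = cinner (site_ketbra z \<phi> w (?K y)) \<Psi>"
      by (rule site_ketbra_adjoint[symmetric])
    also have "site_ketbra z \<phi> w (?K y) = site_ketbra y w \<phi> (site_ketbra z \<phi> w \<Psi>)"
      using False by (intro site_ketbra_commute) simp
    also have "cinner \<dots> \<Psi> = cinner (site_ketbra z \<phi> w \<Psi>) (site_ketbra y \<phi> w \<Psi>)"
      by (rule site_ketbra_adjoint)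
    finally have "cinner (?K y) (?K z) = cinner (site_ketbra z \<phi> w \<Psi>) (site_ketbra y \<phi> w \<Psi>)" .
    then have "Re (cinner (?K y) (?K z)) \<le> norm (site_ketbra z \<phi> w \<Psi>) * norm (site_ketbra y \<phi> w \<Psi>)"
      using complex_Re_le_cmod cinner_Cauchy_Schwarz order_trans by metis
    also have "\<dots> \<le> (norm w * ?q z) * (norm w * ?q y)"
      using norm_site_ketbra_excited[of w _ \<phi> \<Psi>] by (intro mult_mono) (auto simp: norm_phi)
    also have "\<dots> = (norm w * norm w) * (?q y * ?q z)" by simp
    also have "\<dots> \<le> (\<nu> + 1) * (?q y * ?q z)" by (intro mult_right_mono w2) simp
    finally show ?thesis using False by simp
  qed
  have "(norm (\<Sum>z\<in>B. ?K z))\<^sup>2 = Re (cinner (\<Sum>y\<in>B. ?K y) (\<Sum>z\<in>B. ?K z))"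
    by (simp only: cinner_self Re_complex_of_real)
  also have "\<dots> = (\<Sum>y\<in>B. \<Sum>z\<in>B. Re (cinner (?K y) (?K z)))"
    unfolding cinner_sum_left cinner_sum_right Re_sum by (rule sum.swap)
  also have "\<dots> \<le> (\<Sum>y\<in>B. \<Sum>z\<in>B. (\<nu> + 1) * (?q y * ?q z + (if y = z then (norm \<Psi>)\<^sup>2 else 0)))"
    by (intro sum_mono pair)
  also have "\<dots> = (\<nu> + 1) * ((\<Sum>y\<in>B. ?q y)\<^sup>2 + real (card B) * (norm \<Psi>)\<^sup>2)"
    using assms by (simp add: sum_distrib_left[symmetric] sum.distrib power2_eq_square sum_product)
  also have "\<dots> \<le> (\<nu> + 1) * (real (card B) * (\<Sum>z\<in>B. (?q z)\<^sup>2) + real (card B) * (norm \<Psi>)\<^sup>2)"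
    using Cauchy_Schwarz_ineq_sum[of "\<lambda>_. 1" ?q B] nu_nonneg by (intro mult_left_mono add_right_mono) auto
  finally show ?thesis by (simp only: distrib_left)
qed

text \<open>Within one row the operator at \<open>x\<close> is moved so that it acts on an
  excitation of \<open>\<Psi>\<close> at \<open>x\<close>, and the sum over the neighbours falls to
  \<open>norm_sum_pair_creation\<close>. After the arithmetic-geometric mean inequality, the term
  without an excitation factor lacks the factor \<open>k\<close>: it is the origin of an error of
  order 1/d.\<close>

lemma pair_creation_bound:
  fixes \<Psi> :: "('s::finite \<Rightarrow> nat) ell2"
  assumes E: "sym E" "irrefl E" "\<And>x. card {y. (x, y) \<in> E} = k"
  shows "\<bar>\<Sum>(x, z)\<in>E. Im (cinner (site_ketbra x u \<phi> \<Psi>) (site_ketbra z \<phi> w \<Psi>))\<bar>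
    \<le> sqrt \<nu> * sqrt (\<nu> + 1) * (real k * (\<Sum>x\<in>UNIV. (norm (excited x \<Psi>))\<^sup>2) + real CARD('s) * (norm \<Psi>)\<^sup>2 / 2)"
proof -
  let ?q = "\<lambda>z. norm (excited z \<Psi>)" and ?N = "\<lambda>x. {y. (x, y) \<in> E}"
  have row: "\<bar>\<Sum>z\<in>?N x. Im (cinner (site_ketbra x u \<phi> \<Psi>) (site_ketbra z \<phi> w \<Psi>))\<bar>
      \<le> sqrt \<nu> * sqrt (\<nu> + 1) * ((real k * (?q x)\<^sup>2 + (\<Sum>z\<in>?N x. (?q z)\<^sup>2) + (norm \<Psi>)\<^sup>2) / 2)" for x
  proof -
    let ?B = "(\<Sum>z\<in>?N x. (?q z)\<^sup>2) + (norm \<Psi>)\<^sup>2"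
    have B: "?B \<ge> 0" by (intro add_nonneg_nonneg sum_nonneg) auto
    have ad: "cinner (site_ketbra x u \<phi> \<Psi>) (site_ketbra z \<phi> w \<Psi>) = cinner (site_ketbra z w \<phi> \<Psi>) (site_ketbra x \<phi> u \<Psi>)"
      if "(x, z) \<in> E" for z
    proof -
      have "x \<noteq> z" using that E(2) by (auto simp: irrefl_def)
      have "cinner (site_ketbra x u \<phi> \<Psi>) (site_ketbra z \<phi> w \<Psi>) = cinner \<Psi> (site_ketbra x \<phi> u (site_ketbra z \<phi> w \<Psi>))"
        by (rule site_ketbra_adjoint)
      also have "site_ketbra x \<phi> u (site_ketbra z \<phi> w \<Psi>) = site_ketbra z \<phi> w (site_ketbra x \<phi> u \<Psi>)"
        by (rule site_ketbra_commute[OF \<open>x \<noteq> z\<close>])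
      finally show ?thesis by (simp only: site_ketbra_adjoint)
    qed
    have "(\<Sum>z\<in>?N x. Im (cinner (site_ketbra x u \<phi> \<Psi>) (site_ketbra z \<phi> w \<Psi>)))
        = Im (cinner (\<Sum>z\<in>?N x. site_ketbra z w \<phi> \<Psi>) (site_ketbra x \<phi> u \<Psi>))"
      unfolding cinner_sum_left Im_sum by (rule sum.cong[OF refl]) (use ad in \<open>simp only: mem_Collect_eq\<close>)
    also have "\<bar>\<dots>\<bar> \<le> norm (\<Sum>z\<in>?N x. site_ketbra z w \<phi> \<Psi>) * norm (site_ketbra x \<phi> u \<Psi>)"
      using abs_Im_le_cmod cinner_Cauchy_Schwarz order_trans by blast
    also have "\<dots> \<le> (sqrt (\<nu> + 1) * (sqrt (real k) * sqrt ?B)) * (sqrt \<nu> * ?q x)"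
    proof (rule mult_mono)
      show "norm (\<Sum>z\<in>?N x. site_ketbra z w \<phi> \<Psi>) \<le> sqrt (\<nu> + 1) * (sqrt (real k) * sqrt ?B)"
      proof -
        have "norm (\<Sum>z\<in>?N x. site_ketbra z w \<phi> \<Psi>) \<le> sqrt ((\<nu> + 1) * (real k * ?B))"
          using norm_sum_pair_creation[of "?N x" \<Psi>] unfolding E(3) by (intro real_le_rsqrt) simp
        then show ?thesis by (simp only: real_sqrt_mult)
      qed
      have "norm (site_ketbra x \<phi> u \<Psi>) \<le> norm u * ?q x"
        using norm_site_ketbra_excited[of u x \<phi> \<Psi>] by (simp add: norm_phi)
      also have "\<dots> \<le> sqrt \<nu> * ?q x" by (intro mult_right_mono norm_u) simp
      finally show "norm (site_ketbra x \<phi> u \<Psi>) \<le> sqrt \<nu> * ?q x" .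
    qed (use nu_nonneg B in auto)
    also have "\<dots> = sqrt \<nu> * sqrt (\<nu> + 1) * (sqrt (real k) * ?q x * sqrt ?B)" by simp
    also have "\<dots> \<le> sqrt \<nu> * sqrt (\<nu> + 1) * ((real k * (?q x)\<^sup>2 + ?B) / 2)"
      using sum_squares_bound[of "sqrt (real k) * ?q x" "sqrt ?B"] B nu_nonneg
      by (intro mult_left_mono) (auto simp: power_mult_distrib)
    finally show ?thesis by (simp add: add.assoc)
  qed
  have "\<bar>\<Sum>(x, z)\<in>E. Im (cinner (site_ketbra x u \<phi> \<Psi>) (site_ketbra z \<phi> w \<Psi>))\<bar>
      \<le> (\<Sum>x\<in>UNIV. sqrt \<nu> * sqrt (\<nu> + 1) * ((real k * (?q x)\<^sup>2 + (\<Sum>z\<in>?N x. (?q z)\<^sup>2) + (norm \<Psi>)\<^sup>2) / 2))"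
    unfolding sum_regular_graph(3)[OF E(1,3)]
    by (rule order_trans[OF sum_abs]) (intro sum_mono row)
  also have "\<dots> = sqrt \<nu> * sqrt (\<nu> + 1) *
      ((real k * (\<Sum>x\<in>UNIV. (?q x)\<^sup>2) + (\<Sum>x\<in>UNIV. \<Sum>z\<in>?N x. (?q z)\<^sup>2) + real CARD('s) * (norm \<Psi>)\<^sup>2) / 2)"
    by (simp only: sum_distrib_left[symmetric] sum_divide_distrib[symmetric] sum.distrib sum_constant)
  also have "(\<Sum>x\<in>UNIV. \<Sum>z\<in>?N x. (?q z)\<^sup>2) = real k * (\<Sum>x\<in>UNIV. (?q x)\<^sup>2)"
    using sum_regular_graph(1)[OF E(1,3), of "\<lambda>z. (?q z)\<^sup>2"] sum_regular_graph(3)[OF E(1,3), of "\<lambda>x z. (?q z)\<^sup>2"]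
    by simp
  finally show ?thesis by (simp add: field_simps)
qed

text \<open>Among the products of blocks at \<open>x\<close> and \<open>z\<close>, those of u with u
  and of w with w are hermitian under exchange of the sites and drop out. The two mixed products are
  conjugate under this exchange and add up to twice the pair creation term. What is left contains
  \<open>excited z\<close> next to the block qq.\<close>

lemma interaction_bound:
  fixes \<Psi> :: "('s::finite \<Rightarrow> nat) ell2"
  assumes E: "sym E" "irrefl E" "\<And>x. card {y. (x, y) \<in> E} = k" and \<Psi>: "finsup \<Psi>"
  shows "\<bar>\<Sum>(x, z)\<in>E. Im (cinner (site_ketbra x u \<phi> \<Psi>) (fluct z \<Psi>)) - Im (cinner (site_ketbra x \<phi> w \<Psi>) (fluct z \<Psi>))\<bar>
    \<le> 2 * sqrt \<nu> * sqrt (\<nu> + 1) * (real k * (\<Sum>x\<in>UNIV. (norm (excited x \<Psi>))\<^sup>2) + real CARD('s) * (norm \<Psi>)\<^sup>2 / 2)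
      + 2 * sqrt (\<nu> + 1) * real k * (\<Sum>z\<in>UNIV. norm (excited z \<Psi>) * norm (fluct z \<Psi> - site_ketbra z u \<phi> \<Psi>))"
proof -
  let ?G = "\<lambda>z. fluct z \<Psi> - site_ketbra z u \<phi> \<Psi>"
  let ?a = "\<lambda>x z. cinner (site_ketbra x u \<phi> \<Psi>) (site_ketbra z \<phi> w \<Psi>)"
  let ?r = "\<lambda>\<eta> \<xi> x z. cinner (site_ketbra x \<eta> \<xi> (excited z \<Psi>)) (?G z)"
  have neq: "x \<noteq> z" if "(x, z) \<in> E" for x z using that E(2) by (auto simp: irrefl_def)
  have "(\<Sum>(x, z)\<in>E. Im (cinner (site_ketbra x u \<phi> \<Psi>) (fluct z \<Psi>)) - Im (cinner (site_ketbra x \<phi> w \<Psi>) (fluct z \<Psi>)))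
    = (\<Sum>(x, z)\<in>E. Im (?a x z) + Im (cinner (site_ketbra x u \<phi> \<Psi>) (site_ketbra z u \<phi> \<Psi>)) + Im (?r u \<phi> x z)
       - (Im (cinner (site_ketbra x \<phi> w \<Psi>) (site_ketbra z \<phi> w \<Psi>)) - Im (?a z x) + Im (?r \<phi> w x z)))"
  proof (rule sum.cong, safe)
    fix x z assume "(x, z) \<in> E"
    have "cinner (site_ketbra x \<phi> w \<Psi>) (site_ketbra z u \<phi> \<Psi>) = cnj (?a z x)" by (rule cinner_commute)
    then show "Im (cinner (site_ketbra x u \<phi> \<Psi>) (fluct z \<Psi>)) - Im (cinner (site_ketbra x \<phi> w \<Psi>) (fluct z \<Psi>))
      = Im (?a x z) + Im (cinner (site_ketbra x u \<phi> \<Psi>) (site_ketbra z u \<phi> \<Psi>)) + Im (?r u \<phi> x z)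
       - (Im (cinner (site_ketbra x \<phi> w \<Psi>) (site_ketbra z \<phi> w \<Psi>)) - Im (?a z x) + Im (?r \<phi> w x z))"
      unfolding cinner_fluct_decomp[OF \<Psi> neq[OF \<open>(x, z) \<in> E\<close>]] by simp
  qed
  also have "\<dots> = (\<Sum>(x, z)\<in>E. Im (?a x z)) + (\<Sum>(x, z)\<in>E. Im (cinner (site_ketbra x u \<phi> \<Psi>) (site_ketbra z u \<phi> \<Psi>)))
      + (\<Sum>(x, z)\<in>E. Im (?r u \<phi> x z)) - (\<Sum>(x, z)\<in>E. Im (cinner (site_ketbra x \<phi> w \<Psi>) (site_ketbra z \<phi> w \<Psi>)))
      + (\<Sum>(x, z)\<in>E. Im (?a z x)) - (\<Sum>(x, z)\<in>E. Im (?r \<phi> w x z))"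
    by (simp add: case_prod_unfold sum.distrib sum_subtractf)
  also have "(\<Sum>(x, z)\<in>E. Im (cinner (site_ketbra x u \<phi> \<Psi>) (site_ketbra z u \<phi> \<Psi>))) = 0"
    by (rule Im_hermitian_sum[OF E(1)]) (rule cinner_commute)
  also have "(\<Sum>(x, z)\<in>E. Im (cinner (site_ketbra x \<phi> w \<Psi>) (site_ketbra z \<phi> w \<Psi>))) = 0"
    by (rule Im_hermitian_sum[OF E(1)]) (rule cinner_commute)
  also have "(\<Sum>(x, z)\<in>E. Im (?a z x)) = (\<Sum>(x, z)\<in>E. Im (?a x z))"
    by (rule sum.reindex_bij_witness[where i = prod.swap and j = prod.swap])
      (use E(1) in \<open>auto simp: sym_def\<close>)
  finally have eq: "(\<Sum>(x, z)\<in>E. Im (cinner (site_ketbra x u \<phi> \<Psi>) (fluct z \<Psi>)) - Im (cinner (site_ketbra x \<phi> w \<Psi>) (fluct z \<Psi>)))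
    = 2 * (\<Sum>(x, z)\<in>E. Im (?a x z)) + (\<Sum>(x, z)\<in>E. Im (?r u \<phi> x z)) - (\<Sum>(x, z)\<in>E. Im (?r \<phi> w x z))" by simp
  have r: "\<bar>\<Sum>(x, z)\<in>E. Im (?r \<eta> \<xi> x z)\<bar> \<le> sqrt (\<nu> + 1) * real k * (\<Sum>z\<in>UNIV. norm (excited z \<Psi>) * norm (?G z))"
    if "norm \<eta> * norm \<xi> \<le> sqrt (\<nu> + 1)" for \<eta> \<xi>
  proof -
    have "\<bar>\<Sum>(x, z)\<in>E. Im (?r \<eta> \<xi> x z)\<bar> \<le> (\<Sum>p\<in>E. \<bar>case p of (x, z) \<Rightarrow> Im (?r \<eta> \<xi> x z)\<bar>)"
      by (rule sum_abs)
    also have "\<dots> \<le> (\<Sum>(x, z)\<in>E. sqrt (\<nu> + 1) * (norm (excited z \<Psi>) * norm (?G z)))"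
    proof (rule sum_mono, clarify)
      fix x z
      have "\<bar>Im (?r \<eta> \<xi> x z)\<bar> \<le> norm (site_ketbra x \<eta> \<xi> (excited z \<Psi>)) * norm (?G z)"
        using abs_Im_le_cmod cinner_Cauchy_Schwarz order_trans by blast
      also have "\<dots> \<le> (norm \<eta> * norm \<xi> * norm (excited z \<Psi>)) * norm (?G z)"
        by (intro mult_right_mono norm_site_ketbra) simp
      also have "\<dots> \<le> (sqrt (\<nu> + 1) * norm (excited z \<Psi>)) * norm (?G z)"
        by (intro mult_right_mono that) auto
      finally show "\<bar>Im (?r \<eta> \<xi> x z)\<bar> \<le> sqrt (\<nu> + 1) * (norm (excited z \<Psi>) * norm (?G z))" by simp
    qed
    also have "\<dots> = sqrt (\<nu> + 1) * (\<Sum>(x, z)\<in>E. norm (excited z \<Psi>) * norm (?G z))"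
      by (simp add: sum_distrib_left case_prod_unfold)
    also have "(\<Sum>(x, z)\<in>E. norm (excited z \<Psi>) * norm (?G z)) = real k * (\<Sum>z\<in>UNIV. norm (excited z \<Psi>) * norm (?G z))"
      by (rule sum_regular_graph(1)[OF E(1,3)])
    finally show ?thesis by simp
  qed
  have "norm u * norm \<phi> \<le> sqrt (\<nu> + 1)" "norm \<phi> * norm w \<le> sqrt (\<nu> + 1)"
    using norm_u norm_w nu_nonneg order_trans[OF norm_u, of "sqrt (\<nu> + 1)"] by (simp_all add: norm_phi)
  then show ?thesis
    unfolding eq using pair_creation_bound[OF E, of \<Psi>] r[of u \<phi>] r[of \<phi> w] by linarith
qed

text \<open>Up to a multiple \<alpha> of \<open>excited z \<Psi>\<close>, the left-hand side is
  annihilation applied to \<open>excited z \<Psi>\<close>. Occupations up to \<open>M\<close> cost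
  \<open>sqrt M\<close>. Beyond \<open>M\<close> the vector is split into \<open>\<Psi>\<close> and
  its projection; their tails are \<open>T\<close> and, through \<open>\<theta>\<close>, the tail of
  \<phi>.\<close>

lemma fluct_excited_bound:
  fixes \<Psi> :: "('s \<Rightarrow> nat) ell2"
  assumes \<Psi>: "finsup \<Psi>" and M: "M \<ge> 0"
    and \<theta>: "\<And>n. coords \<theta> n = (if real n > M then of_real (sqrt (real n)) * coords \<phi> n else 0)"
    and T: "((\<lambda>n. if real (n z) > M then real (n z) * (cmod (coords \<Psi> n))\<^sup>2 else 0) has_sum T) UNIV"
  shows "norm (fluct z \<Psi> - site_ketbra z u \<phi> \<Psi>)
    \<le> (sqrt \<nu> + sqrt M) * norm (excited z \<Psi>) + sqrt (2 * T + 2 * (norm \<theta>)\<^sup>2 * (norm \<Psi>)\<^sup>2)"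
proof -
  \<comment> \<open>\<open>V\<close> is annihilation applied to \<open>excited z \<Psi>\<close>,
    written so that \<open>lower\<close> meets only the finitely supported
    \<open>\<Psi>\<close>.\<close>
  define V where "V = lower z \<Psi> - site_ketbra z \<phi>a \<phi> \<Psi>"
  let ?q = "excited z \<Psi>"
  have T0: "T \<ge> 0" by (rule has_sum_nonneg[OF T]) auto
  have "site_ketbra z \<phi>a \<phi> \<Psi> = site_ketbra z (u + \<alpha> *\<^sub>C \<phi>) \<phi> \<Psi>" by (simp add: u_def)
  then have G: "fluct z \<Psi> - site_ketbra z u \<phi> \<Psi> = V - \<alpha> *\<^sub>C ?q"
    by (simp add: V_def fluct_def excited_def proj_def site_ketbra_simps scaleC_diff_right)
  have V: "coords V n = of_real (sqrt (real (n z) + 1)) * coords ?q (n(z := Suc (n z)))" for n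
    by (simp add: V_def excited_def proj_def coords_lower[OF \<Psi>] at_site_annihilation coords_a annihilation_def
        algebra_simps)
  have Vs: "((\<lambda>n. real (n z) * (cmod (coords ?q n))\<^sup>2) has_sum (norm V)\<^sup>2) UNIV"
    by (rule has_sum_shift_site[where x = z])
      (use norm_sq_has_sum[of V] in \<open>simp_all add: V norm_mult power_mult_distrib add.commute\<close>)
  have "(norm V)\<^sup>2 \<le> M * (norm ?q)\<^sup>2 + 2 * T + 2 * (norm (site_ketbra z \<theta> \<phi> \<Psi>))\<^sup>2"
  proof (rule has_sum_mono[OF Vs])
    show "((\<lambda>n. M * (cmod (coords ?q n))\<^sup>2
        + 2 * (if real (n z) > M then real (n z) * (cmod (coords \<Psi> n))\<^sup>2 else 0)
        + 2 * (cmod (coords (site_ketbra z \<theta> \<phi> \<Psi>) n))\<^sup>2)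
        has_sum (M * (norm ?q)\<^sup>2 + 2 * T + 2 * (norm (site_ketbra z \<theta> \<phi> \<Psi>))\<^sup>2)) UNIV"
      by (intro has_sum_add has_sum_cmult_right norm_sq_has_sum T)
    fix n
    have 1: "(cmod (coords ?q n))\<^sup>2 \<le> 2 * (cmod (coords \<Psi> n))\<^sup>2 + 2 * (cmod (coords (proj z \<Psi>) n))\<^sup>2"
    proof -
      have "(cmod (coords ?q n))\<^sup>2 \<le> (cmod (coords \<Psi> n) + cmod (coords (proj z \<Psi>) n))\<^sup>2"
        unfolding excited_def coords_diff by (intro power_mono norm_triangle_ineq4) simp
      then show ?thesis
        using sum_squares_bound[of "cmod (coords \<Psi> n)" "cmod (coords (proj z \<Psi>) n)"] by (simp add: power2_sum)
    qed
    show "real (n z) * (cmod (coords ?q n))\<^sup>2 \<le> M * (cmod (coords ?q n))\<^sup>2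
        + 2 * (if real (n z) > M then real (n z) * (cmod (coords \<Psi> n))\<^sup>2 else 0)
        + 2 * (cmod (coords (site_ketbra z \<theta> \<phi> \<Psi>) n))\<^sup>2"
    proof (cases "real (n z) > M")
      case True
      have "(cmod (coords (site_ketbra z \<theta> \<phi> \<Psi>) n))\<^sup>2 = real (n z) * (cmod (coords (proj z \<Psi>) n))\<^sup>2"
        using True by (simp add: proj_def \<theta> norm_mult power_mult_distrib)
      then show ?thesis
        using True M mult_left_mono[OF 1, of "real (n z)"] by (simp add: algebra_simps add_increasing)
    next
      case False
      then have "real (n z) * (cmod (coords ?q n))\<^sup>2 \<le> M * (cmod (coords ?q n))\<^sup>2"
        by (intro mult_right_mono) auto
      then show ?thesis using False by (simp add: add_increasing2)
    qed
  qed
  also have "(norm (site_ketbra z \<theta> \<phi> \<Psi>))\<^sup>2 \<le> (norm \<theta>)\<^sup>2 * (norm \<Psi>)\<^sup>2"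
    using norm_site_ketbra[of z \<theta> \<phi> \<Psi>] norm_phi by (simp add: power_mono flip: power_mult_distrib)
  finally have "(norm V)\<^sup>2 \<le> M * (norm ?q)\<^sup>2 + (2 * T + 2 * (norm \<theta>)\<^sup>2 * (norm \<Psi>)\<^sup>2)" by simp
  then have "norm V \<le> sqrt (M * (norm ?q)\<^sup>2 + (2 * T + 2 * (norm \<theta>)\<^sup>2 * (norm \<Psi>)\<^sup>2))"
    by (rule real_le_rsqrt)
  also have "\<dots> \<le> sqrt (M * (norm ?q)\<^sup>2) + sqrt (2 * T + 2 * (norm \<theta>)\<^sup>2 * (norm \<Psi>)\<^sup>2)"
    using M T0 by (intro sqrt_add_le_add_sqrt) auto
  also have "sqrt (M * (norm ?q)\<^sup>2) = sqrt M * norm ?q" by (simp add: real_sqrt_mult)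
  finally have "norm V \<le> sqrt M * norm ?q + sqrt (2 * T + 2 * (norm \<theta>)\<^sup>2 * (norm \<Psi>)\<^sup>2)" .
  moreover have "norm (V - \<alpha> *\<^sub>C ?q) \<le> norm V + cmod \<alpha> * norm ?q"
    using norm_triangle_ineq4[of V "\<alpha> *\<^sub>C ?q"] by simp
  moreover have "cmod \<alpha> * norm ?q \<le> sqrt \<nu> * norm ?q"
    by (intro mult_right_mono norm_alpha) simp
  ultimately show ?thesis unfolding G by (simp add: algebra_simps)
qed

end


section \<open>Unitary evolution on the sectors of bounded particle number\<close>

section \<open>Lattice dynamics\<close>

definition total :: "('s::finite \<Rightarrow> nat) \<Rightarrow> nat" where
  "total n = (\<Sum>x\<in>UNIV. n x)"

text \<open>Finite and invariant under hopping: these sets carry finite-dimensional invariant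
  subspaces whose union is dense.\<close>

definition level :: "nat \<Rightarrow> ('s::finite \<Rightarrow> nat) set" where
  "level K = {n. total n \<le> K}"

text \<open>The configuration at which creation at \<open>x\<close> after annihilation at
  \<open>y\<close> evaluates its argument, see \<open>at_site_hop\<close>. For
  \<open>n x = 0\<close> the truncated difference is harmless because \<open>hop_amp\<close>
  vanishes.\<close>

definition hop :: "'s \<Rightarrow> 's \<Rightarrow> ('s \<Rightarrow> nat) \<Rightarrow> 's \<Rightarrow> nat" where
  "hop x y n = n(x := n x - 1, y := n y + 1)"

definition hop_amp :: "'s \<Rightarrow> 's \<Rightarrow> ('s \<Rightarrow> nat) \<Rightarrow> real" where
  "hop_amp x y n = sqrt (real (n x) * (real (n y) + 1))"

text \<open>Over a symmetric relation the sum over ordered pairs contains each hopping term together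
  with its adjoint.\<close>

definition ham :: "('s::finite \<times> 's) set \<Rightarrow> real \<Rightarrow> (nat \<Rightarrow> real) \<Rightarrow> (('s \<Rightarrow> nat) \<Rightarrow> complex) \<Rightarrow> ('s \<Rightarrow> nat) \<Rightarrow> complex" where
  "ham E j v f n = - of_real j * (\<Sum>(x, y)\<in>E. at_site creation x (at_site annihilation y f) n)
     + of_real (\<Sum>x\<in>UNIV. v (n x)) * f n"

lemma finite_level: "finite (level K :: ('s::finite \<Rightarrow> nat) set)"
proof (rule finite_subset)
  show "level K \<subseteq> {n :: 's \<Rightarrow> nat. \<forall>x. n x \<in> {..K}}"
  proof
    fix n :: "'s \<Rightarrow> nat" assume "n \<in> level K"
    moreover have "n x \<le> total n" for x unfolding total_def by (rule member_le_sum) auto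
    ultimately show "n \<in> {n. \<forall>x. n x \<in> {..K}}" by (auto simp: level_def intro: order_trans)
  qed
  show "finite {n :: 's \<Rightarrow> nat. \<forall>x. n x \<in> {..K}}"
    using finite_PiE[of "UNIV :: 's set" "\<lambda>_. {..K}"] by (simp add: PiE_UNIV_domain Pi_def)
qed

lemma level_mono: "K \<le> L \<Longrightarrow> level K \<subseteq> level L"
  by (auto simp: level_def)

lemma finite_subset_level:
  assumes "finite A" shows "\<exists>K. A \<subseteq> level K"
proof (intro exI subsetI)
  fix n assume "n \<in> A"
  then show "n \<in> level (Max (total ` A))"
    using assms by (auto simp: level_def intro!: Max_ge)
qed

lemma filterlim_level: "filterlim level (finite_subsets_at_top UNIV) sequentially"
  unfolding filterlim_iff eventually_finite_subsets_at_top
proof (intro allI impI)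
  fix P :: "('a \<Rightarrow> nat) set \<Rightarrow> bool"
  assume "\<exists>X. finite X \<and> X \<subseteq> UNIV \<and> (\<forall>Y. finite Y \<and> X \<subseteq> Y \<and> Y \<subseteq> UNIV \<longrightarrow> P Y)"
  then obtain X where X: "finite X" "\<And>Y. finite Y \<Longrightarrow> X \<subseteq> Y \<Longrightarrow> P Y" by auto
  obtain K where K: "X \<subseteq> level K" using finite_subset_level[OF X(1)] by blast
  show "eventually (\<lambda>K. P (level K)) sequentially"
    unfolding eventually_sequentially
  proof (intro exI[of _ K] allI impI)
    fix L assume "K \<le> L"
    then show "P (level L)" using K level_mono[of K L] by (intro X(2) finite_level) blast
  qed
qed

lemma has_sum_level: "(f has_sum S) UNIV \<Longrightarrow> (\<lambda>K. \<Sum>n\<in>level K. f n) \<longlonglongrightarrow> S"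
  unfolding has_sum_def by (rule filterlim_compose[OF _ filterlim_level])

lemma at_site_hop:
  assumes "x \<noteq> y"
  shows "at_site creation x (at_site annihilation y f) n = of_real (hop_amp x y n) * f (hop x y n)"
  using assms by (simp add: at_site_creation at_site_annihilation hop_amp_def hop_def real_sqrt_mult)

lemma hop_amp_nonneg: "hop_amp x y n \<ge> 0"
  by (simp add: hop_amp_def)

lemma hop_amp_0: "n x = 0 \<Longrightarrow> hop_amp x y n = 0"
  by (simp add: hop_amp_def)

lemma hop_amp_pos: "hop_amp x y n \<noteq> 0 \<Longrightarrow> n x \<ge> 1"
  by (auto simp: hop_amp_def Suc_le_eq)

lemma Im_of_real_mult: "Im (of_real r * z) = r * Im z"
  by simp

lemma total_upd: "total (n(x := k)) + n x = total n + k"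
proof -
  have "total (n(x := k)) = (\<Sum>z\<in>UNIV - {x}. n z) + k"
    unfolding total_def by (subst sum.remove[of UNIV x]) (auto intro: sum.cong)
  moreover have "total n = (\<Sum>z\<in>UNIV - {x}. n z) + n x"
    unfolding total_def by (subst sum.remove[of UNIV x]) auto
  ultimately show ?thesis by simp
qed

lemma total_hop:
  assumes "x \<noteq> y" "n x \<ge> 1" shows "total (hop x y n) = total n"
  using total_upd[of n x "n x - 1"] total_upd[of "n(x := n x - 1)" y "n y + 1"] assms
  by (simp add: hop_def)

lemma hop_hop:
  assumes "x \<noteq> y" "n x \<ge> 1" shows "hop y x (hop x y n) = n" "hop_amp y x (hop x y n) = hop_amp x y n"
  using assms by (auto simp: hop_def hop_amp_def fun_eq_iff of_nat_diff mult.commute)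

text \<open>\<open>hop x y\<close> and \<open>hop y x\<close> are mutually inverse between the
  configurations with a particle at \<open>x\<close> and those with a particle at \<open>y\<close>,
  and they preserve the total number and the amplitude.\<close>

lemma sum_hop:
  fixes F :: "('s::finite \<Rightarrow> nat) \<Rightarrow> ('s \<Rightarrow> nat) \<Rightarrow> 'b::real_vector"
  assumes "x \<noteq> y"
  shows "(\<Sum>n\<in>level K. hop_amp x y n *\<^sub>R F n (hop x y n)) = (\<Sum>n\<in>level K. hop_amp y x n *\<^sub>R F (hop y x n) n)"
proof -
  have drop: "(\<Sum>n\<in>level K. hop_amp x y n *\<^sub>R G n) = (\<Sum>n\<in>{n \<in> level K. n x \<ge> 1}. hop_amp x y n *\<^sub>R G n)"
    for G :: "('s \<Rightarrow> nat) \<Rightarrow> 'b" and x y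
    by (rule sum.mono_neutral_right[OF finite_level]) (auto dest: hop_amp_pos)
  show ?thesis
    unfolding drop
  proof (rule sum.reindex_bij_witness[where i = "hop y x" and j = "hop x y"])
    fix n assume n: "n \<in> {n \<in> level K. 1 \<le> n x}"
    then show "hop y x (hop x y n) = n" "hop x y n \<in> {n \<in> level K. 1 \<le> n y}"
      "hop_amp y x (hop x y n) *\<^sub>R F (hop y x (hop x y n)) (hop x y n) = hop_amp x y n *\<^sub>R F n (hop x y n)"
      using assms by (auto simp: hop_hop level_def total_hop) (auto simp: hop_def)
  next
    fix n assume n: "n \<in> {n \<in> level K. 1 \<le> n y}"
    then show "hop x y (hop y x n) = n" "hop y x n \<in> {n \<in> level K. 1 \<le> n x}"
      using assms by (auto simp: hop_hop level_def total_hop) (auto simp: hop_def)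
  qed
qed

text \<open>Hermiticity of hopping with an arbitrary weight \<open>F\<close>; it serves both the
  symmetry of the Hamiltonian and the moment estimate.\<close>

lemma sum_hop_sym:
  fixes F :: "('s::finite \<Rightarrow> nat) \<Rightarrow> ('s \<Rightarrow> nat) \<Rightarrow> 'b::real_vector"
  assumes "sym E" "irrefl E"
  shows "(\<Sum>(x, y)\<in>E. \<Sum>n\<in>level K. hop_amp x y n *\<^sub>R F n (hop x y n))
    = (\<Sum>(x, y)\<in>E. \<Sum>n\<in>level K. hop_amp x y n *\<^sub>R F (hop x y n) n)"
proof -
  have "(\<Sum>(x, y)\<in>E. \<Sum>n\<in>level K. hop_amp x y n *\<^sub>R F n (hop x y n))
      = (\<Sum>(x, y)\<in>E. \<Sum>n\<in>level K. hop_amp y x n *\<^sub>R F (hop y x n) n)"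
    using assms(2) by (intro sum.cong refl) (auto simp: irrefl_def intro!: sum_hop)
  also have "\<dots> = (\<Sum>(x, y)\<in>E. \<Sum>n\<in>level K. hop_amp x y n *\<^sub>R F (hop x y n) n)"
    by (rule sum.reindex_bij_witness[where i = prod.swap and j = prod.swap])
      (use assms(1) in \<open>auto simp: sym_def\<close>)
  finally show ?thesis .
qed

text \<open>A regular graph in place of the torus: the dynamics sees only its symmetry, the absence
  of loops and the degree.\<close>

locale lattice =
  fixes E :: "('s::finite \<times> 's) set" and j :: real and v :: "nat \<Rightarrow> real" and k :: nat
  assumes E_sym: "sym E" and E_irrefl: "irrefl E" and E_deg: "\<And>x. card {y. (x, y) \<in> E} = k"
begin

abbreviation "H \<equiv> ham E j v"

lemma E_neq: "(x, y) \<in> E \<Longrightarrow> x \<noteq> y"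
  using E_irrefl by (auto simp: irrefl_def)

lemma H_eq: "H f n = - of_real j * (\<Sum>(x, y)\<in>E. of_real (hop_amp x y n) * f (hop x y n))
    + of_real (\<Sum>x\<in>UNIV. v (n x)) * f n"
  unfolding ham_def by (auto intro!: sum.cong simp: at_site_hop E_neq)

lemma H_symmetric:
  "(\<Sum>n\<in>level K. cnj (f n) * H g n) = (\<Sum>n\<in>level K. cnj (H f n) * g n)"
proof -
  define V where "V n = (\<Sum>x\<in>UNIV. v (n x))" for n :: "'s \<Rightarrow> nat"
  have H: "H f n = - of_real j * (\<Sum>(x, y)\<in>E. of_real (hop_amp x y n) * f (hop x y n)) + of_real (V n) * f n" for f n
    unfolding H_eq V_def ..
  have "cnj (f n) * H g n
      = - of_real j * (\<Sum>(x, y)\<in>E. hop_amp x y n *\<^sub>R (cnj (f n) * g (hop x y n))) + of_real (V n) * (cnj (f n) * g n)" for n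
    by (simp add: H sum_distrib_left distrib_left scaleR_conv_of_real case_prod_unfold mult_ac)
  then have "(\<Sum>n\<in>level K. cnj (f n) * H g n)
      = - of_real j * (\<Sum>n\<in>level K. \<Sum>(x, y)\<in>E. hop_amp x y n *\<^sub>R (cnj (f n) * g (hop x y n)))
        + (\<Sum>n\<in>level K. of_real (V n) * (cnj (f n) * g n))"
    by (simp only: sum.distrib sum_distrib_left)
  also have "(\<Sum>n\<in>level K. \<Sum>(x, y)\<in>E. hop_amp x y n *\<^sub>R (cnj (f n) * g (hop x y n)))
      = (\<Sum>(x, y)\<in>E. \<Sum>n\<in>level K. hop_amp x y n *\<^sub>R (cnj (f n) * g (hop x y n)))"
    by (subst sum.swap) (simp add: case_prod_unfold)
  also have "\<dots> = (\<Sum>(x, y)\<in>E. \<Sum>n\<in>level K. hop_amp x y n *\<^sub>R (cnj (f (hop x y n)) * g n))"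
    by (rule sum_hop_sym[OF E_sym E_irrefl])
  also have "\<dots> = (\<Sum>n\<in>level K. \<Sum>(x, y)\<in>E. hop_amp x y n *\<^sub>R (cnj (f (hop x y n)) * g n))"
    by (subst sum.swap) (simp add: case_prod_unfold)
  also have "- of_real j * \<dots> + (\<Sum>n\<in>level K. of_real (V n) * (cnj (f n) * g n)) = (\<Sum>n\<in>level K. cnj (H f n) * g n)"
  proof -
    have "cnj (H f n) * g n
        = - of_real j * (\<Sum>(x, y)\<in>E. hop_amp x y n *\<^sub>R (cnj (f (hop x y n)) * g n)) + of_real (V n) * (cnj (f n) * g n)" for n
      by (simp add: H sum_distrib_left sum_distrib_right distrib_right distrib_left scaleR_conv_of_real case_prod_unfold mult_ac)
    then show ?thesis by (simp only: sum.distrib sum_distrib_left)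
  qed
  finally show ?thesis .
qed

lemma H_support:
  assumes "\<And>n. n \<notin> level K \<Longrightarrow> f n = 0" "n \<notin> level K" shows "H f n = 0"
proof -
  have "of_real (hop_amp x y n) * f (hop x y n) = 0" if "(x, y) \<in> E" for x y
  proof (cases "n x = 0")
    case False
    then have "hop x y n \<notin> level K"
      using assms(2) total_hop[OF E_neq[OF that], of n] by (simp add: level_def)
    then show ?thesis using assms(1) by simp
  qed (simp add: hop_amp_0)
  then have "(\<Sum>(x, y)\<in>E. of_real (hop_amp x y n) * f (hop x y n)) = 0" by (intro sum.neutral) auto
  then show ?thesis using assms by (simp add: H_eq)
qed

text \<open>A crude bound in the maximum norm of one level, enough for the exponential series to
  converge at every time.\<close>

lemma H_bound: "\<exists>C\<ge>0. \<forall>f b. (\<forall>n\<in>level K. cmod (f n) \<le> b) \<longrightarrow> (\<forall>n\<in>level K. cmod (H f n) \<le> C * b)"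
proof -
  define c where "c n = \<bar>j\<bar> * (\<Sum>(x, y)\<in>E. hop_amp x y n) + \<bar>\<Sum>x\<in>UNIV. v (n x)\<bar>" for n
  have c0: "c n \<ge> 0" for n
    unfolding c_def by (intro add_nonneg_nonneg mult_nonneg_nonneg sum_nonneg) (auto simp: hop_amp_nonneg)
  have "cmod (H f n) \<le> (\<Sum>n\<in>level K. c n) * b" if f: "\<And>n. n \<in> level K \<Longrightarrow> cmod (f n) \<le> b" and n: "n \<in> level K" for f b n
  proof -
    have b: "b \<ge> 0" using f[OF n] norm_ge_zero order_trans by blast
    have "cmod (\<Sum>(x, y)\<in>E. of_real (hop_amp x y n) * f (hop x y n)) \<le> (\<Sum>(x, y)\<in>E. hop_amp x y n * b)"
    proof (rule sum_norm_le, clarify)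
      fix x y assume xy: "(x, y) \<in> E"
      show "cmod (of_real (hop_amp x y n) * f (hop x y n)) \<le> hop_amp x y n * b"
      proof (cases "n x = 0")
        case False
        then have "hop x y n \<in> level K" using n total_hop[OF E_neq[OF xy], of n] by (simp add: level_def)
        then show ?thesis using f by (simp add: norm_mult hop_amp_nonneg mult_left_mono)
      qed (simp add: hop_amp_0)
    qed
    also have "\<dots> = (\<Sum>(x, y)\<in>E. hop_amp x y n) * b" by (simp add: sum_distrib_right case_prod_unfold)
    finally have 1: "\<bar>j\<bar> * cmod (\<Sum>(x, y)\<in>E. of_real (hop_amp x y n) * f (hop x y n)) \<le> \<bar>j\<bar> * ((\<Sum>(x, y)\<in>E. hop_amp x y n) * b)"
      by (intro mult_left_mono) auto
    have "cmod (H f n) \<le> \<bar>j\<bar> * cmod (\<Sum>(x, y)\<in>E. of_real (hop_amp x y n) * f (hop x y n)) + \<bar>\<Sum>x\<in>UNIV. v (n x)\<bar> * cmod (f n)"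
      unfolding H_eq by (rule order_trans[OF norm_triangle_ineq]) (simp only: norm_mult norm_minus_cancel norm_of_real)
    also have "\<dots> \<le> \<bar>j\<bar> * ((\<Sum>(x, y)\<in>E. hop_amp x y n) * b) + \<bar>\<Sum>x\<in>UNIV. v (n x)\<bar> * b"
      by (intro add_mono 1 mult_left_mono f n) auto
    also have "\<dots> = c n * b" by (simp add: c_def algebra_simps)
    also have "\<dots> \<le> (\<Sum>n\<in>level K. c n) * b"
      by (intro mult_right_mono b member_le_sum n finite_level c0)
    finally show ?thesis .
  qed
  then show ?thesis by (intro exI[of _ "\<Sum>n\<in>level K. c n"] conjI sum_nonneg c0) blast
qed

text \<open>The coefficientwise Schrodinger equation, for coefficient families of any
  growth.\<close>

definition evolves :: "(real \<Rightarrow> ('s \<Rightarrow> nat) \<Rightarrow> complex) \<Rightarrow> bool" where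
  "evolves f \<longleftrightarrow> (\<forall>t n. ((\<lambda>t. f t n) has_vector_derivative - \<i> * H (f t) n) (at t))"

lemma evolves_cinner_const:
  assumes "evolves f" "evolves g"
  shows "(\<Sum>n\<in>level K. cnj (f s n) * g s n) = (\<Sum>n\<in>level K. cnj (f t n) * g t n)"
proof -
  let ?F = "\<lambda>s. \<Sum>n\<in>level K. cnj (f s n) * g s n"
  have "(?F has_vector_derivative 0) (at s within UNIV)" for s
  proof -
    have "(?F has_vector_derivative (\<Sum>n\<in>level K. cnj (f s n) * (- \<i> * H (g s) n) + cnj (- \<i> * H (f s) n) * g s n)) (at s)"
      by (intro has_vector_derivative_sum has_vector_derivative_mult has_vector_derivative_cnj)
        (use assms in \<open>auto simp: evolves_def\<close>)
    also have "(\<Sum>n\<in>level K. cnj (f s n) * (- \<i> * H (g s) n) + cnj (- \<i> * H (f s) n) * g s n)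
        = - \<i> * (\<Sum>n\<in>level K. cnj (f s n) * H (g s) n) + \<i> * (\<Sum>n\<in>level K. cnj (H (f s) n) * g s n)"
      by (simp add: sum_distrib_left sum.distrib sum_negf sum_subtractf mult_ac)
    also have "\<dots> = 0" unfolding H_symmetric by simp
    finally show ?thesis by simp
  qed
  then obtain c where "\<And>s. ?F s = c"
    using has_vector_derivative_zero_constant[of UNIV ?F] by auto
  then show ?thesis by simp
qed

definition evol :: "real \<Rightarrow> (('s \<Rightarrow> nat) \<Rightarrow> complex) \<Rightarrow> ('s \<Rightarrow> nat) \<Rightarrow> complex" where
  "evol t f n = (\<Sum>k. (- \<i> * of_real t) ^ k / fact k * (H ^^ k) f n)"

text \<open>Stated as a power series in a complex variable so that it can be differentiated term by
  term.\<close>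

lemma evol_summable: "summable (\<lambda>k. ((- \<i>) ^ k / fact k * (H ^^ k) f n) * z ^ k)"
proof -
  define K where "K = total n"
  obtain C where C: "C \<ge> 0" "\<And>f b n. (\<And>n. n \<in> level K \<Longrightarrow> cmod (f n) \<le> b) \<Longrightarrow> n \<in> level K \<Longrightarrow> cmod (H f n) \<le> C * b"
    using H_bound[of K] by blast
  define b where "b = (\<Sum>n\<in>level K. cmod (f n))"
  have bd: "cmod ((H ^^ k) f n) \<le> C ^ k * b" if "n \<in> level K" for k n
    using that
  proof (induction k arbitrary: n)
    case 0
    then show ?case using member_le_sum[of n "level K" "\<lambda>n. cmod (f n)"] by (simp add: b_def finite_level)
  next
    case (Suc k)
    have "cmod (H ((H ^^ k) f) n) \<le> C * (C ^ k * b)" by (rule C(2)[OF Suc.IH Suc.prems])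
    then show ?case by (simp add: mult.assoc)
  qed
  have nK: "n \<in> level K" by (simp add: K_def level_def)
  show ?thesis
  proof (rule summable_comparison_test'[where N = 0])
    show "summable (\<lambda>k. inverse (fact k) * (C * cmod z) ^ k * b)"
      by (intro summable_mult2 summable_exp)
    fix k
    have "norm (((- \<i>) ^ k / fact k * (H ^^ k) f n) * z ^ k) = inverse (fact k) * cmod ((H ^^ k) f n) * cmod z ^ k"
      by (simp add: norm_mult norm_divide norm_power field_simps)
    also have "\<dots> \<le> inverse (fact k) * (C ^ k * b) * cmod z ^ k"
      by (intro mult_right_mono mult_left_mono bd nK) auto
    finally show "norm (((- \<i>) ^ k / fact k * (H ^^ k) f n) * z ^ k) \<le> inverse (fact k) * (C * cmod z) ^ k * b"
      by (simp add: power_mult_distrib mult_ac)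
  qed
qed

lemma evol_power_series: "evol t f n = (\<Sum>k. ((- \<i>) ^ k / fact k * (H ^^ k) f n) * of_real t ^ k)"
  unfolding evol_def power_mult_distrib by (simp add: mult_ac)

lemma evol_summable': "summable (\<lambda>k. (- \<i> * of_real t) ^ k / fact k * (H ^^ k) f n)"
  using evol_summable[of f n "of_real t"] unfolding power_mult_distrib by (simp add: mult_ac)

lemma H_suminf:
  assumes "\<And>n. summable (\<lambda>k. g k n)"
  shows "(\<lambda>k. H (g k) n) sums H (\<lambda>n. \<Sum>k. g k n) n"
  unfolding H_eq case_prod_unfold
  by (intro sums_add sums_mult sums_sum summable_sums assms)

lemma evolves_evol: "evolves (\<lambda>t. evol t f)"
  unfolding evolves_def
proof (intro allI)
  fix t n
  let ?c = "\<lambda>k. (- \<i>) ^ k / fact k * (H ^^ k) f n"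
  have "((\<lambda>z. \<Sum>k. ?c k * z ^ k) has_field_derivative (\<Sum>k. diffs ?c k * of_real t ^ k)) (at (of_real t))"
    by (rule termdiffs_strong_converges_everywhere[OF evol_summable])
  then have "((\<lambda>t. evol t f n) has_vector_derivative (\<Sum>k. diffs ?c k * of_real t ^ k)) (at t)"
    unfolding evol_power_series by (rule has_vector_derivative_real_field)
  also have "(\<Sum>k. diffs ?c k * of_real t ^ k) = - \<i> * H (evol t f) n"
  proof (rule sums_unique[symmetric])
    have "(\<lambda>k. H (\<lambda>n. (- \<i> * of_real t) ^ k / fact k * (H ^^ k) f n) n) sums H (evol t f) n"
      using H_suminf[of "\<lambda>k n. (- \<i> * of_real t) ^ k / fact k * (H ^^ k) f n", OF evol_summable']
      by (simp add: evol_def[abs_def])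
    moreover have "H (\<lambda>n. c * g n) n = c * H g n" for c g
      by (simp add: H_eq distrib_left sum_distrib_left case_prod_unfold mult_ac)
    ultimately have "(\<lambda>k. (- \<i> * of_real t) ^ k / fact k * H ((H ^^ k) f) n) sums H (evol t f) n"
      by (simp only:)
    then have "(\<lambda>k. - \<i> * ((- \<i> * of_real t) ^ k / fact k * H ((H ^^ k) f) n)) sums (- \<i> * H (evol t f) n)"
      by (rule sums_mult)
    moreover have "diffs ?c k * of_real t ^ k = - \<i> * ((- \<i> * of_real t) ^ k / fact k * H ((H ^^ k) f) n)" for k
    proof -
      have "diffs ?c k = - \<i> * ((- \<i>) ^ k / fact k * H ((H ^^ k) f) n)"
        by (simp add: diffs_def del: of_nat_Suc)
      then show ?thesis unfolding power_mult_distrib by (simp add: mult_ac)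
    qed
    ultimately show "(\<lambda>k. diffs ?c k * of_real t ^ k) sums (- \<i> * H (evol t f) n)" by simp
  qed
  finally show "((\<lambda>t. evol t f n) has_vector_derivative - \<i> * H (evol t f) n) (at t)" .
qed

lemma evol_0: "evol 0 f n = f n"
proof -
  have "(\<Sum>k. (- \<i> * of_real 0) ^ k / fact k * (H ^^ k) f n) = (\<Sum>k\<in>{0}. (- \<i> * of_real 0) ^ k / fact k * (H ^^ k) f n)"
    by (rule suminf_finite) auto
  then show ?thesis by (simp add: evol_def)
qed

lemma evol_support:
  assumes "\<And>n. n \<notin> level K \<Longrightarrow> f n = 0" "n \<notin> level K" shows "evol t f n = 0"
proof -
  have "(H ^^ k) f n = 0" if "n \<notin> level K" for k n
    using that by (induction k arbitrary: n) (auto intro: assms(1) H_support)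
  then show ?thesis using assms(2) by (simp add: evol_def)
qed

text \<open>The inner product of the two solutions \<open>evol (s - t) f\<close> and
  \<open>evol s g\<close> is constant in \<open>s\<close>; comparing \<open>s = t\<close> with
  \<open>s = 0\<close> gives adjointness without the group law.\<close>

lemma evol_adjoint_level:
  "(\<Sum>n\<in>level K. cnj (f n) * evol t g n) = (\<Sum>n\<in>level K. cnj (evol (- t) f n) * g n)"
proof -
  have "evolves (\<lambda>s. evol (s - t) f)"
    unfolding evolves_def
  proof (intro allI)
    fix s n
    have "((\<lambda>t. evol t f n) has_vector_derivative - \<i> * H (evol (s - t) f) n) (at (s - t))"
      using evolves_evol by (auto simp: evolves_def)
    moreover have "((\<lambda>s. s - t) has_vector_derivative 1) (at s)" by (auto intro!: derivative_eq_intros)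
    ultimately show "((\<lambda>s. evol (s - t) f n) has_vector_derivative - \<i> * H (evol (s - t) f) n) (at s)"
      using vector_diff_chain_at[of "\<lambda>s. s - t" 1 s "\<lambda>t. evol t f n"] by (simp add: o_def)
  qed
  from evolves_cinner_const[OF this evolves_evol[of g], where K = K and s = t and t = 0]
  show ?thesis by (simp add: evol_0)
qed

lemma evol_norm_level: "(\<Sum>n\<in>level K. (cmod (evol t f n))\<^sup>2) = (\<Sum>n\<in>level K. (cmod (f n))\<^sup>2)"
proof -
  have "(\<Sum>n\<in>level K. cnj (evol t f n) * evol t f n) = (\<Sum>n\<in>level K. cnj (f n) * f n)"
    using evolves_cinner_const[OF evolves_evol[of f] evolves_evol[of f], where K = K and s = t and t = 0] by (simp add: evol_0)
  then have "complex_of_real (\<Sum>n\<in>level K. (cmod (evol t f n))\<^sup>2) = of_real (\<Sum>n\<in>level K. (cmod (f n))\<^sup>2)"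
    by (simp only: of_real_sum complex_norm_square mult.commute)
  then show ?thesis by (simp only: of_real_eq_iff)
qed

definition U :: "real \<Rightarrow> ('s \<Rightarrow> nat) ell2 \<Rightarrow> ('s \<Rightarrow> nat) ell2" where
  "U t \<Psi> = Abs_ell2 (evol t (coords \<Psi>))"

text \<open>Conservation on every level bounds all finite sums by the squared norm of
  \<open>\<Psi>\<close>.\<close>

lemma evol_square_summable: "square_summable (evol t (coords \<Psi>))"
proof (rule norm_le_finite_sums(1)[where b = "norm \<Psi>"])
  fix A :: "('s \<Rightarrow> nat) set" assume "finite A"
  then obtain K where "A \<subseteq> level K" using finite_subset_level by blast
  then have "(\<Sum>n\<in>A. (cmod (evol t (coords \<Psi>) n))\<^sup>2) \<le> (\<Sum>n\<in>level K. (cmod (evol t (coords \<Psi>) n))\<^sup>2)"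
    by (intro sum_mono2 finite_level) auto
  also have "\<dots> \<le> (norm \<Psi>)\<^sup>2"
    unfolding evol_norm_level by (rule sum_cmod_le_norm[OF finite_level])
  finally show "(\<Sum>n\<in>A. (cmod (evol t (coords \<Psi>) n))\<^sup>2) \<le> (norm \<Psi>)\<^sup>2" .
qed simp

lemma coords_U: "coords (U t \<Psi>) = evol t (coords \<Psi>)"
  by (simp add: U_def coords_Abs[OF evol_square_summable])

lemma operator_of_evol: "operator_of (evol t) = U t"
  by (rule ext) (simp add: operator_of_def maximal_domain_def evol_square_summable U_def)

lemma U_adjoint: "cinner \<Phi> (U t \<Psi>) = cinner (U (- t) \<Phi>) \<Psi>"
  using has_sum_level[OF cinner_has_sum[of \<Phi> "U t \<Psi>"]] has_sum_level[OF cinner_has_sum[of "U (- t) \<Phi>" \<Psi>]]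
  by (simp add: coords_U evol_adjoint_level LIMSEQ_unique)

lemma norm_U [simp]: "norm (U t \<Psi>) = norm \<Psi>"
proof -
  have "(norm (U t \<Psi>))\<^sup>2 = (norm \<Psi>)\<^sup>2"
    using has_sum_level[OF norm_sq_has_sum[of "U t \<Psi>"]] has_sum_level[OF norm_sq_has_sum[of \<Psi>]]
    by (simp add: coords_U evol_norm_level LIMSEQ_unique)
  then show ?thesis by simp
qed

lemma U_0: "U 0 \<Psi> = \<Psi>"
  by (rule ell2_eqI) (simp add: coords_U evol_0)

text \<open>Linearity is read off from \<open>U_adjoint\<close>, which moves the evolution away from
  the argument.\<close>

lemma U_bounded: "bounded_clinear (U t)"
proof (rule bounded_clinearI[where b = 1])
  have eqI: "\<psi> = \<eta>" if "\<And>\<xi>. cinner \<xi> \<psi> = cinner \<xi> \<eta>" for \<psi> \<eta> :: "('s \<Rightarrow> nat) ell2"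
    by (rule ell2_eqI) (use that[of "ket _"] in simp)
  show "U t (\<psi> + \<eta>) = U t \<psi> + U t \<eta>" "U t (c *\<^sub>C \<psi>) = c *\<^sub>C U t \<psi>" for c \<psi> \<eta>
    by (rule eqI, simp add: U_adjoint cinner_simps)+
qed simp

section \<open>Moments of the occupation numbers under hopping\<close>

section \<open>Growth of moments on the lattice\<close>

text \<open>After \<open>sum_hop_sym\<close> only the change of the weight across one hop matters.
  For increasing \<open>f\<close> with increasing increments this change is at most the larger of
  the two increments, which belongs to the fuller site; the occupation of that site also dominates
  the hopping amplitude.\<close>

lemma moment_derivative_bound:
  fixes f :: "nat \<Rightarrow> real" and \<Psi> :: "('s \<Rightarrow> nat) \<Rightarrow> complex"
  assumes inc: "\<And>n. f n \<le> f (Suc n)" and conv: "\<And>n. f (Suc n) - f n \<le> f (Suc (Suc n)) - f (Suc n)"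
  shows "\<bar>2 * Im (\<Sum>n\<in>level K. of_real (\<Sum>x\<in>UNIV. f (n x)) * (cnj (\<Psi> n) * H \<Psi> n))\<bar>
    \<le> 2 * \<bar>j\<bar> * real k * (\<Sum>n\<in>level K. (\<Sum>x\<in>UNIV. (real (n x) + 1) * (f (Suc (n x)) - f (n x))) * (cmod (\<Psi> n))\<^sup>2)"
proof -
  let ?F = "\<lambda>n :: 's \<Rightarrow> nat. \<Sum>x\<in>UNIV. f (n x)"
  \<comment> \<open>Bounds the effect of one hop whose fuller site holds \<open>n\<close>
    particles.\<close>
  define g where "g n = real n * (f n - f (n - 1))" for n
  let ?P = "\<lambda>n m. Im (cnj (\<Psi> n) * \<Psi> m)"
  have mono: "f (Suc a) - f a \<le> f (Suc b) - f b" if "a \<le> b" for a b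
    using that by (induction rule: dec_induct) (auto intro: order_trans conv)
  have g0: "g n \<ge> 0" for n
    using inc[of "n - 1"] by (cases n) (auto simp: g_def)
  have gmono: "g n \<le> g (Suc n)" for n
  proof (cases n)
    case (Suc m)
    then show ?thesis
      unfolding g_def using conv[of m] inc[of m] inc[of "Suc m"] by (simp add: mult_mono)
  qed (simp add: g_def inc)
  have Im1: "Im (cnj (\<Psi> n) * H \<Psi> n) = - j * (\<Sum>(x, y)\<in>E. hop_amp x y n * ?P n (hop x y n))" for n
  proof -
    have "cnj (\<Psi> n) * H \<Psi> n = - of_real j * (\<Sum>(x, y)\<in>E. of_real (hop_amp x y n) * (cnj (\<Psi> n) * \<Psi> (hop x y n)))
        + of_real (\<Sum>x\<in>UNIV. v (n x)) * (cnj (\<Psi> n) * \<Psi> n)"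
      by (simp add: H_eq distrib_left sum_distrib_left case_prod_unfold mult_ac)
    moreover have "Im (cnj (\<Psi> n) * \<Psi> n) = 0" by simp
    ultimately show ?thesis
      by (simp only: plus_complex.sel Im_of_real_mult Im_sum case_prod_unfold minus_mult_left[symmetric] uminus_complex.sel)
  qed
  have "2 * Im (\<Sum>n\<in>level K. of_real (?F n) * (cnj (\<Psi> n) * H \<Psi> n))
      = - j * (2 * (\<Sum>(x, y)\<in>E. \<Sum>n\<in>level K. hop_amp x y n *\<^sub>R (?F n * ?P n (hop x y n))))"
  proof -
    have "Im (\<Sum>n\<in>level K. of_real (?F n) * (cnj (\<Psi> n) * H \<Psi> n)) = (\<Sum>n\<in>level K. ?F n * (- j * (\<Sum>(x, y)\<in>E. hop_amp x y n * ?P n (hop x y n))))"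
      by (simp only: Im_sum Im_of_real_mult Im1)
    also have "\<dots> = - j * (\<Sum>n\<in>level K. \<Sum>(x, y)\<in>E. hop_amp x y n * (?F n * ?P n (hop x y n)))"
      by (simp add: sum_distrib_left case_prod_unfold mult_ac)
    also have "(\<Sum>n\<in>level K. \<Sum>(x, y)\<in>E. hop_amp x y n * (?F n * ?P n (hop x y n)))
        = (\<Sum>(x, y)\<in>E. \<Sum>n\<in>level K. hop_amp x y n * (?F n * ?P n (hop x y n)))"
      by (subst sum.swap) (simp add: case_prod_unfold)
    finally show ?thesis by simp
  qed
  also have "2 * (\<Sum>(x, y)\<in>E. \<Sum>n\<in>level K. hop_amp x y n *\<^sub>R (?F n * ?P n (hop x y n)))
      = (\<Sum>(x, y)\<in>E. \<Sum>n\<in>level K. hop_amp x y n *\<^sub>R ((?F n - ?F (hop x y n)) * ?P n (hop x y n)))"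
  proof -
    have "(\<Sum>(x, y)\<in>E. \<Sum>n\<in>level K. hop_amp x y n *\<^sub>R (?F n * ?P n (hop x y n)))
        = (\<Sum>(x, y)\<in>E. \<Sum>n\<in>level K. hop_amp x y n *\<^sub>R (?F (hop x y n) * ?P (hop x y n) n))"
      by (rule sum_hop_sym[OF E_sym E_irrefl, where F = "\<lambda>n m. ?F n * ?P n m"])
    then have "2 * (\<Sum>(x, y)\<in>E. \<Sum>n\<in>level K. hop_amp x y n *\<^sub>R (?F n * ?P n (hop x y n)))
        = (\<Sum>(x, y)\<in>E. \<Sum>n\<in>level K. hop_amp x y n *\<^sub>R (?F n * ?P n (hop x y n)))
          + (\<Sum>(x, y)\<in>E. \<Sum>n\<in>level K. hop_amp x y n *\<^sub>R (?F (hop x y n) * ?P (hop x y n) n))" by simp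
    also have "\<dots> = (\<Sum>(x, y)\<in>E. \<Sum>n\<in>level K. hop_amp x y n *\<^sub>R ((?F n - ?F (hop x y n)) * ?P n (hop x y n)))"
      unfolding case_prod_unfold sum.distrib[symmetric]
      by (intro sum.cong refl) (simp add: algebra_simps)
    finally show ?thesis .
  qed
  also have "\<bar>- j * \<dots>\<bar> \<le> \<bar>j\<bar> * (\<Sum>(x, y)\<in>E. \<Sum>n\<in>level K. hop_amp x y n *\<^sub>R (\<bar>?F n - ?F (hop x y n)\<bar> * (cmod (\<Psi> n))\<^sup>2))"
  proof -
    let ?A = "\<lambda>n m. \<bar>?F n - ?F m\<bar>"
    have "\<bar>\<Sum>(x, y)\<in>E. \<Sum>n\<in>level K. hop_amp x y n *\<^sub>R ((?F n - ?F (hop x y n)) * ?P n (hop x y n))\<bar>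
        \<le> (\<Sum>(x, y)\<in>E. \<Sum>n\<in>level K. hop_amp x y n *\<^sub>R (?A n (hop x y n) * ((cmod (\<Psi> n))\<^sup>2 / 2))
          + hop_amp x y n *\<^sub>R (?A n (hop x y n) * ((cmod (\<Psi> (hop x y n)))\<^sup>2 / 2)))"
      unfolding case_prod_unfold
    proof (rule order_trans[OF sum_abs], intro sum_mono order_trans[OF sum_abs])
      fix p :: "'s \<times> 's" and n :: "'s \<Rightarrow> nat"
      let ?m = "hop (fst p) (snd p) n"
      have "\<bar>?P n ?m\<bar> \<le> cmod (\<Psi> n) * cmod (\<Psi> ?m)"
        using abs_Im_le_cmod[of "cnj (\<Psi> n) * \<Psi> ?m"] by (simp add: norm_mult)
      also have "\<dots> \<le> (cmod (\<Psi> n))\<^sup>2 / 2 + (cmod (\<Psi> ?m))\<^sup>2 / 2"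
        using sum_squares_bound[of "cmod (\<Psi> n)" "cmod (\<Psi> ?m)"] by simp
      finally have "?A n ?m * \<bar>?P n ?m\<bar> \<le> ?A n ?m * ((cmod (\<Psi> n))\<^sup>2 / 2 + (cmod (\<Psi> ?m))\<^sup>2 / 2)"
        by (intro mult_left_mono) auto
      then have "hop_amp (fst p) (snd p) n * (?A n ?m * \<bar>?P n ?m\<bar>)
          \<le> hop_amp (fst p) (snd p) n * (?A n ?m * ((cmod (\<Psi> n))\<^sup>2 / 2 + (cmod (\<Psi> ?m))\<^sup>2 / 2))"
        by (rule mult_left_mono[OF _ hop_amp_nonneg])
      then show "\<bar>hop_amp (fst p) (snd p) n *\<^sub>R ((?F n - ?F ?m) * ?P n ?m)\<bar>
        \<le> hop_amp (fst p) (snd p) n *\<^sub>R (?A n ?m * ((cmod (\<Psi> n))\<^sup>2 / 2))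
          + hop_amp (fst p) (snd p) n *\<^sub>R (?A n ?m * ((cmod (\<Psi> ?m))\<^sup>2 / 2))"
        by (simp add: abs_mult hop_amp_nonneg distrib_left)
    qed
    also have "\<dots> = (\<Sum>(x, y)\<in>E. \<Sum>n\<in>level K. hop_amp x y n *\<^sub>R (?A n (hop x y n) * ((cmod (\<Psi> n))\<^sup>2 / 2)))
          + (\<Sum>(x, y)\<in>E. \<Sum>n\<in>level K. hop_amp x y n *\<^sub>R (?A n (hop x y n) * ((cmod (\<Psi> (hop x y n)))\<^sup>2 / 2)))"
      by (simp add: case_prod_unfold sum.distrib)
    also have "(\<Sum>(x, y)\<in>E. \<Sum>n\<in>level K. hop_amp x y n *\<^sub>R (?A n (hop x y n) * ((cmod (\<Psi> (hop x y n)))\<^sup>2 / 2)))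
        = (\<Sum>(x, y)\<in>E. \<Sum>n\<in>level K. hop_amp x y n *\<^sub>R (?A (hop x y n) n * ((cmod (\<Psi> n))\<^sup>2 / 2)))"
      by (rule sum_hop_sym[OF E_sym E_irrefl, where F = "\<lambda>n m. ?A n m * ((cmod (\<Psi> m))\<^sup>2 / 2)"])
    also have "\<dots> = (\<Sum>(x, y)\<in>E. \<Sum>n\<in>level K. hop_amp x y n *\<^sub>R (?A n (hop x y n) * ((cmod (\<Psi> n))\<^sup>2 / 2)))"
      by (simp add: abs_minus_commute)
    also have "\<dots> + \<dots> = (\<Sum>(x, y)\<in>E. \<Sum>n\<in>level K. hop_amp x y n *\<^sub>R (?A n (hop x y n) * (cmod (\<Psi> n))\<^sup>2))"
      unfolding case_prod_unfold sum.distrib[symmetric] by (intro sum.cong refl) simp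
    finally show ?thesis by (simp add: abs_mult mult_left_mono)
  qed
  also have "\<dots> \<le> \<bar>j\<bar> * (\<Sum>(x, y)\<in>E. \<Sum>n\<in>level K. (g (Suc (n x)) + g (Suc (n y))) * (cmod (\<Psi> n))\<^sup>2)"
  proof -
    have step: "hop_amp x y n *\<^sub>R (\<bar>?F n - ?F (hop x y n)\<bar> * (cmod (\<Psi> n))\<^sup>2) \<le> (g (Suc (n x)) + g (Suc (n y))) * (cmod (\<Psi> n))\<^sup>2"
      if xy: "(x, y) \<in> E" for x y n
  proof -
    note neq = E_neq[OF xy]
    have "hop_amp x y n * \<bar>?F n - ?F (hop x y n)\<bar> \<le> g (Suc (n x)) + g (Suc (n y))"
    proof (cases "n x = 0")
      case True
      then show ?thesis using g0[of "Suc (n x)"] g0[of "Suc (n y)"] by (simp add: hop_amp_0)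
    next
      case False
      \<comment> \<open>Both sites are counted with the hopping particle present.\<close>
      let ?a = "n x" and ?b = "Suc (n y)"
      have "?F n - ?F (hop x y n) = (\<Sum>z\<in>UNIV. f (n z) - f (hop x y n z))" by (simp add: sum_subtractf)
      also have "\<dots> = (\<Sum>z\<in>{x, y}. f (n z) - f (hop x y n z))"
        by (rule sum.mono_neutral_right) (auto simp: hop_def)
      also have "\<dots> = (f ?a - f (?a - 1)) - (f ?b - f (?b - 1))"
        using neq by (simp add: hop_def)
      finally have F: "?F n - ?F (hop x y n) = (f ?a - f (?a - 1)) - (f ?b - f (?b - 1))" .
      \<comment> \<open>The increments are ordered like the occupations, so their difference lies
        between 0 and the larger one, and the geometric mean of \<open>a\<close> and
        \<open>b\<close> is at most \<open>a\<close>.\<close>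
      have aux: "sqrt (real a * real b) * \<bar>(f a - f (a - 1)) - (f b - f (b - 1))\<bar> \<le> g a" if "b \<le> a" "b > 0" for a b
      proof -
        have "sqrt (real a * real b) \<le> real a"
          using that by (intro real_le_lsqrt) (auto simp: power2_eq_square mult_left_mono)
        moreover have "\<bar>(f a - f (a - 1)) - (f b - f (b - 1))\<bar> \<le> f a - f (a - 1)"
          using mono[of "b - 1" "a - 1"] inc[of "b - 1"] that by auto
        ultimately show ?thesis unfolding g_def by (intro mult_mono) auto
      qed
      have amp: "hop_amp x y n = sqrt (real ?a * real ?b)" by (simp add: hop_amp_def add.commute)
      consider "?b \<le> ?a" | "?a \<le> ?b" by linarith
      then show ?thesis
      proof cases
        case 1
        then show ?thesis
          using aux[OF 1] gmono[of ?a] g0[of ?b] unfolding amp F by simp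
      next
        case 2
        then show ?thesis
          using aux[OF 2] False g0[of "Suc ?a"] unfolding amp F
          by (simp add: abs_minus_commute mult.commute del: of_nat_Suc)
      qed
    qed
    then have "hop_amp x y n * \<bar>?F n - ?F (hop x y n)\<bar> * (cmod (\<Psi> n))\<^sup>2 \<le> (g (Suc (n x)) + g (Suc (n y))) * (cmod (\<Psi> n))\<^sup>2"
      by (rule mult_right_mono) simp
    then show ?thesis by (simp add: mult.assoc)
  qed
    show ?thesis
      by (rule mult_left_mono) (auto intro!: sum_mono step simp del: real_scaleR_def)
  qed
  also have "(\<Sum>(x, y)\<in>E. \<Sum>n\<in>level K. (g (Suc (n x)) + g (Suc (n y))) * (cmod (\<Psi> n))\<^sup>2)
      = 2 * real k * (\<Sum>n\<in>level K. (\<Sum>x\<in>UNIV. g (Suc (n x))) * (cmod (\<Psi> n))\<^sup>2)"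
  proof -
    let ?S = "\<lambda>x. \<Sum>n\<in>level K. g (Suc (n x)) * (cmod (\<Psi> n))\<^sup>2"
    have "(\<Sum>(x, y)\<in>E. \<Sum>n\<in>level K. (g (Suc (n x)) + g (Suc (n y))) * (cmod (\<Psi> n))\<^sup>2)
        = (\<Sum>(x, y)\<in>E. ?S x) + (\<Sum>(x, y)\<in>E. ?S y)"
      by (simp add: case_prod_unfold distrib_right sum.distrib)
    also have "\<dots> = 2 * real k * (\<Sum>x\<in>UNIV. ?S x)"
      by (simp only: sum_regular_graph[OF E_sym E_deg])
    also have "(\<Sum>x\<in>UNIV. ?S x) = (\<Sum>n\<in>level K. (\<Sum>x\<in>UNIV. g (Suc (n x))) * (cmod (\<Psi> n))\<^sup>2)"
      by (subst sum.swap) (simp add: sum_distrib_right)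
    finally show ?thesis .
  qed
  finally show ?thesis by (simp add: g_def algebra_simps)
qed

end


section \<open>Time derivative of the number of excitations\<close>

section \<open>Evolution of the excitation number\<close>

locale lattice_mean_field = lattice E j v k + mean_field_vector \<phi> \<phi>a \<phi>c
  for E :: "('s::finite \<times> 's) set" and j v k \<phi> \<phi>a \<phi>c
begin

text \<open>The Hamiltonian as a map between vectors, faithful on finitely supported ones.\<close>

definition HV :: "('s \<Rightarrow> nat) ell2 \<Rightarrow> ('s \<Rightarrow> nat) ell2" where
  "HV \<Psi> = - of_real j *\<^sub>C (\<Sum>(x, y)\<in>E. raise x (lower y \<Psi>)) + (\<Sum>x\<in>UNIV. mult_op (\<lambda>n. v (n x)) \<Psi>)"

lemma coords_HV: "finsup \<Psi> \<Longrightarrow> coords (HV \<Psi>) n = H (coords \<Psi>) n"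
  by (simp add: HV_def ham_def coords_raise coords_lower finsup_lower coords_mult_op case_prod_unfold sum_distrib_right)

lemma proj_lower_other:
  assumes "finsup \<Psi>" "finsup \<Phi>" "x \<noteq> y"
  shows "cinner (site_ketbra x \<eta> \<xi> \<Psi>) (raise y \<Phi>) = cinner (site_ketbra x \<eta> \<xi> (lower y \<Psi>)) \<Phi>"
  by (rule ladder_adjoint) (simp_all only: site_ketbra_lower_other assms coords_raise not_False_eq_True)

text \<open>Makes the hopping terms away from \<open>x\<close> drop out of the derivative.\<close>

lemma proj_raise_lower_other:
  assumes "finsup \<Psi>" "x \<noteq> y" "x \<noteq> z"
  shows "cinner (proj x \<Psi>) (raise y (lower z \<Psi>)) = cnj (cinner (proj x \<Psi>) (raise z (lower y \<Psi>)))"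
proof -
  have "cinner (proj x \<Psi>) (raise y (lower z \<Psi>)) = cinner (proj x (lower y \<Psi>)) (lower z \<Psi>)"
    unfolding proj_def by (rule proj_lower_other) (use assms in \<open>auto intro: finsup_lower\<close>)
  also have "\<dots> = cinner (lower y \<Psi>) (proj x (lower z \<Psi>))"
    by (simp only: proj_def site_ketbra_adjoint)
  also have "\<dots> = cnj (cinner (proj x (lower z \<Psi>)) (lower y \<Psi>))" by (rule cinner_commute)
  also have "cinner (proj x (lower z \<Psi>)) (lower y \<Psi>) = cinner (proj x \<Psi>) (raise z (lower y \<Psi>))"
    unfolding proj_def by (rule proj_lower_other[symmetric]) (use assms in \<open>auto intro: finsup_lower\<close>)
  finally show ?thesis .
qed

text \<open>The creation operator at \<open>x\<close> moves onto the ket \<phi> as annihilation;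
  only the operator at the neighbour \<open>z\<close> stays unbounded.\<close>

lemma proj_raise_same:
  assumes "finsup \<Psi>"
  shows "cinner (proj x \<Psi>) (raise x (lower z \<Psi>)) = cinner (site_ketbra x \<phi>a \<phi> \<Psi>) (lower z \<Psi>)"
proof (rule ladder_adjoint)
  show "coords (site_ketbra x \<phi>a \<phi> \<Psi>) n = at_site annihilation x (coords (proj x \<Psi>)) n" for n
    unfolding proj_def by (rule at_site_annihilation_site_ketbra[OF coords_a, symmetric])
qed (use assms in \<open>simp add: coords_raise finsup_lower\<close>)

lemma proj_lower_same:
  assumes "finsup \<Psi>" "x \<noteq> z"
  shows "cinner (proj x \<Psi>) (raise z (lower x \<Psi>)) = cnj (cinner (site_ketbra x \<phi> \<phi>c \<Psi>) (lower z \<Psi>))"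
proof -
  have "cinner (proj x \<Psi>) (raise z (lower x \<Psi>)) = cinner (proj x (lower z \<Psi>)) (lower x \<Psi>)"
    unfolding proj_def by (rule proj_lower_other) (use assms in \<open>auto intro: finsup_lower\<close>)
  also have "\<dots> = cinner (lower z \<Psi>) (site_ketbra x \<phi> \<phi> (lower x \<Psi>))"
    by (simp only: proj_def site_ketbra_adjoint)
  also have "site_ketbra x \<phi> \<phi> (lower x \<Psi>) = site_ketbra x \<phi> \<phi>c \<Psi>"
    by (rule site_ketbra_lower_same[OF assms(1) coords_c])
  also have "cinner (lower z \<Psi>) \<dots> = cnj (cinner (site_ketbra x \<phi> \<phi>c \<Psi>) (lower z \<Psi>))" by (rule cinner_commute)
  finally show ?thesis .
qed

text \<open>The potential at another site commutes with the projection at \<open>x\<close>, so the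
  product is symmetric.\<close>

lemma Im_proj_mult_op_other:
  assumes "finsup \<Psi>" "x \<noteq> y"
  shows "Im (cinner (proj x \<Psi>) (mult_op (\<lambda>n. v (n y)) \<Psi>)) = 0"
proof -
  let ?D = "mult_op (\<lambda>n. v (n y)) \<Psi>"
  have slice: "contract_bra x n ?D = of_real (v (n y)) *\<^sub>C contract_bra x n \<Psi>" for n
    using assms(2) by (intro ell2_eqI) (simp add: coords_mult_op[OF assms(1)])
  have "cinner (proj x \<Psi>) ?D = cinner \<Psi> (proj x ?D)"
    by (simp only: proj_def site_ketbra_adjoint)
  also have "\<dots> = cinner ?D (proj x \<Psi>)"
  proof (rule cinner_unique)
    have "cnj (coords \<Psi> n) * coords (proj x ?D) n = cnj (coords ?D n) * coords (proj x \<Psi>) n" for n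
      by (simp add: proj_def slice cinner_simps coords_mult_op[OF assms(1)])
    then show "((\<lambda>n. cnj (coords \<Psi> n) * coords (proj x ?D) n) has_sum cinner ?D (proj x \<Psi>)) UNIV"
      using cinner_has_sum[of ?D "proj x \<Psi>"] by simp
  qed
  also have "\<dots> = cnj (cinner (proj x \<Psi>) ?D)" by (rule cinner_commute)
  finally show ?thesis by (simp add: complex_eq_iff)
qed

text \<open>A bond at \<open>x\<close> occurs once as \<open>(x, z)\<close> and once as
  \<open>(z, x)\<close>; the two orders give the two terms of the difference. All other bonds cancel
  in conjugate pairs.\<close>

lemma Im_proj_HV:
  assumes "finsup \<Psi>"
  shows "Im (cinner (proj x \<Psi>) (HV \<Psi>)) =
    - j * (\<Sum>z | (x, z) \<in> E. Im (cinner (site_ketbra x \<phi>a \<phi> \<Psi>) (lower z \<Psi>)) - Im (cinner (site_ketbra x \<phi> \<phi>c \<Psi>) (lower z \<Psi>)))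
    + Im (cinner (proj x \<Psi>) (mult_op (\<lambda>n. v (n x)) \<Psi>))"
proof -
  let ?z = "\<lambda>y z. cinner (proj x \<Psi>) (raise y (lower z \<Psi>))"
  let ?S = "\<lambda>z. Im (cinner (site_ketbra x \<phi>a \<phi> \<Psi>) (lower z \<Psi>))"
  let ?S' = "\<lambda>z. Im (cinner (site_ketbra x \<phi> \<phi>c \<Psi>) (lower z \<Psi>))"
  let ?o = "\<lambda>y z. if y \<noteq> x \<and> z \<noteq> x then ?z y z else 0"
  have sel: "(\<Sum>(y, z)\<in>E. if y = x then F z else 0) = (\<Sum>z | (x, z) \<in> E. F z)" for F :: "'s \<Rightarrow> real"
  proof -
    have "(\<Sum>(y, z)\<in>E. if y = x then F z else 0) = (\<Sum>y\<in>UNIV. \<Sum>z | (y, z) \<in> E. if y = x then F z else 0)"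
      by (rule sum_regular_graph(3)[OF E_sym E_deg])
    also have "\<dots> = (\<Sum>y\<in>UNIV. if y = x then \<Sum>z | (y, z) \<in> E. F z else 0)"
      by (intro sum.cong) auto
    finally show ?thesis by simp
  qed
  have "(\<Sum>(y, z)\<in>E. Im (?z y z)) = (\<Sum>(y, z)\<in>E. (if y = x then ?S z else 0) + (if z = x then - ?S' y else 0) + Im (?o y z))"
  proof (rule sum.cong[OF refl], clarify)
    fix y z assume "(y, z) \<in> E"
    then have "y \<noteq> z" by (rule E_neq)
    then consider "y = x" "z \<noteq> x" | "y \<noteq> x" "z = x" | "y \<noteq> x" "z \<noteq> x" by blast
    then show "Im (?z y z) = (if y = x then ?S z else 0) + (if z = x then - ?S' y else 0) + Im (?o y z)"
      by cases (use assms in \<open>simp_all add: proj_raise_same proj_lower_same\<close>)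
  qed
  also have "\<dots> = (\<Sum>(y, z)\<in>E. if y = x then ?S z else 0) + (\<Sum>(y, z)\<in>E. if z = x then - ?S' y else 0) + (\<Sum>(y, z)\<in>E. Im (?o y z))"
    by (simp add: case_prod_unfold sum.distrib)
  also have "(\<Sum>(y, z)\<in>E. Im (?o y z)) = 0"
  proof (rule Im_hermitian_sum[OF E_sym])
    show "?o z y = cnj (?o y z)" for y z
    proof (cases "y \<noteq> x \<and> z \<noteq> x")
      case True
      then show ?thesis using proj_raise_lower_other[OF assms, of x z y] by (simp only: if_True not_sym simp_thms)
    next
      case False
      then show ?thesis by auto
    qed
  qed
  also have "(\<Sum>(y, z)\<in>E. if z = x then - ?S' y else 0) = (\<Sum>(y, z)\<in>E. if y = x then - ?S' z else 0)"
    by (rule sum.reindex_bij_witness[where i = prod.swap and j = prod.swap])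
      (use E_sym in \<open>auto simp: sym_def\<close>)
  also have "(\<Sum>(y, z)\<in>E. if y = x then ?S z else 0) = (\<Sum>z | (x, z) \<in> E. ?S z)" by (rule sel)
  also have "(\<Sum>(y, z)\<in>E. if y = x then - ?S' z else 0) = (\<Sum>z | (x, z) \<in> E. - ?S' z)" by (rule sel)
  finally have hop: "(\<Sum>(y, z)\<in>E. Im (?z y z)) = (\<Sum>z | (x, z) \<in> E. ?S z - ?S' z)"
    by (simp add: sum_negf sum_subtractf)
  have diag: "(\<Sum>y\<in>UNIV. Im (cinner (proj x \<Psi>) (mult_op (\<lambda>n. v (n y)) \<Psi>))) = Im (cinner (proj x \<Psi>) (mult_op (\<lambda>n. v (n x)) \<Psi>))"
  proof -
    have "(\<Sum>y\<in>UNIV. Im (cinner (proj x \<Psi>) (mult_op (\<lambda>n. v (n y)) \<Psi>)))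
        = (\<Sum>y\<in>{x}. Im (cinner (proj x \<Psi>) (mult_op (\<lambda>n. v (n y)) \<Psi>)))"
      by (rule sum.mono_neutral_right) (auto simp: Im_proj_mult_op_other[OF assms])
    then show ?thesis by simp
  qed
  have "cinner (proj x \<Psi>) (HV \<Psi>) = - (of_real j * (\<Sum>(y, z)\<in>E. ?z y z))
      + (\<Sum>y\<in>UNIV. cinner (proj x \<Psi>) (mult_op (\<lambda>n. v (n y)) \<Psi>))"
    by (simp add: HV_def cinner_simps cinner_sum_right case_prod_unfold)
  then have "Im (cinner (proj x \<Psi>) (HV \<Psi>)) = - (j * (\<Sum>(y, z)\<in>E. Im (?z y z)))
      + (\<Sum>y\<in>UNIV. Im (cinner (proj x \<Psi>) (mult_op (\<lambda>n. v (n y)) \<Psi>)))"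
    by (simp only: plus_complex.sel uminus_complex.sel Im_of_real_mult Im_sum case_prod_unfold)
  then show ?thesis unfolding hop diag by simp
qed

text \<open>The site \<open>x\<close> has \<open>k\<close> neighbours and
  \<open>J = j * real k\<close>, so each bond absorbs one k-th part of the mean-field term:
  \<open>lower z\<close> becomes \<open>fluct z\<close>, \<open>\<phi>a\<close> becomes
  \<open>u\<close> and \<open>\<phi>c\<close> becomes \<open>w\<close>. The on-site potentials on
  both sides agree and cancel.\<close>

lemma proj_energy_difference:
  assumes \<Psi>: "finsup \<Psi>" and J: "J = j * real k"
    and h: "\<And>n. coords h\<phi> n = - of_real J * (\<alpha> * creation (coords \<phi>) n + cnj \<alpha> * annihilation (coords \<phi>) n
        - of_real ((cmod \<alpha>)\<^sup>2) * coords \<phi> n) + of_real (v n) * coords \<phi> n"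
  shows "Im (cinner (proj x \<Psi>) (HV \<Psi>)) - Im (cinner (site_ketbra x h\<phi> \<phi> \<Psi>) \<Psi>) =
    - j * (\<Sum>z | (x, z) \<in> E. Im (cinner (site_ketbra x u \<phi> \<Psi>) (fluct z \<Psi>)) - Im (cinner (site_ketbra x \<phi> w \<Psi>) (fluct z \<Psi>)))"
proof -
  \<comment> \<open>\<open>\<beta>\<close> is the hopping part of the mean-field operator on \<phi>,
    up to the factor \<open>- J\<close>. Obtaining \<open>\<phi>v\<close> as a combination of given
    vectors saves a separate proof that the potential maps \<phi> into the space.\<close>
  define \<beta> where "\<beta> = \<alpha> *\<^sub>C \<phi>c + cnj \<alpha> *\<^sub>C \<phi>a - of_real ((cmod \<alpha>)\<^sup>2) *\<^sub>C \<phi>"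
  define \<phi>v where "\<phi>v = h\<phi> + of_real J *\<^sub>C \<beta>"
  have \<phi>v: "coords \<phi>v n = of_real (v n) * coords \<phi> n" for n
    by (simp add: \<phi>v_def \<beta>_def h coords_a coords_c algebra_simps)
  have "cinner (site_ketbra x \<phi>v \<phi> \<Psi>) \<Psi> = cinner (proj x \<Psi>) (mult_op (\<lambda>n. v (n x)) \<Psi>)"
  proof (rule cinner_unique)
    have "cnj (coords (site_ketbra x \<phi>v \<phi> \<Psi>) n) * coords \<Psi> n
        = cnj (coords (proj x \<Psi>) n) * coords (mult_op (\<lambda>n. v (n x)) \<Psi>) n" for n
      by (simp add: proj_def coords_mult_op[OF \<Psi>] \<phi>v)
    then show "((\<lambda>n. cnj (coords (site_ketbra x \<phi>v \<phi> \<Psi>) n) * coords \<Psi> n)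
        has_sum cinner (proj x \<Psi>) (mult_op (\<lambda>n. v (n x)) \<Psi>)) UNIV"
      using cinner_has_sum[of "proj x \<Psi>" "mult_op (\<lambda>n. v (n x)) \<Psi>"] by simp
  qed
  moreover
  let ?S0 = "cinner (site_ketbra x \<phi>a \<phi> \<Psi>) \<Psi>" and ?S0' = "cinner (site_ketbra x \<phi> \<phi>c \<Psi>) \<Psi>"
  have "Im (cinner (site_ketbra x \<beta> \<phi> \<Psi>) \<Psi>) = Im (\<alpha> * ?S0) - Im (\<alpha> * ?S0')"
  proof -
    have 1: "site_ketbra x \<beta> \<phi> \<Psi> = \<alpha> *\<^sub>C site_ketbra x \<phi>c \<phi> \<Psi> + cnj \<alpha> *\<^sub>C site_ketbra x \<phi>a \<phi> \<Psi>
        - of_real ((cmod \<alpha>)\<^sup>2) *\<^sub>C proj x \<Psi>"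
      by (rule ell2_eqI) (simp add: \<beta>_def proj_def algebra_simps)
    have 2: "cinner (site_ketbra x \<phi>c \<phi> \<Psi>) \<Psi> = cnj ?S0'"
      by (subst site_ketbra_adjoint) (rule cinner_commute)
    have "cinner (proj x \<Psi>) \<Psi> = cnj (cinner (proj x \<Psi>) \<Psi>)"
      unfolding proj_def by (subst site_ketbra_adjoint) (rule cinner_commute)
    then have 3: "Im (cinner (proj x \<Psi>) \<Psi>) = 0" by (simp add: complex_eq_iff)
    have "cinner (site_ketbra x \<beta> \<phi> \<Psi>) \<Psi> = cnj (\<alpha> * ?S0') + \<alpha> * ?S0 - of_real ((cmod \<alpha>)\<^sup>2) * cinner (proj x \<Psi>) \<Psi>"
      unfolding 1 cinner_diff_left cinner_add_left cinner_scaleC_left 2 by simp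
    then show ?thesis
      by (simp only: plus_complex.sel minus_complex.sel cnj.sel Im_of_real_mult 3)
  qed
  moreover have "h\<phi> = \<phi>v - of_real J *\<^sub>C \<beta>" by (simp add: \<phi>v_def)
  then have "cinner (site_ketbra x h\<phi> \<phi> \<Psi>) \<Psi> = cinner (site_ketbra x \<phi>v \<phi> \<Psi>) \<Psi> - of_real J * cinner (site_ketbra x \<beta> \<phi> \<Psi>) \<Psi>"
  proof -
    have "site_ketbra x (\<phi>v - of_real J *\<^sub>C \<beta>) \<phi> \<Psi> = site_ketbra x \<phi>v \<phi> \<Psi> - of_real J *\<^sub>C site_ketbra x \<beta> \<phi> \<Psi>"
      by (rule ell2_eqI) (simp add: algebra_simps)
    then show ?thesis using \<open>h\<phi> = _\<close> by (simp add: cinner_simps)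
  qed
  ultimately have hphi: "Im (cinner (site_ketbra x h\<phi> \<phi> \<Psi>) \<Psi>) =
      Im (cinner (proj x \<Psi>) (mult_op (\<lambda>n. v (n x)) \<Psi>)) - J * (Im (\<alpha> * ?S0) - Im (\<alpha> * ?S0'))"
    by (simp only: minus_complex.sel Im_of_real_mult)
  have fl: "Im (cinner (site_ketbra x u \<phi> \<Psi>) (fluct z \<Psi>)) - Im (cinner (site_ketbra x \<phi> w \<Psi>) (fluct z \<Psi>))
    = (Im (cinner (site_ketbra x \<phi>a \<phi> \<Psi>) (lower z \<Psi>)) - Im (cinner (site_ketbra x \<phi> \<phi>c \<Psi>) (lower z \<Psi>)))
      - (Im (\<alpha> * ?S0) - Im (\<alpha> * ?S0'))" for z
  proof -
    have 1: "site_ketbra x u \<phi> \<Psi> = site_ketbra x \<phi>a \<phi> \<Psi> - \<alpha> *\<^sub>C proj x \<Psi>"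
      by (rule ell2_eqI) (simp add: u_def proj_def algebra_simps)
    have 2: "site_ketbra x \<phi> w \<Psi> = site_ketbra x \<phi> \<phi>c \<Psi> - \<alpha> *\<^sub>C proj x \<Psi>"
      by (rule ell2_eqI) (simp add: w_def proj_def cinner_simps algebra_simps)
    have "cinner (site_ketbra x u \<phi> \<Psi>) (fluct z \<Psi>) - cinner (site_ketbra x \<phi> w \<Psi>) (fluct z \<Psi>)
        = cinner (site_ketbra x \<phi>a \<phi> \<Psi>) (fluct z \<Psi>) - cinner (site_ketbra x \<phi> \<phi>c \<Psi>) (fluct z \<Psi>)"
      unfolding 1 2 cinner_diff_left by simp
    also have "\<dots> = (cinner (site_ketbra x \<phi>a \<phi> \<Psi>) (lower z \<Psi>) - cinner (site_ketbra x \<phi> \<phi>c \<Psi>) (lower z \<Psi>))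
        - (\<alpha> * ?S0 - \<alpha> * ?S0')"
      unfolding fluct_def cinner_diff_right cinner_scaleC_right by simp
    finally show ?thesis by (simp only: minus_complex.sel[symmetric])
  qed
  show ?thesis
    unfolding Im_proj_HV[OF \<Psi>] hphi J fl
    by (simp only: sum_subtractf[of _ "\<lambda>_. _ - _"] sum_constant E_deg) (simp add: algebra_simps)
qed

lemma proj_derivative:
  assumes J: "J = j * real k"
    and h: "\<And>n. coords h\<phi> n = - of_real J * (\<alpha> * creation (coords \<phi>) n + cnj \<alpha> * annihilation (coords \<phi>) n
        - of_real ((cmod \<alpha>)\<^sup>2) * coords \<phi> n) + of_real (v n) * coords \<phi> n"
    and \<phi>t: "\<phi>t t = \<phi>" "(\<phi>t has_vector_derivative - \<i> *\<^sub>C h\<phi>) (at t)"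
    and \<Psi>t: "finsup (\<Psi>t t)" "(\<Psi>t has_vector_derivative - \<i> *\<^sub>C HV (\<Psi>t t)) (at t)"
  shows "((\<lambda>s. Re (cinner (\<Psi>t s) (site_ketbra x (\<phi>t s) (\<phi>t s) (\<Psi>t s)))) has_real_derivative
    - 2 * j * (\<Sum>z | (x, z) \<in> E. Im (cinner (site_ketbra x u \<phi> (\<Psi>t t)) (fluct z (\<Psi>t t)))
        - Im (cinner (site_ketbra x \<phi> w (\<Psi>t t)) (fluct z (\<Psi>t t))))) (at t)"
proof -
  \<comment> \<open>With the fixed ket \<open>ket 0\<close> the expectation of the projection is the
    squared norm of \<open>?C \<xi> \<Psi>\<close>, to which the product rule applies although bra
    and state both move.\<close>
  let ?C = "\<lambda>\<xi> \<Psi>. site_ketbra x (ket 0) \<xi> \<Psi>" and ?\<Psi> = "\<Psi>t t"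
  have e: "Re (cinner \<Psi> (site_ketbra x \<xi> \<xi> \<Psi>)) = inner (?C \<xi> \<Psi>) (?C \<xi> \<Psi>)" for \<xi> \<Psi>
    by (simp add: inner_ell2_def site_ketbra_adjoint site_ketbra_mult coords_ket)
  let ?C' = "?C \<phi> (- \<i> *\<^sub>C HV ?\<Psi>) + ?C (- \<i> *\<^sub>C h\<phi>) ?\<Psi>"
  have C: "((\<lambda>s. ?C (\<phi>t s) (\<Psi>t s)) has_vector_derivative ?C') (at t)"
    using bounded_bilinear.has_vector_derivative[OF bounded_bilinear_site_ketbra \<phi>t(2) \<Psi>t(2)] by (simp add: \<phi>t(1))
  have "((\<lambda>s. inner (?C (\<phi>t s) (\<Psi>t s)) (?C (\<phi>t s) (\<Psi>t s))) has_vector_derivative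
      (inner (?C \<phi> ?\<Psi>) ?C' + inner ?C' (?C \<phi> ?\<Psi>))) (at t)"
    using bounded_bilinear.has_vector_derivative[OF bounded_bilinear_inner C C] by (simp add: \<phi>t(1))
  moreover have "inner (?C \<phi> ?\<Psi>) ?C' = Im (cinner (proj x ?\<Psi>) (HV ?\<Psi>)) - Im (cinner (site_ketbra x h\<phi> \<phi> ?\<Psi>) ?\<Psi>)"
  proof -
    have "cinner (?C \<phi> ?\<Psi>) (?C \<phi> (- \<i> *\<^sub>C HV ?\<Psi>)) = - \<i> * cinner (proj x ?\<Psi>) (HV ?\<Psi>)"
      unfolding site_ketbra_scaleC by (simp add: site_ketbra_adjoint proj_def site_ketbra_mult coords_ket cinner_simps)
    moreover have "cinner (?C \<phi> ?\<Psi>) (?C (- \<i> *\<^sub>C h\<phi>) ?\<Psi>) = \<i> * cinner (site_ketbra x h\<phi> \<phi> ?\<Psi>) ?\<Psi>"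
    proof -
      have "cinner (?C \<phi> ?\<Psi>) (?C (- \<i> *\<^sub>C h\<phi>) ?\<Psi>) = cinner (site_ketbra x (- \<i> *\<^sub>C h\<phi>) (ket 0) (?C \<phi> ?\<Psi>)) ?\<Psi>"
        by (rule site_ketbra_adjoint[symmetric])
      also have "site_ketbra x (- \<i> *\<^sub>C h\<phi>) (ket 0) (?C \<phi> ?\<Psi>) = - \<i> *\<^sub>C site_ketbra x h\<phi> \<phi> ?\<Psi>"
        unfolding site_ketbra_mult site_ketbra_scaleC_ket by (simp add: coords_ket)
      finally show ?thesis by (simp add: cinner_simps)
    qed
    ultimately show ?thesis by (simp add: inner_ell2_def cinner_add_right)
  qed
  ultimately show ?thesis
    unfolding e has_real_derivative_iff_has_vector_derivative
      proj_energy_difference[OF \<Psi>t(1) J h, of x] inner_commute[of ?C'] by (simp add: mult.assoc)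
qed

end

context lattice
begin

text \<open>Finite support makes the evolved vector a finite combination of kets, so coefficientwise
  derivatives are derivatives in norm.\<close>

lemma U_has_vector_derivative:
  assumes "\<And>n. n \<notin> level K \<Longrightarrow> coords \<Psi> n = 0" "\<And>n. coords \<Phi> n = H (evol t (coords \<Psi>)) n"
  shows "((\<lambda>s. U s \<Psi>) has_vector_derivative - \<i> *\<^sub>C \<Phi>) (at t)"
proof -
  have fin: "\<psi> = (\<Sum>n\<in>level K. coords \<psi> n *\<^sub>C ket n)" if "\<And>n. n \<notin> level K \<Longrightarrow> coords \<psi> n = 0" for \<psi> :: "('s \<Rightarrow> nat) ell2"
    using that by (intro ell2_eqI)
      (simp add: coords_ket finite_level if_distrib[of "\<lambda>x. _ * x"] sum.delta' cong: if_cong)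
  have lin: "bounded_linear (\<lambda>z. z *\<^sub>C \<psi>)" for \<psi> :: "('s \<Rightarrow> nat) ell2"
    by (rule bounded_linear_intro[where K = "norm \<psi>"]) (auto simp: scaleC_add_left scaleR_scaleC scaleR_conv_of_real)
  have "((\<lambda>s. \<Sum>n\<in>level K. evol s (coords \<Psi>) n *\<^sub>C ket n) has_vector_derivative
      (\<Sum>n\<in>level K. (- \<i> * coords \<Phi> n) *\<^sub>C ket n)) (at t)"
    unfolding assms(2)
    by (intro has_vector_derivative_sum bounded_linear.has_vector_derivative[OF lin])
      (use evolves_evol[of "coords \<Psi>"] in \<open>simp add: evolves_def\<close>)
  moreover have "U s \<Psi> = (\<Sum>n\<in>level K. evol s (coords \<Psi>) n *\<^sub>C ket n)" for s
    using fin[of "U s \<Psi>"] evol_support[OF assms(1)] by (simp add: coords_U)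
  moreover have "- \<i> *\<^sub>C \<Phi> = (\<Sum>n\<in>level K. (- \<i> * coords \<Phi> n) *\<^sub>C ket n)"
    using fin[of "- \<i> *\<^sub>C \<Phi>"] H_support[OF evol_support[OF assms(1)]] by (simp add: assms(2))
  ultimately show ?thesis by simp
qed

end


section \<open>Conservation laws of the mean-field equation\<close>

section \<open>Mean-field evolution\<close>

lemma square_summable_comparison:
  assumes "square_summable f" "square_summable g" "\<And>n. cmod (h n) \<le> a * cmod (f n) + b * cmod (g n)"
  shows "square_summable h"
  unfolding square_summable_def
proof (rule summable_on_comparison_test)
  show "(\<lambda>n. 2 * a\<^sup>2 * (cmod (f n))\<^sup>2 + 2 * b\<^sup>2 * (cmod (g n))\<^sup>2) summable_on UNIV"
    using assms(1,2) unfolding square_summable_def by (intro summable_on_add summable_on_cmult_right)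
  fix n
  have "(cmod (h n))\<^sup>2 \<le> (a * cmod (f n) + b * cmod (g n))\<^sup>2"
    by (intro power_mono assms(3)) simp
  also have "\<dots> \<le> 2 * a\<^sup>2 * (cmod (f n))\<^sup>2 + 2 * b\<^sup>2 * (cmod (g n))\<^sup>2"
    using sum_squares_bound[of "a * cmod (f n)" "b * cmod (g n)"] by (simp add: power2_sum power_mult_distrib)
  finally show "(cmod (h n))\<^sup>2 \<le> 2 * a\<^sup>2 * (cmod (f n))\<^sup>2 + 2 * b\<^sup>2 * (cmod (g n))\<^sup>2" .
qed auto

lemma square_summable_Suc:
  assumes "square_summable (\<lambda>n. f (Suc n))"
  shows "square_summable f"
proof -
  let ?f = "\<lambda>n. (cmod (f n))\<^sup>2"
  have "(?f \<circ> Suc) summable_on UNIV" using assms by (simp add: square_summable_def o_def)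
  then have "?f summable_on (range Suc)" by (subst summable_on_reindex) auto
  then have "?f summable_on (insert 0 (range Suc))" by (simp add: summable_on_insert_iff)
  moreover have "insert 0 (range Suc) = (UNIV :: nat set)" by (auto simp: image_iff) (metis not0_implies_Suc)
  ultimately show ?thesis by (simp add: square_summable_def)
qed

lemma coords_operator_of: "\<psi> \<in> maximal_domain F \<Longrightarrow> coords (operator_of F \<psi>) = F (coords \<psi>)"
  by (simp add: operator_of_def maximal_domain_def coords_Abs)

lemma number_sq_domain:
  assumes "\<psi> \<in> maximal_domain (number \<circ> number)"
  shows "square_summable (\<lambda>n. of_real ((real n)\<^sup>2) * coords \<psi> n)"
  using assms by (simp add: maximal_domain_def number_eq power2_eq_square mult.assoc)

text \<open>Every operator in the mean-field equation is controlled by the identity and the squared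
  number operator.\<close>

lemma domain_diagonal:
  assumes "\<psi> \<in> maximal_domain (number \<circ> number)" "\<And>n. \<bar>c n\<bar> \<le> a + b * (real n)\<^sup>2"
  shows "square_summable (\<lambda>n. of_real (c n) * coords \<psi> n)"
proof (rule square_summable_comparison[OF square_summable_coords number_sq_domain[OF assms(1)]])
  show "cmod (of_real (c n) * coords \<psi> n) \<le> a * cmod (coords \<psi> n) + b * cmod (of_real ((real n)\<^sup>2) * coords \<psi> n)" for n
    using mult_right_mono[OF assms(2)[of n], of "cmod (coords \<psi> n)"] by (simp add: norm_mult norm_power algebra_simps)
qed

lemma domain_annihilation:
  assumes "\<psi> \<in> maximal_domain (number \<circ> number)"
  shows "\<psi> \<in> maximal_domain annihilation"
proof -
  have "square_summable (\<lambda>n. of_real (sqrt (real n)) * coords \<psi> n)"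
  proof (rule domain_diagonal[OF assms])
    show "\<bar>sqrt (real n)\<bar> \<le> 1 + 1 * (real n)\<^sup>2" for n
      by (cases n) (auto intro!: real_le_lsqrt simp: power2_eq_square algebra_simps)
  qed
  then have "square_summable (\<lambda>n. of_real (sqrt (real (Suc n))) * coords \<psi> (Suc n))"
    by (rule square_summable_inj) simp
  then show ?thesis by (simp add: maximal_domain_def annihilation_def[abs_def] add.commute)
qed

lemma domain_creation:
  assumes "\<psi> \<in> maximal_domain (number \<circ> number)"
  shows "\<psi> \<in> maximal_domain creation"
proof -
  have s: "square_summable (\<lambda>n. of_real (sqrt (real (Suc n))) * coords \<psi> n)"
  proof (rule domain_diagonal[OF assms])
    fix n
    have "sqrt (real (Suc n)) \<le> real (Suc n)"
      by (rule real_le_lsqrt) (auto simp: power2_eq_square algebra_simps)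
    moreover have "real n \<le> (real n)\<^sup>2"
      by (cases n) (auto simp: power2_eq_square algebra_simps)
    moreover have "\<bar>sqrt (real (Suc n))\<bar> = sqrt (real (Suc n))" by simp
    ultimately show "\<bar>sqrt (real (Suc n))\<bar> \<le> 2 + 1 * (real n)\<^sup>2" unfolding of_nat_Suc by linarith
  qed
  show ?thesis
    unfolding maximal_domain_def mem_Collect_eq
    by (rule square_summable_Suc) (use s in \<open>simp add: creation_def\<close>)
qed

definition onsite :: "real \<Rightarrow> real \<Rightarrow> real \<Rightarrow> nat \<Rightarrow> real" where
  "onsite J \<mu> U n = (J - \<mu>) * real n + U / 2 * (real n * (real n - 1))"

lemma mean_field_op_eq:
  "mean_field_op J \<mu> U \<phi> \<psi> n =
    - of_real J * (order_parameter \<phi> * creation \<psi> n + cnj (order_parameter \<phi>) * annihilation \<psi> n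
        - of_real ((cmod (order_parameter \<phi>))\<^sup>2) * \<psi> n) + of_real (onsite J \<mu> U n) * \<psi> n"
  by (simp add: mean_field_op_def Let_def onsite_def number_eq pair_number_def algebra_simps)

lemma domain_mean_field_op:
  assumes "\<psi> \<in> maximal_domain (number \<circ> number)"
  shows "\<psi> \<in> maximal_domain (mean_field_op J \<mu> U \<phi>)"
proof -
  let ?\<alpha> = "order_parameter \<phi>"
  have c: "square_summable (creation (coords \<psi>))" "square_summable (annihilation (coords \<psi>))"
    using domain_creation[OF assms] domain_annihilation[OF assms] by (simp_all add: maximal_domain_def)
  have d: "square_summable (\<lambda>n. of_real (J * (cmod ?\<alpha>)\<^sup>2 + onsite J \<mu> U n) * coords \<psi> n)"
  proof (rule domain_diagonal[OF assms])
    fix n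
    have n: "real n \<le> 1 + (real n)\<^sup>2"
      by (cases n) (auto simp: power2_eq_square algebra_simps)
    have "\<bar>J * (cmod ?\<alpha>)\<^sup>2 + onsite J \<mu> U n\<bar> \<le> \<bar>J\<bar> * (cmod ?\<alpha>)\<^sup>2 + \<bar>J - \<mu>\<bar> * real n + \<bar>U / 2\<bar> * \<bar>real n * (real n - 1)\<bar>"
    proof -
      have "\<bar>x + (y + z)\<bar> \<le> \<bar>x\<bar> + \<bar>y\<bar> + \<bar>z\<bar>" for x y z :: real by linarith
      from this[of "J * (cmod ?\<alpha>)\<^sup>2" "(J - \<mu>) * real n" "U / 2 * (real n * (real n - 1))"]
      show ?thesis unfolding onsite_def by (simp add: abs_mult)
    qed
    also have "\<dots> \<le> \<bar>J\<bar> * (cmod ?\<alpha>)\<^sup>2 + \<bar>J - \<mu>\<bar> * (1 + (real n)\<^sup>2) + \<bar>U / 2\<bar> * (real n)\<^sup>2"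
    proof (intro add_mono order_refl mult_left_mono n)
      show "\<bar>real n * (real n - 1)\<bar> \<le> (real n)\<^sup>2"
        by (cases n) (auto simp: power2_eq_square abs_mult)
    qed auto
    finally show "\<bar>J * (cmod ?\<alpha>)\<^sup>2 + onsite J \<mu> U n\<bar> \<le> (\<bar>J\<bar> * (cmod ?\<alpha>)\<^sup>2 + \<bar>J - \<mu>\<bar>) + (\<bar>J - \<mu>\<bar> + \<bar>U / 2\<bar>) * (real n)\<^sup>2"
      by (simp add: algebra_simps)
  qed
  have eq: "mean_field_op J \<mu> U \<phi> (coords \<psi>) = (\<lambda>n. (- of_real J * ?\<alpha>) * creation (coords \<psi>) n
      + (- of_real J * cnj ?\<alpha>) * annihilation (coords \<psi>) n
      + of_real (J * (cmod ?\<alpha>)\<^sup>2 + onsite J \<mu> U n) * coords \<psi> n)"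
    by (rule ext) (simp add: mean_field_op_eq algebra_simps)
  show ?thesis
    unfolding maximal_domain_def mem_Collect_eq eq
    by (rule square_summable_add[OF square_summable_add[OF square_summable_scale[OF c(1)] square_summable_scale[OF c(2)]] d])
qed

lemma bounded_linear_coords: "bounded_linear (\<lambda>\<psi>. coords \<psi> i)"
  using bounded_bilinear.bounded_linear_right[OF bounded_bilinear_cinner, of "ket i"] by simp

locale mean_field =
  fixes J \<mu> U :: real and \<phi> :: "real \<Rightarrow> nat ell2"
  assumes sol: "mean_field_solution J \<mu> U \<phi>" and norm_0: "norm (\<phi> 0) = 1"
begin

definition "a t = operator_of annihilation (\<phi> t)"
definition "c t = operator_of creation (\<phi> t)"
definition "h t = operator_of (mean_field_op J \<mu> U (\<phi> t)) (\<phi> t)"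
definition "op t = order_parameter (\<phi> t)"

abbreviation "f t n \<equiv> coords (\<phi> t) n"

lemma dom: "\<phi> t \<in> maximal_domain (number \<circ> number)"
  using sol by (simp add: mean_field_solution_def)

lemma coords_a: "coords (a t) n = annihilation (coords (\<phi> t)) n"
  by (simp add: a_def coords_operator_of[OF domain_annihilation[OF dom]])
lemma coords_c: "coords (c t) n = creation (coords (\<phi> t)) n"
  by (simp add: c_def coords_operator_of[OF domain_creation[OF dom]])
lemma op_eq: "op t = cinner (\<phi> t) (a t)"
  by (simp add: op_def order_parameter_def a_def)

lemma coords_h: "coords (h t) n = - of_real J * (op t * creation (coords (\<phi> t)) n + cnj (op t) * annihilation (coords (\<phi> t)) n
        - of_real ((cmod (op t))\<^sup>2) * f t n) + of_real (onsite J \<mu> U n) * f t n"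
  by (simp add: h_def coords_operator_of[OF domain_mean_field_op[OF dom]] mean_field_op_eq op_def)

lemma deriv: "(\<phi> has_vector_derivative - \<i> *\<^sub>C h t) (at t)"
proof -
  obtain \<phi>' where \<phi>': "(\<phi> has_vector_derivative \<phi>' t) (at t)" "\<i> *\<^sub>C \<phi>' t = h t"
    using sol unfolding mean_field_solution_def h_def by blast
  have "- \<i> *\<^sub>C h t = \<phi>' t" unfolding \<phi>'(2)[symmetric] by simp
  then show ?thesis using \<phi>'(1) by simp
qed

lemma deriv_coords: "((\<lambda>t. f t n) has_vector_derivative - \<i> * coords (h t) n) (at t)"
  using bounded_linear.has_vector_derivative[OF bounded_linear_coords deriv] by simp

text \<open>The particle current from level \<open>n\<close> to level \<open>n + 1\<close>.\<close>

definition "cur t n = Im (cnj (op t) * of_real (sqrt (real n + 1)) * cnj (f t n) * f t (Suc n))"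

text \<open>The discrete continuity equation: diagonal terms are real, and the creation and
  annihilation terms are the currents on the two sides of level \<open>n\<close>.\<close>

lemma Im_cnj_h: "2 * Im (cnj (f t n) * coords (h t) n) = 2 * J * ((if n = 0 then 0 else cur t (n - 1)) - cur t n)"
proof -
  have 1: "Im (cnj (f t n) * (op t * creation (coords (\<phi> t)) n)) = - (if n = 0 then 0 else cur t (n - 1))"
  proof (cases n)
    case (Suc m)
    have "cnj (f t n) * (op t * creation (coords (\<phi> t)) n) = cnj (cnj (op t) * of_real (sqrt (real m + 1)) * cnj (f t m) * f t (Suc m))"
      by (simp add: Suc creation_def mult_ac add.commute)
    then show ?thesis using Suc by (simp only: cur_def cnj.sel) simp
  qed (simp add: creation_def)
  have 2: "Im (cnj (f t n) * (cnj (op t) * annihilation (coords (\<phi> t)) n)) = cur t n"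
    unfolding cur_def annihilation_def by (rule arg_cong[of _ _ Im]) (simp add: mult_ac)
  have 3: "Im (cnj (f t n) * f t n) = 0" by simp
  have "cnj (f t n) * coords (h t) n = of_real (- J) * (cnj (f t n) * (op t * creation (coords (\<phi> t)) n)
      + cnj (f t n) * (cnj (op t) * annihilation (coords (\<phi> t)) n) - of_real ((cmod (op t))\<^sup>2) * (cnj (f t n) * f t n))
      + of_real (onsite J \<mu> U n) * (cnj (f t n) * f t n)"
    unfolding coords_h by (simp add: algebra_simps)
  then show ?thesis
    by (simp only: plus_complex.sel minus_complex.sel Im_of_real_mult 1 2 3) (simp add: algebra_simps)
qed

lemma deriv_prob: "((\<lambda>t. (cmod (f t n))\<^sup>2) has_real_derivative 2 * J * ((if n = 0 then 0 else cur t (n - 1)) - cur t n)) (at t)"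
proof -
  have "((\<lambda>t. cnj (f t n) * f t n) has_vector_derivative cnj (f t n) * (- \<i> * coords (h t) n) + cnj (- \<i> * coords (h t) n) * f t n) (at t)"
    by (intro has_vector_derivative_mult has_vector_derivative_cnj deriv_coords)
  then have "((\<lambda>t. Re (cnj (f t n) * f t n)) has_vector_derivative
      Re (cnj (f t n) * (- \<i> * coords (h t) n) + cnj (- \<i> * coords (h t) n) * f t n)) (at t)"
    by (rule bounded_linear.has_vector_derivative[OF bounded_linear_Re])
  moreover have "Re (cnj (f t n) * f t n) = (cmod (f t n))\<^sup>2" for t
    by (subst mult.commute, subst complex_norm_square[symmetric]) simp
  moreover have "Re (cnj (f t n) * (- \<i> * coords (h t) n) + cnj (- \<i> * coords (h t) n) * f t n) = 2 * Im (cnj (f t n) * coords (h t) n)"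
    by (simp add: algebra_simps)
  ultimately show ?thesis
    unfolding has_real_derivative_iff_has_vector_derivative Im_cnj_h[symmetric] by simp
qed

text \<open>Summation by parts; the last term is the weighted current out of the truncated
  range.\<close>

lemma deriv_partial_moment:
  fixes F :: "real \<Rightarrow> nat \<Rightarrow> real"
  assumes "\<And>n. ((\<lambda>t. F t n) has_real_derivative F' n) (at t)"
  shows "((\<lambda>t. \<Sum>n\<le>M. F t n * (cmod (f t n))\<^sup>2) has_real_derivative
    (\<Sum>n\<le>M. F' n * (cmod (f t n))\<^sup>2) + 2 * J * ((\<Sum>n<M. (F t (Suc n) - F t n) * cur t n) - F t M * cur t M)) (at t)"
proof -
  have "((\<lambda>t. \<Sum>n\<le>M. F t n * (cmod (f t n))\<^sup>2) has_real_derivative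
    (\<Sum>n\<le>M. F' n * (cmod (f t n))\<^sup>2 + F t n * (2 * J * ((if n = 0 then 0 else cur t (n - 1)) - cur t n)))) (at t)"
    by (rule DERIV_sum) (rule DERIV_cong[OF DERIV_mult[OF assms deriv_prob]], simp)
  moreover have "(\<Sum>n\<le>M. F t n * (2 * J * ((if n = 0 then 0 else cur t (n - 1)) - cur t n)))
      = 2 * J * ((\<Sum>n<M. (F t (Suc n) - F t n) * cur t n) - F t M * cur t M)"
    by (induction M) (auto simp: algebra_simps)
  ultimately show ?thesis by (simp add: sum.distrib)
qed

text \<open>Uniformly on bounded time intervals, \<open>cur t n = O(n\<^sup>-\<^sup>3)\<close>; this makes the boundary terms vanish.\<close>

lemma current_decay:
  assumes "T \<ge> 0"
  shows "\<exists>K. \<forall>t\<in>{0..T}. \<forall>n. (real n + 1) * \<bar>cur t n\<bar> \<le> K / ((real n + 1) * (real n + 2))"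
proof -
  let ?N2 = "\<lambda>t. operator_of (number \<circ> number) (\<phi> t)"
  have cont: "continuous_on {0..T} \<phi>" "continuous_on {0..T} ?N2"
    using sol unfolding mean_field_solution_def by (blast intro: continuous_on_subset)+
  have "compact ((\<lambda>t. norm (\<phi> t) + norm (?N2 t)) ` {0..T})"
    by (rule compact_continuous_image[OF continuous_on_add[OF cont[THEN continuous_on_norm]] compact_Icc])
  then have "bounded ((\<lambda>t. norm (\<phi> t) + norm (?N2 t)) ` {0..T})" by (rule compact_imp_bounded)
  then obtain B where "\<forall>x\<in>(\<lambda>t. norm (\<phi> t) + norm (?N2 t)) ` {0..T}. norm x \<le> B"
    unfolding bounded_iff by blast
  then have B: "norm (\<phi> t) + norm (?N2 t) \<le> B" if "t \<in> {0..T}" for t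
    using that by fastforce
  \<comment> \<open>Boundedness of the squared number operator along the solution gives coefficients
    of order \<open>n\<close> to the power -2, uniformly in time.\<close>
  have fB: "(real n + 1)\<^sup>2 * cmod (f t n) \<le> 4 * B" if t: "t \<in> {0..T}" for t n
  proof -
    have "coords (?N2 t) n = of_real ((real n)\<^sup>2) * f t n"
      by (simp add: coords_operator_of[OF dom] number_eq power2_eq_square mult.assoc)
    then have "(real n)\<^sup>2 * cmod (f t n) \<le> norm (?N2 t)"
      using cmod_coords_le[of "?N2 t" n] by (simp add: norm_mult norm_power)
    moreover have "cmod (f t n) \<le> norm (\<phi> t)" by (rule cmod_coords_le)
    moreover have "(real n + 1)\<^sup>2 * cmod (f t n) \<le> (2 * (real n)\<^sup>2 + 2) * cmod (f t n)"
      using sum_squares_bound[of "real n" 1] by (intro mult_right_mono) (auto simp: power2_sum)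
    ultimately show ?thesis
      using B[OF t] norm_ge_zero[of "\<phi> t"] norm_ge_zero[of "?N2 t"]
        distrib_right[of "2 * (real n)\<^sup>2" 2 "cmod (f t n)"] mult.assoc[of 2 "(real n)\<^sup>2" "cmod (f t n)"] by linarith
  qed
  have B0: "B \<ge> 0" using B[of 0] assms norm_ge_zero[of "\<phi> 0"] norm_ge_zero[of "?N2 0"] by (simp del: norm_ge_zero)
  have opB: "cmod (op t) \<le> 2 * B\<^sup>2" if t: "t \<in> {0..T}" for t
  proof -
    have "(norm (a t))\<^sup>2 \<le> (norm (\<phi> t))\<^sup>2 + (norm (?N2 t))\<^sup>2"
    proof (rule has_sum_mono[OF norm_sq_annihilation[OF coords_a] has_sum_add[OF norm_sq_has_sum norm_sq_has_sum]])
      fix n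
      have "real n \<le> 1 + (real n) ^ 4"
        by (cases n) (auto simp: power_def algebra_simps numeral_eq_Suc)
      then have "real n * (cmod (f t n))\<^sup>2 \<le> (1 + (real n) ^ 4) * (cmod (f t n))\<^sup>2" by (intro mult_right_mono) auto
      then show "real n * (cmod (f t n))\<^sup>2 \<le> (cmod (f t n))\<^sup>2 + (cmod (coords (?N2 t) n))\<^sup>2"
        by (simp add: coords_operator_of[OF dom] number_eq norm_mult power_mult_distrib algebra_simps flip: power_add power_mult)
    qed
    also have "\<dots> \<le> (norm (\<phi> t) + norm (?N2 t))\<^sup>2" by (simp add: power2_sum)
    finally have "norm (a t) \<le> norm (\<phi> t) + norm (?N2 t)" by (rule power2_le_imp_le) simp
    then have "norm (a t) \<le> B" using B[OF t] by simp
    moreover have "norm (\<phi> t) \<le> B" using B[OF t] norm_ge_zero[of "?N2 t"] by linarith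
    ultimately have "norm (\<phi> t) * norm (a t) \<le> B * B" by (intro mult_mono) (auto simp: B0)
    then show ?thesis
      using cinner_Cauchy_Schwarz[of "\<phi> t" "a t"] mult_nonneg_nonneg[OF B0 B0] unfolding op_eq power2_eq_square by linarith
  qed
  show ?thesis
  \<comment> \<open>The product of \<open>2 * B\<^sup>2\<close> for the order parameter and
    \<open>4 * B\<close> for each of the two coefficients.\<close>
  proof (intro exI[of _ "32 * B ^ 4"] ballI allI)
    fix t n assume t: "t \<in> {0..T}"
    let ?m = "real n + 1"
    have "\<bar>cur t n\<bar> \<le> cmod (op t) * sqrt ?m * cmod (f t n) * cmod (f t (Suc n))"
      unfolding cur_def by (rule order_trans[OF abs_Im_le_cmod]) (simp add: norm_mult)
    also have "\<dots> \<le> (2 * B\<^sup>2) * ?m * (4 * B / ?m\<^sup>2) * (4 * B / (?m + 1)\<^sup>2)"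
    proof (intro mult_mono opB t)
      show "sqrt ?m \<le> ?m" by (rule real_le_lsqrt) (auto simp: power2_eq_square)
      show "cmod (f t n) \<le> 4 * B / ?m\<^sup>2"
        using fB[OF t, of n] by (simp add: pos_le_divide_eq mult.commute)
      show "cmod (f t (Suc n)) \<le> 4 * B / (?m + 1)\<^sup>2"
        using fB[OF t, of "Suc n"] by (simp add: pos_le_divide_eq mult.commute add_ac)
    qed (use B0 in auto)
    also have "\<dots> = 32 * B ^ 4 / (?m * (?m + 1)\<^sup>2)"
    proof -
      have "(2 * B\<^sup>2) * m * (4 * B / m\<^sup>2) * (4 * B / r) = 32 * B ^ 4 / (m * r)" if "m > 0" for m r
        using that by (simp add: power2_eq_square power4_eq_xxxx)
      then show ?thesis by simp
    qed
    finally have "?m * \<bar>cur t n\<bar> \<le> ?m * (32 * B ^ 4 / (?m * (?m + 1)\<^sup>2))"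
      by (intro mult_left_mono) auto
    also have "\<dots> = 32 * B ^ 4 / (?m + 1)\<^sup>2" by simp
    also have "\<dots> \<le> 32 * B ^ 4 / (?m * (?m + 1))"
      by (intro divide_left_mono) (auto simp: power2_eq_square B0)
    finally show "(real n + 1) * \<bar>cur t n\<bar> \<le> 32 * B ^ 4 / ((real n + 1) * (real n + 2))" by (simp add: add_ac)
  qed
qed

text \<open>Self-consistency of the equation: summed over all levels the current is the imaginary
  part of \<open>cnj (op t) * op t\<close>, which is real. This is why the mean particle number is
  conserved although hopping is not number preserving on one site.\<close>

lemma cur_sums: "cur t sums 0"
proof -
  have "((\<lambda>n. cnj (f t n) * annihilation (coords (\<phi> t)) n) has_sum op t) UNIV"
    unfolding op_eq using cinner_has_sum[of "\<phi> t" "a t"] by (simp add: coords_a)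
  from has_sum_Im[OF has_sum_cmult_right[OF this, of "cnj (op t)"]]
  have "((\<lambda>n. cur t n) has_sum Im (cnj (op t) * op t)) UNIV"
    unfolding cur_def annihilation_def by (simp only: mult_ac) (simp add: mult_ac)
  then show ?thesis using has_sum_imp_sums by fastforce
qed

text \<open>As the total vanishes, a partial sum is minus the tail, and the assumed bound telescopes
  along the tail.\<close>

lemma partial_sum_cur:
  assumes K: "\<And>n. (real n + 1) * \<bar>cur t n\<bar> \<le> K / ((real n + 1) * (real n + 2))"
  shows "\<bar>\<Sum>n<M. cur t n\<bar> \<le> K / (real M + 1)"
proof -
  have b: "\<bar>cur t n\<bar> \<le> K / (real n + 1) - K / (real n + 2)" for n
  proof -
    have "\<bar>cur t n\<bar> \<le> (real n + 1) * \<bar>cur t n\<bar>" by (simp add: algebra_simps)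
    also have "\<dots> \<le> K / ((real n + 1) * (real n + 2))" by (rule K)
    also have "\<dots> = K / (real n + 1) - K / (real n + 2)" by (simp add: field_simps)
    finally show ?thesis .
  qed
  have 0: "(\<lambda>n. K / (real n + 1)) \<longlonglongrightarrow> 0" by real_asymp
  have "(\<lambda>n. K / (real (n + M) + 1) - K / (real (Suc n + M) + 1)) sums (K / (real (0 + M) + 1) - 0)"
    by (rule telescope_sums'[where f = "\<lambda>n. K / (real (n + M) + 1)"]) real_asymp
  then have tel: "(\<lambda>n. K / (real (n + M) + 1) - K / (real (n + M) + 2)) sums (K / (real M + 1))" by (simp add: add_ac)
  have "(\<lambda>n. cur t (n + M)) sums (0 - (\<Sum>n<M. cur t n))"
    using cur_sums[of t] by (rule sums_split_initial_segment)
  then have s: "(\<Sum>n. cur t (n + M)) = - (\<Sum>n<M. cur t n)" by (simp add: sums_iff)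
  have "norm (\<Sum>n. cur t (n + M)) \<le> (\<Sum>n. K / (real (n + M) + 1) - K / (real (n + M) + 2))"
  proof (rule norm_suminf_le)
    show "norm (cur t (n + M)) \<le> K / (real (n + M) + 1) - K / (real (n + M) + 2)" for n
      using b[of "n + M"] by simp
  qed (use tel in \<open>simp add: sums_iff\<close>)
  also have "\<dots> = K / (real M + 1)" using tel by (simp add: sums_iff)
  finally show ?thesis unfolding s by simp
qed

lemma mean_value_bound:
  fixes P :: "real \<Rightarrow> real"
  assumes "t \<ge> 0" "\<And>s. s \<in> {0..t} \<Longrightarrow> (P has_real_derivative P' s) (at s)" "\<And>s. s \<in> {0..t} \<Longrightarrow> \<bar>P' s\<bar> \<le> b"
  shows "\<bar>P t - P 0\<bar> \<le> b * t"
  using field_differentiable_bound[of "{0..t}" P P' b t 0] assms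
  by (auto intro: DERIV_subset)

text \<open>Norm (\<open>q = 0\<close>) and mean particle number (\<open>p = 0\<close>) at once. The
  infinite sums are never differentiated: the truncated sums change by a quantity of order
  \<open>1 / M\<close>, uniformly on the time interval.\<close>

lemma conserved:
  assumes t: "t \<ge> 0" and F: "\<And>n. F n = p + q * real n" and s: "\<And>s. ((\<lambda>n. F n * (cmod (f s n))\<^sup>2) has_sum S s) UNIV"
  shows "S t = S 0"
proof -
  obtain K where K: "\<And>s n. s \<in> {0..t} \<Longrightarrow> (real n + 1) * \<bar>cur s n\<bar> \<le> K / ((real n + 1) * (real n + 2))"
    using current_decay[OF t] by blast
  have "0 \<le> (real 0 + 1) * \<bar>cur 0 0\<bar>" by simp
  also have "\<dots> \<le> K / 2" using K[of 0 0] t by simp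
  finally have K0: "K \<ge> 0" by simp
  let ?P = "\<lambda>M s. \<Sum>n\<le>M. F n * (cmod (f s n))\<^sup>2"
  define b where "b M = 2 * \<bar>J\<bar> * (\<bar>q\<bar> * (K / (real M + 1)) + (\<bar>p\<bar> + \<bar>q\<bar>) * (K / (real M + 1)))" for M
  define D where "D M s = (\<Sum>n\<le>M. 0 * (cmod (f s n))\<^sup>2) + 2 * J * ((\<Sum>n<M. (F (Suc n) - F n) * cur s n) - F M * cur s M)" for M s
  have "\<bar>?P M t - ?P M 0\<bar> \<le> b M * t" for M
  proof (rule mean_value_bound[OF t, where P' = "D M"])
    fix s assume "s \<in> {0..t}"
    show "(?P M has_real_derivative D M s) (at s)"
      unfolding D_def by (rule deriv_partial_moment) simp
    have 1: "(\<Sum>n<M. (F (Suc n) - F n) * cur s n) = q * (\<Sum>n<M. cur s n)"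
      by (simp add: F sum_distrib_left algebra_simps)
    have 2: "\<bar>F M * cur s M\<bar> \<le> (\<bar>p\<bar> + \<bar>q\<bar>) * (K / (real M + 1))"
    proof -
      have "\<bar>F M\<bar> \<le> \<bar>p\<bar> + \<bar>q\<bar> * real M" unfolding F by (rule order_trans[OF abs_triangle_ineq]) (simp add: abs_mult)
      also have "\<dots> \<le> (\<bar>p\<bar> + \<bar>q\<bar>) * (real M + 1)" by (simp add: algebra_simps)
      finally have "\<bar>F M * cur s M\<bar> \<le> (\<bar>p\<bar> + \<bar>q\<bar>) * (real M + 1) * \<bar>cur s M\<bar>"
        unfolding abs_mult by (rule mult_right_mono) simp
      also have "\<dots> = (\<bar>p\<bar> + \<bar>q\<bar>) * ((real M + 1) * \<bar>cur s M\<bar>)" by simp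
      also have "\<dots> \<le> (\<bar>p\<bar> + \<bar>q\<bar>) * (K / ((real M + 1) * (real M + 2)))"
        by (intro mult_left_mono K \<open>s \<in> {0..t}\<close>) auto
      also have "\<dots> \<le> (\<bar>p\<bar> + \<bar>q\<bar>) * (K / (real M + 1))"
        using K0 by (intro mult_left_mono divide_left_mono) auto
      finally show ?thesis .
    qed
    have "\<bar>(\<Sum>n<M. (F (Suc n) - F n) * cur s n) - F M * cur s M\<bar> \<le> \<bar>q\<bar> * (K / (real M + 1)) + (\<bar>p\<bar> + \<bar>q\<bar>) * (K / (real M + 1))"
      using 2 mult_left_mono[OF partial_sum_cur[OF K[OF \<open>s \<in> {0..t}\<close>], of M], of "\<bar>q\<bar>"]
      unfolding 1 by (intro order_trans[OF abs_triangle_ineq4] add_mono) (auto simp: abs_mult)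
    then have "2 * \<bar>J\<bar> * \<bar>(\<Sum>n<M. (F (Suc n) - F n) * cur s n) - F M * cur s M\<bar> \<le> b M"
      unfolding b_def by (rule mult_left_mono) simp
    then show "\<bar>D M s\<bar> \<le> b M" by (simp add: D_def abs_mult)
  qed
  moreover have "b \<longlonglongrightarrow> 0" unfolding b_def by real_asymp
  then have "(\<lambda>M. b M * t) \<longlonglongrightarrow> 0" using tendsto_mult_left_zero by blast
  moreover have P: "(\<lambda>M. ?P M s) \<longlonglongrightarrow> S s" for s
    using has_sum_imp_sums[OF s[of s]] by (simp add: sums_def_le)
  have "(\<lambda>M. \<bar>?P M t - ?P M 0\<bar>) \<longlonglongrightarrow> \<bar>S t - S 0\<bar>" by (intro tendsto_intros P)
  ultimately have "\<bar>S t - S 0\<bar> \<le> 0" by (intro LIMSEQ_le) auto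
  then show ?thesis by simp
qed

lemma norm_phi: "t \<ge> 0 \<Longrightarrow> norm (\<phi> t) = 1"
proof -
  assume t: "t \<ge> 0"
  have "(norm (\<phi> t))\<^sup>2 = (norm (\<phi> 0))\<^sup>2"
    by (rule conserved[OF t, where F = "\<lambda>_. 1" and p = 1 and q = 0]) (use norm_sq_has_sum in auto)
  then show ?thesis unfolding norm_0 by (rule power2_eq_imp_eq) auto
qed

lemma norm_a: "t \<ge> 0 \<Longrightarrow> norm (a t) = norm (a 0)"
proof -
  assume t: "t \<ge> 0"
  have "(norm (a t))\<^sup>2 = (norm (a 0))\<^sup>2"
    by (rule conserved[OF t, where F = real and p = 0 and q = 1]) (use norm_sq_annihilation[OF coords_a] in auto)
  then show ?thesis by simp
qed

end


section \<open>Exponential moments with a scale growing in time\<close>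

section \<open>Propagation of exponential moments\<close>

text \<open>For \<open>\<kappa> \<ge> 4\<close> the relative increment of the weight is at most 5/4
  over \<kappa>. For positive \<open>n\<close>, replacing \<open>n + 1\<close> by
  \<open>2 * n\<close> doubles 5/4 to 5/2, which is below Euler's number; for \<open>n = 0\<close>
  the summand 1/2 suffices. This is the Euler number in \<open>C\<^sub>1\<close>.\<close>

lemma exp_growth_step:
  assumes "\<kappa> \<ge> 4"
  shows "(real n + 1) * (exp (real (Suc n) / \<kappa>) - exp (real n / \<kappa>)) \<le> exp 1 / \<kappa> * (real n * exp (real n / \<kappa>) + 1 / 2)"
proof -
  define r where "r = exp (1 / \<kappa>) - 1"
  define E where "E = exp (real n / \<kappa>)"
  have \<kappa>: "\<kappa> > 0" "1 / \<kappa> \<le> 1 / 4" "1 / \<kappa> \<ge> 0" using assms by (auto simp: field_simps)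
  have "exp (1 / \<kappa>) \<le> 1 + 1 / \<kappa> + (1 / \<kappa>)\<^sup>2"
    using \<kappa> by (intro exp_bound) auto
  also have "(1 / \<kappa>)\<^sup>2 \<le> 1 / 4 * (1 / \<kappa>)"
    unfolding power2_eq_square by (intro mult_right_mono \<kappa>)
  finally have r: "r \<le> (5 / 4) / \<kappa>" by (simp add: r_def)
  have e: "exp (1::real) \<ge> 5 / 2" using exp_lower_Taylor_quadratic[of "1 :: real"] by simp
  have E: "E \<ge> 1" using \<kappa>(1) by (simp add: E_def)
  have "exp (real (Suc n) / \<kappa>) = E * exp (1 / \<kappa>)"
    by (simp add: E_def add_divide_distrib flip: exp_add)
  then have "exp (real (Suc n) / \<kappa>) - exp (real n / \<kappa>) = E * r"
    by (simp add: r_def E_def algebra_simps)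
  then have "(real n + 1) * (exp (real (Suc n) / \<kappa>) - exp (real n / \<kappa>)) = ((real n + 1) * E) * r" by simp
  also have "\<dots> \<le> ((real n + 1) * E) * ((5 / 4) / \<kappa>)"
    using E by (intro mult_left_mono r) auto
  also have "\<dots> = ((5 / 4) * (real n + 1) * E) / \<kappa>" by simp
  also have "\<dots> \<le> (exp 1 * (real n * E + 1 / 2)) / \<kappa>"
  proof (intro divide_right_mono)
    show "(5 / 4) * (real n + 1) * E \<le> exp 1 * (real n * E + 1 / 2)"
    proof (cases "n = 0")
      case True
      then show ?thesis using e by (simp add: E_def)
    next
      case False
      then have "(5 / 4) * (real n + 1) * E \<le> (5 / 2) * (real n * E)"
        using E by (simp add: algebra_simps)
      also have "\<dots> \<le> exp 1 * (real n * E)"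
        using E by (intro mult_right_mono e) auto
      also have "\<dots> \<le> exp 1 * (real n * E + 1 / 2)" by simp
      finally show ?thesis .
    qed
  qed (use \<kappa> in auto)
  finally show ?thesis by (simp add: E_def)
qed

lemma DERIV_exp_moment:
  assumes "\<kappa>\<^sub>0 > 0"
  shows "((\<lambda>t. exp (x / (\<kappa>\<^sub>0 * exp (C * t)))) has_real_derivative
    - (C / (\<kappa>\<^sub>0 * exp (C * t))) * (x * exp (x / (\<kappa>\<^sub>0 * exp (C * t))))) (at t)"
proof -
  have *: "x / (\<kappa>\<^sub>0 * exp (C * t)) = x / \<kappa>\<^sub>0 * exp (- C * t)" for t
    by (simp add: exp_minus divide_inverse)
  have "((\<lambda>t. exp (z * exp (- C * t))) has_real_derivative
      exp (z * exp (- C * t)) * (z * (exp (- C * t) * (- C)))) (at t)" for z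
    by (auto intro!: derivative_eq_intros)
  from this[of "x / \<kappa>\<^sub>0"]
  have "((\<lambda>t. exp (x / \<kappa>\<^sub>0 * exp (- C * t))) has_real_derivative
      exp (x / \<kappa>\<^sub>0 * exp (- C * t)) * (x / \<kappa>\<^sub>0 * (exp (- C * t) * (- C)))) (at t)" .
  also have "exp (x / \<kappa>\<^sub>0 * exp (- C * t)) * (x / \<kappa>\<^sub>0 * (exp (- C * t) * (- C)))
      = - (C / (\<kappa>\<^sub>0 * exp (C * t))) * (x * exp (x / \<kappa>\<^sub>0 * exp (- C * t)))"
    by (simp add: exp_minus divide_inverse mult_ac)
  finally show ?thesis unfolding * by simp
qed

text \<open>This additive term decays at the rate that pays for the summand 1/2 in
  \<open>exp_growth_step\<close>.\<close>

lemma DERIV_inverse_scale: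
  assumes "\<kappa>\<^sub>0 > 0"
  shows "((\<lambda>t. 1 / (2 * (\<kappa>\<^sub>0 * exp (C * t)))) has_real_derivative - (C / (\<kappa>\<^sub>0 * exp (C * t))) * (1 / 2)) (at t)"
  using assms by (auto intro!: derivative_eq_intros simp: field_simps power2_eq_square)

context lattice
begin

lemma deriv_level_moment:
  fixes F :: "real \<Rightarrow> ('s \<Rightarrow> nat) \<Rightarrow> real"
  assumes "\<And>n. ((\<lambda>t. F t n) has_real_derivative F' n) (at t)"
  shows "((\<lambda>t. \<Sum>n\<in>level K. F t n * (cmod (evol t g n))\<^sup>2) has_real_derivative
    (\<Sum>n\<in>level K. F' n * (cmod (evol t g n))\<^sup>2)
    + 2 * Im (\<Sum>n\<in>level K. of_real (F t n) * (cnj (evol t g n) * H (evol t g) n))) (at t)"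
proof -
  have p: "((\<lambda>t. (cmod (evol t g n))\<^sup>2) has_real_derivative 2 * Im (cnj (evol t g n) * H (evol t g) n)) (at t)" for n
  proof -
    let ?f = "\<lambda>t. evol t g n" and ?h = "H (evol t g) n"
    have d: "(?f has_vector_derivative - \<i> * ?h) (at t)"
      using evolves_evol[of g] by (simp add: evolves_def)
    have "((\<lambda>t. cnj (?f t) * ?f t) has_vector_derivative cnj (?f t) * (- \<i> * ?h) + cnj (- \<i> * ?h) * ?f t) (at t)"
      by (intro has_vector_derivative_mult has_vector_derivative_cnj d)
    then have "((\<lambda>t. Re (cnj (?f t) * ?f t)) has_vector_derivative Re (cnj (?f t) * (- \<i> * ?h) + cnj (- \<i> * ?h) * ?f t)) (at t)"
      by (rule bounded_linear.has_vector_derivative[OF bounded_linear_Re])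
    moreover have "Re (cnj (?f t) * ?f t) = (cmod (?f t))\<^sup>2" for t
      by (subst mult.commute, subst complex_norm_square[symmetric]) simp
    moreover have "Re (cnj (?f t) * (- \<i> * ?h) + cnj (- \<i> * ?h) * ?f t) = 2 * Im (cnj (?f t) * ?h)"
      by (simp add: algebra_simps)
    ultimately show ?thesis
      unfolding has_real_derivative_iff_has_vector_derivative by simp
  qed
  have "((\<lambda>t. \<Sum>n\<in>level K. F t n * (cmod (evol t g n))\<^sup>2) has_real_derivative
    (\<Sum>n\<in>level K. F' n * (cmod (evol t g n))\<^sup>2 + 2 * Im (cnj (evol t g n) * H (evol t g) n) * F t n)) (at t)"
    by (rule DERIV_sum) (rule DERIV_mult[OF assms p])
  then show ?thesis
    by (simp only: Im_sum Im_of_real_mult sum.distrib sum_distrib_left mult_ac)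
qed

text \<open>Widening the scale costs the weight exactly the amount that
  \<open>exp_growth_step\<close> allows hopping to produce, once \<open>C\<close> is at least twice
  Euler's number times \<open>\<bar>j\<bar> * real k\<close>. The quantity that decreases is the
  moment plus one half of the inverse scale per site; at time 0 the addition is at most 1/8 per site
  since \<open>\<kappa>\<^sub>0 \<ge> 4\<close>.\<close>

lemma level_exp_moment:
  assumes \<kappa>: "\<kappa>\<^sub>0 \<ge> 4" and C: "C \<ge> 2 * exp 1 * (\<bar>j\<bar> * real k)" and t: "t \<ge> 0"
  defines "\<kappa> \<equiv> \<lambda>t. \<kappa>\<^sub>0 * exp (C * t)"
  shows "(\<Sum>n\<in>level K. (\<Sum>x\<in>UNIV. exp (real (n x) / \<kappa> t)) * (cmod (evol t g n))\<^sup>2)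
    \<le> (\<Sum>n\<in>level K. (\<Sum>x\<in>UNIV. exp (real (n x) / \<kappa>\<^sub>0)) * (cmod (g n))\<^sup>2)
      + real CARD('s) / 8 * (\<Sum>n\<in>level K. (cmod (g n))\<^sup>2)"
proof -
  have \<kappa>0: "\<kappa>\<^sub>0 > 0" using \<kappa> by simp
  have C0: "C \<ge> 0" using C order_trans[OF _ C] by (simp add: mult_nonneg_nonneg)
  define F where "F t n = (\<Sum>x\<in>UNIV. exp (real (n x) / \<kappa> t)) + real CARD('s) * (1 / (2 * \<kappa> t))" for t and n :: "'s \<Rightarrow> nat"
  define F' where "F' t n = (\<Sum>x\<in>UNIV. - (C / \<kappa> t) * (real (n x) * exp (real (n x) / \<kappa> t)))
      + real CARD('s) * (- (C / \<kappa> t) * (1 / 2))" for t and n :: "'s \<Rightarrow> nat"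
  have F: "((\<lambda>t. F t n) has_real_derivative F' t n) (at t)" for t n
    unfolding F_def F'_def \<kappa>_def
    by (intro DERIV_add DERIV_sum DERIV_cmult DERIV_exp_moment DERIV_inverse_scale \<kappa>0)
  let ?G = "\<lambda>t. \<Sum>n\<in>level K. F t n * (cmod (evol t g n))\<^sup>2"
  define G' where "G' t = (\<Sum>n\<in>level K. F' t n * (cmod (evol t g n))\<^sup>2)
    + 2 * Im (\<Sum>n\<in>level K. of_real (F t n) * (cnj (evol t g n) * H (evol t g) n))" for t
  have "?G t \<le> ?G 0"
  proof (rule DERIV_nonpos_imp_nonincreasing[OF t])
    fix s :: real assume s: "0 \<le> s" "s \<le> t"
    have \<kappa>s: "\<kappa> s \<ge> 4"
      using \<kappa> mult_mono[of 4 "\<kappa>\<^sub>0" 1 "exp (C * s)"] s C0 by (simp add: \<kappa>_def)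
    let ?\<Psi> = "evol s g"
    have real1: "Im (of_real r * (cnj z * w)) = r * Im (cnj z * w)" for r z w by simp
    \<comment> \<open>The additive term of \<open>F\<close> does not depend on the configuration, so
      hopping leaves it unchanged.\<close>
    have Hreal: "(\<Sum>n\<in>level K. Im (cnj (?\<Psi> n) * H ?\<Psi> n)) = 0"
    proof -
      have "cnj (\<Sum>n\<in>level K. cnj (?\<Psi> n) * H ?\<Psi> n) = (\<Sum>n\<in>level K. cnj (H ?\<Psi> n) * ?\<Psi> n)"
        by (simp add: mult.commute)
      also have "\<dots> = (\<Sum>n\<in>level K. cnj (?\<Psi> n) * H ?\<Psi> n)" by (rule H_symmetric[symmetric])
      finally have "Im (\<Sum>n\<in>level K. cnj (?\<Psi> n) * H ?\<Psi> n) = 0"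
        by (metis cnj.sel(2) neg_equal_zero)
      then show ?thesis by (simp only: Im_sum)
    qed
    have "Im (\<Sum>n\<in>level K. of_real (F s n) * (cnj (?\<Psi> n) * H ?\<Psi> n))
        = Im (\<Sum>n\<in>level K. of_real (\<Sum>x\<in>UNIV. exp (real (n x) / \<kappa> s)) * (cnj (?\<Psi> n) * H ?\<Psi> n))
          + real CARD('s) * (1 / (2 * \<kappa> s)) * (\<Sum>n\<in>level K. Im (cnj (?\<Psi> n) * H ?\<Psi> n))"
      by (simp only: Im_sum real1 F_def distrib_right sum.distrib sum_distrib_left)
    then have eqIm: "2 * Im (\<Sum>n\<in>level K. of_real (F s n) * (cnj (?\<Psi> n) * H ?\<Psi> n))
        = 2 * Im (\<Sum>n\<in>level K. of_real (\<Sum>x\<in>UNIV. exp (real (n x) / \<kappa> s)) * (cnj (?\<Psi> n) * H ?\<Psi> n))"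
      using Hreal by simp
    have E1: "exp (real (Suc n) / \<kappa> s) = exp (real n / \<kappa> s) * exp (1 / \<kappa> s)" for n
      by (simp add: add_divide_distrib flip: exp_add)
    have "\<bar>2 * Im (\<Sum>n\<in>level K. of_real (\<Sum>x\<in>UNIV. exp (real (n x) / \<kappa> s)) * (cnj (?\<Psi> n) * H ?\<Psi> n))\<bar>
        \<le> 2 * \<bar>j\<bar> * real k * (\<Sum>n\<in>level K. (\<Sum>x\<in>UNIV. (real (n x) + 1) * (exp (real (Suc (n x)) / \<kappa> s) - exp (real (n x) / \<kappa> s))) * (cmod (?\<Psi> n))\<^sup>2)"
    proof (rule moment_derivative_bound)
      fix n
      show "exp (real n / \<kappa> s) \<le> exp (real (Suc n) / \<kappa> s)"
        using \<kappa>s by (simp add: divide_right_mono)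
      have "exp (real n / \<kappa> s) * (exp (1 / \<kappa> s) - 1) \<le> exp (real (Suc n) / \<kappa> s) * (exp (1 / \<kappa> s) - 1)"
        using \<kappa>s by (intro mult_right_mono) (auto simp: divide_right_mono)
      then show "exp (real (Suc n) / \<kappa> s) - exp (real n / \<kappa> s) \<le> exp (real (Suc (Suc n)) / \<kappa> s) - exp (real (Suc n) / \<kappa> s)"
        unfolding E1[of n] E1[of "Suc n"] by (simp add: algebra_simps)
    qed
    also have "\<dots> \<le> 2 * \<bar>j\<bar> * real k * (\<Sum>n\<in>level K. (\<Sum>x\<in>UNIV. exp 1 / \<kappa> s * (real (n x) * exp (real (n x) / \<kappa> s) + 1 / 2)) * (cmod (?\<Psi> n))\<^sup>2)"
      by (intro mult_left_mono sum_mono mult_right_mono exp_growth_step \<kappa>s) auto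
    also have "\<dots> = (2 * exp 1 * (\<bar>j\<bar> * real k)) / \<kappa> s * (\<Sum>n\<in>level K. (\<Sum>x\<in>UNIV. real (n x) * exp (real (n x) / \<kappa> s) + 1 / 2) * (cmod (?\<Psi> n))\<^sup>2)"
    proof -
      have "(\<Sum>n\<in>level K. (\<Sum>x\<in>UNIV. exp 1 / \<kappa> s * (real (n x) * exp (real (n x) / \<kappa> s) + 1 / 2)) * (cmod (?\<Psi> n))\<^sup>2)
          = exp 1 / \<kappa> s * (\<Sum>n\<in>level K. (\<Sum>x\<in>UNIV. real (n x) * exp (real (n x) / \<kappa> s) + 1 / 2) * (cmod (?\<Psi> n))\<^sup>2)"
        by (simp only: sum_distrib_left[symmetric] mult.assoc)
      then show ?thesis by (simp only:) simp
    qed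
    also have "\<dots> \<le> C / \<kappa> s * (\<Sum>n\<in>level K. (\<Sum>x\<in>UNIV. real (n x) * exp (real (n x) / \<kappa> s) + 1 / 2) * (cmod (?\<Psi> n))\<^sup>2)"
      using \<kappa>s by (intro mult_right_mono divide_right_mono C sum_nonneg mult_nonneg_nonneg) (auto intro!: sum_nonneg add_nonneg_nonneg)
    also have "\<dots> = - (\<Sum>n\<in>level K. F' s n * (cmod (?\<Psi> n))\<^sup>2)"
    proof -
      have "F' s n = - (C / \<kappa> s) * (\<Sum>x\<in>UNIV. real (n x) * exp (real (n x) / \<kappa> s) + 1 / 2)" for n
        unfolding F'_def by (simp add: sum.distrib sum_distrib_left sum_negf algebra_simps)
      then show ?thesis
        by (simp only: mult_minus_left sum_negf minus_minus mult.assoc sum_distrib_left[symmetric])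
    qed
    finally have "G' s \<le> 0" unfolding G'_def eqIm by linarith
    moreover have "(?G has_real_derivative G' s) (at s)"
      unfolding G'_def by (rule deriv_level_moment[OF F])
    ultimately show "\<exists>y. (?G has_real_derivative y) (at s) \<and> y \<le> 0" by blast
  qed
  moreover have "(\<Sum>n\<in>level K. (\<Sum>x\<in>UNIV. exp (real (n x) / \<kappa> t)) * (cmod (evol t g n))\<^sup>2) \<le> ?G t"
    using \<kappa>0 by (intro sum_mono mult_right_mono) (auto simp: F_def \<kappa>_def)
  moreover have "?G 0 \<le> (\<Sum>n\<in>level K. (\<Sum>x\<in>UNIV. exp (real (n x) / \<kappa>\<^sub>0)) * (cmod (g n))\<^sup>2)
      + real CARD('s) / 8 * (\<Sum>n\<in>level K. (cmod (g n))\<^sup>2)"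
    unfolding sum_distrib_left sum.distrib[symmetric]
  proof (rule sum_mono)
    fix n
    have "F 0 n \<le> (\<Sum>x\<in>UNIV. exp (real (n x) / \<kappa>\<^sub>0)) + real CARD('s) / 8"
      using \<kappa> by (simp add: F_def \<kappa>_def field_simps)
    from mult_right_mono[OF this, of "(cmod (g n))\<^sup>2"]
    show "F 0 n * (cmod (evol 0 g n))\<^sup>2 \<le> (\<Sum>x\<in>UNIV. exp (real (n x) / \<kappa>\<^sub>0)) * (cmod (g n))\<^sup>2 + real CARD('s) / 8 * (cmod (g n))\<^sup>2"
      by (simp add: evol_0 distrib_right)
  qed
  ultimately show ?thesis by linarith
qed

end

context mean_field
begin

text \<open>The argument of \<open>level_exp_moment\<close> on one site. Here hopping is multiplied
  by the order parameter, whose bound \<open>m\<close> enters \<open>C\<close>.\<close>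

lemma exp_moment:
  assumes \<kappa>: "\<kappa>\<^sub>0 \<ge> 4" and C: "C = 2 * exp 1 * \<bar>J\<bar> * m" and m: "m \<ge> 1" "norm (a 0) \<le> m" and t: "t \<ge> 0"
    and init: "((\<lambda>n. exp (real n / \<kappa>\<^sub>0) * (cmod (f 0 n))\<^sup>2) has_sum E0) UNIV"
  shows "(\<Sum>n\<le>M. exp (real n / (\<kappa>\<^sub>0 * exp (C * t))) * (cmod (f t n))\<^sup>2) \<le> E0 + 1 / 8"
proof -
  define \<kappa> where "\<kappa> t = \<kappa>\<^sub>0 * exp (C * t)" for t
  have \<kappa>0: "\<kappa>\<^sub>0 > 0" using \<kappa> by simp
  have C0: "C \<ge> 0" using m by (simp add: C)
  define X where "X t n = exp (real n / \<kappa> t)" for t n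
  define X' where "X' t n = - (C / \<kappa> t) * (real n * X t n)" for t n
  have X: "((\<lambda>t. X t n) has_real_derivative X' t n) (at t)" for t n
    unfolding X_def X'_def \<kappa>_def by (rule DERIV_exp_moment[OF \<kappa>0])
  \<comment> \<open>As the total probability is 1, this is the moment with the weight frozen at
    \<open>X t M\<close> above level \<open>M\<close>, plus the compensating term; freezing the
    weight removes the boundary current.\<close>
  define G where "G t = (\<Sum>n\<le>M. (X t n - X t M) * (cmod (f t n))\<^sup>2) + X t M + 1 / (2 * \<kappa> t)" for t
  define G' where "G' t = (\<Sum>n\<le>M. (X' t n - X' t M) * (cmod (f t n))\<^sup>2)
      + 2 * J * ((\<Sum>n<M. ((X t (Suc n) - X t M) - (X t n - X t M)) * cur t n) - (X t M - X t M) * cur t M)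
      + X' t M + - (C / \<kappa> t) * (1 / 2)" for t
  have part: "(\<Sum>n\<le>M. (cmod (f s n))\<^sup>2) \<le> 1" if "s \<ge> 0" for s
    using sum_cmod_le_norm[of "{..M}" "\<phi> s"] norm_phi[OF that] by simp
  have "G t \<le> G 0"
  proof (rule DERIV_nonpos_imp_nonincreasing[OF t])
    fix s :: real assume s: "0 \<le> s" "s \<le> t"
    have \<kappa>s: "\<kappa> s \<ge> 4"
      using \<kappa> mult_mono[of 4 "\<kappa>\<^sub>0" 1 "exp (C * s)"] s C0 by (simp add: \<kappa>_def)
    have X0: "X s n \<ge> 0" for n by (simp add: X_def)
    have Xinc: "X s n \<le> X s (Suc n)" for n using \<kappa>s by (simp add: X_def divide_right_mono)
    have E1: "X s (Suc n) = X s n * exp (1 / \<kappa> s)" for n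
      unfolding X_def by (simp add: add_divide_distrib flip: exp_add)
    have Xconv: "X s (Suc n) - X s n \<le> X s (Suc (Suc n)) - X s (Suc n)" for n
    proof -
      have "X s n * (exp (1 / \<kappa> s) - 1) \<le> X s (Suc n) * (exp (1 / \<kappa> s) - 1)"
        using \<kappa>s by (intro mult_right_mono Xinc) auto
      then show ?thesis unfolding E1[of n] E1[of "Suc n"] by (simp add: algebra_simps)
    qed
    define g where "g n = (real n + 1) * (X s (Suc n) - X s n)" for n
    have g0: "g n \<ge> 0" for n using Xinc[of n] by (simp add: g_def)
    have ginc: "g n \<le> g (Suc n)" for n
      unfolding g_def using Xconv[of n] Xinc[of n] Xinc[of "Suc n"] by (intro mult_mono) auto
    have opm: "cmod (op s) \<le> m"
    proof -
      have "cmod (op s) \<le> norm (\<phi> s) * norm (a s)" unfolding op_eq by (rule cinner_Cauchy_Schwarz)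
      then show ?thesis using m(2) norm_phi[OF s(1)] norm_a[OF s(1)] by simp
    qed
    have cur: "(X s (Suc n) - X s n) * \<bar>cur s n\<bar> \<le> m * (g n * ((cmod (f s n))\<^sup>2 / 2) + g n * ((cmod (f s (Suc n)))\<^sup>2 / 2))" for n
    proof -
      have "\<bar>cur s n\<bar> \<le> cmod (op s) * sqrt (real n + 1) * (cmod (f s n) * cmod (f s (Suc n)))"
        unfolding cur_def by (rule order_trans[OF abs_Im_le_cmod]) (simp add: norm_mult)
      also have "\<dots> \<le> m * (real n + 1) * ((cmod (f s n))\<^sup>2 / 2 + (cmod (f s (Suc n)))\<^sup>2 / 2)"
      proof (intro mult_mono opm)
        show "sqrt (real n + 1) \<le> real n + 1" by (rule real_le_lsqrt) (auto simp: power2_eq_square)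
        show "cmod (f s n) * cmod (f s (Suc n)) \<le> (cmod (f s n))\<^sup>2 / 2 + (cmod (f s (Suc n)))\<^sup>2 / 2"
          using sum_squares_bound[of "cmod (f s n)" "cmod (f s (Suc n))"] by simp
      qed (use m in auto)
      finally have "(X s (Suc n) - X s n) * \<bar>cur s n\<bar> \<le> (X s (Suc n) - X s n) * (m * (real n + 1) * ((cmod (f s n))\<^sup>2 / 2 + (cmod (f s (Suc n)))\<^sup>2 / 2))"
        using Xinc[of n] by (intro mult_left_mono) auto
      also have "\<dots> = m * (g n * ((cmod (f s n))\<^sup>2 / 2) + g n * ((cmod (f s (Suc n)))\<^sup>2 / 2))"
      proof -
        have "d * (m * r * (x + y)) = m * (r * d * x + r * d * y)" for d r x y :: real
          by (simp add: algebra_simps)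
        then show ?thesis unfolding g_def by (simp only:)
      qed
      finally show ?thesis .
    qed
    have "\<bar>2 * J * (\<Sum>n<M. (X s (Suc n) - X s n) * cur s n)\<bar> \<le> 2 * \<bar>J\<bar> * (\<Sum>n<M. (X s (Suc n) - X s n) * \<bar>cur s n\<bar>)"
      unfolding abs_mult
      by (intro mult_mono order_trans[OF sum_abs] sum_mono) (auto simp: abs_mult Xinc)
    also have "\<dots> \<le> 2 * \<bar>J\<bar> * (\<Sum>n<M. m * (g n * ((cmod (f s n))\<^sup>2 / 2) + g n * ((cmod (f s (Suc n)))\<^sup>2 / 2)))"
      by (intro mult_left_mono sum_mono cur) auto
    also have "\<dots> = 2 * \<bar>J\<bar> * m * ((\<Sum>n<M. g n * ((cmod (f s n))\<^sup>2 / 2)) + (\<Sum>n<M. g n * ((cmod (f s (Suc n)))\<^sup>2 / 2)))"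
      by (simp only: sum_distrib_left[symmetric] sum.distrib mult.assoc)
    also have "\<dots> \<le> 2 * \<bar>J\<bar> * m * ((\<Sum>n\<le>M. g n * ((cmod (f s n))\<^sup>2 / 2)) + (\<Sum>n\<le>M. g n * ((cmod (f s n))\<^sup>2 / 2)))"
    proof (intro mult_left_mono add_mono)
      show "(\<Sum>n<M. g n * ((cmod (f s n))\<^sup>2 / 2)) \<le> (\<Sum>n\<le>M. g n * ((cmod (f s n))\<^sup>2 / 2))"
        by (intro sum_mono2) (auto simp: g0)
      have "(\<Sum>n<M. g n * ((cmod (f s (Suc n)))\<^sup>2 / 2)) \<le> (\<Sum>n<M. g (Suc n) * ((cmod (f s (Suc n)))\<^sup>2 / 2))"
        by (intro sum_mono mult_right_mono ginc) auto
      also have "\<dots> = (\<Sum>n\<in>{1..M}. g n * ((cmod (f s n))\<^sup>2 / 2))"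
        by (rule sum.reindex_bij_witness[where i = "\<lambda>n. n - 1" and j = Suc]) auto
      also have "\<dots> \<le> (\<Sum>n\<le>M. g n * ((cmod (f s n))\<^sup>2 / 2))"
        by (intro sum_mono2) (auto simp: g0)
      finally show "(\<Sum>n<M. g n * ((cmod (f s (Suc n)))\<^sup>2 / 2)) \<le> (\<Sum>n\<le>M. g n * ((cmod (f s n))\<^sup>2 / 2))" .
    qed (use m in auto)
    also have "\<dots> = 2 * \<bar>J\<bar> * m * (\<Sum>n\<le>M. g n * (cmod (f s n))\<^sup>2)"
      by (simp flip: sum_divide_distrib)
    also have "\<dots> \<le> 2 * \<bar>J\<bar> * m * (\<Sum>n\<le>M. exp 1 / \<kappa> s * (real n * X s n + 1 / 2) * (cmod (f s n))\<^sup>2)"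
      using m unfolding g_def X_def by (intro mult_left_mono sum_mono mult_right_mono exp_growth_step \<kappa>s) auto
    also have "\<dots> = C / \<kappa> s * (\<Sum>n\<le>M. (real n * X s n + 1 / 2) * (cmod (f s n))\<^sup>2)"
    proof -
      have "(\<Sum>n\<le>M. exp 1 / \<kappa> s * (real n * X s n + 1 / 2) * (cmod (f s n))\<^sup>2)
          = exp 1 / \<kappa> s * (\<Sum>n\<le>M. (real n * X s n + 1 / 2) * (cmod (f s n))\<^sup>2)"
        by (simp only: sum_distrib_left[symmetric] mult.assoc)
      then show ?thesis unfolding C by (simp only:) simp
    qed
    also have "\<dots> = C / \<kappa> s * (1 / 2) * (\<Sum>n\<le>M. (cmod (f s n))\<^sup>2) - (\<Sum>n\<le>M. X' s n * (cmod (f s n))\<^sup>2)"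
      unfolding X'_def by (simp add: distrib_right sum.distrib sum_distrib_left sum_negf algebra_simps)
    finally have hop: "\<bar>2 * J * (\<Sum>n<M. (X s (Suc n) - X s n) * cur s n)\<bar>
      \<le> C / \<kappa> s * (1 / 2) * (\<Sum>n\<le>M. (cmod (f s n))\<^sup>2) - (\<Sum>n\<le>M. X' s n * (cmod (f s n))\<^sup>2)" .
    have "C / \<kappa> s * (1 / 2) * (\<Sum>n\<le>M. (cmod (f s n))\<^sup>2) \<le> C / \<kappa> s * (1 / 2) * 1"
      using C0 \<kappa>s by (intro mult_left_mono part s) auto
    moreover have "X' s M * (1 - (\<Sum>n\<le>M. (cmod (f s n))\<^sup>2)) \<le> 0"
      using part[OF s(1)] C0 \<kappa>s X0 by (intro mult_nonpos_nonneg) (auto simp: X'_def)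
    moreover have "G' s = (\<Sum>n\<le>M. X' s n * (cmod (f s n))\<^sup>2) + X' s M * (1 - (\<Sum>n\<le>M. (cmod (f s n))\<^sup>2))
        + 2 * J * (\<Sum>n<M. (X s (Suc n) - X s n) * cur s n) - C / \<kappa> s * (1 / 2)"
      unfolding G'_def by (simp add: left_diff_distrib sum_subtractf sum_distrib_left algebra_simps)
    ultimately have "G' s \<le> 0" using hop by linarith
    moreover have "(G has_real_derivative G' s) (at s)"
      unfolding G_def[abs_def] G'_def \<kappa>_def
      by (intro DERIV_add deriv_partial_moment[where F = "\<lambda>t n. X t n - X t M"] DERIV_diff X DERIV_inverse_scale \<kappa>0)
    ultimately show "\<exists>y. (G has_real_derivative y) (at s) \<and> y \<le> 0" by blast
  qed
  moreover have split: "G s = (\<Sum>n\<le>M. X s n * (cmod (f s n))\<^sup>2) + X s M * (1 - (\<Sum>n\<le>M. (cmod (f s n))\<^sup>2)) + 1 / (2 * \<kappa> s)" for s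
    unfolding G_def by (simp add: left_diff_distrib sum_subtractf sum_distrib_left algebra_simps)
  have "(\<Sum>n\<le>M. X t n * (cmod (f t n))\<^sup>2) \<le> G t"
    using part[OF t] \<kappa>0 by (simp add: split X_def \<kappa>_def)
  moreover have "G 0 \<le> E0 + 1 / 8"
  proof -
    have "(\<Sum>n\<le>M. X 0 n * (cmod (f 0 n))\<^sup>2) + X 0 M * (1 - (\<Sum>n\<le>M. (cmod (f 0 n))\<^sup>2)) \<le> E0"
    proof -
      have "((\<lambda>n. (cmod (f 0 n))\<^sup>2) has_sum (1 - (\<Sum>n\<le>M. (cmod (f 0 n))\<^sup>2))) (UNIV - {..M})"
        using has_sum_Diff[OF norm_sq_has_sum[of "\<phi> 0"] has_sum_finite[of "{..M}"]] norm_0 by simp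
      then have "((\<lambda>n. X 0 M * (cmod (f 0 n))\<^sup>2) has_sum (X 0 M * (1 - (\<Sum>n\<le>M. (cmod (f 0 n))\<^sup>2)))) (UNIV - {..M})"
        by (rule has_sum_cmult_right)
      moreover have "((\<lambda>n. X 0 n * (cmod (f 0 n))\<^sup>2) has_sum (E0 - (\<Sum>n\<le>M. X 0 n * (cmod (f 0 n))\<^sup>2))) (UNIV - {..M})"
        using has_sum_Diff[OF init has_sum_finite[of "{..M}"]] by (simp add: X_def \<kappa>_def)
      ultimately have "X 0 M * (1 - (\<Sum>n\<le>M. (cmod (f 0 n))\<^sup>2)) \<le> E0 - (\<Sum>n\<le>M. X 0 n * (cmod (f 0 n))\<^sup>2)"
        by (rule has_sum_mono) (use \<kappa>0 in \<open>auto intro!: mult_right_mono simp: X_def \<kappa>_def divide_right_mono\<close>)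
      then show ?thesis by simp
    qed
    moreover have "1 / (2 * \<kappa> 0) \<le> 1 / 8" using \<kappa> by (simp add: \<kappa>_def)
    ultimately show ?thesis unfolding split by linarith
  qed
  ultimately show ?thesis by (simp add: X_def \<kappa>_def)
qed

end


section \<open>Differential inequality for the excitations of one vector\<close>

section \<open>Gronwall estimate for a single vector\<close>

locale dynamics = lattice E j v k + mean_field J \<mu> V \<phi>
  for E :: "('s::finite \<times> 's) set" and j v k J \<mu> V \<phi> +
  assumes J_eq: "J = j * real k" and v_eq: "v = onsite J \<mu> V" and k_pos: "k > 0"
begin

definition "nu = (norm (a 0))\<^sup>2"

text \<open>For a unit vector this is the number of sites times the quantity of the Gronwall
  estimate. In this form it is continuous in \<open>\<Psi>\<close> and can be summed over a
  mixture.\<close>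

definition excitation :: "real \<Rightarrow> ('s \<Rightarrow> nat) ell2 \<Rightarrow> real" where
  "excitation s \<Psi> = (\<Sum>x\<in>UNIV. (norm \<Psi>)\<^sup>2 - Re (cinner \<Psi> (site_ketbra x (\<phi> s) (\<phi> s) \<Psi>)))"

lemma nu_nonneg: "nu \<ge> 0" by (simp add: nu_def)

lemma finsup_level:
  assumes "\<And>n. n \<notin> level K \<Longrightarrow> coords \<Psi> n = 0" shows "finsup \<Psi>"
  unfolding finsup_def by (rule finite_subset[OF _ finite_level[of K]]) (use assms in auto)

text \<open>The degree \<open>k\<close> combines with \<open>j\<close> to \<open>J\<close>; it
  remains only under the pair creation term, where it yields an error of order 1/k.\<close>

lemma excitation_derivative_bound:
  assumes s: "s \<ge> 0" and \<Psi>: "\<And>n. n \<notin> level K \<Longrightarrow> coords \<Psi> n = 0" and M: "M \<ge> 0" and \<sigma>: "\<sigma> > 0"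
    and T: "\<And>z. ((\<lambda>n. if real (n z) > M then real (n z) * (cmod (coords (U s \<Psi>) n))\<^sup>2 else 0) has_sum T z) UNIV"
    and \<tau>: "((\<lambda>n. if real n > M then real n * (cmod (f s n))\<^sup>2 else 0) has_sum \<tau>) UNIV"
  shows "\<exists>d. ((\<lambda>s. excitation s (U s \<Psi>)) has_real_derivative d) (at s) \<and>
    d \<le> 4 * \<bar>J\<bar> * sqrt (nu + 1) * ((2 * sqrt nu + sqrt M + \<sigma>) * excitation s (U s \<Psi>)
      + sqrt nu * real CARD('s) * (norm \<Psi>)\<^sup>2 / (2 * real k)
      + ((\<Sum>z\<in>UNIV. T z) + real CARD('s) * \<tau> * (norm \<Psi>)\<^sup>2) / (2 * \<sigma>))"
proof -
  interpret M: lattice_mean_field E j v k "\<phi> s" "a s" "c s"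
    by unfold_locales (use norm_phi[OF s] coords_a coords_c in auto)
  have \<nu>: "M.\<nu> = nu" by (simp add: M.\<nu>_def nu_def norm_a[OF s])
  have \<alpha>: "M.\<alpha> = op s" by (simp add: M.\<alpha>_def op_eq)
  define \<Phi> where "\<Phi> = U s \<Psi>"
  have supp: "n \<notin> level K \<Longrightarrow> coords \<Phi> n = 0" for n
    unfolding \<Phi>_def coords_U by (rule evol_support[OF \<Psi>])
  have fin: "finsup \<Phi>" by (rule finsup_level[OF supp])
  have \<Phi>N: "norm \<Phi> = norm \<Psi>" by (simp add: \<Phi>_def)
  let ?D = "\<lambda>x. - 2 * j * (\<Sum>z | (x, z) \<in> E. Im (cinner (site_ketbra x M.u (\<phi> s) \<Phi>) (M.fluct z \<Phi>))
        - Im (cinner (site_ketbra x (\<phi> s) M.w \<Phi>) (M.fluct z \<Phi>)))"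
  have d: "((\<lambda>s. Re (cinner (U s \<Psi>) (site_ketbra x (\<phi> s) (\<phi> s) (U s \<Psi>)))) has_real_derivative ?D x) (at s)" for x
    unfolding \<Phi>_def
  proof (rule M.proj_derivative[OF J_eq _ refl deriv])
    show "coords (h s) n = - of_real J * (M.\<alpha> * creation (coords (\<phi> s)) n + cnj M.\<alpha> * annihilation (coords (\<phi> s)) n
        - of_real ((cmod M.\<alpha>)\<^sup>2) * f s n) + of_real (v n) * f s n" for n
      unfolding \<alpha> v_eq by (rule coords_h)
    show "finsup (U s \<Psi>)" using fin by (simp add: \<Phi>_def)
    show "((\<lambda>s. U s \<Psi>) has_vector_derivative - \<i> *\<^sub>C M.HV (U s \<Psi>)) (at s)"
      by (rule U_has_vector_derivative[OF \<Psi>]) (use fin in \<open>simp_all add: M.coords_HV \<Phi>_def coords_U\<close>)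
  qed
  let ?q = "\<lambda>z. norm (M.excited z \<Phi>)" and ?G = "\<lambda>z. norm (M.fluct z \<Phi> - site_ketbra z M.u (\<phi> s) \<Phi>)"
  have S: "excitation s \<Phi> = (\<Sum>x\<in>UNIV. (?q x)\<^sup>2)"
    unfolding excitation_def by (simp add: M.norm_sq_excited M.proj_def)
  have "((\<lambda>s. excitation s (U s \<Psi>)) has_real_derivative (\<Sum>x\<in>UNIV. 0 - ?D x)) (at s)"
    unfolding excitation_def norm_U by (intro DERIV_sum DERIV_diff DERIV_const d)
  moreover have "(\<Sum>x\<in>UNIV. 0 - ?D x) \<le> 4 * \<bar>J\<bar> * sqrt (nu + 1) * ((2 * sqrt nu + sqrt M + \<sigma>) * excitation s \<Phi>
      + sqrt nu * real CARD('s) * (norm \<Psi>)\<^sup>2 / (2 * real k)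
      + ((\<Sum>z\<in>UNIV. T z) + real CARD('s) * \<tau> * (norm \<Psi>)\<^sup>2) / (2 * \<sigma>))"
  proof -
    let ?X = "\<Sum>(x, z)\<in>E. Im (cinner (site_ketbra x M.u (\<phi> s) \<Phi>) (M.fluct z \<Phi>)) - Im (cinner (site_ketbra x (\<phi> s) M.w \<Phi>) (M.fluct z \<Phi>))"
    have "(\<Sum>x\<in>UNIV. 0 - ?D x) = 2 * j * ?X"
      unfolding sum_regular_graph(3)[OF E_sym E_deg] sum_distrib_left[of _ _ UNIV] by (intro sum.cong refl) simp
    also have "\<dots> \<le> 2 * \<bar>j\<bar> * \<bar>?X\<bar>"
      using abs_ge_self[of "2 * j * ?X"] by (simp add: abs_mult)
    also have "\<dots> \<le> 2 * \<bar>j\<bar> * (2 * sqrt nu * sqrt (nu + 1) * (real k * excitation s \<Phi> + real CARD('s) * (norm \<Psi>)\<^sup>2 / 2)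
      + 2 * sqrt (nu + 1) * real k * (\<Sum>z\<in>UNIV. ?q z * ?G z))"
      using M.interaction_bound[OF E_sym E_irrefl E_deg fin] unfolding \<nu> S \<Phi>N by (intro mult_left_mono) auto
    also have "\<dots> = 4 * (\<bar>j\<bar> * real k) * sqrt (nu + 1) * (sqrt nu * (excitation s \<Phi> + real CARD('s) * (norm \<Psi>)\<^sup>2 / (2 * real k)) + (\<Sum>z\<in>UNIV. ?q z * ?G z))"
      using k_pos by (simp add: field_simps)
    also have "\<bar>j\<bar> * real k = \<bar>J\<bar>" by (simp add: J_eq abs_mult)
    also have "4 * \<bar>J\<bar> * sqrt (nu + 1) * (sqrt nu * (excitation s \<Phi> + real CARD('s) * (norm \<Psi>)\<^sup>2 / (2 * real k)) + (\<Sum>z\<in>UNIV. ?q z * ?G z))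
      \<le> 4 * \<bar>J\<bar> * sqrt (nu + 1) * ((2 * sqrt nu + sqrt M + \<sigma>) * excitation s \<Phi>
      + sqrt nu * real CARD('s) * (norm \<Psi>)\<^sup>2 / (2 * real k)
      + ((\<Sum>z\<in>UNIV. T z) + real CARD('s) * \<tau> * (norm \<Psi>)\<^sup>2) / (2 * \<sigma>))"
    proof (rule mult_left_mono)
      have \<tau>0: "\<tau> \<ge> 0" by (rule has_sum_nonneg[OF \<tau>]) auto
      define th where "th = Abs_ell2 (\<lambda>n. if real n > M then of_real (sqrt (real n)) * f s n else 0)"
      have th2: "(cmod (if real n > M then of_real (sqrt (real n)) * f s n else 0))\<^sup>2 = (if real n > M then real n * (cmod (f s n))\<^sup>2 else 0)" for n
        by (simp add: norm_mult power_mult_distrib)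
      have "square_summable (\<lambda>n. if real n > M then of_real (sqrt (real n)) * f s n else 0)"
        unfolding square_summable_def th2 using \<tau> by (rule has_sum_imp_summable)
      then have th: "coords th n = (if real n > M then of_real (sqrt (real n)) * f s n else 0)" for n
        by (simp add: th_def coords_Abs)
      have "((\<lambda>n. if real n > M then real n * (cmod (f s n))\<^sup>2 else 0) has_sum (norm th)\<^sup>2) UNIV"
        using norm_sq_has_sum[of th] unfolding th th2 .
      then have thn: "(norm th)\<^sup>2 = \<tau>" using \<tau> has_sum_unique by blast
      have qG: "?q z * ?G z \<le> (sqrt nu + sqrt M + \<sigma>) * (?q z)\<^sup>2 + (T z + \<tau> * (norm \<Psi>)\<^sup>2) / (2 * \<sigma>)" for z
      proof -
        define B where "B = 2 * T z + 2 * \<tau> * (norm \<Psi>)\<^sup>2"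
        have "T z \<ge> 0" by (rule has_sum_nonneg[OF T]) auto
        then have B: "B \<ge> 0" using \<tau>0 by (simp add: B_def)
        have "?G z \<le> (sqrt nu + sqrt M) * ?q z + sqrt B"
          using M.fluct_excited_bound[OF fin M th T[folded \<Phi>_def], of z] unfolding \<nu> thn \<Phi>N B_def .
        then have "?q z * ?G z \<le> ?q z * ((sqrt nu + sqrt M) * ?q z + sqrt B)" by (rule mult_left_mono) simp
        also have "\<dots> = (sqrt nu + sqrt M) * (?q z)\<^sup>2 + ?q z * sqrt B" by (simp add: power2_eq_square algebra_simps)
        \<comment> \<open>Young's inequality with weight \<sigma>: the tail enters the source
          divided by \<sigma>, at the price of \<sigma> in the rate.\<close>
        also have "?q z * sqrt B \<le> \<sigma> * (?q z)\<^sup>2 + B / (4 * \<sigma>)"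
        proof -
          have "2 * (sqrt \<sigma> * ?q z) * (sqrt B / (2 * sqrt \<sigma>)) \<le> (sqrt \<sigma> * ?q z)\<^sup>2 + (sqrt B / (2 * sqrt \<sigma>))\<^sup>2"
            by (rule sum_squares_bound)
          then show ?thesis using \<sigma> B by (simp add: power_mult_distrib power_divide)
        qed
        also have "B / (4 * \<sigma>) = (T z + \<tau> * (norm \<Psi>)\<^sup>2) / (2 * \<sigma>)" using \<sigma> by (simp add: B_def field_simps)
        finally show ?thesis by (simp add: algebra_simps)
      qed
      have "(\<Sum>z\<in>UNIV. ?q z * ?G z) \<le> (\<Sum>z\<in>UNIV. (sqrt nu + sqrt M + \<sigma>) * (?q z)\<^sup>2 + (T z + \<tau> * (norm \<Psi>)\<^sup>2) / (2 * \<sigma>))"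
        by (intro sum_mono qG)
      also have "\<dots> = (sqrt nu + sqrt M + \<sigma>) * excitation s \<Phi> + ((\<Sum>z\<in>UNIV. T z) + real CARD('s) * \<tau> * (norm \<Psi>)\<^sup>2) / (2 * \<sigma>)"
        unfolding S sum_distrib_left by (simp add: sum.distrib sum_distrib_left sum_divide_distrib[symmetric])
      finally show "sqrt nu * (excitation s \<Phi> + real CARD('s) * (norm \<Psi>)\<^sup>2 / (2 * real k)) + (\<Sum>z\<in>UNIV. ?q z * ?G z)
        \<le> (2 * sqrt nu + sqrt M + \<sigma>) * excitation s \<Phi> + sqrt nu * real CARD('s) * (norm \<Psi>)\<^sup>2 / (2 * real k)
          + ((\<Sum>z\<in>UNIV. T z) + real CARD('s) * \<tau> * (norm \<Psi>)\<^sup>2) / (2 * \<sigma>)"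
        by (simp add: algebra_simps)
    qed (use nu_nonneg in auto)
    finally show ?thesis .
  qed
  ultimately show ?thesis unfolding \<Phi>_def by blast
qed

text \<open>One quarter of the exponent of \<open>exp (x / \<kappa>)\<close> absorbs the factor
  \<open>x\<close>, the other three quarters give the decay at the cut-off. Passing to the larger
  \<open>\<kappa>'\<close> lets one constant serve all times up to the final one.\<close>

lemma tail_weight:
  fixes M x \<kappa> \<kappa>' :: real
  assumes "x > M" "M \<ge> 0" "0 < \<kappa>" "\<kappa> \<le> \<kappa>'"
  shows "x \<le> 4 * \<kappa>' / exp 1 * exp (- (3 * M / (4 * \<kappa>'))) * exp (x / \<kappa>)"
proof -
  define y where "y = x / (4 * \<kappa>)"
  have "y \<le> exp (y - 1)" using exp_ge_add_one_self[of "y - 1"] by simp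
  then have "x \<le> 4 * \<kappa> * exp (y - 1)" using assms by (simp add: y_def field_simps)
  also have "\<dots> = 4 * \<kappa> / exp 1 * exp y" by (simp add: exp_diff)
  also have "\<dots> \<le> 4 * \<kappa>' / exp 1 * (exp (- (3 * M / (4 * \<kappa>'))) * exp (x / \<kappa>))"
  proof (intro mult_mono)
    have "3 * M / (4 * \<kappa>') \<le> 3 * M / (4 * \<kappa>)" using assms by (intro divide_left_mono) auto
    also have "\<dots> \<le> 3 * x / (4 * \<kappa>)" using assms by (intro divide_right_mono) auto
    finally have "y \<le> - (3 * M / (4 * \<kappa>')) + x / \<kappa>" using assms by (simp add: y_def field_simps)
    then show "exp y \<le> exp (- (3 * M / (4 * \<kappa>'))) * exp (x / \<kappa>)" by (simp flip: exp_add)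
    show "4 * \<kappa> / exp 1 \<le> 4 * \<kappa>' / exp 1" using assms by (intro divide_right_mono) auto
  qed (use assms in auto)
  finally show ?thesis by (simp add: mult.assoc)
qed

lemma gronwall_exp:
  fixes S :: "real \<Rightarrow> real"
  assumes "t \<ge> 0" "\<And>s. 0 \<le> s \<Longrightarrow> s \<le> t \<Longrightarrow> \<exists>d. (S has_real_derivative d) (at s) \<and> d \<le> A * (S s + X)"
  shows "S t + X \<le> (S 0 + X) * exp (A * t)"
proof -
  let ?G = "\<lambda>s. (S s + X) * exp (- (A * s))"
  have "?G t \<le> ?G 0"
  proof (rule DERIV_nonpos_imp_nonincreasing[OF assms(1)])
    fix s assume "0 \<le> s" "s \<le> t"
    then obtain d where d: "(S has_real_derivative d) (at s)" "d \<le> A * (S s + X)" using assms(2) by blast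
    have "(?G has_real_derivative (d - A * (S s + X)) * exp (- (A * s))) (at s)"
      by (auto intro!: derivative_eq_intros d(1) simp: algebra_simps)
    moreover have "(d - A * (S s + X)) * exp (- (A * s)) \<le> 0"
      using d(2) by (intro mult_nonpos_nonneg) auto
    ultimately show "\<exists>y. (?G has_real_derivative y) (at s) \<and> y \<le> 0" by blast
  qed
  then have "?G t * exp (A * t) \<le> ?G 0 * exp (A * t)" by (rule mult_right_mono) simp
  then show ?thesis by (simp add: mult.assoc flip: exp_add)
qed

text \<open>Here \<open>M\<close> is the cut-off of the occupation numbers and \<open>\<sigma>\<close> the weight in the Young inequality
  for the part beyond the cut-off.\<close>

definition growth :: "real \<Rightarrow> real \<Rightarrow> real" where
  "growth M \<sigma> = 4 * \<bar>J\<bar> * sqrt (nu + 1) * (2 * sqrt nu + sqrt M + \<sigma>)"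

text \<open>The factor of \<open>tail_weight\<close>: times an exponential moment of scale at most
  \<kappa>, it bounds the particle number beyond \<open>M\<close>.\<close>

definition tail_factor :: "real \<Rightarrow> real \<Rightarrow> real" where
  "tail_factor \<kappa> M = 4 * \<kappa> / exp 1 * exp (- (3 * M / (4 * \<kappa>)))"

text \<open>The inhomogeneity of the Gronwall inequality divided by its rate; \<open>m\<close>
  stands for the exponential moment and \<open>N\<close> for the squared norm of the vector. It is
  jointly linear in \<open>m\<close> and \<open>N\<close>, which permits summation over a
  mixture.\<close>

definition source :: "real \<Rightarrow> real \<Rightarrow> real \<Rightarrow> real \<Rightarrow> real \<Rightarrow> real \<Rightarrow> real" where
  "source \<kappa> M \<sigma> E0 m N = (sqrt nu * real CARD('s) * N / (2 * real k)
     + tail_factor \<kappa> M * (m + real CARD('s) / 8 * N + real CARD('s) * (E0 + 1 / 8) * N) / (2 * \<sigma>))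
     / (2 * sqrt nu + sqrt M + \<sigma>)"

text \<open>Cut-off and tail factor belong to the final time \<open>t\<close>; since the scale
  increases they remain valid at every earlier \<open>s\<close>, and the rate is constant.
  \<open>m\<close> and \<open>N\<close> are upper bounds, so that one choice serves all truncations
  of a vector.\<close>

lemma excitation_growth_level:
  assumes \<kappa>: "\<kappa>\<^sub>0 \<ge> 4" and C: "C = 2 * exp 1 * \<bar>J\<bar> * max nu 1" and t: "t \<ge> 0" and M: "M \<ge> 0" and \<sigma>: "\<sigma> > 0"
    and init: "((\<lambda>n. exp (real n / \<kappa>\<^sub>0) * (cmod (f 0 n))\<^sup>2) has_sum E0) UNIV"
    and \<Psi>: "\<And>n. n \<notin> level K \<Longrightarrow> coords \<Psi> n = 0"
    and m: "(\<Sum>n\<in>level K. (\<Sum>x\<in>UNIV. exp (real (n x) / \<kappa>\<^sub>0)) * (cmod (coords \<Psi> n))\<^sup>2) \<le> m"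
    and N: "(norm \<Psi>)\<^sup>2 \<le> N"
  defines "X \<equiv> source (\<kappa>\<^sub>0 * exp (C * t)) M \<sigma> E0 m N"
  shows "excitation t (U t \<Psi>) + X \<le> (excitation 0 \<Psi> + X) * exp (growth M \<sigma> * t)"
proof -
  define \<kappa> where "\<kappa> t = \<kappa>\<^sub>0 * exp (C * t)" for t
  define \<theta> where "\<theta> = tail_factor (\<kappa> t) M"
  define W where "W = m + real CARD('s) / 8 * N + real CARD('s) * (E0 + 1 / 8) * N"
  have \<kappa>0: "\<kappa>\<^sub>0 > 0" using \<kappa> by simp
  have C0: "C \<ge> 0" by (simp add: C)
  have \<theta>0: "\<theta> \<ge> 0" using \<kappa>0 by (simp add: \<theta>_def tail_factor_def \<kappa>_def)
  have E0: "E0 \<ge> 0" by (rule has_sum_nonneg[OF init]) auto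
  \<comment> \<open>The maximum in \<open>C\<close> covers both this bound on the order parameter
    and the factor 1 required by \<open>level_exp_moment\<close>.\<close>
  have m1: "norm (a 0) \<le> max nu 1"
  proof (cases "norm (a 0) \<le> 1")
    case False
    then have "norm (a 0) \<le> norm (a 0) * norm (a 0)"
      using mult_left_mono[of 1 "norm (a 0)" "norm (a 0)"] by simp
    then show ?thesis by (simp add: nu_def power2_eq_square)
  qed simp
  define D where "D = 2 * sqrt nu + sqrt M + \<sigma>"
  have D: "D > 0" using nu_nonneg M \<sigma> unfolding D_def by (simp add: add_nonneg_pos)
  define Y where "Y = sqrt nu * real CARD('s) * N / (2 * real k) + \<theta> * W / (2 * \<sigma>)"
  have X: "X = Y / D" by (simp add: X_def source_def Y_def D_def \<theta>_def W_def \<kappa>_def)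
  have "excitation t (U t \<Psi>) + X \<le> (excitation 0 (U 0 \<Psi>) + X) * exp (growth M \<sigma> * t)"
  proof (rule gronwall_exp[OF t, where S = "\<lambda>t. excitation t (U t \<Psi>)"])
    fix s assume s: "0 \<le> s" "s \<le> t"
    have \<kappa>s: "0 < \<kappa> s" "\<kappa> s \<le> \<kappa> t"
      using \<kappa>0 s C0 by (auto simp: \<kappa>_def intro!: mult_left_mono)
    have tw: "x \<le> \<theta> * exp (x / \<kappa> s)" if "x > M" for x
      using tail_weight[OF that M \<kappa>s] by (simp add: \<theta>_def tail_factor_def)
    define T where "T z = (\<Sum>n\<in>level K. if real (n z) > M then real (n z) * (cmod (coords (U s \<Psi>) n))\<^sup>2 else 0)" for z
    have supp: "n \<notin> level K \<Longrightarrow> coords (U s \<Psi>) n = 0" for n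
      unfolding coords_U by (rule evol_support[OF \<Psi>])
    have T: "((\<lambda>n. if real (n z) > M then real (n z) * (cmod (coords (U s \<Psi>) n))\<^sup>2 else 0) has_sum T z) UNIV" for z
      unfolding T_def
      by (rule has_sum_finite_neutralI) (auto simp: finite_level supp)
    have lev: "(\<Sum>n\<in>level K. (cmod (coords \<Psi> n))\<^sup>2) \<le> N"
      using sum_cmod_le_norm[OF finite_level, of \<Psi> K] N by simp
    have Tsum: "(\<Sum>z\<in>UNIV. T z) \<le> \<theta> * (m + real CARD('s) / 8 * N)"
    proof -
      have "(\<Sum>z\<in>UNIV. T z) \<le> (\<Sum>z\<in>UNIV. \<Sum>n\<in>level K. \<theta> * (exp (real (n z) / \<kappa> s) * (cmod (coords (U s \<Psi>) n))\<^sup>2))"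
        unfolding T_def
      proof (intro sum_mono)
        fix z n
        show "(if real (n z) > M then real (n z) * (cmod (coords (U s \<Psi>) n))\<^sup>2 else 0)
            \<le> \<theta> * (exp (real (n z) / \<kappa> s) * (cmod (coords (U s \<Psi>) n))\<^sup>2)"
          using mult_right_mono[OF tw[of "real (n z)"], of "(cmod (coords (U s \<Psi>) n))\<^sup>2"] \<theta>0 by (simp add: mult.assoc)
      qed
      also have "\<dots> = \<theta> * (\<Sum>n\<in>level K. (\<Sum>z\<in>UNIV. exp (real (n z) / \<kappa> s)) * (cmod (evol s (coords \<Psi>) n))\<^sup>2)"
        unfolding coords_U by (subst sum.swap) (simp add: sum_distrib_left sum_distrib_right)
      also have "\<dots> \<le> \<theta> * ((\<Sum>n\<in>level K. (\<Sum>x\<in>UNIV. exp (real (n x) / \<kappa>\<^sub>0)) * (cmod (coords \<Psi> n))\<^sup>2)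
          + real CARD('s) / 8 * (\<Sum>n\<in>level K. (cmod (coords \<Psi> n))\<^sup>2))"
        unfolding \<kappa>_def
      proof (intro mult_left_mono \<theta>0 level_exp_moment[OF \<kappa> _ s(1)])
        have "2 * exp 1 * \<bar>J\<bar> * 1 \<le> C" unfolding C by (intro mult_left_mono) auto
        then show "2 * exp 1 * (\<bar>j\<bar> * real k) \<le> C" by (simp add: J_eq abs_mult)
      qed
      also have "\<dots> \<le> \<theta> * (m + real CARD('s) / 8 * N)"
        by (intro mult_left_mono \<theta>0 add_mono m lev) auto
      finally show ?thesis .
    qed
    have fin: "(\<Sum>n\<in>F. if real n > M then real n * (cmod (f s n))\<^sup>2 else 0) \<le> \<theta> * (E0 + 1 / 8)" if "finite F" for F
    proof -
      obtain b where b: "F \<subseteq> {..b}" using \<open>finite F\<close> finite_nat_iff_bounded_le[of F] by blast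
      have "(\<Sum>n\<in>F. if real n > M then real n * (cmod (f s n))\<^sup>2 else 0) \<le> (\<Sum>n\<in>F. \<theta> * (exp (real n / \<kappa> s) * (cmod (f s n))\<^sup>2))"
      proof (intro sum_mono)
        fix n
        show "(if real n > M then real n * (cmod (f s n))\<^sup>2 else 0) \<le> \<theta> * (exp (real n / \<kappa> s) * (cmod (f s n))\<^sup>2)"
          using mult_right_mono[OF tw[of "real n"], of "(cmod (f s n))\<^sup>2"] \<theta>0 by (simp add: mult.assoc)
      qed
      also have "\<dots> \<le> (\<Sum>n\<le>b. \<theta> * (exp (real n / \<kappa> s) * (cmod (f s n))\<^sup>2))"
        by (intro sum_mono2 b) (auto simp: \<theta>0)
      also have "\<dots> = \<theta> * (\<Sum>n\<le>b. exp (real n / \<kappa> s) * (cmod (f s n))\<^sup>2)" by (simp add: sum_distrib_left)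
      also have "\<dots> \<le> \<theta> * (E0 + 1 / 8)"
        unfolding \<kappa>_def by (intro mult_left_mono \<theta>0 exp_moment[OF \<kappa> C _ m1 s(1) init]) simp
      finally show ?thesis .
    qed
    define \<tau> where "\<tau> = (\<Sum>\<^sub>\<infinity>n. if real n > M then real n * (cmod (f s n))\<^sup>2 else 0)"
    have \<tau>: "((\<lambda>n. if real n > M then real n * (cmod (f s n))\<^sup>2 else 0) has_sum \<tau>) UNIV"
      unfolding \<tau>_def
      by (rule has_sum_infsum, rule nonneg_bdd_above_summable_on) (use fin in \<open>auto intro!: bdd_aboveI2\<close>)
    have \<tau>le: "\<tau> \<le> \<theta> * (E0 + 1 / 8)"
      by (rule has_sum_le_finite_sums[OF \<tau>]) (use fin in auto)
    obtain d where d: "((\<lambda>s. excitation s (U s \<Psi>)) has_real_derivative d) (at s)"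
      "d \<le> 4 * \<bar>J\<bar> * sqrt (nu + 1) * (D * excitation s (U s \<Psi>)
        + sqrt nu * real CARD('s) * (norm \<Psi>)\<^sup>2 / (2 * real k)
        + ((\<Sum>z\<in>UNIV. T z) + real CARD('s) * \<tau> * (norm \<Psi>)\<^sup>2) / (2 * \<sigma>))"
      using excitation_derivative_bound[OF s(1) \<Psi> M \<sigma> T \<tau>] unfolding D_def by blast
    have "sqrt nu * real CARD('s) * (norm \<Psi>)\<^sup>2 / (2 * real k) + ((\<Sum>z\<in>UNIV. T z) + real CARD('s) * \<tau> * (norm \<Psi>)\<^sup>2) / (2 * \<sigma>) \<le> Y"
      unfolding Y_def
    proof (intro add_mono divide_right_mono)
      show "sqrt nu * real CARD('s) * (norm \<Psi>)\<^sup>2 \<le> sqrt nu * real CARD('s) * N"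
        using nu_nonneg by (intro mult_left_mono N) auto
      have "real CARD('s) * \<tau> * (norm \<Psi>)\<^sup>2 \<le> real CARD('s) * (\<theta> * (E0 + 1 / 8)) * N"
        using \<theta>0 E0 by (intro mult_mono \<tau>le N mult_left_mono) auto
      then show "(\<Sum>z\<in>UNIV. T z) + real CARD('s) * \<tau> * (norm \<Psi>)\<^sup>2 \<le> \<theta> * W"
        using Tsum by (simp add: W_def algebra_simps)
    qed (use \<sigma> in auto)
    then have "D * excitation s (U s \<Psi>) + sqrt nu * real CARD('s) * (norm \<Psi>)\<^sup>2 / (2 * real k)
        + ((\<Sum>z\<in>UNIV. T z) + real CARD('s) * \<tau> * (norm \<Psi>)\<^sup>2) / (2 * \<sigma>) \<le> D * (excitation s (U s \<Psi>) + X)"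
    proof -
      have "D * X = Y" using D by (simp add: X)
      then show ?thesis
        using \<open>_ \<le> Y\<close> unfolding distrib_left by linarith
    qed
    then have "d \<le> 4 * \<bar>J\<bar> * sqrt (nu + 1) * (D * (excitation s (U s \<Psi>) + X))"
      by (intro order_trans[OF d(2)] mult_left_mono) (use nu_nonneg in auto)
    then have "d \<le> growth M \<sigma> * (excitation s (U s \<Psi>) + X)"
      by (simp add: growth_def D_def mult.assoc)
    with d(1) show "\<exists>d. ((\<lambda>t. excitation t (U t \<Psi>)) has_real_derivative d) (at s) \<and> d \<le> growth M \<sigma> * (excitation s (U s \<Psi>) + X)"
      by blast
  qed
  then show ?thesis by (simp add: U_0)
qed

definition trunc :: "nat \<Rightarrow> ('s \<Rightarrow> nat) ell2 \<Rightarrow> ('s \<Rightarrow> nat) ell2" where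
  "trunc K \<Psi> = (\<Sum>n\<in>level K. coords \<Psi> n *\<^sub>C ket n)"

lemma coords_trunc: "coords (trunc K \<Psi>) n = (if n \<in> level K then coords \<Psi> n else 0)"
  by (simp add: trunc_def coords_ket finite_level if_distrib[of "\<lambda>x. _ * x"] sum.delta' cong: if_cong)

lemma trunc_tendsto: "(\<lambda>K. trunc K \<Psi>) \<longlonglongrightarrow> \<Psi>"
  unfolding trunc_def by (rule has_sum_level[OF ket_expansion])

lemma norm_trunc_le: "(norm (trunc K \<Psi>))\<^sup>2 \<le> (norm \<Psi>)\<^sup>2"
  by (rule has_sum_mono[OF norm_sq_has_sum norm_sq_has_sum]) (simp add: coords_trunc)

lemma excitation_tendsto:
  assumes "(\<Psi>s \<longlongrightarrow> \<Psi>) F"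
  shows "((\<lambda>K. excitation s (\<Psi>s K)) \<longlongrightarrow> excitation s \<Psi>) F"
  unfolding excitation_def
  by (intro tendsto_intros assms bounded_bilinear.tendsto[OF bounded_bilinear_cinner]
      bounded_linear.tendsto[OF bounded_clinear_bounded_linear[OF site_ketbra_bounded]])

text \<open>Both sides are continuous in the vector, so the truncation is removed by a
  limit.\<close>

lemma excitation_growth:
  assumes \<kappa>: "\<kappa>\<^sub>0 \<ge> 4" and C: "C = 2 * exp 1 * \<bar>J\<bar> * max nu 1" and t: "t \<ge> 0" and M: "M \<ge> 0" and \<sigma>: "\<sigma> > 0"
    and init: "((\<lambda>n. exp (real n / \<kappa>\<^sub>0) * (cmod (f 0 n))\<^sup>2) has_sum E0) UNIV"
    and m: "((\<lambda>n. (\<Sum>x\<in>UNIV. exp (real (n x) / \<kappa>\<^sub>0)) * (cmod (coords \<Psi> n))\<^sup>2) has_sum m) UNIV"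
  defines "X \<equiv> source (\<kappa>\<^sub>0 * exp (C * t)) M \<sigma> E0 m ((norm \<Psi>)\<^sup>2)"
  shows "excitation t (U t \<Psi>) + X \<le> (excitation 0 \<Psi> + X) * exp (growth M \<sigma> * t)"
proof (rule tendsto_le[OF sequentially_bot])
  show "(\<lambda>K. excitation t (U t (trunc K \<Psi>)) + X) \<longlonglongrightarrow> excitation t (U t \<Psi>) + X"
    by (intro tendsto_intros excitation_tendsto
        bounded_linear.tendsto[OF bounded_clinear_bounded_linear[OF U_bounded]] trunc_tendsto)
  show "(\<lambda>K. (excitation 0 (trunc K \<Psi>) + X) * exp (growth M \<sigma> * t)) \<longlonglongrightarrow> (excitation 0 \<Psi> + X) * exp (growth M \<sigma> * t)"
    by (intro tendsto_intros excitation_tendsto trunc_tendsto)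
  have "excitation t (U t (trunc K \<Psi>)) + X \<le> (excitation 0 (trunc K \<Psi>) + X) * exp (growth M \<sigma> * t)" for K
    unfolding X_def
  proof (rule excitation_growth_level[OF \<kappa> C t M \<sigma> init _ _ norm_trunc_le])
    show "n \<notin> level K \<Longrightarrow> coords (trunc K \<Psi>) n = 0" for n by (simp add: coords_trunc)
    have "(\<Sum>n\<in>level K. (\<Sum>x\<in>UNIV. exp (real (n x) / \<kappa>\<^sub>0)) * (cmod (coords (trunc K \<Psi>) n))\<^sup>2)
        = (\<Sum>n\<in>level K. (\<Sum>x\<in>UNIV. exp (real (n x) / \<kappa>\<^sub>0)) * (cmod (coords \<Psi> n))\<^sup>2)"
      by (simp add: coords_trunc)
    also have "\<dots> \<le> m"
      by (rule finite_sum_le_has_sum[OF m finite_level]) (auto intro!: mult_nonneg_nonneg sum_nonneg)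
    finally show "(\<Sum>n\<in>level K. (\<Sum>x\<in>UNIV. exp (real (n x) / \<kappa>\<^sub>0)) * (cmod (coords (trunc K \<Psi>) n))\<^sup>2) \<le> m" .
  qed
  then show "\<forall>\<^sub>F K in sequentially. excitation t (U t (trunc K \<Psi>)) + X \<le> (excitation 0 (trunc K \<Psi>) + X) * exp (growth M \<sigma> * t)"
    by simp
qed

end


section \<open>Density matrices as mixtures and their one-site marginals\<close>

section \<open>The one-site reduced density matrix\<close>

text \<open>The columns \<open>S (ket k)\<close> of the square root, in general not orthogonal, take
  the place of weighted eigenvectors: inserting the basis between the two factors of
  \<open>S\<close> gives the decomposition.\<close>

lemma density_matrix_mixture:
  assumes "positive_op \<gamma>" "trace_class \<gamma>" "op_trace \<gamma> = 1"
  shows "\<exists>g :: 'a \<Rightarrow> 'a ell2. mixture UNIV g \<gamma> \<and> ((\<lambda>k. (norm (g k))\<^sup>2) has_sum 1) UNIV"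
proof -
  obtain S where S: "positive_op S" "\<And>\<psi>. S (S \<psi>) = \<gamma> \<psi>"
    using positive_sqrt_exists[OF assms(1)] by blast
  note sa = self_adjointD[OF positive_op_self_adjoint[OF S(1)]]
  have "mixture UNIV (\<lambda>k. S (ket k)) \<gamma>"
    unfolding mixture_def
  proof (intro allI)
    fix \<eta> \<psi>
    have "((\<lambda>k. cnj (coords (S \<eta>) k) * coords (S \<psi>) k) has_sum cinner (S \<eta>) (S \<psi>)) UNIV" by (rule cinner_has_sum)
    moreover have "cinner \<eta> (S (ket k)) * cinner (S (ket k)) \<psi> = cnj (coords (S \<eta>) k) * coords (S \<psi>) k" for k
      by (simp only: sa[symmetric, of \<eta> "ket k"] sa[of "ket k" \<psi>] cinner_ket_left cinner_ket_right)
    ultimately show "((\<lambda>k. cinner \<eta> (S (ket k)) * cinner (S (ket k)) \<psi>) has_sum cinner \<eta> (\<gamma> \<psi>)) UNIV"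
      by (simp only: sa S(2))
  qed
  moreover have "abs_op \<gamma> = \<gamma>"
    by (rule abs_op_eqI[OF positive_op_self_adjoint[OF assms(1)] assms(1)]) simp
  then have "((\<lambda>k. cinner (ket k) (\<gamma> (ket k))) has_sum 1) UNIV"
    using assms(2,3) has_sum_infsum unfolding trace_class_def op_trace_def by metis
  then have "((\<lambda>k. Re (cinner (ket k) (\<gamma> (ket k)))) has_sum 1) UNIV"
    using has_sum_Re by fastforce
  moreover have "Re (cinner (ket k) (\<gamma> (ket k))) = (norm (S (ket k)))\<^sup>2" for k
    unfolding S(2)[symmetric] sa[of "ket k" "S (ket k)", symmetric] by (simp only: cinner_self Re_complex_of_real)
  ultimately show ?thesis by auto
qed

lemma tensor_ket_adjoint: "cinner (tensor_ket x \<sigma> \<eta>) \<Psi> = cinner \<eta> (contract_bra x \<sigma> \<Psi>)"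
proof -
  let ?h = "\<lambda>m. \<sigma>(x := m)" and ?f = "\<lambda>n. cnj (coords (tensor_ket x \<sigma> \<eta>) n) * coords \<Psi> n"
  have inj: "inj ?h" by (rule injI) (metis fun_upd_same)
  have "((\<lambda>m. cnj (coords \<eta> m) * coords (contract_bra x \<sigma> \<Psi>) m) has_sum cinner \<eta> (contract_bra x \<sigma> \<Psi>)) UNIV"
    by (rule cinner_has_sum)
  also have "(\<lambda>m. cnj (coords \<eta> m) * coords (contract_bra x \<sigma> \<Psi>) m) = ?f \<circ> ?h"
    by (rule ext) (simp add: coords_tensor_ket)
  also have "(?f \<circ> ?h has_sum cinner \<eta> (contract_bra x \<sigma> \<Psi>)) UNIV \<longleftrightarrow> (?f has_sum cinner \<eta> (contract_bra x \<sigma> \<Psi>)) (range ?h)"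
    by (rule has_sum_reindex[OF inj, symmetric])
  also have "\<dots> \<longleftrightarrow> (?f has_sum cinner \<eta> (contract_bra x \<sigma> \<Psi>)) UNIV"
  proof (rule has_sum_cong_neutral)
    fix n assume n: "n \<in> UNIV - range ?h"
    have "\<not> (\<forall>y. y \<noteq> x \<longrightarrow> n y = \<sigma> y)"
    proof
      assume "\<forall>y. y \<noteq> x \<longrightarrow> n y = \<sigma> y"
      then have "n = ?h (n x)" by auto
      with n show False by blast
    qed
    then show "?f n = 0" by (auto simp: coords_tensor_ket)
  qed auto
  finally show ?thesis by (rule cinner_unique)
qed

lemma contract_bra_slices_summable:
  assumes "((\<lambda>k. (norm (g k))\<^sup>2) has_sum b) I"
  shows "((\<lambda>(\<sigma>, k). (norm (contract_bra x \<sigma> (g k)))\<^sup>2) has_sum b) ({\<sigma>. \<sigma> x = 0} \<times> I)"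
proof -
  let ?f = "\<lambda>(k, \<sigma>). (norm (contract_bra x \<sigma> (g k)))\<^sup>2"
  have "(?f has_sum b) (I \<times> {\<sigma>. \<sigma> x = 0})"
    by (rule has_sum_SigmaI[where g = "\<lambda>k. (norm (g k))\<^sup>2"])
      (use norm_sq_slices assms in \<open>auto intro!: summable_on_SigmaI[where g = "\<lambda>k. (norm (g k))\<^sup>2"] simp: has_sum_imp_summable\<close>)
  then show ?thesis
    using has_sum_reindex_bij_betw[of prod.swap "{\<sigma>. \<sigma> x = 0} \<times> I" "I \<times> {\<sigma>. \<sigma> x = 0}" ?f b]
    by (simp add: case_prod_unfold bij_betw_def inj_on_def product_swap)
qed

lemma mixture_partial_trace:
  assumes \<Gamma>: "mixture I g \<Gamma>" and s: "((\<lambda>k. (norm (g k))\<^sup>2) has_sum b) I"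
  shows "mixture ({\<sigma>. \<sigma> x = 0} \<times> I) (\<lambda>(\<sigma>, k). contract_bra x \<sigma> (g k)) (partial_trace x \<Gamma>)"
proof -
  define B where "B \<sigma> \<psi> = contract_bra x \<sigma> (\<Gamma> (tensor_ket x \<sigma> \<psi>))" for \<sigma> \<psi>
  have mixB: "mixture I (\<lambda>k. contract_bra x \<sigma> (g k)) (B \<sigma>)" for \<sigma>
    unfolding mixture_def
  proof (intro allI)
    fix \<eta> \<psi>
    have "cinner \<eta> (contract_bra x \<sigma> (g k)) * cinner (contract_bra x \<sigma> (g k)) \<psi>
        = cinner (tensor_ket x \<sigma> \<eta>) (g k) * cinner (g k) (tensor_ket x \<sigma> \<psi>)" for k
      by (simp add: tensor_ket_adjoint cinner_commute[of "contract_bra x \<sigma> (g k)" \<psi>] cinner_commute[of "g k" "tensor_ket x \<sigma> \<psi>"])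
    then show "((\<lambda>k. cinner \<eta> (contract_bra x \<sigma> (g k)) * cinner (contract_bra x \<sigma> (g k)) \<psi>) has_sum cinner \<eta> (B \<sigma> \<psi>)) I"
      using mixtureD[OF \<Gamma>, of "tensor_ket x \<sigma> \<eta>" "tensor_ket x \<sigma> \<psi>"] by (simp only: B_def tensor_ket_adjoint)
  qed
  note pairs = contract_bra_slices_summable[OF s, of x]
  define b' where "b' \<sigma> = (\<Sum>\<^sub>\<infinity>k\<in>I. (norm (contract_bra x \<sigma> (g k)))\<^sup>2)" for \<sigma>
  have row: "((\<lambda>k. (norm (contract_bra x \<sigma> (g k)))\<^sup>2) has_sum b' \<sigma>) I" if "\<sigma> x = 0" for \<sigma>
  proof -
    have "(\<lambda>k. (norm (contract_bra x \<sigma> (g k)))\<^sup>2) summable_on I"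
      using summable_on_SigmaD1[of "\<lambda>\<sigma> k. (norm (contract_bra x \<sigma> (g k)))\<^sup>2" "{\<sigma>. \<sigma> x = 0}" "\<lambda>_. I" \<sigma>] pairs that
      by (simp add: has_sum_imp_summable)
    then show ?thesis unfolding b'_def by (rule has_sum_infsum)
  qed
  have b': "(b' has_sum b) {\<sigma>. \<sigma> x = 0}"
    by (rule has_sum_SigmaD[OF pairs]) (use row in simp)
  show ?thesis
    unfolding mixture_def
  proof (intro allI)
    fix \<eta> \<psi>
    \<comment> \<open>Norm summability matters here: without it the infinite sum in
      \<open>partial_trace\<close> would take its default value 0.\<close>
    have "(\<lambda>\<sigma>. B \<sigma> \<psi>) summable_on {\<sigma>. \<sigma> x = 0}"
    proof (rule abs_summable_summable, rule summable_on_comparison_test)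
      show "(\<lambda>\<sigma>. b' \<sigma> * norm \<psi>) summable_on {\<sigma>. \<sigma> x = 0}"
        using b' by (intro summable_on_cmult_left) (rule has_sum_imp_summable)
      show "norm (B \<sigma> \<psi>) \<le> b' \<sigma> * norm \<psi>" if "\<sigma> \<in> {\<sigma>. \<sigma> x = 0}" for \<sigma>
        using mixture_norm_le[OF mixB row] that by simp
    qed auto
    then have "((\<lambda>\<sigma>. B \<sigma> \<psi>) has_sum partial_trace x \<Gamma> \<psi>) {\<sigma>. \<sigma> x = 0}"
      unfolding partial_trace_def B_def by (rule has_sum_infsum)
    then have outer: "((\<lambda>\<sigma>. cinner \<eta> (B \<sigma> \<psi>)) has_sum cinner \<eta> (partial_trace x \<Gamma> \<psi>)) {\<sigma>. \<sigma> x = 0}"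
      using has_sum_bounded_linear[OF bounded_bilinear.bounded_linear_right[OF bounded_bilinear_cinner, of \<eta>]] by fastforce
    let ?f = "\<lambda>(\<sigma>, k). cinner \<eta> (contract_bra x \<sigma> (g k)) * cinner (contract_bra x \<sigma> (g k)) \<psi>"
    have "?f summable_on ({\<sigma>. \<sigma> x = 0} \<times> I)"
    proof (rule abs_summable_summable, rule summable_on_comparison_test)
      show "(\<lambda>p. norm \<eta> * norm \<psi> * (case p of (\<sigma>, k) \<Rightarrow> (norm (contract_bra x \<sigma> (g k)))\<^sup>2)) summable_on ({\<sigma>. \<sigma> x = 0} \<times> I)"
        using pairs by (intro summable_on_cmult_right) (rule has_sum_imp_summable)
      fix p
      let ?c = "contract_bra x (fst p) (g (snd p))"
      have "cmod (cinner \<eta> ?c * cinner ?c \<psi>) \<le> (norm \<eta> * norm ?c) * (norm ?c * norm \<psi>)"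
        unfolding norm_mult by (intro mult_mono cinner_Cauchy_Schwarz) auto
      then show "norm (?f p) \<le> norm \<eta> * norm \<psi> * (case p of (\<sigma>, k) \<Rightarrow> (norm (contract_bra x \<sigma> (g k)))\<^sup>2)"
        by (simp add: case_prod_unfold power2_eq_square mult_ac)
    qed auto
    then have f: "(?f has_sum infsum ?f ({\<sigma>. \<sigma> x = 0} \<times> I)) ({\<sigma>. \<sigma> x = 0} \<times> I)" by (rule has_sum_infsum)
    then have "((\<lambda>\<sigma>. cinner \<eta> (B \<sigma> \<psi>)) has_sum infsum ?f ({\<sigma>. \<sigma> x = 0} \<times> I)) {\<sigma>. \<sigma> x = 0}"
      by (rule has_sum_SigmaD) (use mixtureD[OF mixB] in simp)
    then have "infsum ?f ({\<sigma>. \<sigma> x = 0} \<times> I) = cinner \<eta> (partial_trace x \<Gamma> \<psi>)"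
      using outer has_sum_unique by blast
    then show "((\<lambda>p. cinner \<eta> (case p of (\<sigma>, k) \<Rightarrow> contract_bra x \<sigma> (g k)) * cinner (case p of (\<sigma>, k) \<Rightarrow> contract_bra x \<sigma> (g k)) \<psi>)
        has_sum cinner \<eta> (partial_trace x \<Gamma> \<psi>)) ({\<sigma>. \<sigma> x = 0} \<times> I)"
      using f by (simp add: case_prod_unfold)
  qed
qed

lemma has_sum_sum:
  fixes f :: "'a \<Rightarrow> 'b \<Rightarrow> 'c::topological_comm_monoid_add"
  assumes "\<And>x. x \<in> A \<Longrightarrow> (f x has_sum s x) B"
  shows "((\<lambda>y. \<Sum>x\<in>A. f x y) has_sum (\<Sum>x\<in>A. s x)) B"
  using assms by (induction A rule: infinite_finite_induct) (auto intro!: has_sum_add)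

lemma has_sum_finite_Sigma:
  fixes f :: "'a \<Rightarrow> 'b \<Rightarrow> 'c::{topological_comm_monoid_add, t2_space}"
  assumes "finite A" "\<And>x. x \<in> A \<Longrightarrow> (f x has_sum s x) (B x)"
  shows "((\<lambda>(x, y). f x y) has_sum (\<Sum>x\<in>A. s x)) (Sigma A B)"
proof -
  have "((\<lambda>(x, y). f x y) has_sum s x) (Pair x ` B x)" if "x \<in> A" for x
    by (subst has_sum_reindex) (use assms(2)[OF that] in \<open>auto simp: inj_on_def o_def\<close>)
  then have "((\<lambda>(x, y). f x y) has_sum (\<Sum>x\<in>A. s x)) (\<Union>x\<in>A. Pair x ` B x)"
    by (intro sum_has_sum assms(1)) auto
  moreover have "(\<Union>x\<in>A. Pair x ` B x) = Sigma A B" by auto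
  ultimately show ?thesis by simp
qed

lemma mixture_one_site_density:
  fixes \<Gamma> :: "('s::finite \<Rightarrow> nat) ell2 \<Rightarrow> ('s \<Rightarrow> nat) ell2"
  assumes \<Gamma>: "mixture I g \<Gamma>" and s: "((\<lambda>k. (norm (g k))\<^sup>2) has_sum b) I"
  defines "g' \<equiv> \<lambda>(x, \<sigma>, k). (1 / sqrt (real CARD('s))) *\<^sub>R contract_bra x \<sigma> (g k)"
    and "I' \<equiv> SIGMA x:UNIV. {\<sigma>. \<sigma> x = 0} \<times> I"
  shows "mixture I' g' (one_site_density \<Gamma>)" "((\<lambda>k. (norm (g' k))\<^sup>2) has_sum b) I'"
proof -
  let ?L = "real CARD('s)"
  have L: "?L > 0" by simp
  have sq: "1 / sqrt ?L * (1 / sqrt ?L) = 1 / ?L" by simp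
  show "mixture I' g' (one_site_density \<Gamma>)"
    unfolding mixture_def
  proof (intro allI)
    fix \<eta> \<psi>
    have "((\<lambda>(x, p). cinner \<eta> (case p of (\<sigma>, k) \<Rightarrow> contract_bra x \<sigma> (g k)) * cinner (case p of (\<sigma>, k) \<Rightarrow> contract_bra x \<sigma> (g k)) \<psi>)
        has_sum (\<Sum>x\<in>UNIV. cinner \<eta> (partial_trace x \<Gamma> \<psi>))) I'"
      unfolding I'_def by (rule has_sum_finite_Sigma) (use mixtureD[OF mixture_partial_trace[OF \<Gamma> s]] in auto)
    then have "((\<lambda>q. of_real (1 / ?L) * (case q of (x, p) \<Rightarrow> cinner \<eta> (case p of (\<sigma>, k) \<Rightarrow> contract_bra x \<sigma> (g k)) * cinner (case p of (\<sigma>, k) \<Rightarrow> contract_bra x \<sigma> (g k)) \<psi>))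
        has_sum of_real (1 / ?L) * (\<Sum>x\<in>UNIV. cinner \<eta> (partial_trace x \<Gamma> \<psi>))) I'"
      by (rule has_sum_cmult_right)
    also have "of_real (1 / ?L) * (\<Sum>x\<in>UNIV. cinner \<eta> (partial_trace x \<Gamma> \<psi>)) = cinner \<eta> (one_site_density \<Gamma> \<psi>)"
      by (simp add: one_site_density_def cinner_simps cinner_sum_right divide_inverse)
    also have "(\<lambda>q. of_real (1 / ?L) * (case q of (x, p) \<Rightarrow> cinner \<eta> (case p of (\<sigma>, k) \<Rightarrow> contract_bra x \<sigma> (g k)) * cinner (case p of (\<sigma>, k) \<Rightarrow> contract_bra x \<sigma> (g k)) \<psi>))
      = (\<lambda>q. cinner \<eta> (g' q) * cinner (g' q) \<psi>)"
    proof
      fix q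
      have "cinner \<eta> (r *\<^sub>R z) * cinner (r *\<^sub>R z) \<psi> = of_real (r * r) * (cinner \<eta> z * cinner z \<psi>)" for r z
        by (simp add: cinner_simps)
      from this[of "1 / sqrt ?L"] show "of_real (1 / ?L) * (case q of (x, p) \<Rightarrow> cinner \<eta> (case p of (\<sigma>, k) \<Rightarrow> contract_bra x \<sigma> (g k)) * cinner (case p of (\<sigma>, k) \<Rightarrow> contract_bra x \<sigma> (g k)) \<psi>)
        = cinner \<eta> (g' q) * cinner (g' q) \<psi>"
        unfolding sq g'_def case_prod_unfold by (simp only:)
    qed
    finally show "((\<lambda>q. cinner \<eta> (g' q) * cinner (g' q) \<psi>) has_sum cinner \<eta> (one_site_density \<Gamma> \<psi>)) I'" .
  qed
  have "((\<lambda>(x, p). case p of (\<sigma>, k) \<Rightarrow> (norm (contract_bra x \<sigma> (g k)))\<^sup>2) has_sum (\<Sum>x\<in>(UNIV :: 's set). b)) I'"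
    unfolding I'_def by (rule has_sum_finite_Sigma) (use contract_bra_slices_summable[OF s] in auto)
  then have "((\<lambda>q. 1 / ?L * (case q of (x, \<sigma>, k) \<Rightarrow> (norm (contract_bra x \<sigma> (g k)))\<^sup>2)) has_sum (1 / ?L * (\<Sum>x\<in>(UNIV :: 's set). b))) I'"
    by (rule has_sum_cmult_right)
  moreover have "(norm (g' q))\<^sup>2 = 1 / ?L * (case q of (x, \<sigma>, k) \<Rightarrow> (norm (contract_bra x \<sigma> (g k)))\<^sup>2)" for q
    by (simp add: g'_def case_prod_unfold power_divide)
  ultimately show "((\<lambda>k. (norm (g' k))\<^sup>2) has_sum b) I'" by simp
qed

text \<open>With \<open>\<psi> = \<phi> s\<close> it relates the summed excitations to the reduced
  density; with \<open>\<psi> = ket n\<close> it brings in the decay hypothesis.\<close>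

lemma one_site_density_form:
  fixes \<Gamma> :: "('s::finite \<Rightarrow> nat) ell2 \<Rightarrow> ('s \<Rightarrow> nat) ell2"
  assumes \<Gamma>: "mixture I g \<Gamma>" and s: "((\<lambda>k. (norm (g k))\<^sup>2) has_sum b) I"
  shows "((\<lambda>k. \<Sum>x\<in>UNIV. Re (cinner (g k) (site_ketbra x \<psi> \<psi> (g k)))) has_sum
    (real CARD('s) * Re (cinner \<psi> (one_site_density \<Gamma> \<psi>)))) I"
proof -
  have "((\<lambda>k. Re (cinner (g k) (site_ketbra x \<psi> \<psi> (g k)))) has_sum Re (cinner \<psi> (partial_trace x \<Gamma> \<psi>))) I" for x
  proof -
    let ?f = "\<lambda>(\<sigma>, k). (cmod (cinner \<psi> (contract_bra x \<sigma> (g k))))\<^sup>2"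
    have "(?f has_sum Re (cinner \<psi> (partial_trace x \<Gamma> \<psi>))) ({\<sigma>. \<sigma> x = 0} \<times> I)"
      using mixture_form[OF mixture_partial_trace[OF \<Gamma> s], of \<psi> x] by (simp add: case_prod_unfold)
    then have "((\<lambda>(k, \<sigma>). (cmod (cinner \<psi> (contract_bra x \<sigma> (g k))))\<^sup>2) has_sum Re (cinner \<psi> (partial_trace x \<Gamma> \<psi>))) (I \<times> {\<sigma>. \<sigma> x = 0})"
      using has_sum_reindex_bij_betw[of prod.swap "I \<times> {\<sigma>. \<sigma> x = 0}" "{\<sigma>. \<sigma> x = 0} \<times> I" ?f]
      by (simp add: case_prod_unfold bij_betw_def inj_on_def product_swap)
    then show ?thesis
    proof (rule has_sum_SigmaD)
      fix k
      have "((\<lambda>\<sigma>. Re (cinner (contract_bra x \<sigma> (g k)) (contract_bra x \<sigma> (site_ketbra x \<psi> \<psi> (g k))))) has_sum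
          Re (cinner (g k) (site_ketbra x \<psi> \<psi> (g k)))) {\<sigma>. \<sigma> x = 0}"
        by (rule has_sum_Re[OF cinner_slices])
      moreover have "Re (cinner (contract_bra x \<sigma> (g k)) (contract_bra x \<sigma> (site_ketbra x \<psi> \<psi> (g k))))
          = (cmod (cinner \<psi> (contract_bra x \<sigma> (g k))))\<^sup>2" for \<sigma>
        unfolding contract_bra_site_ketbra cinner_scaleC_right cinner_commute[of "contract_bra x \<sigma> (g k)" \<psi>]
        by (simp flip: complex_norm_square)
      ultimately show "((\<lambda>\<sigma>. case (k, \<sigma>) of (k, \<sigma>) \<Rightarrow> (cmod (cinner \<psi> (contract_bra x \<sigma> (g k))))\<^sup>2) has_sum
          Re (cinner (g k) (site_ketbra x \<psi> \<psi> (g k)))) {\<sigma>. \<sigma> x = 0}" by simp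
    qed
  qed
  then have "((\<lambda>k. \<Sum>x\<in>UNIV. Re (cinner (g k) (site_ketbra x \<psi> \<psi> (g k)))) has_sum (\<Sum>x\<in>UNIV. Re (cinner \<psi> (partial_trace x \<Gamma> \<psi>)))) I"
    by (intro has_sum_sum) auto
  moreover have "(\<Sum>x\<in>UNIV. Re (cinner \<psi> (partial_trace x \<Gamma> \<psi>))) = real CARD('s) * Re (cinner \<psi> (one_site_density \<Gamma> \<psi>))"
    by (simp add: one_site_density_def cinner_simps cinner_sum_right power2_eq_square)
  ultimately show ?thesis by simp
qed

lemma sum_level_prob:
  assumes "finite F"
  shows "(\<Sum>m\<in>{m\<in>F. m x = n}. (cmod (coords \<Psi> m))\<^sup>2) \<le> Re (cinner \<Psi> (site_ketbra x (ket n) (ket n) \<Psi>))"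
proof -
  have c: "coords (site_ketbra x (ket n) (ket n) \<Psi>) m = (if m x = n then coords \<Psi> m else 0)" for m
    by (auto simp: coords_ket)
  have "((\<lambda>m. Re (cnj (coords \<Psi> m) * (if m x = n then coords \<Psi> m else 0))) has_sum Re (cinner \<Psi> (site_ketbra x (ket n) (ket n) \<Psi>))) UNIV"
    using has_sum_Re[OF cinner_has_sum[of \<Psi> "site_ketbra x (ket n) (ket n) \<Psi>"]] unfolding c .
  moreover have "Re (cnj (coords \<Psi> m) * (if m x = n then coords \<Psi> m else 0)) = (if m x = n then (cmod (coords \<Psi> m))\<^sup>2 else 0)" for m
    unfolding cmod_power2 by (simp add: power2_eq_square)
  ultimately have "((\<lambda>m. if m x = n then (cmod (coords \<Psi> m))\<^sup>2 else 0) has_sum Re (cinner \<Psi> (site_ketbra x (ket n) (ket n) \<Psi>))) UNIV"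
    by simp
  from finite_sum_le_has_sum[OF this assms]
  show ?thesis using assms by (simp add: sum.inter_filter)
qed

text \<open>Since \<open>3 / 2 * \<kappa> \<le> \<kappa>\<^sub>0\<close>, the exponents differ by at
  least \<open>s = 1 / (3 * \<kappa>)\<close>, and the geometric series with ratio
  \<open>exp (- s)\<close> sums to at most \<open>1 + 1 / s\<close>.\<close>

lemma geometric_moment:
  assumes "\<kappa> > 0" "c \<ge> 0" "finite F" "3 / 2 * \<kappa> \<le> \<kappa>\<^sub>0"
  shows "(\<Sum>n\<in>F. exp (real n / \<kappa>\<^sub>0) * (c * exp (- real n / \<kappa>))) \<le> c * (1 + 3 * \<kappa>)"
proof -
  define s where "s = 1 / (3 * \<kappa>)"
  have s: "s > 0" using assms by (simp add: s_def)
  have "exp s \<ge> 1 + s" by (rule exp_ge_add_one_self)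
  then have q: "exp (- s) \<le> 1 / (1 + s)" using s by (simp add: exp_minus field_simps)
  have step: "exp (real n / \<kappa>\<^sub>0) * (c * exp (- real n / \<kappa>)) \<le> c * exp (- s) ^ n" for n
  proof -
    have "1 / \<kappa>\<^sub>0 \<le> 1 / (3 / 2 * \<kappa>)" using assms by (intro divide_left_mono) auto
    also have "\<dots> = 1 / \<kappa> - s" using assms by (simp add: s_def field_simps)
    finally have "real n * (1 / \<kappa>\<^sub>0) \<le> real n * (1 / \<kappa> - s)" by (intro mult_left_mono) auto
    then have "real n / \<kappa>\<^sub>0 + (- real n / \<kappa>) \<le> real n * (- s)" by (simp add: algebra_simps)
    then have "exp (real n / \<kappa>\<^sub>0) * exp (- real n / \<kappa>) \<le> exp (real n * (- s))"
      unfolding exp_add[symmetric] by simp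
    then have "c * (exp (real n / \<kappa>\<^sub>0) * exp (- real n / \<kappa>)) \<le> c * exp (- s) ^ n"
      using assms by (simp only: exp_of_nat_mult) (rule mult_left_mono)
    then show ?thesis by (simp add: mult_ac)
  qed
  have geo: "summable (\<lambda>n. c * exp (- s) ^ n)" using s by (intro summable_mult summable_geometric) auto
  have "(\<Sum>n\<in>F. exp (real n / \<kappa>\<^sub>0) * (c * exp (- real n / \<kappa>))) \<le> (\<Sum>n\<in>F. c * exp (- s) ^ n)"
    by (intro sum_mono step)
  also have "\<dots> \<le> (\<Sum>n. c * exp (- s) ^ n)"
    by (rule sum_le_suminf[OF geo assms(3)]) (use assms in auto)
  also have "\<dots> = c * (1 / (1 - exp (- s)))"
    using s by (subst suminf_mult) (auto simp: suminf_geometric)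
  also have "\<dots> \<le> c * (1 + 3 * \<kappa>)"
  proof (rule mult_left_mono)
    have "1 - exp (- s) \<ge> s / (1 + s)" using q s by (simp add: field_simps)
    then have "1 / (1 - exp (- s)) \<le> 1 / (s / (1 + s))" using s by (intro divide_left_mono) auto
    also have "\<dots> = 1 + 1 / s" using s by (simp add: field_simps)
    also have "1 / s = 3 * \<kappa>" by (simp add: s_def)
    finally show "1 / (1 - exp (- s)) \<le> 1 + 3 * \<kappa>" .
  qed (use assms in simp)
  finally show ?thesis .
qed

text \<open>The decay hypothesis concerns the average over the sites and over the mixture. All terms
  are nonnegative, so a bound on all finite parts of the total already makes the exponential moment
  of each single vector finite.\<close>

lemma exp_moment_mixture:
  fixes \<Gamma> :: "('s::finite \<Rightarrow> nat) ell2 \<Rightarrow> ('s \<Rightarrow> nat) ell2"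
  assumes \<Gamma>: "mixture I g \<Gamma>" and s: "((\<lambda>k. (norm (g k))\<^sup>2) has_sum b) I"
    and c: "\<And>n. Re (coords (one_site_density \<Gamma> (ket n)) n) \<le> c * exp (- real n / \<kappa>)"
    and \<kappa>: "\<kappa> > 0" "c \<ge> 0" "3 / 2 * \<kappa> \<le> \<kappa>\<^sub>0"
  shows "\<exists>m E. (\<forall>k\<in>I. ((\<lambda>n. (\<Sum>x\<in>UNIV. exp (real (n x) / \<kappa>\<^sub>0)) * (cmod (coords (g k) n))\<^sup>2) has_sum m k) UNIV) \<and>
    (m has_sum E) I \<and> E \<le> real CARD('s) * (c * (1 + 3 * \<kappa>))"
proof -
  let ?L = "real CARD('s)"
  let ?f = "\<lambda>(k, n). (\<Sum>x\<in>UNIV. exp (real (n x) / \<kappa>\<^sub>0)) * (cmod (coords (g k) n))\<^sup>2"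
  let ?P = "\<lambda>k n. \<Sum>x\<in>UNIV. Re (cinner (g k) (site_ketbra x (ket n) (ket n) (g k)))"
  have fin: "sum ?f F \<le> ?L * (c * (1 + 3 * \<kappa>))" if F: "finite F" "F \<subseteq> I \<times> UNIV" for F
  proof -
    define F1 F2 where "F1 = fst ` F" and "F2 = snd ` F"
    have F12: "finite F1" "finite F2" "F1 \<subseteq> I" "F \<subseteq> F1 \<times> F2"
      using F by (auto simp: F1_def F2_def image_iff) force+
    define N where "N = (\<Union>x. (\<lambda>m. m x) ` F2)"
    have N: "finite N" "\<And>m x. m \<in> F2 \<Longrightarrow> m x \<in> N" using F12(2) by (auto simp: N_def)
    have "sum ?f F \<le> sum ?f (F1 \<times> F2)"
      using F12 by (intro sum_mono2) (auto intro!: mult_nonneg_nonneg sum_nonneg)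
    also have "\<dots> = (\<Sum>k\<in>F1. \<Sum>x\<in>UNIV. \<Sum>m\<in>F2. exp (real (m x) / \<kappa>\<^sub>0) * (cmod (coords (g k) m))\<^sup>2)"
      unfolding sum.cartesian_product[symmetric] sum_distrib_right by (intro sum.cong refl sum.swap)
    \<comment> \<open>Configurations are grouped by their occupation at \<open>x\<close>; each group
      is bounded by an expectation of a level projection.\<close>
    also have "\<dots> = (\<Sum>k\<in>F1. \<Sum>x\<in>UNIV. \<Sum>n\<in>N. \<Sum>m\<in>{m\<in>F2. m x = n}. exp (real (m x) / \<kappa>\<^sub>0) * (cmod (coords (g k) m))\<^sup>2)"
      by (intro sum.cong refl sum.group[symmetric] F12 N) (use N in auto)
    also have "\<dots> = (\<Sum>k\<in>F1. \<Sum>x\<in>UNIV. \<Sum>n\<in>N. exp (real n / \<kappa>\<^sub>0) * (\<Sum>m\<in>{m\<in>F2. m x = n}. (cmod (coords (g k) m))\<^sup>2))"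
      unfolding sum_distrib_left by (intro sum.cong refl) auto
    also have "\<dots> \<le> (\<Sum>k\<in>F1. \<Sum>x\<in>UNIV. \<Sum>n\<in>N. exp (real n / \<kappa>\<^sub>0) * Re (cinner (g k) (site_ketbra x (ket n) (ket n) (g k))))"
      by (intro sum_mono mult_left_mono sum_level_prob F12) auto
    also have "\<dots> = (\<Sum>n\<in>N. exp (real n / \<kappa>\<^sub>0) * (\<Sum>k\<in>F1. ?P k n))"
    proof -
      have "(\<Sum>k\<in>F1. \<Sum>x\<in>UNIV. \<Sum>n\<in>N. exp (real n / \<kappa>\<^sub>0) * Re (cinner (g k) (site_ketbra x (ket n) (ket n) (g k))))
          = (\<Sum>k\<in>F1. \<Sum>n\<in>N. exp (real n / \<kappa>\<^sub>0) * ?P k n)"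
        unfolding sum_distrib_left by (intro sum.cong refl sum.swap)
      also have "\<dots> = (\<Sum>n\<in>N. \<Sum>k\<in>F1. exp (real n / \<kappa>\<^sub>0) * ?P k n)" by (rule sum.swap)
      finally show ?thesis by (simp only: sum_distrib_left)
    qed
    also have "\<dots> \<le> (\<Sum>n\<in>N. exp (real n / \<kappa>\<^sub>0) * (?L * (c * exp (- real n / \<kappa>))))"
    proof (intro sum_mono mult_left_mono)
      fix n
      have "(\<Sum>k\<in>F1. ?P k n) \<le> ?L * Re (cinner (ket n) (one_site_density \<Gamma> (ket n)))"
      proof (rule finite_sum_le_has_sum[OF one_site_density_form[OF \<Gamma> s] F12(1) F12(3)])
        fix k
        show "?P k n \<ge> 0"
          by (intro sum_nonneg order_trans[OF _ sum_level_prob[of "{}"]]) auto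
      qed
      also have "\<dots> \<le> ?L * (c * exp (- real n / \<kappa>))"
        using c[of n] by (intro mult_left_mono) auto
      finally show "(\<Sum>k\<in>F1. ?P k n) \<le> ?L * (c * exp (- real n / \<kappa>))" .
    qed auto
    also have "\<dots> = ?L * (\<Sum>n\<in>N. exp (real n / \<kappa>\<^sub>0) * (c * exp (- real n / \<kappa>)))"
      by (simp add: sum_distrib_left mult_ac)
    also have "\<dots> \<le> ?L * (c * (1 + 3 * \<kappa>))"
      by (intro mult_left_mono geometric_moment \<kappa> N) auto
    finally show ?thesis .
  qed
  have "?f summable_on (I \<times> UNIV)"
  proof (rule nonneg_bdd_above_summable_on)
    show "bdd_above (sum ?f ` {F. F \<subseteq> I \<times> UNIV \<and> finite F})"
      by (rule bdd_aboveI2[where M = "?L * (c * (1 + 3 * \<kappa>))"]) (use fin in blast)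
    show "?f q \<ge> 0" for q
      unfolding case_prod_unfold by (intro mult_nonneg_nonneg sum_nonneg) simp_all
  qed
  then have sum: "?f summable_on (I \<times> UNIV)" "(?f has_sum infsum ?f (I \<times> UNIV)) (I \<times> UNIV)" by auto
  define m where "m k = (\<Sum>\<^sub>\<infinity>n. (\<Sum>x\<in>UNIV. exp (real (n x) / \<kappa>\<^sub>0)) * (cmod (coords (g k) n))\<^sup>2)" for k
  have m: "((\<lambda>n. (\<Sum>x\<in>UNIV. exp (real (n x) / \<kappa>\<^sub>0)) * (cmod (coords (g k) n))\<^sup>2) has_sum m k) UNIV" if "k \<in> I" for k
    unfolding m_def
    using summable_on_SigmaD1[OF sum(1) that] by (rule has_sum_infsum)
  moreover have "(m has_sum infsum ?f (I \<times> UNIV)) I"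
    by (rule has_sum_SigmaD[OF sum(2)]) (use m in simp)
  moreover have "infsum ?f (I \<times> UNIV) \<le> ?L * (c * (1 + 3 * \<kappa>))"
    by (rule has_sum_le_finite_sums[OF sum(2)]) (use fin in blast)
  ultimately show ?thesis by blast
qed

section \<open>The torus as a regular graph\<close>

section \<open>The periodic lattice\<close>

lemma two_neq_0_mod_ring:
  assumes "CARD('l::nontriv) \<ge> 3" shows "(1 :: 'l mod_ring) + 1 \<noteq> 0"
  using assms by transfer simp

text \<open>With side length at least 3 the forward and backward steps along the axes are all
  distinct; with side length 2 opposite steps would coincide and the degree would be halved.\<close>

lemma nearest_neighbours_graph:
  fixes E :: "(('l::nontriv mod_ring ^ 'd::finite) \<times> ('l mod_ring ^ 'd)) set"
  assumes "CARD('l) \<ge> 3"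
  defines "E \<equiv> {(x, y). nearest_neighbours x y}"
  shows "sym E" "irrefl E" "card {y. (x, y) \<in> E} = 2 * CARD('d)"
proof -
  let ?e = "\<lambda>i. axis i 1 :: 'l mod_ring ^ 'd"
  have axis_ne: "?e i \<noteq> 0" for i by (simp add: axis_eq_0_iff)
  have axis_inj: "?e i = ?e i' \<Longrightarrow> i = i'" for i i'
    by (auto simp: axis_eq_axis)
  have axis_neg: "?e i \<noteq> - ?e i'" for i i'
  proof
    assume "?e i = - ?e i'"
    then have "?e i $ i = - (?e i' $ i)" by simp
    then have "(1 :: 'l mod_ring) = - (if i = i' then 1 else 0)" by (simp add: axis_def)
    then show False
      using two_neq_0_mod_ring[OF assms(1)] by (auto split: if_splits simp: eq_neg_iff_add_eq_0)
  qed
  show "sym E"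
    unfolding E_def sym_def nearest_neighbours_def by (auto simp: algebra_simps)
  show "irrefl E"
    unfolding E_def irrefl_def nearest_neighbours_def using axis_ne by auto
  let ?f = "\<lambda>(i, b). if b then x + ?e i else x - ?e i"
  have "{y. (x, y) \<in> E} = ?f ` (UNIV \<times> UNIV)"
    unfolding E_def nearest_neighbours_def image_def by (auto simp: all_bool_eq ex_bool_eq)
  moreover have "inj_on ?f (UNIV \<times> UNIV)"
  proof (rule inj_onI, clarify)
    fix i b i' b'
    assume "(if b then x + ?e i else x - ?e i) = (if b' then x + ?e i' else x - ?e i')"
    then show "i = i' \<and> b = b'"
      using axis_inj[of i i'] axis_neg[of i i'] axis_neg[of i' i]
      by (cases b; cases b') (simp_all add: eq_commute[of "- ?e i" "?e i'"])
  qed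
  ultimately have "card {y. (x, y) \<in> E} = card ((UNIV :: 'd set) \<times> (UNIV :: bool set))"
    by (simp only: card_image)
  then show "card {y. (x, y) \<in> E} = 2 * CARD('d)" by (simp add: card_cartesian_product)
qed

text \<open>Over ordered pairs the two adjoint hopping terms have the same sum, which cancels the
  factor 1/2. Degree times hopping constant is then \<open>J\<close>.\<close>

lemma bose_hubbard_eq_ham:
  assumes "CARD('l::nontriv) \<ge> 3"
  shows "bose_hubbard J \<mu> V = ham {(x :: 'l mod_ring ^ 'd::finite, y). nearest_neighbours x y} (J / (2 * real CARD('d))) (onsite J \<mu> V)"
proof (intro ext)
  fix \<Psi> :: "('l mod_ring ^ 'd \<Rightarrow> nat) \<Rightarrow> complex" and n
  let ?E = "{(x :: 'l mod_ring ^ 'd, y). nearest_neighbours x y}"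
  let ?T = "\<lambda>x y. at_site creation x (at_site annihilation y \<Psi>) n"
  have "(\<Sum>(x, y)\<in>?E. ?T y x) = (\<Sum>(x, y)\<in>?E. ?T x y)"
    by (rule sum.reindex_bij_witness[where i = prod.swap and j = prod.swap])
      (use nearest_neighbours_graph(1)[OF assms] in \<open>auto simp: sym_def\<close>)
  then have hop: "(\<Sum>(x, y)\<in>?E. ?T x y + ?T y x) = 2 * (\<Sum>(x, y)\<in>?E. ?T x y)"
    by (simp add: case_prod_unfold sum.distrib)
  have "of_real (J - \<mu>) * (\<Sum>x\<in>UNIV. at_site number x \<Psi> n) + of_real (V / 2) * (\<Sum>x\<in>UNIV. at_site pair_number x \<Psi> n)
      = (\<Sum>x\<in>UNIV. of_real (onsite J \<mu> V (n x)) * \<Psi> n)"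
    unfolding sum_distrib_left sum.distrib[symmetric]
    by (intro sum.cong refl) (simp add: at_site_diagonal onsite_def algebra_simps)
  then show "bose_hubbard J \<mu> V \<Psi> n = ham ?E (J / (2 * real CARD('d))) (onsite J \<mu> V) \<Psi> n"
    unfolding bose_hubbard_def ham_def hop by (simp add: sum_distrib_right add.assoc)
qed


section \<open>Choice of the constants and the final estimate\<close>

section \<open>Summation over the initial state\<close>

text \<open>8/3 is what makes \<open>3 / 2 * (\<kappa> + exp 1)\<close> at least 4 for every
  positive \<kappa>.\<close>

lemma exp_1_ge: "exp (1 :: real) \<ge> 8 / 3"
proof -
  have "exp (1 / 4 :: real) \<ge> 1 + 1 / 4 + (1 / 4)\<^sup>2 / 2"
    by (rule exp_lower_Taylor_quadratic) simp
  then have "(41 / 32) ^ 4 \<le> exp (1 / 4 :: real) ^ 4"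
    by (intro power_mono) (simp_all add: power2_eq_square)
  also have "\<dots> = exp 1" by (simp flip: exp_of_nat_mult)
  finally show ?thesis by (simp add: power4_eq_xxxx)
qed

text \<open>Gives \<open>\<sigma> \<ge> 9 / 5\<close> for every \<open>d \<ge> 1\<close>.\<close>

lemma sqrt_ln_2_ge: "sqrt (ln 2) \<ge> 4 / 5"
proof (rule real_le_rsqrt)
  show "(4 / 5)\<^sup>2 \<le> ln (2 :: real)"
    using ln2_ge_two_thirds by (simp add: power2_eq_square)
qed

context dynamics
begin

text \<open>\<open>M\<close> is chosen so that the exponential in \<open>tail_factor\<close> is
  exactly \<open>1 / (d + 1)\<close>. The rest fits the moments into the constant
  \<open>C\<^sub>2\<close>: the part \<open>c * (1 + \<kappa>)\<close> stems from the initial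
  geometric series, and \<open>exp (- 1)\<close> absorbs the two summands 1/8 produced by moment
  propagation.\<close>

lemma source_bound:
  fixes d \<kappa> c G E0 E\<^sub>1 :: real
  assumes d: "d \<ge> 1" "real k = 2 * d" and \<kappa>: "\<kappa> > 0" "c > 0" and G: "G > 0"
    and E0: "E0 \<le> c * (1 + 3 * \<kappa>)" and E1: "E\<^sub>1 \<le> real CARD('s) * (c * (1 + 3 * \<kappa>))"
  defines "e \<equiv> exp 1" and "M \<equiv> 2 * (\<kappa> + exp 1) * G * ln (d + 1)" and "\<sigma> \<equiv> 1 + sqrt (ln (d + 1))"
  shows "source (3 / 2 * (\<kappa> + e) * G) M \<sigma> E0 E\<^sub>1 1 \<le> real CARD('s) *
    ((4 * (c * (1 + \<kappa>) + exp (- 1)) * (2 + 4 * (\<kappa> + e)) * G + sqrt nu) / (2 * d * (2 * (2 * sqrt nu + sqrt M + \<sigma>))))"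
proof -
  let ?L = "real CARD('s)"
  define B where "B = c * (1 + \<kappa>) + exp (- 1)"
  define S where "S = 2 * sqrt nu + sqrt M + \<sigma>"
  have e: "e \<ge> 8 / 3" unfolding e_def by (rule exp_1_ge)
  have ln: "ln (d + 1) \<ge> ln 2" using d by simp
  then have ln0: "ln (d + 1) > 0" using ln2_ge_two_thirds by linarith
  have \<sigma>: "\<sigma> \<ge> 9 / 5"
    using sqrt_ln_2_ge real_sqrt_le_mono[OF ln] unfolding \<sigma>_def by linarith
  have M0: "M \<ge> 0" using \<kappa> G ln0 by (simp add: M_def add_nonneg_nonneg)
  have S: "S > 0" using \<sigma> M0 nu_nonneg by (simp add: S_def add_nonneg_pos)
  have B: "B > 0" using \<kappa> by (simp add: B_def add_pos_pos)
  have "exp (- 1 :: real) \<ge> 1 / 3"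
    using exp_le by (simp add: exp_minus field_simps)
  then have "2 * (c * (1 + 3 * \<kappa>)) + 1 / 4 \<le> 6 * B" using \<kappa> by (simp add: B_def algebra_simps)
  then have "?L * (2 * (c * (1 + 3 * \<kappa>)) + 1 / 4) \<le> ?L * (6 * B)" by (intro mult_left_mono) auto
  moreover have "?L * E0 \<le> ?L * (c * (1 + 3 * \<kappa>))" using E0 by (intro mult_left_mono) auto
  ultimately have Q: "E\<^sub>1 + ?L / 8 + ?L * (E0 + 1 / 8) \<le> 6 * ?L * B"
    using E1 by (simp add: algebra_simps)
  have "(\<kappa> + e) * G \<noteq> 0" using \<kappa> G e by auto
  moreover have "3 * M = 6 * ((\<kappa> + e) * G) * ln (d + 1)" by (simp add: M_def e_def)
  ultimately have "3 * M / (4 * (3 / 2 * (\<kappa> + e) * G)) = ln (d + 1)"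
    by (simp only: mult.assoc) simp
  then have "exp (- (3 * M / (4 * (3 / 2 * (\<kappa> + e) * G)))) = inverse (d + 1)"
    using d by (simp only: exp_minus) simp
  then have "tail_factor (3 / 2 * (\<kappa> + e) * G) M = 4 * (3 / 2 * (\<kappa> + e) * G) / e * inverse (d + 1)"
    unfolding tail_factor_def e_def[symmetric] by (simp only:)
  moreover have "4 * (3 / 2 * (\<kappa> + e) * G) = 6 * (\<kappa> + e) * G" by simp
  ultimately have tail: "tail_factor (3 / 2 * (\<kappa> + e) * G) M = 6 * (\<kappa> + e) * G / e / (d + 1)"
    by (simp only: divide_inverse)
  \<comment> \<open>5/2 and 9/5 bound \<open>e\<close> and \<sigma> from below; dividing 36 by their
    product leaves 8, which is twice the 4 in \<open>2 + 4 * (\<kappa> + e)\<close>.\<close>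
  have "9 / 2 \<le> e * \<sigma>" using mult_mono[of "5 / 2" e "9 / 5" \<sigma>] e \<sigma> by simp
  then have "36 * ((\<kappa> + e) * B * G) / (e * \<sigma>) \<le> 36 * ((\<kappa> + e) * B * G) / (9 / 2)"
    using \<kappa> e G B \<sigma> by (intro divide_left_mono) auto
  also have "\<dots> \<le> 2 * B * (2 + 4 * (\<kappa> + e)) * G"
    using B G by (simp add: algebra_simps)
  finally have num: "36 * ((\<kappa> + e) * B * G) / (e * \<sigma>) \<le> 2 * B * (2 + 4 * (\<kappa> + e)) * G" .
  have "tail_factor (3 / 2 * (\<kappa> + e) * G) M * (E\<^sub>1 + ?L / 8 + ?L * (E0 + 1 / 8)) / (2 * \<sigma>)
      \<le> 6 * (\<kappa> + e) * G / e / (d + 1) * (6 * ?L * B) / (2 * \<sigma>)"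
    unfolding tail using \<kappa> e G d \<sigma> Q by (intro divide_right_mono mult_left_mono) auto
  also have "\<dots> = ?L * (36 * ((\<kappa> + e) * B * G) / (e * \<sigma>) / (2 * (d + 1)))"
    using e \<sigma> d by (simp add: field_simps)
  also have "\<dots> \<le> ?L * (2 * B * (2 + 4 * (\<kappa> + e)) * G / (2 * d))"
    using num \<kappa> e G B d \<sigma> by (intro mult_left_mono frac_le) auto
  finally have "tail_factor (3 / 2 * (\<kappa> + e) * G) M * (E\<^sub>1 + ?L / 8 + ?L * (E0 + 1 / 8)) / (2 * \<sigma>)
      \<le> ?L * (2 * B * (2 + 4 * (\<kappa> + e)) * G / (2 * d))" .
  then have "source (3 / 2 * (\<kappa> + e) * G) M \<sigma> E0 E\<^sub>1 1
      \<le> (sqrt nu * ?L / (2 * real k) + ?L * (2 * B * (2 + 4 * (\<kappa> + e)) * G / (2 * d))) / S"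
    unfolding source_def S_def[symmetric] using S by (intro divide_right_mono add_mono) auto
  also have "\<dots> = ?L * ((4 * B * (2 + 4 * (\<kappa> + e)) * G + sqrt nu) / (2 * d * (2 * S)))"
    using d S by (simp add: field_simps)
  finally show ?thesis by (simp only: B_def S_def)
qed

lemma source_linear:
  assumes "(m has_sum E\<^sub>1) I" "(w has_sum b) I"
  shows "((\<lambda>i. source \<kappa> M \<sigma> E0 (m i) (w i)) has_sum source \<kappa> M \<sigma> E0 E\<^sub>1 b) I"
proof -
  define p q where "p = tail_factor \<kappa> M / (2 * \<sigma>) / (2 * sqrt nu + sqrt M + \<sigma>)"
    and "q = (sqrt nu * real CARD('s) / (2 * real k)
      + tail_factor \<kappa> M * (real CARD('s) / 8 + real CARD('s) * (E0 + 1 / 8)) / (2 * \<sigma>)) / (2 * sqrt nu + sqrt M + \<sigma>)"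
  have "source \<kappa> M \<sigma> E0 m' w' = p * m' + q * w'" for m' w'
    unfolding source_def p_def q_def divide_inverse by (simp only: algebra_simps)
  then show ?thesis
    using assms by (simp add: has_sum_add has_sum_cmult_right)
qed

text \<open>The estimates for single vectors are summed over the mixture and divided by the number
  of sites. Only the sum \<open>X\<^sub>1\<close> of the sources is bounded explicitly, which is
  possible by \<open>source_linear\<close>.\<close>

lemma one_site_deviation:
  fixes \<Gamma>\<^sub>0 \<Gamma>\<^sub>t :: "('s \<Rightarrow> nat) ell2 \<Rightarrow> ('s \<Rightarrow> nat) ell2" and d \<kappa> c C t :: real
  assumes \<Gamma>0: "mixture I g \<Gamma>\<^sub>0" "((\<lambda>i. (norm (g i))\<^sup>2) has_sum 1) I" and \<Gamma>t: "mixture I (\<lambda>i. U t (g i)) \<Gamma>\<^sub>t"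
    and d: "d \<ge> 1" "real k = 2 * d" and \<kappa>: "\<kappa> > 0" "c > 0" and t: "t \<ge> 0"
    and f0: "\<And>n. (cmod (f 0 n))\<^sup>2 \<le> c * exp (- real n / \<kappa>)"
    and g0: "\<And>n. Re (coords (one_site_density \<Gamma>\<^sub>0 (ket n)) n) \<le> c * exp (- real n / \<kappa>)"
    and C: "C = 2 * exp 1 * \<bar>J\<bar> * max nu 1"
  defines "M \<equiv> 2 * (\<kappa> + exp 1) * exp (C * t) * ln (d + 1)" and "\<sigma> \<equiv> 1 + sqrt (ln (d + 1))"
  defines "Z \<equiv> (4 * (c * (1 + \<kappa>) + exp (- 1)) * (2 + 4 * (\<kappa> + exp 1)) * exp (C * t) + sqrt nu) / (2 * d * (2 * (2 * sqrt nu + sqrt M + \<sigma>)))"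
    and "\<delta> \<equiv> \<lambda>s \<Gamma>. 1 - Re (cinner (\<phi> s) (one_site_density \<Gamma> (\<phi> s)))"
  shows "\<delta> t \<Gamma>\<^sub>t \<le> (\<delta> 0 \<Gamma>\<^sub>0 + Z) * exp (growth M \<sigma> * t)"
proof -
  let ?L = "real CARD('s)"
  define \<kappa>\<^sub>0 where "\<kappa>\<^sub>0 = 3 / 2 * (\<kappa> + exp 1)"
  have \<kappa>0: "\<kappa>\<^sub>0 \<ge> 4" "3 / 2 * \<kappa> \<le> \<kappa>\<^sub>0" using exp_1_ge \<kappa> by (simp_all add: \<kappa>\<^sub>0_def)
  have ln0: "ln (d + 1) > 0" using d by simp
  have M: "M \<ge> 0" using \<kappa> ln0 by (simp add: M_def add_nonneg_nonneg)
  have \<sigma>: "\<sigma> > 0" using ln0 by (simp add: \<sigma>_def add_pos_nonneg)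
  have fin: "(\<Sum>n\<in>F. exp (real n / \<kappa>\<^sub>0) * (cmod (f 0 n))\<^sup>2) \<le> c * (1 + 3 * \<kappa>)" if "finite F" for F
  proof -
    have "(\<Sum>n\<in>F. exp (real n / \<kappa>\<^sub>0) * (cmod (f 0 n))\<^sup>2) \<le> (\<Sum>n\<in>F. exp (real n / \<kappa>\<^sub>0) * (c * exp (- real n / \<kappa>)))"
      by (intro sum_mono mult_left_mono f0) auto
    also have "\<dots> \<le> c * (1 + 3 * \<kappa>)"
      by (rule geometric_moment) (use \<kappa> \<kappa>0 that in auto)
    finally show ?thesis .
  qed
  have "(\<lambda>n. exp (real n / \<kappa>\<^sub>0) * (cmod (f 0 n))\<^sup>2) summable_on UNIV"
    by (rule nonneg_bdd_above_summable_on) (use fin in \<open>auto intro!: bdd_aboveI2\<close>)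
  then obtain E0 where init: "((\<lambda>n. exp (real n / \<kappa>\<^sub>0) * (cmod (f 0 n))\<^sup>2) has_sum E0) UNIV"
    by (auto simp: summable_on_def)
  have E0: "E0 \<le> c * (1 + 3 * \<kappa>)"
    by (rule has_sum_le_finite_sums[OF init]) (use fin in auto)
  obtain m E\<^sub>1 where m: "\<And>i. i \<in> I \<Longrightarrow> ((\<lambda>n. (\<Sum>x\<in>UNIV. exp (real (n x) / \<kappa>\<^sub>0)) * (cmod (coords (g i) n))\<^sup>2) has_sum m i) UNIV"
    and E1: "(m has_sum E\<^sub>1) I" "E\<^sub>1 \<le> ?L * (c * (1 + 3 * \<kappa>))"
    using exp_moment_mixture[OF \<Gamma>0 g0 \<kappa>(1) less_imp_le[OF \<kappa>(2)] \<kappa>0(2)] by blast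
  have dev: "((\<lambda>i. excitation s (h i)) has_sum (?L * \<delta> s \<Gamma>)) I"
    if "mixture I h \<Gamma>" "((\<lambda>i. (norm (h i))\<^sup>2) has_sum 1) I" for s h \<Gamma>
  proof -
    have "((\<lambda>i. ?L * (norm (h i))\<^sup>2 - (\<Sum>x\<in>UNIV. Re (cinner (h i) (site_ketbra x (\<phi> s) (\<phi> s) (h i))))) has_sum
        (?L * 1 - ?L * Re (cinner (\<phi> s) (one_site_density \<Gamma> (\<phi> s))))) I"
      by (intro has_sum_diff has_sum_cmult_right that one_site_density_form[OF that])
    then show ?thesis by (simp add: excitation_def sum_subtractf \<delta>_def right_diff_distrib)
  qed
  define X where "X i = source (\<kappa>\<^sub>0 * exp (C * t)) M \<sigma> E0 (m i) ((norm (g i))\<^sup>2)" for i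
  define X\<^sub>1 where "X\<^sub>1 = source (\<kappa>\<^sub>0 * exp (C * t)) M \<sigma> E0 E\<^sub>1 1"
  have X: "(X has_sum X\<^sub>1) I"
    unfolding X_def X\<^sub>1_def by (rule source_linear[OF E1(1) \<Gamma>0(2)])
  have X1: "X\<^sub>1 \<le> ?L * Z"
    unfolding X\<^sub>1_def Z_def \<kappa>\<^sub>0_def M_def \<sigma>_def by (rule source_bound[OF d \<kappa> _ E0 E1(2)]) simp
  have nt: "((\<lambda>i. (norm (U t (g i)))\<^sup>2) has_sum 1) I" using \<Gamma>0(2) by simp
  have "?L * \<delta> t \<Gamma>\<^sub>t + X\<^sub>1 \<le> (?L * \<delta> 0 \<Gamma>\<^sub>0 + X\<^sub>1) * exp (growth M \<sigma> * t)"
  proof (rule has_sum_mono)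
    show "((\<lambda>i. excitation t (U t (g i)) + X i) has_sum (?L * \<delta> t \<Gamma>\<^sub>t + X\<^sub>1)) I"
      by (intro has_sum_add dev \<Gamma>t nt X)
    show "((\<lambda>i. (excitation 0 (g i) + X i) * exp (growth M \<sigma> * t)) has_sum ((?L * \<delta> 0 \<Gamma>\<^sub>0 + X\<^sub>1) * exp (growth M \<sigma> * t))) I"
      by (intro has_sum_cmult_left has_sum_add dev \<Gamma>0 X)
    show "excitation t (U t (g i)) + X i \<le> (excitation 0 (g i) + X i) * exp (growth M \<sigma> * t)" if "i \<in> I" for i
      unfolding X_def by (rule excitation_growth[OF \<kappa>0(1) C t M \<sigma> init m[OF that]])
  qed
  moreover have "(?L * \<delta> 0 \<Gamma>\<^sub>0 + X\<^sub>1) * exp (growth M \<sigma> * t) \<le> (?L * \<delta> 0 \<Gamma>\<^sub>0 + ?L * Z) * exp (growth M \<sigma> * t)"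
    using X1 by (intro mult_right_mono) auto
  \<comment> \<open>Lets the source be dropped on the left-hand side.\<close>
  moreover have "X\<^sub>1 \<ge> 0"
  proof (rule has_sum_nonneg[OF X])
    fix i assume "i \<in> I"
    have "m i \<ge> 0" by (rule has_sum_nonneg[OF m[OF \<open>i \<in> I\<close>]]) (auto intro!: mult_nonneg_nonneg sum_nonneg)
    moreover have "E0 \<ge> 0" by (rule has_sum_nonneg[OF init]) auto
    ultimately show "X i \<ge> 0"
      unfolding X_def source_def tail_factor_def using M \<sigma> \<kappa>0 nu_nonneg
      by (intro divide_nonneg_nonneg add_nonneg_nonneg mult_nonneg_nonneg) auto
  qed
  moreover have "?L * ((\<delta> 0 \<Gamma>\<^sub>0 + Z) * exp (growth M \<sigma> * t)) = (?L * \<delta> 0 \<Gamma>\<^sub>0 + ?L * Z) * exp (growth M \<sigma> * t)"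
    by (simp only: distrib_left distrib_right mult.assoc)
  ultimately have "?L * \<delta> t \<Gamma>\<^sub>t \<le> ?L * ((\<delta> 0 \<Gamma>\<^sub>0 + Z) * exp (growth M \<sigma> * t))"
    by linarith
  then show ?thesis by (rule mult_left_le_imp_le) simp
qed

end

lemma op_trace_level_proj:
  assumes "bounded_clinear A"
  shows "op_trace (A \<circ> level_proj n) = coords (A (ket n)) n"
proof -
  have "cinner (ket i) ((A \<circ> level_proj n) (ket i)) = (if i = n then coords (A (ket n)) n else 0)" for i
    using assms by (auto simp: level_proj_def ketbra_def coords_ket bounded_clinear_def)
  then show ?thesis
    unfolding op_trace_def by (intro infsumI has_sum_finite_neutralI[where B = "{n}"]) auto
qed

text \<open>Identifies \<open>N\<^sub>0\<close> with the quantity conserved by the mean-field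
  flow.\<close>

lemma op_trace_ketbra_number:
  assumes "\<And>n. coords \<phi>a n = annihilation (coords \<phi>) n"
  shows "op_trace (ketbra \<phi> \<phi> \<circ> operator_of number) = of_real ((norm \<phi>a)\<^sup>2)"
proof -
  have "operator_of number (ket i) = of_nat i *\<^sub>C ket i" for i
  proof -
    have eq: "number (coords (ket i)) = coords (of_nat i *\<^sub>C ket i)"
      by (auto simp: number_eq coords_ket)
    have "ket i \<in> maximal_domain number"
      using coords[of "of_nat i *\<^sub>C ket i"] by (simp add: maximal_domain_def eq)
    then show ?thesis
      by (simp add: coords_inject[symmetric] coords_operator_of eq fun_eq_iff)
  qed
  then have "cinner (ket i) ((ketbra \<phi> \<phi> \<circ> operator_of number) (ket i)) = of_real (real i * (cmod (coords \<phi> i))\<^sup>2)" for i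
    unfolding ketbra_def o_def by (simp add: cinner_simps complex_norm_square mult_ac del: of_real_power)
  then show ?thesis
    unfolding op_trace_def using norm_sq_annihilation[OF assms]
    by (simp only: infsumI[OF has_sum_of_real])
qed

lemma (in lattice) mixture_evolution:
  assumes "mixture I g \<Gamma>"
  shows "mixture I (\<lambda>i. U t (g i)) (U t \<circ> \<Gamma> \<circ> U (- t))"
  unfolding mixture_def
proof (intro allI)
  fix \<eta> \<psi>
  have "cinner \<eta> (U t \<xi>) * cinner (U t \<xi>) \<psi> = cinner (U (- t) \<eta>) \<xi> * cinner \<xi> (U (- t) \<psi>)" for \<xi>
    using U_adjoint[of \<xi> "- t" \<psi>] by (simp add: U_adjoint[of \<eta>])
  then show "((\<lambda>i. cinner \<eta> (U t (g i)) * cinner (U t (g i)) \<psi>) has_sum cinner \<eta> ((U t \<circ> \<Gamma> \<circ> U (- t)) \<psi>)) I"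
    using mixtureD[OF assms, of "U (- t) \<eta>" "U (- t) \<psi>"] by (simp only: o_apply U_adjoint[of \<eta>])
qed

theorem theorem2p1:
  fixes d L :: nat
    and J \<mu> U \<kappa> c C\<^sub>1 C\<^sub>2 C\<^sub>3 C\<^sub>4 N\<^sub>0 t :: real
    and D :: "real \<Rightarrow> real"
    and \<gamma> :: "real \<Rightarrow> ('l::nontriv mod_ring ^ 'd::finite \<Rightarrow> nat) ell2 \<Rightarrow> ('l mod_ring ^ 'd \<Rightarrow> nat) ell2"
    and \<phi> :: "real \<Rightarrow> nat ell2"
    and p :: "real \<Rightarrow> nat ell2 \<Rightarrow> nat ell2"
  assumes "d = CARD('d)" "L = CARD('l)" "d \<ge> 1" "L \<ge> 3"
    and "positive_op (\<gamma> 0)" "trace_class (\<gamma> 0)" "op_trace (\<gamma> 0) = 1"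
    and "\<And>t. \<gamma> t = von_neumann_evolution J \<mu> U (\<gamma> 0) t"
    and "mean_field_solution J \<mu> U \<phi>" "norm (\<phi> 0) = 1"
    and "\<And>t. p t = ketbra (\<phi> t) (\<phi> t)"
    and "\<kappa> > 0" "c > 0"
    and "\<And>n. Re (op_trace (p 0 \<circ> level_proj n)) \<le> c * exp (- real n / \<kappa>)"
    and "\<And>n. Re (op_trace (one_site_density (\<gamma> 0) \<circ> level_proj n)) \<le> c * exp (- real n / \<kappa>)"
    and "N\<^sub>0 = Re (op_trace (p 0 \<circ> operator_of number))"
    and "C\<^sub>1 = 2 * exp 1 * \<bar>J\<bar> * max N\<^sub>0 1"
    and "C\<^sub>2 = 4 * (c * (1 + \<kappa>) + exp (-1)) * (2 + 4 * (\<kappa> + exp 1))"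
    and "C\<^sub>3 = sqrt (N\<^sub>0 + 1)"
    and "C\<^sub>4 = 4 * sqrt N\<^sub>0 + 2"
    and "\<And>t. D t = C\<^sub>4 + 2 * (sqrt (2 * (\<kappa> + exp 1)) * exp (C\<^sub>1 / 2 * t) + 1) * sqrt (ln (real d + 1))"
    and "t \<ge> 0"
  shows "trace_norm (\<lambda>\<psi>. one_site_density (\<gamma> t) \<psi> - p t \<psi>)
    \<le> sqrt 2 * sqrt (trace_norm (\<lambda>\<psi>. one_site_density (\<gamma> 0) \<psi> - p 0 \<psi>)
                      + (C\<^sub>2 * exp (C\<^sub>1 * t) + sqrt N\<^sub>0) / (real d * D t))
      * exp (\<bar>J\<bar> * C\<^sub>3 * D t * t)"
proof -
  let ?E = "{(x :: 'l mod_ring ^ 'd, y). nearest_neighbours x y}" and ?j = "J / (2 * real CARD('d))"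
  have L3: "CARD('l) \<ge> 3" using assms(2,4) by simp
  note graph = nearest_neighbours_graph[OF L3]
  interpret B: dynamics ?E ?j "onsite J \<mu> U" "2 * CARD('d)" J \<mu> U \<phi>
    by unfold_locales (use graph assms(9,10) in auto)
  have propagator_U: "propagator J \<mu> U s = B.U s" for s
    unfolding propagator_def bose_hubbard_eq_ham[OF L3] B.operator_of_evol[symmetric] B.evol_def ..
  obtain g :: "('l mod_ring ^ 'd \<Rightarrow> nat) \<Rightarrow> ('l mod_ring ^ 'd \<Rightarrow> nat) ell2"
    where g: "mixture UNIV g (\<gamma> 0)" "((\<lambda>i. (norm (g i))\<^sup>2) has_sum 1) UNIV"
    using density_matrix_mixture[OF assms(5-7)] by blast
  have "\<gamma> t = B.U t \<circ> \<gamma> 0 \<circ> B.U (- t)"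
    using assms(8)[of t] by (simp add: von_neumann_evolution_def propagator_U)
  then have gt: "mixture UNIV (\<lambda>i. B.U t (g i)) (\<gamma> t)"
    using B.mixture_evolution[OF g(1)] by simp
  have gt': "((\<lambda>i. (norm (B.U t (g i)))\<^sup>2) has_sum 1) UNIV" using g(2) by simp
  have N0: "N\<^sub>0 = B.nu"
    using assms(16) op_trace_ketbra_number[OF B.coords_a, of 0] by (simp add: assms(11) B.nu_def)
  let ?\<delta> = "\<lambda>s. 1 - Re (cinner (\<phi> s) (one_site_density (\<gamma> s) (\<phi> s)))"
  let ?T = "\<lambda>s. trace_norm (\<lambda>\<psi>. one_site_density (\<gamma> s) \<psi> - p s \<psi>)"
  have T0: "2 * ?\<delta> 0 \<le> ?T 0"
    using trace_norm_pure_state_bounds(1)[OF mixture_one_site_density[OF g] assms(10)] by (simp only: assms(11))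
  have Tt: "?T t \<le> 2 * sqrt (?\<delta> t)"
    using trace_norm_pure_state_bounds(2)[OF mixture_one_site_density[OF gt gt'] B.norm_phi[OF assms(22)]] by (simp only: assms(11))
  have f0: "(cmod (coords (\<phi> 0) n))\<^sup>2 \<le> c * exp (- real n / \<kappa>)" for n
  proof -
    have "coords (p 0 (ket n)) n = of_real ((cmod (coords (\<phi> 0) n))\<^sup>2)"
      by (simp add: assms(11) ketbra_def complex_norm_square mult.commute del: of_real_power)
    then show ?thesis
      using assms(14)[of n] by (simp add: op_trace_level_proj assms(11) ketbra_bounded)
  qed
  have g0: "Re (coords (one_site_density (\<gamma> 0) (ket n)) n) \<le> c * exp (- real n / \<kappa>)" for n
    using assms(15)[of n] by (simp add: op_trace_level_proj mixture_bounded[OF mixture_one_site_density[OF g]])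
  define M where "M = 2 * (\<kappa> + exp 1) * exp (C\<^sub>1 * t) * ln (real d + 1)"
  define \<sigma> where "\<sigma> = 1 + sqrt (ln (real d + 1))"
  have "exp (C\<^sub>1 * t) = (exp (C\<^sub>1 / 2 * t))\<^sup>2" by (simp flip: exp_double)
  then have "sqrt M = sqrt (2 * (\<kappa> + exp 1)) * exp (C\<^sub>1 / 2 * t) * sqrt (ln (real d + 1))"
    by (simp add: M_def real_sqrt_mult)
  \<comment> \<open>\<open>C\<^sub>4\<close> collects the part with \<open>sqrt nu\<close> and the 1
    in \<sigma>; the logarithmic part comes from \<open>sqrt M\<close> and the rest of
    \<sigma>.\<close>
  then have D: "D t = 2 * (2 * sqrt B.nu + sqrt M + \<sigma>)"
    by (simp add: assms(20,21) N0 \<sigma>_def algebra_simps)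
  define Z where "Z = (C\<^sub>2 * exp (C\<^sub>1 * t) + sqrt N\<^sub>0) / (real d * D t)"
  \<comment> \<open>The rate times \<open>t\<close> is twice the exponent of the theorem; the square
    root in the upper trace norm bound halves it.\<close>
  have growth: "B.growth M \<sigma> = 2 * \<bar>J\<bar> * C\<^sub>3 * D t"
    by (simp add: B.growth_def D assms(19) N0)
  have half: "Z / 2 = (C\<^sub>2 * exp (C\<^sub>1 * t) + sqrt B.nu) / (2 * real d * D t)"
    by (simp add: Z_def N0)
  have dims: "1 \<le> real d" "real (2 * CARD('d)) = 2 * real d"
    using assms(1,3) by simp_all
  have "?\<delta> t \<le> (?\<delta> 0 + Z / 2) * exp (B.growth M \<sigma> * t)"
    using B.one_site_deviation[OF g gt dims assms(12,13,22) f0 g0 assms(17)[unfolded N0]]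
    unfolding half D M_def[symmetric] \<sigma>_def[symmetric] assms(18) .
  also have "\<dots> \<le> (?T 0 / 2 + Z / 2) * exp (B.growth M \<sigma> * t)"
    using T0 by (intro mult_right_mono) auto
  also have "\<dots> = (?T 0 + Z) / 2 * (exp (\<bar>J\<bar> * C\<^sub>3 * D t * t))\<^sup>2"
    by (simp add: growth add_divide_distrib mult_ac flip: exp_double)
  finally have "sqrt (?\<delta> t) \<le> sqrt ((?T 0 + Z) / 2) * exp (\<bar>J\<bar> * C\<^sub>3 * D t * t)"
    by (metis exp_ge_zero real_sqrt_le_mono real_sqrt_mult real_sqrt_unique)
  with Tt have "?T t \<le> 2 * (sqrt ((?T 0 + Z) / 2) * exp (\<bar>J\<bar> * C\<^sub>3 * D t * t))" by linarith
  also have "\<dots> = sqrt 2 * sqrt (?T 0 + Z) * exp (\<bar>J\<bar> * C\<^sub>3 * D t * t)"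
  proof -
    have "2 * sqrt ((?T 0 + Z) / 2) = sqrt 2 * sqrt 2 * sqrt ((?T 0 + Z) / 2)" by simp
    also have "\<dots> = sqrt 2 * sqrt (?T 0 + Z)" by (simp only: mult.assoc real_sqrt_mult[symmetric]) simp
    finally show ?thesis by simp
  qed
  finally show ?thesis by (simp only: Z_def)
qed

end
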